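(* Let $\rho_{ABC}$ be any tripartite quantum state. Then $$E(A:BC)_{\rho}\;\geq\;E_{\mathsf{LOCC}_1}(B\to A)_{\rho}+E_{\mathsf{ALL}}(A:C)_{\rho},$$ and, consequently, $$E(A:BC)_{\rho}\;\geq\;E_{\mathsf{LOCC}_1}(B\to A)_{\rho}+E^{\infty}(A:C)_{\rho}$$ and $$E^{\infty}(A:BC)_{\rho}\;\geq\;E^{\infty}_{\mathsf{LOCC}_1}(B\to A)_{\rho}+E^{\infty}(A:C)_{\rho}.$$
   Context: All Hilbert spaces are finite-dimensional; quantum states are positive semidefinite operators of unit trace; marginals are denoted by subscripts and obtained by partial trace. $\log$ is the natural logarithm. Relative entropy: $D(\rho\|\sigma)=\operatorname{tr}[\rho(\log\rho-\log\sigma)]$ if the support of $\rho$ is contained in that of $\sigma$ and $+\infty$ otherwise; for nonnegative functions $P,Q$ on a finite set, $D(P\|Q)=\sum_z P(z)\log\frac{P(z)}{Q(z)}$ (same support convention). For a bipartition $A:B$ (where each side may be a composite system), $\mathsf{Sep}(A:B)$ is the set of states of the form $\sigma_{AB}=\sum_x Y_A^x\otimes Y_B^x$ (finite sum) with $Y_A^x,Y_B^x\geq0$. $E(A:B)_\rho=\min_{\sigma_{AB}\in\mathsf{Sep}(A:B)}D(\rho_{AB}\|\sigma_{AB})$ and $E^\infty(A:B)_\rho=\lim_{n\to\infty}\frac1nE(A^n:B^n)_{\rho^{\otimes n}}$. A POVM is a finite family $M=\{M^z\}_z$ of positive semidefinite operators with $\sum_zM^z=1$. For a set $\mathcal M$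 of POVMs, $D_{\mathcal M}(\rho\|\sigma)=\sup_{M\in\mathcal M}D(\mathbb P_{\rho,M}\|\mathbb P_{\sigma,M})$ with $\mathbb P_{\rho,M}(z)=\operatorname{tr}[\rho M^z]$, and $E_{\mathcal M}(A:B)_\rho=\min_{\sigma_{AB}\in\mathsf{Sep}(A:B)}D_{\mathcal M}(\rho_{AB}\|\sigma_{AB})$. $\mathsf{ALL}$ is the set of all POVMs. $\mathsf{LOCC}_1(B\to A)$ is the set of POVMs on $A\otimes B$ of the form $M^z_{AB}=\sum_x Q_A^{z|x}\otimes Q_B^x$ with $Q_B^x,Q_A^{z|x}\geq0$, $\sum_xQ_B^x=1_B$ and $\sum_zQ_A^{z|x}=1_A$ for every $x$. $E_{\mathsf{LOCC}_1}(B\to A)_\rho:=E_{\mathsf{LOCC}_1(B\to A)}(A:B)_\rho$ and $E^\infty_{\mathsf{LOCC}_1}(B\to A)_\rho=\lim_{n\to\infty}\frac1nE_{\mathsf{LOCC}_1}(B^n\to A^n)_{\rho^{\otimes n}}$. *)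

theory Defs
  imports "Jordan_Normal_Form.Schur_Decomposition" "Jordan_Normal_Form.Matrix_Kernel" "HOL-Library.Extended_Real"
begin

text \<open>
  A Hilbert space of dimension \<open>n\<close> is \<open>\<complex>\<^sup>n\<close> with its standard basis, and its operators are the
  elements of \<^term>\<open>carrier_mat n n\<close>. Basis vectors of a tensor product are numbered in mixed radix:
  \<open>e\<^sub>a \<otimes> e\<^sub>b\<close> in \<open>\<complex>\<^sup>m \<otimes> \<complex>\<^sup>n\<close> has number \<open>a * n + b\<close>. This numbering is associative, so
  an operator on \<open>A \<otimes> B \<otimes> C\<close> is at the same time one on \<open>A \<otimes> (B \<otimes> C)\<close> and on \<open>(A \<otimes> B) \<otimes> C\<close>.
\<close>

definition tr :: "complex mat \<Rightarrow> complex" where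
  "tr A = (\<Sum>i<dim_row A. A $$ (i, i))"

definition sum_op :: "nat \<Rightarrow> ('x \<Rightarrow> complex mat) \<Rightarrow> 'x set \<Rightarrow> complex mat" where
  "sum_op n F X = mat n n (\<lambda>ij. \<Sum>x\<in>X. F x $$ ij)"

definition tensor_op :: "complex mat \<Rightarrow> complex mat \<Rightarrow> complex mat"  (infixr \<open>\<otimes>\<^sub>m\<close> 75) where
  "A \<otimes>\<^sub>m B = mat (dim_row A * dim_row B) (dim_col A * dim_col B)
     (\<lambda>(i, j). A $$ (i div dim_row B, j div dim_col B) * B $$ (i mod dim_row B, j mod dim_col B))"

text \<open>The complex order makes \<open>0 \<le> z\<close> include that \<open>z\<close> is real, so positivity implies Hermiticity.\<close>

definition pos_semidef :: "nat \<Rightarrow> complex mat \<Rightarrow> bool" where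
  "pos_semidef n A \<longleftrightarrow> A \<in> carrier_mat n n \<and> (\<forall>v\<in>carrier_vec n. 0 \<le> (A *\<^sub>v v) \<bullet>c v)"

definition states :: "nat \<Rightarrow> complex mat set" where
  "states n = {\<rho>. pos_semidef n \<rho> \<and> tr \<rho> = 1}"


subsection \<open>Partial traces and tensor powers\<close>

text \<open>\<open>ptrace_last m n\<close> maps operators on \<open>\<complex>\<^sup>m \<otimes> \<complex>\<^sup>n\<close> to operators on \<open>\<complex>\<^sup>m\<close>;
  \<open>ptrace_mid l m n\<close> maps operators on \<open>\<complex>\<^sup>l \<otimes> \<complex>\<^sup>m \<otimes> \<complex>\<^sup>n\<close> to operators on \<open>\<complex>\<^sup>l \<otimes> \<complex>\<^sup>n\<close>.\<close>

definition ptrace_last :: "nat \<Rightarrow> nat \<Rightarrow> complex mat \<Rightarrow> complex mat" where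
  "ptrace_last m n \<rho> = mat m m (\<lambda>(i, j). \<Sum>c<n. \<rho> $$ (i * n + c, j * n + c))"

definition ptrace_mid :: "nat \<Rightarrow> nat \<Rightarrow> nat \<Rightarrow> complex mat \<Rightarrow> complex mat" where
  "ptrace_mid l m n \<rho> = mat (l * n) (l * n) (\<lambda>(i, j).
     \<Sum>b<m. \<rho> $$ ((i div n * m + b) * n + i mod n, (j div n * m + b) * n + j mod n))"

text \<open>The \<open>k\<close>-th base-\<open>d\<close> digit of the number of a basis vector of \<open>(\<complex>\<^sup>d)\<^sup>\<otimes>\<^sup>n\<close> is the number of its
  \<open>k\<close>-th tensor factor. \<open>tensor_power dA dB n \<rho>\<close> is \<open>\<rho>\<^sup>\<otimes>\<^sup>n\<close>, regrouped from \<open>(A \<otimes> B)\<^sup>\<otimes>\<^sup>n\<close>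
  as an operator on \<open>A\<^sup>\<otimes>\<^sup>n \<otimes> B\<^sup>\<otimes>\<^sup>n\<close>.\<close>

definition digit :: "nat \<Rightarrow> nat \<Rightarrow> nat \<Rightarrow> nat" where
  "digit d k i = i div d ^ k mod d"

definition tensor_power :: "nat \<Rightarrow> nat \<Rightarrow> nat \<Rightarrow> complex mat \<Rightarrow> complex mat" where
  "tensor_power dA dB n \<rho> = mat (dA ^ n * dB ^ n) (dA ^ n * dB ^ n) (\<lambda>(i, j).
     \<Prod>k<n. \<rho> $$ (digit dA k (i div dB ^ n) * dB + digit dB k (i mod dB ^ n),
                  digit dA k (j div dB ^ n) * dB + digit dB k (j mod dB ^ n)))"


subsection \<open>Relative entropy\<close>

text \<open>Logarithm of a positive semidefinite operator, computed on its support and extended by \<open>0\<close>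
  on its kernel.\<close>

definition ln_supp :: "real \<Rightarrow> real" where
  "ln_supp x = (if x > 0 then ln x else 0)"

definition is_log_op :: "nat \<Rightarrow> complex mat \<Rightarrow> complex mat \<Rightarrow> bool" where
  "is_log_op n A L \<longleftrightarrow> (\<exists>U\<in>carrier_mat n n. \<exists>d :: nat \<Rightarrow> real.
     mat_adjoint U * U = 1\<^sub>m n \<and>
     A = U * mat_diag n (\<lambda>i. complex_of_real (d i)) * mat_adjoint U \<and>
     L = U * mat_diag n (\<lambda>i. complex_of_real (ln_supp (d i))) * mat_adjoint U)"

definition log_op :: "complex mat \<Rightarrow> complex mat" where
  "log_op A = (THE L. is_log_op (dim_row A) A L)"

text \<open>The support is the orthogonal complement of the kernel.\<close>

definition supp :: "complex mat \<Rightarrow> complex vec set" where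
  "supp A = {v \<in> carrier_vec (dim_col A). \<forall>w\<in>mat_kernel A. v \<bullet>c w = 0}"

definition rel_entropy :: "complex mat \<Rightarrow> complex mat \<Rightarrow> ereal" where
  "rel_entropy \<rho> \<sigma> =
     (if supp \<rho> \<subseteq> supp \<sigma> then ereal (Re (tr (\<rho> * (log_op \<rho> - log_op \<sigma>)))) else \<infinity>)"

definition classical_rel_entropy :: "'z set \<Rightarrow> ('z \<Rightarrow> real) \<Rightarrow> ('z \<Rightarrow> real) \<Rightarrow> ereal" where
  "classical_rel_entropy Z P Q =
     (if {z \<in> Z. P z \<noteq> 0} \<subseteq> {z \<in> Z. Q z \<noteq> 0} then ereal (\<Sum>z\<in>Z. P z * ln (P z / Q z)) else \<infinity>)"


subsection \<open>Measurements\<close>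

text \<open>A POVM is represented by the list of its elements.\<close>

definition ALL_povms :: "nat \<Rightarrow> complex mat list set" where
  "ALL_povms n = {M. (\<forall>z<length M. pos_semidef n (M ! z)) \<and>
                     sum_op n (\<lambda>z. M ! z) {..<length M} = 1\<^sub>m n}"

text \<open>The first tensor factor is \<open>A\<close>, the second one \<open>B\<close>; classical communication is from \<open>B\<close> to \<open>A\<close>.\<close>

definition LOCC1_povms :: "nat \<Rightarrow> nat \<Rightarrow> complex mat list set" where
  "LOCC1_povms dA dB = {M \<in> ALL_povms (dA * dB). \<exists>(m :: nat) QA QB.
     (\<forall>x<m. pos_semidef dB (QB x)) \<and>
     (\<forall>x<m. \<forall>z<length M. pos_semidef dA (QA z x)) \<and>
     sum_op dB QB {..<m} = 1\<^sub>m dB \<and>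
     (\<forall>x<m. sum_op dA (\<lambda>z. QA z x) {..<length M} = 1\<^sub>m dA) \<and>
     (\<forall>z<length M. M ! z = sum_op (dA * dB) (\<lambda>x. QA z x \<otimes>\<^sub>m QB x) {..<m})}"

definition outcome_prob :: "complex mat \<Rightarrow> complex mat list \<Rightarrow> nat \<Rightarrow> real" where
  "outcome_prob \<rho> M z = Re (tr (\<rho> * M ! z))"

definition measured_rel_entropy ::
    "complex mat list set \<Rightarrow> complex mat \<Rightarrow> complex mat \<Rightarrow> ereal" where
  "measured_rel_entropy \<M> \<rho> \<sigma> =
     (SUP M\<in>\<M>. classical_rel_entropy {..<length M} (outcome_prob \<rho> M) (outcome_prob \<sigma> M))"


subsection \<open>Relative entropies of entanglement\<close>

definition Sep :: "nat \<Rightarrow> nat \<Rightarrow> complex mat set" where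
  "Sep dA dB = {\<sigma> \<in> states (dA * dB). \<exists>(m :: nat) YA YB.
     (\<forall>x<m. pos_semidef dA (YA x) \<and> pos_semidef dB (YB x)) \<and>
     \<sigma> = sum_op (dA * dB) (\<lambda>x. YA x \<otimes>\<^sub>m YB x) {..<m}}"

text \<open>The minima over \<^const>\<open>Sep\<close> are infima in \<^typ>\<open>ereal\<close>; they are attained since
  \<^const>\<open>Sep\<close> is compact and both divergences are lower semicontinuous in \<open>\<sigma>\<close>.\<close>

definition E_rel :: "nat \<Rightarrow> nat \<Rightarrow> complex mat \<Rightarrow> ereal" where
  "E_rel dA dB \<rho> = (INF \<sigma>\<in>Sep dA dB. rel_entropy \<rho> \<sigma>)"

definition E_meas :: "complex mat list set \<Rightarrow> nat \<Rightarrow> nat \<Rightarrow> complex mat \<Rightarrow> ereal" where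
  "E_meas \<M> dA dB \<rho> = (INF \<sigma>\<in>Sep dA dB. measured_rel_entropy \<M> \<rho> \<sigma>)"

definition E_ALL :: "nat \<Rightarrow> nat \<Rightarrow> complex mat \<Rightarrow> ereal" where
  "E_ALL dA dB \<rho> = E_meas (ALL_povms (dA * dB)) dA dB \<rho>"

definition E_LOCC1 :: "nat \<Rightarrow> nat \<Rightarrow> complex mat \<Rightarrow> ereal" where
  "E_LOCC1 dA dB \<rho> = E_meas (LOCC1_povms dA dB) dA dB \<rho>"

definition E_rel_reg :: "nat \<Rightarrow> nat \<Rightarrow> complex mat \<Rightarrow> ereal" where
  "E_rel_reg dA dB \<rho> =
     lim (\<lambda>n. E_rel (dA ^ n) (dB ^ n) (tensor_power dA dB n \<rho>) / ereal (real n))"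

definition E_LOCC1_reg :: "nat \<Rightarrow> nat \<Rightarrow> complex mat \<Rightarrow> ereal" where
  "E_LOCC1_reg dA dB \<rho> =
     lim (\<lambda>n. E_LOCC1 (dA ^ n) (dB ^ n) (tensor_power dA dB n \<rho>) / ereal (real n))"

end

theory Submission
  imports Defs
begin

text \<open>
  A measured relative entropy is a supremum of \<open>\<Sum>\<^sub>z P(z) ln f(z)\<close> over measurements and weights
  \<open>f > 0\<close> with \<open>\<Sum>\<^sub>z Q(z) f(z) \<le> 1\<close>. Let \<open>\<sigma>\<close> be separable across \<open>A:BC\<close> and take a nearly optimal
  one-way LOCC witness \<open>(Q\<^sub>B\<^sup>x, Q\<^sub>A\<^sup>z\<^sup>|\<^sup>x, f)\<close> for the marginal of \<open>\<sigma>\<close> on \<open>AB\<close>. Put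
  \<open>F\<^sub>x = \<Sum>\<^sub>z f(z) Q\<^sub>A\<^sup>z\<^sup>|\<^sup>x\<close> and let \<open>\<sigma>\<^sub>x\<close> be the operator on \<open>AC\<close> left by the outcome \<open>x\<close> on \<open>B\<close>.
  The derivative \<open>T\<^sub>x\<close> of the operator logarithm at \<open>F\<^sub>x\<^sup>-\<^sup>1\<close> is positive and acts on \<open>A\<close> only, so
  \<open>\<tau> = \<Sum>\<^sub>x T\<^sub>x(\<sigma>\<^sub>x)\<close> is separable across \<open>A:C\<close>, and its trace is the expectation of \<open>f\<close> under \<open>\<sigma>\<close>,
  hence at most \<open>1\<close>. With a nearly optimal witness \<open>(M, g)\<close> for \<open>\<tau>\<close> and \<open>G = \<Sum>\<^sub>w g(w) M\<^sup>w\<close>, monotonicity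
  of \<open>D\<close> under the instrument \<open>Q\<^sub>B\<close> and Lieb's three-operator inequality bound \<open>D(\<rho>\<parallel>\<sigma>)\<close> below by
  \<open>\<Sum>\<^sub>x tr \<rho>\<^sub>x log F\<^sub>x + tr \<rho> log G + 1 - tr \<tau> G\<close>, and the operator Jensen inequality for \<open>log\<close> turns the
  first two terms into the two values of the witnesses.

  For the regularized inequalities this is applied to \<open>n\<close> copies. \<open>E\<close> is subadditive, \<open>E\<close> restricted
  to one-way LOCC measurements is superadditive, and \<open>E\<close> exceeds its measured version by at most
  \<open>O(log log d)\<close> in dimension \<open>d\<close>, because \<open>\<sigma>\<close> can be mixed with the maximally mixed state and then
  pinched to \<open>O(log d)\<close> windows of eigenvalues. Division by \<open>n\<close> and Fekete's lemma finish the proof.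
\<close>

text \<open>The obstacle is that \<open>\<rho>\<close>, \<open>\<sigma>\<close>, \<open>F x\<close>
  and \<open>G\<close> do not commute. It is met by one functional, \<open>quad\<close>, concave
  quadratic in a trial operator X and linear in the pair of positive operators. Its maximum over X
  is the integrand of the resolvent representation of the relative entropy. Monotonicity then
  becomes Kadison-Schwarz for a pulled-back X, and Lieb's inequality is the insertion of an X that
  is optimal for another pair. The integrals are handled through explicit scalar antiderivatives in
  the truncation point T, so that an inequality of integrands passes to the limits by comparing
  derivatives.

  Strict lower bounds r below the infima take the place of minimizers. The order of choices matters:
  the second witness is requested for \<tau>, which is built from the first. The operators left by
  the outcomes on B are not normalized, so traces such as tr \<rho> stay in the bounds and a witness
  has to exist for separable operators of trace at most 1.

  The second inequality comes, like the third, from n copies, where the gap between E and its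
  measured version is negligible after division by n.\<close>

abbreviation adj :: "complex mat \<Rightarrow> complex mat" where "adj \<equiv> mat_adjoint"

section \<open>Adjoints and entries of matrix products\<close>

lemma adj_dim [simp]: "dim_row (adj A) = dim_col A" "dim_col (adj A) = dim_row A"
  by (auto simp: mat_adjoint_def mat_of_rows_def)

lemma adj_carrier [simp, intro]: "A \<in> carrier_mat n m \<Longrightarrow> adj A \<in> carrier_mat m n"
  by (metis adj_dim carrier_matD carrier_matI)

lemma adj_carrier_iff [simp]: "adj A \<in> carrier_mat m n \<longleftrightarrow> A \<in> carrier_mat n m"
  by (metis adj_dim carrier_matD carrier_matI)

lemma adj_index [simp]: "i < dim_col A \<Longrightarrow> j < dim_row A \<Longrightarrow> adj A $$ (i, j) = cnj (A $$ (j, i))"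
  by (auto simp: mat_adjoint_def mat_of_rows_def)

lemma adj_adj [simp]: "adj (adj A) = A"
  by (rule eq_matI) auto

lemma mat_mult_index: "i < dim_row A \<Longrightarrow> j < dim_col B \<Longrightarrow> dim_col A = dim_row B \<Longrightarrow>
    (A * B) $$ (i, j) = (\<Sum>k<dim_row B. A $$ (i, k) * B $$ (k, j))"
  by (auto simp: scalar_prod_def atLeast0LessThan)

lemma adj_mult: "dim_col A = dim_row B \<Longrightarrow> adj (A * B) = adj B * adj A"
  by (rule eq_matI) (auto simp: mat_mult_index mult.commute simp del: index_mult_mat(1))

lemma adj_one [simp]: "adj (1\<^sub>m n) = 1\<^sub>m n"
  by (rule eq_matI) auto

lemma mat_diag_index [simp]: "i < n \<Longrightarrow> j < n \<Longrightarrow> mat_diag n f $$ (i, j) = (if i = j then f j else 0)"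
  by (simp add: mat_diag_def)

lemma mat_diag_dims [simp]: "dim_row (mat_diag n f) = n" "dim_col (mat_diag n f) = n"
  by (auto simp: mat_diag_def)

lemma adj_mat_diag [simp]: "adj (mat_diag n (\<lambda>i. complex_of_real (d i))) = mat_diag n (\<lambda>i. complex_of_real (d i))"
  by (rule eq_matI) auto

lemma adj_minus: "A \<in> carrier_mat n m \<Longrightarrow> B \<in> carrier_mat n m \<Longrightarrow> adj (A - B) = adj A - adj B"
  by (rule eq_matI) auto

subsection \<open>Trace\<close>

lemma tr_mult: "dim_col A = dim_row B \<Longrightarrow> dim_col B = dim_row A \<Longrightarrow>
   tr (A * B) = (\<Sum>i<dim_row A. \<Sum>k<dim_row B. A $$ (i, k) * B $$ (k, i))"
  by (simp add: tr_def mat_mult_index del: index_mult_mat(1))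

lemma tr_comm: "A \<in> carrier_mat n m \<Longrightarrow> B \<in> carrier_mat m n \<Longrightarrow> tr (A * B) = tr (B * A)"
  by (simp add: tr_mult carrier_matD[of A] carrier_matD[of B]) (subst sum.swap, simp add: mult.commute)

lemma tr_add: "A \<in> carrier_mat n n \<Longrightarrow> B \<in> carrier_mat n n \<Longrightarrow> tr (A + B) = tr A + tr B"
  by (auto simp: tr_def sum.distrib)

lemma tr_minus: "A \<in> carrier_mat n n \<Longrightarrow> B \<in> carrier_mat n n \<Longrightarrow> tr (A - B) = tr A - tr B"
  by (auto simp: tr_def sum_subtractf)

lemma tr_smult: "A \<in> carrier_mat n n \<Longrightarrow> tr (c \<cdot>\<^sub>m A) = c * tr A"
  by (auto simp: tr_def sum_distrib_left)

lemma tr_one: "tr (1\<^sub>m n) = of_nat n"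
  by (simp add: tr_def)

lemma tr_mat_diag_mult: "A \<in> carrier_mat n n \<Longrightarrow> tr (mat_diag n f * A) = (\<Sum>i<n. f i * A $$ (i, i))"
  by (simp add: mat_diag_mult_left tr_def)

subsection \<open>Finite sums of matrices\<close>

lemma sum_op_carrier [simp]: "sum_op n F X \<in> carrier_mat n n"
  by (simp add: sum_op_def)

lemma sum_op_dim [simp]: "dim_row (sum_op n F X) = n" "dim_col (sum_op n F X) = n"
  by (auto simp: sum_op_def)

lemma sum_op_index [simp]: "i < n \<Longrightarrow> j < n \<Longrightarrow> sum_op n F X $$ (i, j) = (\<Sum>x\<in>X. F x $$ (i, j))"
  by (simp add: sum_op_def)

lemma sum_op_cong: "(\<And>x. x \<in> X \<Longrightarrow> F x = G x) \<Longrightarrow> sum_op n F X = sum_op n G X"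
  by (auto simp: sum_op_def)

lemma sum_op_mult_left:
  assumes "A \<in> carrier_mat n n" "\<And>x. x \<in> X \<Longrightarrow> F x \<in> carrier_mat n n"
  shows "A * sum_op n F X = sum_op n (\<lambda>x. A * F x) X"
proof (rule eq_matI)
  fix i j assume ij: "i < dim_row (sum_op n (\<lambda>x. A * F x) X)" "j < dim_col (sum_op n (\<lambda>x. A * F x) X)"
  have "(A * sum_op n F X) $$ (i, j) = (\<Sum>k<n. \<Sum>x\<in>X. A $$ (i, k) * F x $$ (k, j))"
    using assms ij by (subst mat_mult_index) (auto simp: sum_distrib_left)
  also have "\<dots> = (\<Sum>x\<in>X. (A * F x) $$ (i, j))"
    using assms ij by (subst sum.swap, intro sum.cong refl, subst mat_mult_index) (auto dest!: assms(2))
  finally show "(A * sum_op n F X) $$ (i, j) = sum_op n (\<lambda>x. A * F x) X $$ (i, j)"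
    using ij by simp
qed (use assms in auto)

lemma sum_op_mult_right:
  assumes "A \<in> carrier_mat n n" "\<And>x. x \<in> X \<Longrightarrow> F x \<in> carrier_mat n n"
  shows "sum_op n F X * A = sum_op n (\<lambda>x. F x * A) X"
proof (rule eq_matI)
  fix i j assume ij: "i < dim_row (sum_op n (\<lambda>x. F x * A) X)" "j < dim_col (sum_op n (\<lambda>x. F x * A) X)"
  have "(sum_op n F X * A) $$ (i, j) = (\<Sum>k<n. \<Sum>x\<in>X. F x $$ (i, k) * A $$ (k, j))"
    using assms ij by (subst mat_mult_index) (auto simp: sum_distrib_right)
  also have "\<dots> = (\<Sum>x\<in>X. (F x * A) $$ (i, j))"
    using assms ij by (subst sum.swap, intro sum.cong refl, subst mat_mult_index) (auto dest!: assms(2))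
  finally show "(sum_op n F X * A) $$ (i, j) = sum_op n (\<lambda>x. F x * A) X $$ (i, j)"
    using ij by simp
qed (use assms in auto)

lemma tr_sum_op: 
  assumes "\<And>x. x \<in> X \<Longrightarrow> F x \<in> carrier_mat n n"
  shows "tr (sum_op n F X) = (\<Sum>x\<in>X. tr (F x))"
proof -
  have "tr (sum_op n F X) = (\<Sum>x\<in>X. \<Sum>i<n. F x $$ (i, i))"
    by (simp add: tr_def) (rule sum.swap)
  also have "\<dots> = (\<Sum>x\<in>X. tr (F x))"
    by (intro sum.cong refl) (auto simp: tr_def dest!: assms)
  finally show ?thesis .
qed

subsection \<open>Positive semidefinite matrices\<close>

lemma quad_form:
  assumes "A \<in> carrier_mat n n" "v \<in> carrier_vec n"
  shows "(A *\<^sub>v v) \<bullet>c v = (\<Sum>i<n. \<Sum>j<n. cnj (v $ i) * A $$ (i, j) * v $ j)"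
  using assms by (auto simp: scalar_prod_def atLeast0LessThan sum_distrib_left sum_distrib_right mult_ac
      intro!: sum.cong)

lemma psd_carrier: "pos_semidef n A \<Longrightarrow> A \<in> carrier_mat n n"
  by (simp add: pos_semidef_def)

lemma sum_unit_quad:
  fixes i n :: nat
  assumes "i < n"
  shows "(\<Sum>k<n. \<Sum>l<n. cnj (if k = i then 1 else 0) * g k l * (if l = i then 1 else 0)) = (g i i :: complex)"
proof -
  have "(\<Sum>l<n. cnj (if k = i then 1 else 0) * g k l * (if l = i then 1 else 0)) = (if k = i then g i i else 0)" for k
  proof -
    have "(\<Sum>l<n. cnj (if k = i then 1 else 0) * g k l * (if l = i then 1 else 0))
        = (\<Sum>l<n. if l = i then (if k = i then g i i else 0) else 0)"
      by (intro sum.cong refl) auto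
    also have "\<dots> = (if k = i then g i i else 0)" using assms by simp
    finally show ?thesis .
  qed
  then show ?thesis using assms by simp
qed

lemma psd_quad: "pos_semidef n A \<Longrightarrow> 0 \<le> (\<Sum>i<n. \<Sum>j<n. cnj (f i) * A $$ (i, j) * f j)"
proof -
  assume A: "pos_semidef n A"
  then have "0 \<le> (A *\<^sub>v vec n f) \<bullet>c vec n f" by (simp add: pos_semidef_def)
  then show ?thesis using A quad_form[of A n "vec n f"] by (simp add: pos_semidef_def)
qed

lemma psdI: "A \<in> carrier_mat n n \<Longrightarrow> (\<And>f. 0 \<le> (\<Sum>i<n. \<Sum>j<n. cnj (f i) * A $$ (i, j) * f j)) \<Longrightarrow> pos_semidef n A"
  by (auto simp: pos_semidef_def quad_form)

text \<open>Polarization: the complex order makes the quadratic form real, and realness at e_i, e_j,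
  e_i + e_j and e_i + \<open>\<i>\<close> e_j fixes the real and imaginary part of the mirrored
  entry.\<close>

lemma psd_hermitian_index:
  assumes A: "pos_semidef n A" and ij: "i < n" "j < n"
  shows "A $$ (j, i) = cnj (A $$ (i, j))"
proof (cases "i = j")
  case True
  have "0 \<le> (\<Sum>k<n. \<Sum>l<n. cnj (if k = i then 1 else 0) * A $$ (k, l) * (if l = i then 1 else 0))"
    by (rule psd_quad[OF A, of "\<lambda>k. if k = i then 1 else 0"])
  also have "\<dots> = A $$ (i, i)"
    using ij by (intro sum_unit_quad)
  finally show ?thesis using True by (simp add: complex_eq_iff less_eq_complex_def)
next
  case False
  have *: "0 \<le> cnj a * a * A $$ (i, i) + cnj a * b * A $$ (i, j) + (cnj b * a * A $$ (j, i) + cnj b * b * A $$ (j, j))" for a b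
  proof -
    define f where "f k = (if k = i then a else if k = j then b else 0)" for k
    have S: "(\<Sum>l<n. g l * f l) = g i * a + g j * b" for g
    proof -
      have "(\<Sum>l<n. g l * f l) = (\<Sum>l\<in>{i, j}. g l * f l)"
        using ij by (intro sum.mono_neutral_right) (auto simp: f_def)
      then show ?thesis using False by (simp add: f_def)
    qed
    have S': "(\<Sum>l<n. cnj (f l) * g l) = cnj a * g i + cnj b * g j" for g
    proof -
      have "(\<Sum>l<n. cnj (f l) * g l) = (\<Sum>l\<in>{i, j}. cnj (f l) * g l)"
        using ij by (intro sum.mono_neutral_right) (auto simp: f_def)
      then show ?thesis using False by (simp add: f_def)
    qed
    have "0 \<le> (\<Sum>k<n. \<Sum>l<n. cnj (f k) * A $$ (k, l) * f l)"
      by (rule psd_quad[OF A])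
    also have "\<dots> = (\<Sum>k<n. cnj (f k) * (A $$ (k, i) * a + A $$ (k, j) * b))"
      by (intro sum.cong refl, subst S) (simp add: algebra_simps)
    also have "\<dots> = cnj a * (A $$ (i, i) * a + A $$ (i, j) * b) + cnj b * (A $$ (j, i) * a + A $$ (j, j) * b)"
      by (rule S')
    finally show ?thesis by (simp add: algebra_simps)
  qed
  from *[of 1 0] *[of 0 1] *[of 1 1] *[of 1 \<i>] show ?thesis
    by (auto simp: less_eq_complex_def complex_eq_iff)
qed

lemma psd_hermitian: "pos_semidef n A \<Longrightarrow> adj A = A"
  using psd_carrier[of n A] by (intro eq_matI) (auto dest: psd_hermitian_index)

lemma mult_cnj_nonneg: "0 \<le> z * cnj z"
  by (auto simp: less_eq_complex_def)

lemma psd_gram: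
  assumes R: "R \<in> carrier_mat n m"
  shows "pos_semidef n (R * adj R)"
proof (rule psdI)
  fix f :: "nat \<Rightarrow> complex"
  have "(\<Sum>i<n. \<Sum>j<n. cnj (f i) * (R * adj R) $$ (i, j) * f j)
      = (\<Sum>i<n. \<Sum>j<n. \<Sum>k<m. cnj (f i) * (R $$ (i, k) * cnj (R $$ (j, k))) * f j)"
    using R by (intro sum.cong refl, subst mat_mult_index) (auto simp: sum_distrib_left sum_distrib_right)
  also have "\<dots> = (\<Sum>i<n. \<Sum>k<m. \<Sum>j<n. cnj (f i) * (R $$ (i, k) * cnj (R $$ (j, k))) * f j)"
    by (intro sum.cong refl sum.swap)
  also have "\<dots> = (\<Sum>k<m. \<Sum>i<n. \<Sum>j<n. cnj (f i) * (R $$ (i, k) * cnj (R $$ (j, k))) * f j)"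
    by (rule sum.swap)
  also have "\<dots> = (\<Sum>k<m. (\<Sum>i<n. cnj (f i) * R $$ (i, k)) * cnj (\<Sum>i<n. cnj (f i) * R $$ (i, k)))"
    by (intro sum.cong refl, simp only: cnj_sum sum_product) (simp add: mult_ac)
  also have "\<dots> \<ge> 0"
    by (intro sum_nonneg mult_cnj_nonneg)
  finally show "0 \<le> (\<Sum>i<n. \<Sum>j<n. cnj (f i) * (R * adj R) $$ (i, j) * f j)" .
qed (use R in auto)

lemma psd_gram': "R \<in> carrier_mat m n \<Longrightarrow> pos_semidef n (adj R * R)"
  using psd_gram[of "adj R" n m] by simp

lemma psd_smult: "pos_semidef n A \<Longrightarrow> 0 \<le> c \<Longrightarrow> pos_semidef n (c \<cdot>\<^sub>m A)"
proof (rule psdI)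
  fix f assume "pos_semidef n A" "0 \<le> c"
  have "0 \<le> c * (\<Sum>i<n. \<Sum>j<n. cnj (f i) * A $$ (i, j) * f j)"
    using psd_quad[OF \<open>pos_semidef n A\<close>, of f] \<open>0 \<le> c\<close> by (simp add: less_eq_complex_def)
  then show "0 \<le> (\<Sum>i<n. \<Sum>j<n. cnj (f i) * (c \<cdot>\<^sub>m A) $$ (i, j) * f j)"
    using psd_carrier[OF \<open>pos_semidef n A\<close>] by (simp add: sum_distrib_left mult_ac)
qed (auto dest: psd_carrier)

lemma psd_zero [simp]: "pos_semidef n (0\<^sub>m n n)"
  by (intro psdI) auto

lemma psd_one [simp]: "pos_semidef n (1\<^sub>m n)"
  using psd_gram[of "1\<^sub>m n" n n] by simp

lemma psd_sum_op:
  assumes "\<And>x. x \<in> X \<Longrightarrow> pos_semidef n (F x)"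
  shows "pos_semidef n (sum_op n F X)"
proof (rule psdI)
  fix f
  have "(\<Sum>i<n. \<Sum>j<n. cnj (f i) * sum_op n F X $$ (i, j) * f j)
     = (\<Sum>i<n. \<Sum>j<n. \<Sum>x\<in>X. cnj (f i) * F x $$ (i, j) * f j)"
    by (simp add: sum_distrib_left sum_distrib_right)
  also have "\<dots> = (\<Sum>i<n. \<Sum>x\<in>X. \<Sum>j<n. cnj (f i) * F x $$ (i, j) * f j)"
    by (intro sum.cong refl sum.swap)
  also have "\<dots> = (\<Sum>x\<in>X. \<Sum>i<n. \<Sum>j<n. cnj (f i) * F x $$ (i, j) * f j)"
    by (rule sum.swap)
  also have "\<dots> \<ge> 0"
    by (intro sum_nonneg psd_quad assms)
  finally show "0 \<le> (\<Sum>i<n. \<Sum>j<n. cnj (f i) * sum_op n F X $$ (i, j) * f j)" .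
qed simp

lemma psd_diag: "pos_semidef n A \<Longrightarrow> i < n \<Longrightarrow> 0 \<le> A $$ (i, i)"
  using psd_quad[of n A "\<lambda>k. if k = i then 1 else 0"] by (simp only: sum_unit_quad)

lemma psd_tr: "pos_semidef n A \<Longrightarrow> 0 \<le> tr A"
  using psd_carrier[of n A] by (auto simp: tr_def intro!: sum_nonneg psd_diag[of n])

lemma mat_assoc: "dim_col A = dim_row B \<Longrightarrow> dim_col B = dim_row C \<Longrightarrow> A * B * C = A * (B * (C :: complex mat))"
  by (rule assoc_mult_mat[of _ "dim_row A" "dim_col A" _ "dim_col B" _ "dim_col C"]) auto

lemma mat_carrier_iff: "A \<in> carrier_mat n m \<longleftrightarrow> dim_row A = n \<and> dim_col A = m"
  by auto

subsection \<open>Spectral theorem\<close>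

definition unitary_mat :: "nat \<Rightarrow> complex mat \<Rightarrow> bool" where
  "unitary_mat n U \<longleftrightarrow> U \<in> carrier_mat n n \<and> adj U * U = 1\<^sub>m n"

definition real_diag :: "nat \<Rightarrow> (nat \<Rightarrow> real) \<Rightarrow> complex mat" where
  "real_diag n d = mat_diag n (\<lambda>i. complex_of_real (d i))"

definition is_spec :: "nat \<Rightarrow> complex mat \<Rightarrow> complex mat \<Rightarrow> (nat \<Rightarrow> real) \<Rightarrow> bool" where
  "is_spec n A U d \<longleftrightarrow> unitary_mat n U \<and> A = U * real_diag n d * adj U"

lemma real_diag_carrier [simp]: "real_diag n d \<in> carrier_mat n n"
  by (simp add: real_diag_def)

lemma real_diag_dim [simp]: "dim_row (real_diag n d) = n" "dim_col (real_diag n d) = n"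
  by (simp_all add: real_diag_def)

lemma real_diag_index [simp]: "i < n \<Longrightarrow> j < n \<Longrightarrow> real_diag n d $$ (i, j) = (if i = j then complex_of_real (d j) else 0)"
  by (simp add: real_diag_def)

lemma adj_real_diag [simp]: "adj (real_diag n d) = real_diag n d"
  by (simp add: real_diag_def)

lemma unitary_carrier: "unitary_mat n U \<Longrightarrow> U \<in> carrier_mat n n"
  by (simp add: unitary_mat_def)

lemma unitary_dims: assumes "unitary_mat n U" shows "dim_row U = n" "dim_col U = n"
  using unitary_carrier[OF assms] by auto

lemma unitary_left: "unitary_mat n U \<Longrightarrow> adj U * U = 1\<^sub>m n"
  by (simp add: unitary_mat_def)

lemma unitary_right: "unitary_mat n U \<Longrightarrow> U * adj U = 1\<^sub>m n"
  unfolding unitary_mat_def using mat_mult_left_right_inverse[of "adj U" n U] by auto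

lemma unitary_adj: "unitary_mat n U \<Longrightarrow> unitary_mat n (adj U)"
  using unitary_right[of n U] by (auto simp: unitary_mat_def)

lemma unitary_mult: 
  assumes "unitary_mat n U" "unitary_mat n V" shows "unitary_mat n (U * V)"
proof -
  note [simp] = unitary_dims[OF assms(1)] unitary_dims[OF assms(2)]
  have "adj (U * V) * (U * V) = adj V * (adj U * U) * V"
    by (simp add: adj_mult[of U V] mat_assoc)
  also have "\<dots> = 1\<^sub>m n" using unitary_left[OF assms(1)] unitary_left[OF assms(2)] by simp
  finally show ?thesis by (auto simp: unitary_mat_def mat_carrier_iff)
qed

lemma unitary_cancel:
  assumes "unitary_mat n U" "dim_row X = n"
  shows "adj U * (U * X) = X" "U * (adj U * X) = X"
proof -
  note [simp] = unitary_dims[OF assms(1)] assms(2)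
  show "adj U * (U * X) = X"
    using unitary_left[OF assms(1)] by (subst mat_assoc[symmetric]) auto
  show "U * (adj U * X) = X"
    using unitary_right[OF assms(1)] by (subst mat_assoc[symmetric]) auto
qed

text \<open>The deflation step of Schur's theorem. The characteristic polynomial splits over the
  complex numbers, so an eigenvector exists; it is completed to a basis and orthogonalized with the
  eigenvector kept in front. In the resulting basis the first column of \<open>A\<close> is l times
  the first basis vector.\<close>

lemma unitary_extension:
  fixes A :: "complex mat"
  assumes A: "A \<in> carrier_mat n n" and n: "n \<noteq> 0"
  obtains V l where "unitary_mat n V" "\<And>i. i < n \<Longrightarrow> (adj V * (A * V)) $$ (i, 0) = (if i = 0 then l else 0)"
proof -
  obtain es where es: "char_poly A = (\<Prod>a\<leftarrow>es. [:- a, 1:])" "length es = n"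
    using char_poly_factorized[OF A] by blast
  then obtain e es' where "es = e # es'" using n by (cases es) auto
  with es have e: "eigenvalue A e"
    unfolding eigenvalue_root_char_poly[OF A] by simp
  define v where "v = find_eigenvector A e"
  define b where "b = basis_completion v"
  define ws where "ws = gram_schmidt n b"
  define W where "W = mat_of_cols n ws"
  from find_eigenvector[OF A e] have ev: "eigenvector A v e" unfolding v_def .
  from this[unfolded eigenvector_def]
  have v[simp]: "v \<in> carrier_vec n" and v0: "v \<noteq> 0\<^sub>v n" and Av: "A *\<^sub>v v = e \<cdot>\<^sub>v v" using A by auto
  interpret cof_vec_space n "TYPE(complex)" .
  from basis_completion[OF v v0, folded b_def]
  have dist_b: "distinct b" 
    and indep: "\<not> lin_dep (set b)" and b: "set b \<subseteq> carrier_vec n" and hdb: "hd b = v" 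
    and len_b: "length b = n" by auto
  from hdb len_b n obtain vs where bv: "b = v # vs" by (cases b, auto)
  from gram_schmidt_result[OF b dist_b indep refl, folded ws_def]
  have ws: "set ws \<subseteq> carrier_vec n" "corthogonal ws" "length ws = n" 
    by (auto simp: len_b)
  from gram_schmidt_hd[OF v, of vs, folded bv] have hdws: "hd ws = v" unfolding ws_def .
  have orth_W: "corthogonal_mat W" using orthogonal_mat_of_cols ws unfolding W_def .
  have W: "W \<in> carrier_mat n n"
    using ws unfolding W_def using mat_of_cols_carrier(1)[of n ws] by auto
  have colW: "col W 0 = v" unfolding W_def using ws n hdws
    by (metis col_mat_of_cols hd_conv_nth list.size(3) neq0_conv nth_mem subset_code(1))
  \<comment> \<open>Gram-Schmidt delivers orthogonal columns that are not normalized; c holds their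
    norms, and dividing by them makes the matrix unitary.\<close>
  define c where "c j = sqrt (\<Sum>k<n. (cmod (W $$ (k, j)))\<^sup>2)" for j
  define V where "V = mat n n (\<lambda>(i, j). W $$ (i, j) / complex_of_real (c j))"
  have V: "V \<in> carrier_mat n n" by (simp add: V_def)
  have WW: "(adj W * W) $$ (i, j) = (if i = j then complex_of_real ((c i)\<^sup>2) else 0)" if "i < n" "j < n" for i j
  proof (cases "i = j")
    case True
    then show ?thesis using that W
      by (subst mat_mult_index) (auto simp: c_def real_sqrt_pow2 sum_nonneg complex_norm_square mult.commute simp del: of_real_power intro!: sum.cong)
  next
    case False
    then show ?thesis using that W orth_W
      unfolding corthogonal_mat_def Let_def diagonal_mat_def by auto
  qed
  have c0: "c j \<noteq> 0" if "j < n" for j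
    using WW[OF that that] orth_W that W unfolding corthogonal_mat_def Let_def diagonal_mat_def by auto
  have VV: "adj V * V = 1\<^sub>m n"
  proof (rule eq_matI)
    fix i j assume "i < dim_row (1\<^sub>m n :: complex mat)" "j < dim_col (1\<^sub>m n :: complex mat)"
    then have ij: "i < n" "j < n" by auto
    have "(adj V * V) $$ (i, j) = (\<Sum>k<n. cnj (W $$ (k, i)) * W $$ (k, j)) / (c i * c j)"
      using ij V by (subst mat_mult_index) (auto simp: V_def sum_divide_distrib)
    also have "(\<Sum>k<n. cnj (W $$ (k, i)) * W $$ (k, j)) = (adj W * W) $$ (i, j)"
      using ij W by (subst mat_mult_index) auto
    also have "\<dots> / (c i * c j) = 1\<^sub>m n $$ (i, j)"
      using ij c0[of i] c0[of j] by (auto simp: WW power2_eq_square)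
    finally show "(adj V * V) $$ (i, j) = 1\<^sub>m n $$ (i, j)" .
  qed (use V in auto)
  have AV: "(A * V) $$ (k, 0) = e * V $$ (k, 0)" if "k < n" for k
  proof -
    have "(A * V) $$ (k, 0) = (\<Sum>l<n. A $$ (k, l) * W $$ (l, 0)) / c 0"
      using that n A V by (subst mat_mult_index) (auto simp: V_def sum_divide_distrib)
    also have "(\<Sum>l<n. A $$ (k, l) * W $$ (l, 0)) = (A *\<^sub>v col W 0) $ k"
      using that n A W by (auto simp: scalar_prod_def atLeast0LessThan)
    also have "\<dots> = e * W $$ (k, 0)"
      unfolding colW Av using that n W by (simp flip: colW)
    finally show ?thesis using that n by (simp add: V_def)
  qed
  have "(adj V * (A * V)) $$ (i, 0) = (if i = 0 then e else 0)" if "i < n" for i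
  proof -
    have "(adj V * (A * V)) $$ (i, 0) = e * (\<Sum>k<n. cnj (V $$ (k, i)) * V $$ (k, 0))"
      using that n A V by (subst mat_mult_index) (auto simp: AV sum_distrib_left mult_ac simp del: index_mult_mat(1))
    also have "(\<Sum>k<n. cnj (V $$ (k, i)) * V $$ (k, 0)) = (adj V * V) $$ (i, 0)"
      using that n V by (subst mat_mult_index) auto
    finally show ?thesis using that n by (simp add: VV)
  qed
  moreover have "unitary_mat n V" using V VV by (simp add: unitary_mat_def)
  ultimately show ?thesis using that by blast
qed

lemma adj_four_block:
  assumes "A1 \<in> carrier_mat a b" "A2 \<in> carrier_mat a d" "A3 \<in> carrier_mat c b" "A4 \<in> carrier_mat c d"
  shows "adj (four_block_mat A1 A2 A3 A4) = four_block_mat (adj A1) (adj A3) (adj A2) (adj A4)"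
  using assms by (intro eq_matI) auto

text \<open>Induction on the dimension. After deflation Hermiticity clears the first row together
  with the first column, so the matrix is block diagonal and the lower right block is again
  Hermitian.\<close>

theorem spectral_theorem:
  assumes "A \<in> carrier_mat n n" "adj A = A"
  shows "\<exists>U d. is_spec n A U d"
  using assms
proof (induction n arbitrary: A)
  case 0
  have "is_spec 0 A (1\<^sub>m 0) (\<lambda>_. 0)"
    using 0 by (auto simp: is_spec_def unitary_mat_def intro!: eq_matI)
  then show ?case by blast
next
  case (Suc n)
  note A = Suc.prems(1)
  obtain V l where V: "unitary_mat (Suc n) V"
    and col0: "\<And>i. i < Suc n \<Longrightarrow> (adj V * (A * V)) $$ (i, 0) = (if i = 0 then l else 0)"
    using unitary_extension[OF A] by blast
  note [simp] = unitary_dims[OF V] carrier_matD[OF A]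
  define M where "M = adj V * (A * V)"
  have M: "M \<in> carrier_mat (Suc n) (Suc n)" by (simp add: M_def mat_carrier_iff)
  note [simp] = carrier_matD[OF M]
  have adjM: "adj M = M"
    by (simp add: M_def adj_mult[of _ "_ * _"] adj_mult[of A] Suc.prems mat_assoc)
  have Msym: "M $$ (j, i) = cnj (M $$ (i, j))" if "i < Suc n" "j < Suc n" for i j
    using that M arg_cong[OF adjM, of "\<lambda>X. X $$ (j, i)"] by auto
  define B where "B = mat n n (\<lambda>(i, j). M $$ (Suc i, Suc j))"
  have "B \<in> carrier_mat n n" by (simp add: B_def)
  moreover have "adj B = B"
    by (rule eq_matI) (auto simp: B_def intro: Msym[symmetric])
  ultimately obtain U d where "is_spec n B U d" using Suc.IH by blast
  then have U: "unitary_mat n U" and B: "B = U * real_diag n d * adj U" by (auto simp: is_spec_def)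
  note [simp] = unitary_dims[OF U] unitary_carrier[OF U]
  \<comment> \<open>The direct sum of the scalar 1 and the unitary that diagonalizes the lower
    block.\<close>
  define W where "W = four_block_mat (1\<^sub>m 1) (0\<^sub>m 1 n) (0\<^sub>m n 1) U"
  define d' where "d' i = (case i of 0 \<Rightarrow> Re l | Suc j \<Rightarrow> d j)" for i
  have W: "W \<in> carrier_mat (Suc n) (Suc n)"
    using four_block_carrier_mat[of "1\<^sub>m 1" 1 1 U n n] by (simp add: W_def)
  have adjW: "adj W = four_block_mat (1\<^sub>m 1) (0\<^sub>m 1 n) (0\<^sub>m n 1) (adj U)"
  proof -
    have "adj (0\<^sub>m 1 n) = 0\<^sub>m n 1" "adj (0\<^sub>m n 1) = 0\<^sub>m 1 n" by (auto intro!: eq_matI)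
    then show ?thesis unfolding W_def by (subst adj_four_block[of _ 1 1 _ n _ n]) auto
  qed
  have WW: "unitary_mat (Suc n) W"
  proof -
    have "adj W * W = 1\<^sub>m (1 + n)"
      unfolding adjW unfolding W_def
      by (subst mult_four_block_mat[of _ 1 1 _ n _ n _ _ 1 _ n]) (auto simp: unitary_left[OF U] intro!: eq_matI)
    then show ?thesis using W by (simp add: unitary_mat_def)
  qed
  \<comment> \<open>A diagonal entry of a Hermitian matrix is real; this lets the eigenvalue list be
    real valued.\<close>
  have l: "l = complex_of_real (Re l)"
    using Msym[of 0 0] col0[of 0, folded M_def] by (simp add: complex_eq_iff)
  have D: "real_diag (Suc n) d' = four_block_mat (mat 1 1 (\<lambda>_. l)) (0\<^sub>m 1 n) (0\<^sub>m n 1) (real_diag n d)"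
    by (rule eq_matI) (auto simp: d'_def l[symmetric] split: nat.splits)
  have "W * real_diag (Suc n) d' * adj W = four_block_mat (mat 1 1 (\<lambda>_. l)) (0\<^sub>m 1 n) (0\<^sub>m n 1) B"
    unfolding D W_def adjW[unfolded W_def] B
    by (subst mult_four_block_mat[of _ 1 1 _ n _ n _ _ 1 _ n], simp_all)
      (subst mult_four_block_mat[of _ 1 1 _ n _ n _ _ 1 _ n], simp_all add: left_add_zero_mat[of _ n n] mat_carrier_iff)
  also have "\<dots> = M"
  proof (rule eq_matI)
    fix i j assume "i < dim_row M" "j < dim_col M"
    then have "i < Suc n" "j < Suc n" using M by auto
    then show "four_block_mat (mat 1 1 (\<lambda>_. l)) (0\<^sub>m 1 n) (0\<^sub>m n 1) B $$ (i, j) = M $$ (i, j)"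
      using col0[of i, folded M_def] col0[of j, folded M_def] Msym[of j 0]
      by (cases i; cases j) (auto simp: B_def)
  qed (use M in \<open>auto simp: B_def\<close>)
  finally have MW: "M = W * real_diag (Suc n) d' * adj W" by simp
  have "A = V * (adj V * (A * V)) * adj V"
    using unitary_right[OF V] by (simp add: mat_assoc unitary_cancel[OF V])
  also have "\<dots> = (V * W) * real_diag (Suc n) d' * adj (V * W)"
    using W by (simp add: M_def[symmetric] MW adj_mult[of V W] mat_assoc)
  finally have "is_spec (Suc n) A (V * W) d'"
    using unitary_mult[OF V WW] by (simp add: is_spec_def)
  then show ?case by blast
qed

text \<open>Carriers are tracked through dimension equations, so that the side conditions of matrix
  identities are left to the simplifier.\<close>

declare index_mult_mat(1) [simp del]
declare carrier_matD [simp del] carrier_vecD [simp del] assoc_mult_mat [simp del] assoc_mult_mat_vec [simp del] adj_carrier_iff [simp del]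
declare mat_carrier_iff [simp] carrier_dim_vec [simp]

lemma mult_real_diag_index [simp]:
  assumes "dim_col A = n" "i < dim_row A" "j < n"
  shows "(A * real_diag n d) $$ (i, j) = A $$ (i, j) * complex_of_real (d j)"
  unfolding real_diag_def using assms by (subst mat_diag_mult_right[of _ "dim_row A"]) auto

lemma real_diag_mult_index [simp]:
  assumes "dim_row A = n" "i < n" "j < dim_col A"
  shows "(real_diag n d * A) $$ (i, j) = complex_of_real (d i) * A $$ (i, j)"
  unfolding real_diag_def using assms by (subst mat_diag_mult_left[of _ _ "dim_col A"]) auto

lemma real_diag_mult_vec:
  assumes "dim_vec v = n" "i < n"
  shows "(real_diag n d *\<^sub>v v) $ i = complex_of_real (d i) * v $ i"
proof -
  have "(real_diag n d *\<^sub>v v) $ i = (\<Sum>k<n. real_diag n d $$ (i, k) * v $ k)"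
    using assms by (auto simp: scalar_prod_def atLeast0LessThan)
  also have "\<dots> = (\<Sum>k<n. (if k = i then d i * v $ i else 0))"
    using assms by (intro sum.cong) auto
  finally show ?thesis using assms by simp
qed

lemma is_specD:
  assumes "is_spec n A U d"
  shows "unitary_mat n U" "A = U * real_diag n d * adj U" "dim_row U = n" "dim_col U = n" 
    "A \<in> carrier_mat n n" "dim_row A = n" "dim_col A = n" "adj U * A * U = real_diag n d"
proof -
  show U: "unitary_mat n U" and A: "A = U * real_diag n d * adj U" using assms by (auto simp: is_spec_def)
  note [simp] = unitary_dims[OF U]
  show "dim_row U = n" "dim_col U = n" by simp_all
  show "A \<in> carrier_mat n n" "dim_row A = n" "dim_col A = n" using A by (auto simp: mat_carrier_iff)
  show "adj U * A * U = real_diag n d"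
    unfolding A by (simp add: mat_assoc unitary_cancel[OF U] unitary_left[OF U])
qed

lemma diag_conj_index:
  assumes "C \<in> carrier_mat n n" "i < n" "j < n"
  shows "(C * real_diag n e * adj C) $$ (i, j) = (\<Sum>k<n. C $$ (i, k) * e k * cnj (C $$ (j, k)))"
  using assms by (subst mat_mult_index) auto

lemma diag_conj_index_diag:
  assumes "C \<in> carrier_mat n n" "i < n"
  shows "(C * real_diag n e * adj C) $$ (i, i) = complex_of_real (\<Sum>k<n. e k * (cmod (C $$ (i, k)))\<^sup>2)"
  using assms by (auto simp: diag_conj_index complex_norm_square mult_ac simp del: of_real_power intro!: sum.cong)

text \<open>\<open>d i\<close> is the quadratic form of \<open>A\<close> at the i-th column of
  \<open>U\<close>.\<close>

lemma spec_psd_nonneg: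
  assumes "is_spec n A U d" "pos_semidef n A" "i < n"
  shows "0 \<le> d i"
proof -
  note [simp] = is_specD(3,4,6,7)[OF assms(1)]
  have "real_diag n d $$ (i, i) = (\<Sum>k<n. \<Sum>l<n. cnj (U $$ (k, i)) * A $$ (k, l) * U $$ (l, i))"
    unfolding is_specD(8)[OF assms(1), symmetric] using assms(3)
    by (simp add: mat_assoc) (subst mat_mult_index, auto simp: mat_mult_index sum_distrib_left mult_ac)
  also have "\<dots> \<ge> 0" by (rule psd_quad[OF assms(2)])
  finally show ?thesis using assms(3) by (simp add: less_eq_complex_def)
qed

lemma psd_spec:
  assumes "pos_semidef n A"
  obtains U d where "is_spec n A U d" "\<And>i. i < n \<Longrightarrow> 0 \<le> d i"
  using spectral_theorem[OF psd_carrier[OF assms] psd_hermitian[OF assms]] spec_psd_nonneg[OF _ assms]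
  by blast

lemma real_diag_mult: "real_diag n d * real_diag n e = real_diag n (\<lambda>i. d i * e i)"
  by (simp add: real_diag_def)

lemma real_diag_cong: "(\<And>i. i < n \<Longrightarrow> d i = e i) \<Longrightarrow> real_diag n d = real_diag n e"
  by (auto intro!: eq_matI)

text \<open>Scaling the eigenvectors by the square roots of the eigenvalues gives a factor R, not
  necessarily Hermitian. It suffices for congruences, for traces of products, for tensor products,
  and for writing the effect of a measurement as a sum of Kraus operators.\<close>

lemma psd_factor:
  assumes "pos_semidef n A"
  obtains R where "R \<in> carrier_mat n n" "A = R * adj R"
proof -
  obtain U d where s: "is_spec n A U d" and d: "\<And>i. i < n \<Longrightarrow> 0 \<le> d i" using psd_spec[OF assms] by blast
  note [simp] = is_specD(3,4)[OF s]
  define R where "R = U * real_diag n (\<lambda>i. sqrt (d i))"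
  have "R * adj R = U * (real_diag n (\<lambda>i. sqrt (d i)) * real_diag n (\<lambda>i. sqrt (d i))) * adj U"
    by (simp add: R_def adj_mult mat_assoc)
  also have "\<dots> = A"
    using d unfolding is_specD(2)[OF s] real_diag_mult
    by (simp cong: real_diag_cong)
  finally show ?thesis using that[of R] by (simp add: R_def mat_carrier_iff)
qed

lemma psd_conj:
  assumes "pos_semidef n A" "C \<in> carrier_mat n m"
  shows "pos_semidef m (adj C * A * C)"
proof -
  obtain R where R: "R \<in> carrier_mat n n" "A = R * adj R" using psd_factor[OF assms(1)] by blast
  then have "adj C * A * C = (adj C * R) * adj (adj C * R)"
    using assms(2) by (auto simp: adj_mult mat_assoc mat_carrier_iff)
  then show ?thesis using R assms(2) psd_gram[of "adj C * R" m n] by (auto simp: mat_carrier_iff)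
qed

lemma psd_conj':
  assumes "pos_semidef n A" "C \<in> carrier_mat m n"
  shows "pos_semidef m (C * A * adj C)"
  using psd_conj[of n A "adj C" m] assms by simp

text \<open>Cyclicity turns the trace into that of the congruence \<open>adj R * B * R\<close>.
  Outcome probabilities and the squares used in the operator inequalities below are nonnegative for
  this reason.\<close>

lemma psd_tr_mult:
  assumes "pos_semidef n A" "pos_semidef n B"
  shows "0 \<le> tr (A * B)"
proof -
  obtain R where R: "R \<in> carrier_mat n n" "A = R * adj R" using psd_factor[OF assms(1)] by blast
  have [simp]: "dim_row R = n" "dim_col R = n" "dim_row B = n" "dim_col B = n"
    using R psd_carrier[OF assms(2)] by auto
  have "tr (A * B) = tr (adj R * B * R)"
    unfolding R(2) using tr_comm[of R n n "adj R * B"] by (simp add: mat_assoc mat_carrier_iff)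
  then show ?thesis using psd_tr[OF psd_conj[OF assms(2) R(1)]] by simp
qed

lemma spec_psd:
  assumes "is_spec n A U d" "\<And>i. i < n \<Longrightarrow> 0 \<le> d i"
  shows "pos_semidef n A"
proof -
  have "pos_semidef n (real_diag n d)"
  proof -
    have "real_diag n d = real_diag n (\<lambda>i. sqrt (d i)) * adj (real_diag n (\<lambda>i. sqrt (d i)))"
      using assms(2) by (simp add: real_diag_mult cong: real_diag_cong)
    then show ?thesis using psd_gram[of "real_diag n (\<lambda>i. sqrt (d i))" n n] by simp
  qed
  then show ?thesis
    using psd_conj'[of n "real_diag n d" U n] unitary_carrier[OF is_specD(1)[OF assms(1)]] is_specD(2)[OF assms(1)] by simp
qed

subsection \<open>The logarithm and the Nussbaum--Szkola form of the relative entropy\<close>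

text \<open>The squared overlaps of the two eigenbases, a doubly stochastic matrix. With eigenvalues
  p and q the products p_i ovl_ij and q_j ovl_ij form the Nussbaum-Szkola pair, on which the quantum
  relative entropy becomes a classical one.\<close>

definition ovl :: "complex mat \<Rightarrow> complex mat \<Rightarrow> nat \<Rightarrow> nat \<Rightarrow> real" where
  "ovl U V i j = (cmod ((adj U * V) $$ (i, j)))\<^sup>2"

lemma ovl_nonneg [simp]: "0 \<le> ovl U V i j"
  by (simp add: ovl_def)

lemma ovl_sum:
  assumes "unitary_mat n U" "unitary_mat n V" "i < n"
  shows "(\<Sum>j<n. ovl U V i j) = 1"
proof -
  define C where "C = adj U * V"
  have C: "unitary_mat n C" unfolding C_def by (intro unitary_mult unitary_adj assms)
  note [simp] = unitary_dims[OF C]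
  have "1 = (C * adj C) $$ (i, i)" using assms(3) by (simp add: unitary_right[OF C])
  also have "\<dots> = (\<Sum>j<n. C $$ (i, j) * cnj (C $$ (i, j)))"
    using assms(3) by (subst mat_mult_index) auto
  also have "\<dots> = complex_of_real (\<Sum>j<n. ovl U V i j)"
    by (simp add: ovl_def C_def complex_norm_square del: of_real_power)
  finally show ?thesis using of_real_eq_1_iff by metis
qed

lemma ovl_commute:
  assumes "unitary_mat n U" "unitary_mat n V" "i < n" "j < n"
  shows "ovl U V i j = ovl V U j i"
proof -
  note [simp] = unitary_dims[OF assms(1)] unitary_dims[OF assms(2)]
  have "adj V * U = adj (adj U * V)" by (simp add: adj_mult)
  then show ?thesis using assms(3,4) by (simp add: ovl_def)
qed

lemma ovl_sum':
  assumes "unitary_mat n U" "unitary_mat n V" "j < n"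
  shows "(\<Sum>i<n. ovl U V i j) = 1"
proof -
  have "(\<Sum>i<n. ovl U V i j) = (\<Sum>i<n. ovl V U j i)"
    using assms by (intro sum.cong refl ovl_commute) auto
  then show ?thesis using ovl_sum[OF assms(2,1,3)] by simp
qed

lemma ovl_self:
  assumes "unitary_mat n U" "i < n" "j < n"
  shows "ovl U U i j = (if i = j then 1 else 0)"
  using assms by (simp add: ovl_def unitary_left)

lemma tr_spec_mult:
  assumes "is_spec n A U d" "is_spec n B V e"
  shows "tr (A * B) = complex_of_real (\<Sum>i<n. \<Sum>j<n. d i * e j * ovl U V i j)"
proof -
  note [simp] = is_specD(3,4)[OF assms(1)] is_specD(3,4)[OF assms(2)]
  define C where "C = adj U * V"
  have C: "C \<in> carrier_mat n n" by (simp add: C_def mat_carrier_iff)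
  have "tr (A * B) = tr (U * (real_diag n d * (adj U * V * real_diag n e * adj V)))"
    by (simp add: is_specD(2)[OF assms(1)] is_specD(2)[OF assms(2)] mat_assoc)
  also have "\<dots> = tr (real_diag n d * (C * real_diag n e * adj C))"
    by (subst tr_comm[of _ n n]) (auto simp: mat_carrier_iff mat_assoc C_def adj_mult)
  also have "\<dots> = (\<Sum>i<n. d i * (C * real_diag n e * adj C) $$ (i, i))"
    using C by (subst real_diag_def, subst tr_mat_diag_mult) (auto simp: mat_carrier_iff)
  also have "\<dots> = complex_of_real (\<Sum>i<n. \<Sum>j<n. d i * e j * ovl U V i j)"
    using C by (simp add: diag_conj_index_diag sum_distrib_left ovl_def C_def mult.assoc)
  finally show ?thesis .
qed

lemma tr_spec:
  assumes "is_spec n A U d"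
  shows "tr A = complex_of_real (\<Sum>i<n. d i)"
proof -
  note [simp] = is_specD(3,4)[OF assms(1)] 
  have "tr A = tr (real_diag n d * (adj U * U))"
    unfolding is_specD(2)[OF assms] mat_assoc
    by (subst tr_comm[of _ n n]) (auto simp: mat_carrier_iff mat_assoc unitary_left[OF is_specD(1)[OF assms]] unitary_cancel[OF is_specD(1)[OF assms]])
  also have "\<dots> = complex_of_real (\<Sum>i<n. d i)"
    by (simp add: unitary_left[OF is_specD(1)[OF assms]]) (simp add: tr_def)
  finally show ?thesis .
qed

text \<open>The change of basis C between two diagonalizations intertwines the eigenvalue lists, so
  an entry of C is nonzero only where the eigenvalues agree, and there every function of them agrees
  too. This makes the definite description in \<open>log_op\<close> meaningful.\<close>

lemma log_op_unique:
  assumes "is_log_op n A L" "is_log_op n A L'" shows "L = L'"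
proof -
  obtain U d where U: "unitary_mat n U" "A = U * real_diag n d * adj U" "L = U * real_diag n (\<lambda>i. ln_supp (d i)) * adj U"
    using assms(1) unfolding is_log_op_def unitary_mat_def real_diag_def by blast
  obtain V e where V: "unitary_mat n V" "A = V * real_diag n e * adj V" "L' = V * real_diag n (\<lambda>i. ln_supp (e i)) * adj V"
    using assms(2) unfolding is_log_op_def unitary_mat_def real_diag_def by blast
  note [simp] = unitary_dims[OF U(1)] unitary_dims[OF V(1)]
  define C where "C = adj U * V"
  have C[simp]: "dim_row C = n" "dim_col C = n" by (simp_all add: C_def)
  have "real_diag n d * C = adj U * A * V"
    unfolding U(2) by (simp add: C_def mat_assoc unitary_cancel[OF U(1)])
  also have "\<dots> = C * real_diag n e"
    unfolding V(2) by (simp add: C_def mat_assoc unitary_left[OF V(1)])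
  finally have eq: "real_diag n d * C = C * real_diag n e" .
  have *: "d i * C $$ (i, j) = C $$ (i, j) * e j" if "i < n" "j < n" for i j
    using arg_cong[OF eq, of "\<lambda>M. M $$ (i, j)"] that
    by simp
  have "real_diag n (\<lambda>i. ln_supp (d i)) * C = C * real_diag n (\<lambda>i. ln_supp (e i))"
  proof (rule eq_matI)
    fix i j assume "i < dim_row (C * real_diag n (\<lambda>i. ln_supp (e i)))" "j < dim_col (C * real_diag n (\<lambda>i. ln_supp (e i)))"
    then have ij: "i < n" "j < n" by auto
    have "C $$ (i, j) = 0 \<or> d i = e j" using *[OF ij] by (auto simp: mult.commute)
    then show "(real_diag n (\<lambda>i. ln_supp (d i)) * C) $$ (i, j) = (C * real_diag n (\<lambda>i. ln_supp (e i))) $$ (i, j)"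
      using ij by auto
  qed auto
  then have "U * (real_diag n (\<lambda>i. ln_supp (d i)) * C) * adj V = U * (C * real_diag n (\<lambda>i. ln_supp (e i))) * adj V" by simp
  then show ?thesis
    by (simp add: C_def mat_assoc unitary_cancel[OF U(1)] unitary_right[OF V(1)] U(3)[symmetric] V(3))
      (simp add: U(3) mat_assoc)
qed

lemma log_op_spec:
  assumes "is_spec n A U d"
  shows "log_op A = U * real_diag n (\<lambda>i. ln_supp (d i)) * adj U"
proof -
  have h: "is_log_op n A (U * real_diag n (\<lambda>i. ln_supp (d i)) * adj U)"
    using assms unfolding is_log_op_def is_spec_def unitary_mat_def real_diag_def by blast
  show ?thesis unfolding log_op_def is_specD(6)[OF assms]
    by (rule the_equality[where P="is_log_op n A", OF h]) (rule log_op_unique[OF _ h])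
qed

lemma is_spec_log:
  assumes "is_spec n A U d"
  shows "is_spec n (log_op A) U (\<lambda>i. ln_supp (d i))"
  using assms log_op_spec[OF assms] by (simp add: is_spec_def)

lemma spec_col:
  assumes "is_spec n A U d" "j < n"
  shows "A *\<^sub>v col U j = complex_of_real (d j) \<cdot>\<^sub>v col U j"
proof -
  note [simp] = is_specD(3,4,6,7)[OF assms(1)]
  have "A * U = U * real_diag n d"
    unfolding is_specD(2)[OF assms(1)] using unitary_left[OF is_specD(1)[OF assms(1)]] by (simp add: mat_assoc)
  then have "(A * U) $$ (i, j) = (U * real_diag n d) $$ (i, j)" if "i < n" for i by simp
  then have "(A * U) $$ (i, j) = U $$ (i, j) * d j" if "i < n" for i 
    using that assms(2) by (simp del: mult_real_diag_index add: mult_real_diag_index[of U n])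
  then show ?thesis using assms(2) by (intro eq_vecI) (auto simp: mat_mult_index mult.commute scalar_prod_def atLeast0LessThan)
qed

text \<open>An eigenvector with nonzero eigenvalue lies in the support, one with eigenvalue 0 in the
  kernel. Inclusion of supports thus says that an eigenvector of \<rho> of positive weight never
  overlaps a kernel eigenvector of \<sigma>.\<close>

lemma supp_subset_spec:
  assumes A: "is_spec n \<rho> U p" and B: "is_spec n \<sigma> V q"
  shows "supp \<rho> \<subseteq> supp \<sigma> \<longleftrightarrow> (\<forall>i<n. \<forall>j<n. p i * ovl U V i j \<noteq> 0 \<longrightarrow> q j \<noteq> 0)"
proof
  note [simp] = is_specD(3,4,6,7)[OF A] is_specD(3,4,6,7)[OF B]
  note UU = is_specD(1)[OF A] and VV = is_specD(1)[OF B]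
  assume sub: "supp \<rho> \<subseteq> supp \<sigma>"
  show "\<forall>i<n. \<forall>j<n. p i * ovl U V i j \<noteq> 0 \<longrightarrow> q j \<noteq> 0"
  proof (intro allI impI notI)
    fix i j assume ij: "i < n" "j < n" and nz: "p i * ovl U V i j \<noteq> 0" and q: "q j = 0"
    \<comment> \<open>For w in the kernel the i-th coordinate of U-adjoint \<rho> w is
      \<open>p i\<close> times the inner product with column i, and \<open>p i\<close> is nonzero
      here.\<close>
    have "col U i \<in> supp \<rho>" unfolding supp_def
    proof (intro CollectI conjI ballI)
      fix w assume "w \<in> mat_kernel \<rho>"
      then have w: "w \<in> carrier_vec n" "\<rho> *\<^sub>v w = 0\<^sub>v n" 
        using mat_kernelD[of \<rho> n n w] is_specD(5)[OF A] by auto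
      have "adj U * \<rho> = real_diag n p * adj U"
        unfolding is_specD(2)[OF A] by (simp add: mat_assoc unitary_cancel[OF UU])
      then have "(real_diag n p * adj U) *\<^sub>v w = adj U *\<^sub>v (\<rho> *\<^sub>v w)"
        using assoc_mult_mat_vec[OF adj_carrier[OF unitary_carrier[OF UU]] is_specD(5)[OF A] w(1)] by simp
      then have "((real_diag n p * adj U) *\<^sub>v w) $ i = 0"
        using ij w by simp
      then have "p i * (\<Sum>k<n. cnj (U $$ (k, i)) * w $ k) = 0"
        using ij w by (simp add: scalar_prod_def atLeast0LessThan
            sum_distrib_left mult_ac del: row_mult)
      then have "(\<Sum>k<n. cnj (U $$ (k, i)) * w $ k) = 0" using nz by auto
      from arg_cong[OF this, of cnj] show "col U i \<bullet>c w = 0"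
        using w(1) ij by (simp add: scalar_prod_def atLeast0LessThan)
    qed (use ij in auto)
    then have "col U i \<in> supp \<sigma>" using sub by auto
    moreover have "col V j \<in> mat_kernel \<sigma>"
      using spec_col[OF B ij(2)] q ij by (intro mat_kernelI[of _ n n]) (auto simp: mat_carrier_iff)
    ultimately have "col U i \<bullet>c col V j = 0" by (auto simp: supp_def)
    moreover have "(adj U * V) $$ (i, j) = cnj (col U i \<bullet>c col V j)"
      using ij by (subst mat_mult_index) (auto simp: scalar_prod_def atLeast0LessThan mult_ac)
    ultimately show False using nz by (simp add: ovl_def)
  qed
next
  note [simp] = is_specD(3,4,6,7)[OF A] is_specD(3,4,6,7)[OF B]
  note UU = is_specD(1)[OF A] and VV = is_specD(1)[OF B]
  assume H: "\<forall>i<n. \<forall>j<n. p i * ovl U V i j \<noteq> 0 \<longrightarrow> q j \<noteq> 0"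
  have ker: "w \<in> mat_kernel \<rho>" if "w \<in> mat_kernel \<sigma>" for w
  proof -
    have w: "w \<in> carrier_vec n" "\<sigma> *\<^sub>v w = 0\<^sub>v n" 
      using that mat_kernelD[of \<sigma> n n w] is_specD(5)[OF B] by auto
    \<comment> \<open>Coordinates of the kernel vector in the eigenbasis of \<sigma>; they are
      supported where q vanishes, which is exactly where the assumption kills the overlap with
      eigenvectors of \<rho>.\<close>
    define a where "a = adj V *\<^sub>v w"
    have a: "a \<in> carrier_vec n" using w by (simp add: a_def)
    have "adj V * \<sigma> = real_diag n q * adj V"
      unfolding is_specD(2)[OF B] by (simp add: mat_assoc unitary_cancel[OF VV])
    then have "real_diag n q *\<^sub>v a = adj V *\<^sub>v (\<sigma> *\<^sub>v w)"
      using w(1) is_specD(5)[OF B] unfolding a_def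
      using assoc_mult_mat_vec[OF adj_carrier[OF unitary_carrier[OF VV]] is_specD(5)[OF B] w(1)]
        assoc_mult_mat_vec[OF real_diag_carrier adj_carrier[OF unitary_carrier[OF VV]] w(1), of q] by simp
    then have qa: "q j * a $ j = 0" if "j < n" for j
    proof -
      assume "real_diag n q *\<^sub>v a = adj V *\<^sub>v (\<sigma> *\<^sub>v w)"
      then have "(real_diag n q *\<^sub>v a) $ j = 0" using w that by simp
      moreover have "(real_diag n q *\<^sub>v a) $ j = q j * a $ j"
        using that a by (intro real_diag_mult_vec) auto
      ultimately show ?thesis using that by simp
    qed
    have wV: "w = V *\<^sub>v a" unfolding a_def using w(1) unitary_right[OF VV] 
      by (subst assoc_mult_mat_vec[symmetric, of _ n n _ n]) (auto simp: mat_carrier_iff)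
    have Uw: "adj U *\<^sub>v w = (adj U * V) *\<^sub>v a" unfolding wV using a
      by (subst assoc_mult_mat_vec[of _ n n _ n]) (auto simp: mat_carrier_iff)
    have "real_diag n p *\<^sub>v (adj U *\<^sub>v w) = 0\<^sub>v n"
    proof (rule eq_vecI)
      fix i assume "i < dim_vec (0\<^sub>v n :: complex vec)"
      then have i: "i < n" by simp
      have "(real_diag n p *\<^sub>v (adj U *\<^sub>v w)) $ i = p i * (adj U *\<^sub>v w) $ i"
        using i w by (intro real_diag_mult_vec) auto
      also have "\<dots> = (\<Sum>j<n. p i * ((adj U * V) $$ (i, j) * a $ j))"
        unfolding Uw using i a by (simp add: mat_mult_index scalar_prod_def atLeast0LessThan sum_distrib_left)
      also have "\<dots> = 0"
      proof (rule sum.neutral, intro ballI)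
        fix j assume "j \<in> {..<n}"
        then have j: "j < n" by simp
        show "p i * ((adj U * V) $$ (i, j) * a $ j) = 0"
          using H[rule_format, OF i j] qa[OF j] by (auto simp: ovl_def)
      qed
      finally show "(real_diag n p *\<^sub>v (adj U *\<^sub>v w)) $ i = 0\<^sub>v n $ i" using i by simp
    qed auto
    moreover have "\<rho> *\<^sub>v w = U *\<^sub>v (real_diag n p *\<^sub>v (adj U *\<^sub>v w))"
      unfolding is_specD(2)[OF A] using w(1)
      by (simp add: assoc_mult_mat_vec[of _ n n _ n] mat_carrier_iff)
    ultimately have "\<rho> *\<^sub>v w = 0\<^sub>v n" by (auto intro!: eq_vecI simp: scalar_prod_def)
    then show ?thesis using w(1) by (intro mat_kernelI[of _ n n]) (auto simp: mat_carrier_iff)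
  qed
  show "supp \<rho> \<subseteq> supp \<sigma>" using ker by (auto simp: supp_def)
qed

text \<open>In the quotient of the Nussbaum-Szkola weights the overlap cancels, leaving ln p_i - ln
  q_j; pairs of weight 0 contribute 0 on both sides, whatever the logarithm is.\<close>

lemma rel_entropy_spec:
  assumes A: "is_spec n \<rho> U p" and B: "is_spec n \<sigma> V q"
    and p: "\<And>i. i < n \<Longrightarrow> 0 \<le> p i" and q: "\<And>i. i < n \<Longrightarrow> 0 \<le> q i"
  shows "rel_entropy \<rho> \<sigma> = classical_rel_entropy ({..<n} \<times> {..<n})
      (\<lambda>(i, j). p i * ovl U V i j) (\<lambda>(i, j). q j * ovl U V i j)"
proof -
  note [simp] = is_specD(3,4,6,7)[OF A] is_specD(3,4,6,7)[OF B]
  note [simp] = is_specD(6,7)[OF is_spec_log[OF A]] is_specD(6,7)[OF is_spec_log[OF B]]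
  note UU = is_specD(1)[OF A] and VV = is_specD(1)[OF B]
  let ?P = "\<lambda>(i, j). p i * ovl U V i j" and ?Q = "\<lambda>(i, j). q j * ovl U V i j"
  have S: "supp \<rho> \<subseteq> supp \<sigma> \<longleftrightarrow> 
     {z \<in> {..<n} \<times> {..<n}. ?P z \<noteq> 0} \<subseteq> {z \<in> {..<n} \<times> {..<n}. ?Q z \<noteq> 0}"
    unfolding supp_subset_spec[OF A B] by (auto split: prod.splits)
  have "Re (tr (\<rho> * (log_op \<rho> - log_op \<sigma>))) = (\<Sum>z\<in>{..<n} \<times> {..<n}. ?P z * ln (?P z / ?Q z))"
    if "supp \<rho> \<subseteq> supp \<sigma>"
  proof -
    have "\<rho> * (log_op \<rho> - log_op \<sigma>) = \<rho> * log_op \<rho> - \<rho> * log_op \<sigma>"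
      by (rule mult_minus_distrib_mat[of _ n n _ n]) (auto simp: mat_carrier_iff)
    then have "tr (\<rho> * (log_op \<rho> - log_op \<sigma>)) = tr (\<rho> * log_op \<rho>) - tr (\<rho> * log_op \<sigma>)"
      by (simp add: tr_minus[of _ n] mat_carrier_iff)
    also have "\<dots> = complex_of_real ((\<Sum>i<n. \<Sum>j<n. p i * ln_supp (p j) * ovl U U i j) - (\<Sum>i<n. \<Sum>j<n. p i * ln_supp (q j) * ovl U V i j))"
      by (simp add: tr_spec_mult[OF A is_spec_log[OF A]] tr_spec_mult[OF A is_spec_log[OF B]])
    also have "(\<Sum>i<n. \<Sum>j<n. p i * ln_supp (p j) * ovl U U i j) = (\<Sum>i<n. p i * ln_supp (p i))"
    proof (intro sum.cong refl)
      fix i assume "i \<in> {..<n}"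
      then have "(\<Sum>j<n. p i * ln_supp (p j) * ovl U U i j) = (\<Sum>j<n. if j = i then p i * ln_supp (p i) else 0)"
        by (intro sum.cong refl) (auto simp: ovl_self[OF UU])
      then show "(\<Sum>j<n. p i * ln_supp (p j) * ovl U U i j) = p i * ln_supp (p i)" using \<open>i \<in> {..<n}\<close> by simp
    qed
    \<comment> \<open>The rows of \<open>ovl\<close> sum to 1, so the sum over j can be inserted to
      match the cross term.\<close>
    also have "(\<Sum>i<n. p i * ln_supp (p i)) = (\<Sum>i<n. \<Sum>j<n. p i * ln_supp (p i) * ovl U V i j)"
      using ovl_sum[OF UU VV] by (simp flip: sum_distrib_left)
    also have "(\<Sum>i<n. \<Sum>j<n. p i * ln_supp (p i) * ovl U V i j) - (\<Sum>i<n. \<Sum>j<n. p i * ln_supp (q j) * ovl U V i j)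
       = (\<Sum>i<n. \<Sum>j<n. p i * ovl U V i j * (ln_supp (p i) - ln_supp (q j)))"
      by (simp add: sum_subtractf algebra_simps)
    also have "\<dots> = (\<Sum>i<n. \<Sum>j<n. ?P (i, j) * ln (?P (i, j) / ?Q (i, j)))"
    proof (intro sum.cong refl)
      fix i j assume ij: "i \<in> {..<n}" "j \<in> {..<n}"
      show "p i * ovl U V i j * (ln_supp (p i) - ln_supp (q j)) = ?P (i, j) * ln (?P (i, j) / ?Q (i, j))"
      proof (cases "p i * ovl U V i j = 0")
        case False
        then have "q j \<noteq> 0" using that ij unfolding supp_subset_spec[OF A B] by auto
        then show ?thesis using False p[of i] q[of j] ij by (auto simp: ln_supp_def ln_div)
      qed auto
    qed
    finally have "tr (\<rho> * (log_op \<rho> - log_op \<sigma>)) =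
        complex_of_real (\<Sum>i<n. \<Sum>j<n. ?P (i, j) * ln (?P (i, j) / ?Q (i, j)))" .
    moreover have "(\<Sum>i<n. \<Sum>j<n. ?P (i, j) * ln (?P (i, j) / ?Q (i, j))) = (\<Sum>z\<in>{..<n} \<times> {..<n}. ?P z * ln (?P z / ?Q z))"
      by (simp only: sum.cartesian_product) (intro sum.cong, auto)
    ultimately show ?thesis by (simp only: Re_complex_of_real)
  qed
  then show ?thesis unfolding rel_entropy_def classical_rel_entropy_def S by auto
qed

subsection \<open>A quadratic variational formula for the relative entropy\<close>

lemma tr_spec_any:
  assumes "is_spec n A U d" "X \<in> carrier_mat n n"
  shows "tr (A * X) = (\<Sum>i<n. complex_of_real (d i) * (adj U * X * U) $$ (i, i))"
proof -
  note [simp] = is_specD(3,4,6,7)[OF assms(1)] carrier_matD[OF assms(2)]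
  have "tr (A * X) = tr (U * (real_diag n d * (adj U * X)))"
    by (simp add: is_specD(2)[OF assms(1)] mat_assoc)
  also have "\<dots> = tr (real_diag n d * (adj U * X * U))"
    by (subst tr_comm[of _ n n]) (auto simp: mat_assoc)
  also have "\<dots> = (\<Sum>i<n. complex_of_real (d i) * (adj U * X * U) $$ (i, i))"
    by (simp add: tr_def del: index_mult_mat(1))
  finally show ?thesis .
qed

text \<open>The maximum over X is the value at t of the resolvent quadratic form behind - ln.
  Linearity in (\<rho>, \<sigma>) is what makes a fixed X a usable lower bound and turns joint
  convexity into a supremum of linear functions.\<close>

definition quad :: "complex mat \<Rightarrow> complex mat \<Rightarrow> real \<Rightarrow> complex mat \<Rightarrow> real" where
  "quad \<rho> \<sigma> t X = 2 * Re (tr (\<rho> * X)) - Re (tr (\<sigma> * (X * adj X))) - t * Re (tr (\<rho> * (adj X * X)))"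

text \<open>The maximum of \<open>quad\<close> written in the Nussbaum-Szkola weights. Terms with
  vanishing denominator count as 0 by the convention for division.\<close>

definition quad_max :: "nat \<Rightarrow> complex mat \<Rightarrow> (nat \<Rightarrow> real) \<Rightarrow> complex mat \<Rightarrow> (nat \<Rightarrow> real) \<Rightarrow> real \<Rightarrow> real" where
  "quad_max n U p V q t = (\<Sum>i<n. \<Sum>j<n. ovl U V i j * (p i)\<^sup>2 / (q j + t * p i))"

lemma cmod_square: "Re z * Re z + Im z * Im z = (cmod z)\<^sup>2"
  using cmod_power2[of z] by (simp only: power2_eq_square)

text \<open>With X read as a matrix from the eigenbasis of \<rho> to that of \<sigma>, the two
  quadratic terms become weighted sums of squared entries, so the maximization decouples into one
  scalar problem per entry.\<close>

lemma quad_expand: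
  assumes A: "is_spec n \<rho> U p" and B: "is_spec n \<sigma> V q" and X: "X \<in> carrier_mat n n"
  defines "Y \<equiv> adj V * X * U" and "C \<equiv> adj U * V"
  shows "quad \<rho> \<sigma> t X = (\<Sum>i<n. \<Sum>j<n. 2 * p i * Re (C $$ (i, j) * Y $$ (j, i)) - (q j + t * p i) * (cmod (Y $$ (j, i)))\<^sup>2)"
proof -
  note [simp] = is_specD(3,4,6,7)[OF A] is_specD(3,4,6,7)[OF B] carrier_matD[OF X]
  note UU = is_specD(1)[OF A] and VV = is_specD(1)[OF B]
  have [simp]: "dim_row Y = n" "dim_col Y = n" "dim_row C = n" "dim_col C = n" by (simp_all add: Y_def C_def)
  have 1: "adj U * X * U = C * Y"
    by (simp add: C_def Y_def mat_assoc unitary_cancel[OF VV])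
  have 2: "adj V * (X * adj X) * V = Y * adj Y"
    by (simp add: Y_def mat_assoc adj_mult unitary_cancel[OF UU])
  have 3: "adj U * (adj X * X) * U = adj Y * Y"
    by (simp add: Y_def mat_assoc adj_mult unitary_cancel[OF VV])
  have "2 * Re (tr (\<rho> * X)) = (\<Sum>i<n. \<Sum>j<n. 2 * p i * Re (C $$ (i, j) * Y $$ (j, i)))"
    using tr_spec_any[OF A X] unfolding 1
    by (simp add: mat_mult_index sum_distrib_left mult.assoc del: times_complex.sel)
       (simp add: sum_distrib_left right_diff_distrib)
  moreover have "Re (tr (\<sigma> * (X * adj X))) = (\<Sum>i<n. \<Sum>j<n. q i * (cmod (Y $$ (i, j)))\<^sup>2)"
    by (subst tr_spec_any[OF B]) (simp_all add: 2 mat_mult_index sum_distrib_left cmod_square)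
  moreover have "Re (tr (\<rho> * (adj X * X))) = (\<Sum>i<n. \<Sum>j<n. p i * (cmod (Y $$ (j, i)))\<^sup>2)"
    by (subst tr_spec_any[OF A]) (simp_all add: 3 mat_mult_index sum_distrib_left cmod_square)
  moreover have "(\<Sum>i<n. \<Sum>j<n. q i * (cmod (Y $$ (i, j)))\<^sup>2) = (\<Sum>i<n. \<Sum>j<n. q j * (cmod (Y $$ (j, i)))\<^sup>2)"
    by (rule sum.swap)
  ultimately show ?thesis
    by (simp add: quad_def sum_subtractf sum.distrib distrib_right sum_distrib_left mult.assoc del: times_complex.sel)
qed

text \<open>For s > 0 this is completing the square. For s = 0 the quotient on the right is 0 by
  convention, and the second assumption removes the linear term on the left.\<close>

lemma quad_term_le:
  fixes c y :: complex and p s :: real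
  assumes "s \<ge> 0" "s = 0 \<Longrightarrow> p * (cmod c)\<^sup>2 = 0" "p \<ge> 0"
  shows "2 * p * Re (c * y) - s * (cmod y)\<^sup>2 \<le> (cmod c)\<^sup>2 * p\<^sup>2 / s"
proof (cases "s = 0")
  case True
  then show ?thesis using assms by auto
next
  case False
  then have s: "s > 0" using assms by auto
  have "2 * p * Re (c * y) \<le> 2 * p * (cmod c * cmod y)"
    using complex_Re_le_cmod[of "c * y"] assms by (simp add: norm_mult mult_left_mono)
  moreover have "0 \<le> (s * cmod y - p * cmod c)\<^sup>2 / s" using s by simp
  moreover have "(s * cmod y - p * cmod c)\<^sup>2 / s = s * (cmod y)\<^sup>2 - 2 * p * (cmod c * cmod y) + (cmod c)\<^sup>2 * p\<^sup>2 / s"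
    using s by (simp add: power2_eq_square field_simps)
  ultimately show ?thesis by linarith
qed

text \<open>At t = 0 the support condition is essential: an entry with q_j = 0 and positive weight
  has no quadratic term and makes \<open>quad\<close> unbounded, while \<open>quad_max\<close> reads
  0 there.\<close>

lemma quad_le:
  assumes A: "is_spec n \<rho> U p" and B: "is_spec n \<sigma> V q" and X: "X \<in> carrier_mat n n"
    and p: "\<And>i. i < n \<Longrightarrow> 0 \<le> p i" and q: "\<And>i. i < n \<Longrightarrow> 0 \<le> q i" and t: "0 \<le> t"
    and s: "t > 0 \<or> (\<forall>i<n. \<forall>j<n. p i * ovl U V i j \<noteq> 0 \<longrightarrow> q j \<noteq> 0)"
  shows "quad \<rho> \<sigma> t X \<le> quad_max n U p V q t"
  unfolding quad_expand[OF A B X] quad_max_def ovl_def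
proof (intro sum_mono quad_term_le)
  fix i j assume ij: "i \<in> {..<n}" "j \<in> {..<n}"
  then show "0 \<le> q j + t * p i" using p[of i] q[of j] t by auto
  show "0 \<le> p i" using p ij by auto
  assume "q j + t * p i = 0"
  then have "q j = 0 \<and> t * p i = 0" using p[of i] q[of j] t ij
    by (simp add: add_nonneg_eq_0_iff)
  then show "p i * (cmod ((adj U * V) $$ (i, j)))\<^sup>2 = 0" using s ij by (auto simp: ovl_def)
qed

lemma quad_attained:
  assumes A: "is_spec n \<rho> U p" and B: "is_spec n \<sigma> V q"
    and p: "\<And>i. i < n \<Longrightarrow> 0 \<le> p i" and q: "\<And>i. i < n \<Longrightarrow> 0 \<le> q i" and t: "0 \<le> t"
  obtains X where "X \<in> carrier_mat n n" "quad \<rho> \<sigma> t X = quad_max n U p V q t"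
proof -
  note [simp] = is_specD(3,4,6,7)[OF A] is_specD(3,4,6,7)[OF B]
  note UU = is_specD(1)[OF A] and VV = is_specD(1)[OF B]
  define C where "C = adj U * V"
  \<comment> \<open>The stationary point of each scalar problem. Where the denominator vanishes,
    division yields the entry 0, and the claimed value is 0 as well.\<close>
  define Y where "Y = mat n n (\<lambda>(j, i). cnj (C $$ (i, j)) * complex_of_real (p i / (q j + t * p i)))"
  define X where "X = V * Y * adj U"
  have [simp]: "dim_row Y = n" "dim_col Y = n" by (simp_all add: Y_def)
  have X: "X \<in> carrier_mat n n" by (simp add: X_def)
  have Y: "adj V * X * U = Y"
    by (simp add: X_def mat_assoc unitary_cancel[OF VV] unitary_left[OF UU])
  have quad_opt: "2 * P * (c * (P / s)) - s * (c * (P / s)\<^sup>2) = c * P\<^sup>2 / s" if "s \<noteq> 0" for P c s :: real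
    using that by (simp add: power2_eq_square field_simps)
  have "quad \<rho> \<sigma> t X = quad_max n U p V q t"
    unfolding quad_expand[OF A B X] quad_max_def Y ovl_def C_def[symmetric]
  proof (intro sum.cong refl)
    fix i j assume ij: "i \<in> {..<n}" "j \<in> {..<n}"
    let ?c = "C $$ (i, j)" let ?s = "q j + t * p i"
    have "?c * Y $$ (j, i) = complex_of_real ((cmod ?c)\<^sup>2 * (p i / ?s))"
      unfolding of_real_mult complex_norm_square using ij by (simp add: Y_def)
    then have "Re (?c * Y $$ (j, i)) = (cmod ?c)\<^sup>2 * (p i / ?s)"
      by (simp only: Re_complex_of_real)
    moreover have "(cmod (Y $$ (j, i)))\<^sup>2 = (cmod ?c)\<^sup>2 * (p i / ?s)\<^sup>2"
      using ij by (simp add: Y_def norm_mult norm_divide power_mult_distrib power_divide flip: of_real_add of_real_mult)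
    ultimately show "2 * p i * Re (?c * Y $$ (j, i)) - ?s * (cmod (Y $$ (j, i)))\<^sup>2 = (cmod ?c)\<^sup>2 * (p i)\<^sup>2 / ?s"
      using quad_opt[of ?s "p i" "(cmod ?c)\<^sup>2"] by (cases "?s = 0") simp_all
  qed
  then show ?thesis using that X by blast
qed

lemma quad_max_nonneg:
  assumes "\<And>i. i < n \<Longrightarrow> 0 \<le> p i" "\<And>i. i < n \<Longrightarrow> 0 \<le> q i" "0 \<le> t"
  shows "0 \<le> quad_max n U p V q t"
  unfolding quad_max_def using assms by (intro sum_nonneg divide_nonneg_nonneg mult_nonneg_nonneg add_nonneg_nonneg) auto

text \<open>The truncation at \<open>T\<close> of the integral representation
  \<open>- ln x = \<integral>\<^sub>0\<^sup>\<infinity> (1 / (x + t) - 1 / (1 + t)) dt\<close> applied to the Nussbaum--Szkola form.\<close>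

definition Dtrunc :: "nat \<Rightarrow> complex mat \<Rightarrow> (nat \<Rightarrow> real) \<Rightarrow> complex mat \<Rightarrow> (nat \<Rightarrow> real) \<Rightarrow> real \<Rightarrow> real" where
  "Dtrunc n U p V q T = (\<Sum>i<n. \<Sum>j<n. p i * ovl U V i j *
     (if p i * ovl U V i j = 0 then 0 else ln (q j / p i + T) - ln (q j / p i) - ln (1 + T)))"

definition Dval :: "nat \<Rightarrow> complex mat \<Rightarrow> (nat \<Rightarrow> real) \<Rightarrow> complex mat \<Rightarrow> (nat \<Rightarrow> real) \<Rightarrow> real" where
  "Dval n U p V q = (\<Sum>i<n. \<Sum>j<n. p i * ovl U V i j * (ln (p i) - ln (q j)))"

lemma Dtrunc_0: "Dtrunc n U p V q 0 = 0"
  by (simp add: Dtrunc_def)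

context
  fixes n :: nat and U V :: "complex mat" and p q :: "nat \<Rightarrow> real"
  assumes p: "\<And>i. i < n \<Longrightarrow> 0 \<le> p i" and q: "\<And>i. i < n \<Longrightarrow> 0 \<le> q i"
    and s: "\<And>i j. i < n \<Longrightarrow> j < n \<Longrightarrow> p i * ovl U V i j \<noteq> 0 \<Longrightarrow> q j \<noteq> 0"
begin

text \<open>Multiplying 1 / (q_j / p_i + T) by p_i gives p_i squared over q_j + T p_i, the summand
  of \<open>quad_max\<close>. The subtracted 1 / (1 + T) collects to the trace of \<rho> because the
  overlaps sum to 1.\<close>

lemma Dtrunc_deriv:
  assumes UU: "unitary_mat n U" and VV: "unitary_mat n V" and T: "0 \<le> T"
  shows "(Dtrunc n U p V q has_real_derivative quad_max n U p V q T - (\<Sum>i<n. p i) / (1 + T)) (at T)"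
proof -
  have "((\<lambda>T. Dtrunc n U p V q T) has_real_derivative
     (\<Sum>i<n. \<Sum>j<n. p i * ovl U V i j * (if p i * ovl U V i j = 0 then 0 else 1 / (q j / p i + T) - 1 / (1 + T)))) (at T)"
    unfolding Dtrunc_def
  proof (intro DERIV_sum DERIV_cmult)
    fix i j assume ij: "i \<in> {..<n}" "j \<in> {..<n}"
    show "((\<lambda>T. if p i * ovl U V i j = 0 then 0 else ln (q j / p i + T) - ln (q j / p i) - ln (1 + T)) has_real_derivative
       (if p i * ovl U V i j = 0 then 0 else 1 / (q j / p i + T) - 1 / (1 + T))) (at T)"
    proof (cases "p i * ovl U V i j = 0")
      case False
      then have "q j / p i > 0" using s[of i j] p[of i] q[of j] ij by (auto simp: less_le)
      then show ?thesis using False T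
        by (auto intro!: derivative_eq_intros)
    qed simp
  qed
  also have "(\<Sum>i<n. \<Sum>j<n. p i * ovl U V i j * (if p i * ovl U V i j = 0 then 0 else 1 / (q j / p i + T) - 1 / (1 + T)))
     = (\<Sum>i<n. \<Sum>j<n. ovl U V i j * (p i)\<^sup>2 / (q j + T * p i) - p i * ovl U V i j / (1 + T))"
  proof (intro sum.cong refl)
    fix i j assume ij: "i \<in> {..<n}" "j \<in> {..<n}"
    show "p i * ovl U V i j * (if p i * ovl U V i j = 0 then 0 else 1 / (q j / p i + T) - 1 / (1 + T)) =
       ovl U V i j * (p i)\<^sup>2 / (q j + T * p i) - p i * ovl U V i j / (1 + T)"
    proof (cases "p i * ovl U V i j = 0")
      case False
      then have pos: "q j > 0" "p i > 0" using s[of i j] p[of i] q[of j] ij by (auto simp: less_le)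
      have "1 / (q j / p i + T) = p i / (q j + T * p i)" using pos by (simp add: field_simps)
      then show ?thesis using False by (simp add: right_diff_distrib power2_eq_square mult_ac)
    qed auto
  qed
  also have "\<dots> = quad_max n U p V q T - (\<Sum>i<n. p i * (\<Sum>j<n. ovl U V i j)) / (1 + T)"
    by (simp add: quad_max_def sum_subtractf sum_distrib_left sum_divide_distrib)
  also have "(\<Sum>i<n. p i * (\<Sum>j<n. ovl U V i j)) = (\<Sum>i<n. p i)"
    using ovl_sum[OF UU VV] by simp
  finally show ?thesis .
qed

lemma Dtrunc_limit: "(Dtrunc n U p V q \<longlongrightarrow> Dval n U p V q) at_top"
proof -
  have L: "((\<lambda>T. ln (r + T) - ln (1 + T)) \<longlongrightarrow> 0) at_top" if "r > 0" for r :: real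
  proof -
    have "((\<lambda>T. (r + T) / (1 + T)) \<longlongrightarrow> 1) at_top"
    proof -
      have "((\<lambda>T::real. 1 + (r - 1) * inverse (1 + T)) \<longlongrightarrow> 1 + (r - 1) * 0) at_top"
        by (intro tendsto_add tendsto_mult tendsto_const tendsto_inverse_0_at_top
            filterlim_tendsto_add_at_top[OF tendsto_const filterlim_ident])
      moreover have "eventually (\<lambda>T::real. 1 + (r - 1) * inverse (1 + T) = (r + T) / (1 + T)) at_top"
        using eventually_ge_at_top[of 0] by eventually_elim (simp add: field_simps)
      ultimately show ?thesis using Lim_transform_eventually by fastforce
    qed
    then have "((\<lambda>T. ln ((r + T) / (1 + T))) \<longlongrightarrow> ln 1) at_top" by (intro tendsto_ln) auto
    moreover have "eventually (\<lambda>T. ln ((r + T) / (1 + T)) = ln (r + T) - ln (1 + T)) at_top"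
      using eventually_ge_at_top[of 0] by eventually_elim (use that in \<open>simp add: ln_div\<close>)
    ultimately show ?thesis using Lim_transform_eventually by fastforce
  qed
  have "((\<lambda>T. \<Sum>i<n. \<Sum>j<n. p i * ovl U V i j *
     (if p i * ovl U V i j = 0 then 0 else ln (q j / p i + T) - ln (q j / p i) - ln (1 + T))) \<longlongrightarrow>
     (\<Sum>i<n. \<Sum>j<n. p i * ovl U V i j * (ln (p i) - ln (q j)))) at_top"
  proof (intro tendsto_sum)
    fix i j assume ij: "i \<in> {..<n}" "j \<in> {..<n}"
    show "((\<lambda>T. p i * ovl U V i j *
     (if p i * ovl U V i j = 0 then 0 else ln (q j / p i + T) - ln (q j / p i) - ln (1 + T))) \<longlongrightarrow>
       p i * ovl U V i j * (ln (p i) - ln (q j))) at_top"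
    proof (cases "p i * ovl U V i j = 0")
      case False
      then have pos: "q j > 0" "p i > 0" using s[of i j] p[of i] q[of j] ij by (auto simp: less_le)
      have "((\<lambda>T. p i * ovl U V i j * ((ln (q j / p i + T) - ln (1 + T)) - ln (q j / p i))) \<longlongrightarrow>
        p i * ovl U V i j * (0 - ln (q j / p i))) at_top"
        using pos by (intro tendsto_intros L) auto
      then show ?thesis using False pos by (simp add: ln_div algebra_simps)
    qed auto
  qed
  moreover have "Dtrunc n U p V q = (\<lambda>T. \<Sum>i<n. \<Sum>j<n. p i * ovl U V i j *
     (if p i * ovl U V i j = 0 then 0 else ln (q j / p i + T) - ln (q j / p i) - ln (1 + T)))"
    by (rule ext) (simp only: Dtrunc_def)
  ultimately show ?thesis by (simp only: Dval_def)
qed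

end

lemma rel_entropy_Dval:
  assumes A: "is_spec n \<rho> U p" and B: "is_spec n \<sigma> V q"
    and p: "\<And>i. i < n \<Longrightarrow> 0 \<le> p i" and q: "\<And>i. i < n \<Longrightarrow> 0 \<le> q i"
  shows "rel_entropy \<rho> \<sigma> = (if \<forall>i<n. \<forall>j<n. p i * ovl U V i j \<noteq> 0 \<longrightarrow> q j \<noteq> 0 then ereal (Dval n U p V q) else \<infinity>)"
proof -
  let ?P = "\<lambda>(i, j). p i * ovl U V i j" and ?Q = "\<lambda>(i, j). q j * ovl U V i j"
  have S: "(\<forall>i<n. \<forall>j<n. p i * ovl U V i j \<noteq> 0 \<longrightarrow> q j \<noteq> 0) \<longleftrightarrow> 
     {z \<in> {..<n} \<times> {..<n}. ?P z \<noteq> 0} \<subseteq> {z \<in> {..<n} \<times> {..<n}. ?Q z \<noteq> 0}"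
    by (auto split: prod.splits)
  have "(\<Sum>z\<in>{..<n} \<times> {..<n}. ?P z * ln (?P z / ?Q z)) = Dval n U p V q" 
    if s: "\<forall>i<n. \<forall>j<n. p i * ovl U V i j \<noteq> 0 \<longrightarrow> q j \<noteq> 0"
  proof -
    have "(\<Sum>z\<in>{..<n} \<times> {..<n}. ?P z * ln (?P z / ?Q z)) = (\<Sum>(i, j)\<in>{..<n} \<times> {..<n}. p i * ovl U V i j * (ln (p i) - ln (q j)))"
    proof (intro sum.cong refl)
      fix z assume "z \<in> {..<n} \<times> {..<n}"
      then obtain i j where z: "z = (i, j)" and ij: "i < n" "j < n" by auto
      have "?P (i, j) * ln (?P (i, j) / ?Q (i, j)) = p i * ovl U V i j * (ln (p i) - ln (q j))"
        using s[rule_format, OF ij] p[OF ij(1)] q[OF ij(2)]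
        by (cases "p i * ovl U V i j = 0") (auto simp: ln_div)
      then show "?P z * ln (?P z / ?Q z) = (case z of (i, j) \<Rightarrow> p i * ovl U V i j * (ln (p i) - ln (q j)))"
        by (simp add: z)
    qed
    then show ?thesis by (simp add: Dval_def sum.cartesian_product)
  qed
  moreover have "rel_entropy \<rho> \<sigma> = classical_rel_entropy ({..<n} \<times> {..<n}) ?P ?Q"
    by (rule rel_entropy_spec[OF A B]) (use p q in auto)
  ultimately show ?thesis unfolding classical_rel_entropy_def S by auto
qed

text \<open>The form in which improper integrals over [0, \<infinity>) are compared: f and g are
  antiderivatives, g - f is nondecreasing, and the limits inherit the order.\<close>

lemma limit_le_of_deriv_le:
  fixes f g :: "real \<Rightarrow> real"
  assumes "f 0 \<le> g 0"
    and "\<And>t. 0 \<le> t \<Longrightarrow> (f has_real_derivative f' t) (at t)"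
    and "\<And>t. 0 \<le> t \<Longrightarrow> (g has_real_derivative g' t) (at t)"
    and "\<And>t. 0 \<le> t \<Longrightarrow> f' t \<le> g' t"
    and "(f \<longlongrightarrow> a) at_top" "(g \<longlongrightarrow> b) at_top"
  shows "a \<le> b"
proof (rule tendsto_le[OF _ assms(6,5)])
  have "f t \<le> g t" if "0 \<le> t" for t
  proof -
    have "g 0 - f 0 \<le> g t - f t"
    proof (rule DERIV_nonneg_imp_nondecreasing[OF that])
      fix x :: real assume "0 \<le> x"
      then show "\<exists>y. ((\<lambda>t. g t - f t) has_real_derivative y) (at x) \<and> 0 \<le> y"
        using DERIV_diff[OF assms(3,2)[of x]] assms(4)[of x] by auto
    qed
    then show ?thesis using assms(1) by simp
  qed
  then show "\<forall>\<^sub>F x in at_top. f x \<le> g x" using eventually_ge_at_top[of 0] by (rule eventually_mono[rotated])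
qed simp

text \<open>A trial operator for each t bounds the integrand from below, and f is an antiderivative
  of such a lower bound. An infinite right side needs separate treatment because the integrand at t
  = 0 is then not controlled.\<close>

lemma rel_entropy_lower:
  assumes A: "is_spec n \<rho> U p" and B: "is_spec n \<sigma> V q"
    and p: "\<And>i. i < n \<Longrightarrow> 0 \<le> p i" and q: "\<And>i. i < n \<Longrightarrow> 0 \<le> q i"
    and "f 0 = 0" "\<And>t. 0 \<le> t \<Longrightarrow> (f has_real_derivative f' t) (at t)" "(f \<longlongrightarrow> L) at_top"
    and X: "\<And>t. 0 \<le> t \<Longrightarrow> X t \<in> carrier_mat n n"
      "\<And>t. 0 \<le> t \<Longrightarrow> f' t \<le> quad \<rho> \<sigma> t (X t) - (\<Sum>i<n. p i) / (1 + t)"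
  shows "ereal L \<le> rel_entropy \<rho> \<sigma>"
proof (cases "\<forall>i<n. \<forall>j<n. p i * ovl U V i j \<noteq> 0 \<longrightarrow> q j \<noteq> 0")
  case True
  have "L \<le> Dval n U p V q"
  proof (rule limit_le_of_deriv_le[OF _ assms(6) _ _ assms(7)])
    fix t :: real assume t: "0 \<le> t"
    show "f' t \<le> quad_max n U p V q t - (\<Sum>i<n. p i) / (1 + t)"
      using X(2)[OF t] quad_le[OF A B X(1)[OF t] p q t] True by fastforce
  next
    show "(Dtrunc n U p V q \<longlongrightarrow> Dval n U p V q) at_top"
      using p q True by (intro Dtrunc_limit) auto
    fix t :: real assume "0 \<le> t"
    then show "(Dtrunc n U p V q has_real_derivative quad_max n U p V q t - (\<Sum>i<n. p i) / (1 + t)) (at t)"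
      using p q True is_specD(1)[OF A] is_specD(1)[OF B] by (intro Dtrunc_deriv) auto
  qed (simp_all add: Dtrunc_0 assms(5))
  then show ?thesis using True by (simp add: rel_entropy_Dval[OF A B p q])
next
  case False
  then have "rel_entropy \<rho> \<sigma> = \<infinity>" by (subst rel_entropy_Dval[OF A B]) (use p q in auto)
  then show ?thesis by simp
qed

text \<open>An inequality between integrands gives one between relative entropies once the traces
  agree, since these govern the subtracted terms. The delicate point is finiteness of the left side:
  a violated support condition there would make the integrand grow like 1/t near 0, whereas the
  right integrand stays bounded.\<close>

lemma sum_rel_entropy_le_of_gfun:
  assumes fin: "finite I"
    and A: "is_spec n \<rho> U p" and B: "is_spec n \<sigma> V q"
    and p: "\<And>i. i < n \<Longrightarrow> 0 \<le> p i" and q: "\<And>i. i < n \<Longrightarrow> 0 \<le> q i"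
    and Ax: "\<And>x. x \<in> I \<Longrightarrow> is_spec m (\<rho>' x) (U' x) (p' x)" and Bx: "\<And>x. x \<in> I \<Longrightarrow> is_spec m (\<sigma>' x) (V' x) (q' x)"
    and p': "\<And>x i. x \<in> I \<Longrightarrow> i < m \<Longrightarrow> 0 \<le> p' x i" and q': "\<And>x i. x \<in> I \<Longrightarrow> i < m \<Longrightarrow> 0 \<le> q' x i"
    and tr: "(\<Sum>x\<in>I. \<Sum>i<m. p' x i) = (\<Sum>i<n. p i)"
    and g: "\<And>t. 0 < t \<Longrightarrow> (\<Sum>x\<in>I. quad_max m (U' x) (p' x) (V' x) (q' x) t) \<le> quad_max n U p V q t"
    and g0: "rel_entropy \<rho> \<sigma> \<noteq> \<infinity> \<Longrightarrow> (\<Sum>x\<in>I. quad_max m (U' x) (p' x) (V' x) (q' x) 0) \<le> quad_max n U p V q 0"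
  shows "(\<Sum>x\<in>I. rel_entropy (\<rho>' x) (\<sigma>' x)) \<le> rel_entropy \<rho> \<sigma>"
proof (cases "\<forall>i<n. \<forall>j<n. p i * ovl U V i j \<noteq> 0 \<longrightarrow> q j \<noteq> 0")
  case True
  note UU = is_specD(1)[OF A] and VV = is_specD(1)[OF B]
  \<comment> \<open>The integrand decreases in t, so its finite value at 0 bounds it
    everywhere.\<close>
  have gmono: "quad_max n U p V q t \<le> quad_max n U p V q 0" if "t > 0" for t
    unfolding quad_max_def
  proof (intro sum_mono)
    fix i j assume ij: "i \<in> {..<n}" "j \<in> {..<n}"
    show "ovl U V i j * (p i)\<^sup>2 / (q j + t * p i) \<le> ovl U V i j * (p i)\<^sup>2 / (q j + 0 * p i)"
    proof (cases "p i * ovl U V i j = 0")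
      case False
      then have pos: "q j > 0" "p i > 0" using True[rule_format, of i j] p[of i] q[of j] ij by (auto simp: less_le)
      have "ovl U V i j * (p i)\<^sup>2 / (q j + t * p i) \<le> ovl U V i j * (p i)\<^sup>2 / q j"
        using that pos by (intro divide_left_mono mult_pos_pos) (auto intro!: add_pos_pos)
      then show ?thesis by simp
    qed auto
  qed
  have supp': "q' x j \<noteq> 0" if x: "x \<in> I" and ij: "i < m" "j < m" and nz: "p' x i * ovl (U' x) (V' x) i j \<noteq> 0" for x i j
  proof
    assume q0: "q' x j = 0"
    let ?w = "p' x i * ovl (U' x) (V' x) i j"
    have pp: "p' x i > 0" using p'[OF x ij(1)] nz by (auto simp: less_le)
    have "?w > 0" using nz pp by (auto simp: less_le)
    have bd: "?w / t \<le> quad_max n U p V q 0" if t: "t > 0" for t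
    proof -
      have "?w / t = ovl (U' x) (V' x) i j * (p' x i)\<^sup>2 / (q' x j + t * p' x i)"
        using pp q0 t by (simp add: power2_eq_square field_simps)
      also have "\<dots> \<le> (\<Sum>j<m. ovl (U' x) (V' x) i j * (p' x i)\<^sup>2 / (q' x j + t * p' x i))"
        using ij t p'[OF x] q'[OF x] by (intro member_le_sum divide_nonneg_nonneg mult_nonneg_nonneg add_nonneg_nonneg) auto
      also have "\<dots> \<le> quad_max m (U' x) (p' x) (V' x) (q' x) t"
        unfolding quad_max_def using ij t p'[OF x] q'[OF x]
        by (intro member_le_sum[where f = "\<lambda>i. \<Sum>j<m. ovl (U' x) (V' x) i j * (p' x i)\<^sup>2 / (q' x j + t * p' x i)"]
            sum_nonneg divide_nonneg_nonneg mult_nonneg_nonneg add_nonneg_nonneg) auto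
      also have "\<dots> \<le> (\<Sum>x\<in>I. quad_max m (U' x) (p' x) (V' x) (q' x) t)"
        using x fin t p' q' by (intro member_le_sum[where f = "\<lambda>x. quad_max m (U' x) (p' x) (V' x) (q' x) t"] quad_max_nonneg) auto
      also have "\<dots> \<le> quad_max n U p V q 0" using g[OF t] gmono[OF t] by simp
      finally show ?thesis .
    qed
    define G where "G = quad_max n U p V q 0"
    have "G > 0" using bd[of 1] \<open>?w > 0\<close> by (simp add: G_def)
    have aux: "w / (w / (2 * g)) = 2 * g" if "w > 0" for w g :: real using that by simp
    \<comment> \<open>The value t = w / (2 G) makes the blow-up term w / t equal to 2 G, twice the
      bound G.\<close>
    have "0 < ?w / (2 * G)" using \<open>G > 0\<close> \<open>?w > 0\<close> by (intro divide_pos_pos) auto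
    from bd[OF this] have "2 * G \<le> G" unfolding aux[OF \<open>?w > 0\<close>] G_def .
    then show False using \<open>G > 0\<close> by simp
  qed
  have fin_rel: "rel_entropy \<rho> \<sigma> = ereal (Dval n U p V q)" using True by (simp add: rel_entropy_Dval[OF A B p q])
  have "(\<Sum>x\<in>I. Dval m (U' x) (p' x) (V' x) (q' x)) \<le> Dval n U p V q"
  proof (rule limit_le_of_deriv_le)
    fix t :: real assume t: "0 \<le> t"
    show "((\<lambda>T. \<Sum>x\<in>I. Dtrunc m (U' x) (p' x) (V' x) (q' x) T) has_real_derivative
      (\<Sum>x\<in>I. quad_max m (U' x) (p' x) (V' x) (q' x) t - (\<Sum>i<m. p' x i) / (1 + t))) (at t)"
      using t p' q' supp' is_specD(1)[OF Ax] is_specD(1)[OF Bx] by (intro DERIV_sum Dtrunc_deriv) auto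
    show "(Dtrunc n U p V q has_real_derivative quad_max n U p V q t - (\<Sum>i<n. p i) / (1 + t)) (at t)"
      using p q True UU VV t by (intro Dtrunc_deriv) auto
    have "(\<Sum>x\<in>I. quad_max m (U' x) (p' x) (V' x) (q' x) t) \<le> quad_max n U p V q t"
      using g[of t] g0 t fin_rel by (cases "t = 0") auto
    then show "(\<Sum>x\<in>I. quad_max m (U' x) (p' x) (V' x) (q' x) t - (\<Sum>i<m. p' x i) / (1 + t)) \<le> quad_max n U p V q t - (\<Sum>i<n. p i) / (1 + t)"
      by (simp add: sum_subtractf tr[symmetric] sum_divide_distrib)
  next
    show "((\<lambda>T. \<Sum>x\<in>I. Dtrunc m (U' x) (p' x) (V' x) (q' x) T) \<longlongrightarrow> (\<Sum>x\<in>I. Dval m (U' x) (p' x) (V' x) (q' x))) at_top"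
      using p' q' supp' by (intro tendsto_sum Dtrunc_limit) auto
    show "(Dtrunc n U p V q \<longlongrightarrow> Dval n U p V q) at_top"
      using p q True by (intro Dtrunc_limit) auto
  qed (simp add: Dtrunc_0)
  moreover have "(\<Sum>x\<in>I. rel_entropy (\<rho>' x) (\<sigma>' x)) = (\<Sum>x\<in>I. ereal (Dval m (U' x) (p' x) (V' x) (q' x)))"
    using supp' by (intro sum.cong refl) (auto simp: rel_entropy_Dval[OF Ax Bx p' q'])
  ultimately show ?thesis by (simp add: fin_rel)
next
  case False
  then have "rel_entropy \<rho> \<sigma> = \<infinity>" by (subst rel_entropy_Dval[OF A B]) (use p q in auto)
  then show ?thesis by simp
qed

subsection \<open>Monotonicity under quantum instruments\<close>

lemma mat_minus_mult: "dim_row A = dim_row B \<Longrightarrow> dim_col A = dim_col B \<Longrightarrow> dim_col A = dim_row C \<Longrightarrow>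
   (A - B) * C = A * C - B * (C :: complex mat)"
  by (rule minus_mult_distrib_mat[of _ "dim_row A" "dim_col A" _ _ "dim_col C"]) auto

lemma mat_mult_minus: "dim_row C = dim_row B \<Longrightarrow> dim_col C = dim_col B \<Longrightarrow> dim_col A = dim_row C \<Longrightarrow>
   A * (B - C) = A * B - A * (C :: complex mat)"
  by (rule mult_minus_distrib_mat[of _ "dim_row A" "dim_col A" _ "dim_col B"]) auto

lemma tr_rot: "dim_col A = dim_row B \<Longrightarrow> dim_col B = dim_row A \<Longrightarrow> tr (A * B) = tr (B * A)"
  by (rule tr_comm[of _ "dim_row A" "dim_col A"]) auto

lemma tr_mult_sum_op:
  assumes "dim_row A = n" "dim_col A = n" "\<And>x. x \<in> X \<Longrightarrow> F x \<in> carrier_mat n n"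
  shows "tr (A * sum_op n F X) = (\<Sum>x\<in>X. tr (A * F x))"
proof -
  have "tr (A * sum_op n F X) = tr (sum_op n (\<lambda>x. A * F x) X)"
    using assms by (subst sum_op_mult_left) auto
  also have "\<dots> = (\<Sum>x\<in>X. tr (A * F x))"
    by (rule tr_sum_op) (use assms in fastforce)
  finally show ?thesis .
qed

lemma adj_sum_op:
  assumes "\<And>x. x \<in> X \<Longrightarrow> F x \<in> carrier_mat n n"
  shows "adj (sum_op n F X) = sum_op n (\<lambda>x. adj (F x)) X"
  using assms by (intro eq_matI) (auto intro!: sum.cong)

text \<open>The Kadison-Schwarz inequality for the unital map that sends a family Y to the sum of
  \<open>adj (L j) * Y j * L j\<close>. The argument may depend on j, which covers instruments whose
  outcome is kept.\<close>

lemma kadison_schwarz: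
  assumes s: "pos_semidef n \<sigma>" 
    and L: "\<And>j. j \<in> J \<Longrightarrow> L j \<in> carrier_mat m n" and Y: "\<And>j. j \<in> J \<Longrightarrow> Y j \<in> carrier_mat m m"
    and one: "sum_op n (\<lambda>j. adj (L j) * L j) J = 1\<^sub>m n"
  defines "X \<equiv> sum_op n (\<lambda>j. adj (L j) * Y j * L j) J"
  shows "Re (tr (\<sigma> * (X * adj X))) \<le> (\<Sum>j\<in>J. Re (tr (\<sigma> * (adj (L j) * (Y j * adj (Y j)) * L j))))"
proof -
  have [simp]: "dim_row X = n" "dim_col X = n" by (simp_all add: X_def)
  have [simp]: "dim_row (L j) = m" "dim_col (L j) = n" "dim_row (Y j) = m" "dim_col (Y j) = m" if "j \<in> J" for j
    using L[OF that] Y[OF that] by auto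
  have [simp]: "dim_row \<sigma> = n" "dim_col \<sigma> = n" using psd_carrier[OF s] by auto
  have adjX: "adj X = sum_op n (\<lambda>j. adj (L j) * adj (Y j) * L j) J"
    unfolding X_def by (subst adj_sum_op) (auto simp: adj_mult mat_assoc intro!: sum_op_cong)
  \<comment> \<open>The failure of L j to intertwine the adjoints of X and Y j. In the sum of its
    squares both mixed terms and, by unitality, the last term equal the trace of \<sigma> X
    X-adjoint, so one copy is left with a minus sign.\<close>
  let ?T = "\<lambda>j. adj (Y j) * L j - L j * adj X"
  have T: "tr (\<sigma> * (adj (?T j) * ?T j)) = tr (\<sigma> * (adj (L j) * (Y j * adj (Y j)) * L j))
      - tr ((adj X * \<sigma>) * (adj (L j) * Y j * L j)) - tr ((\<sigma> * X) * (adj (L j) * adj (Y j) * L j))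
      + tr ((adj X * \<sigma> * X) * (adj (L j) * L j))" if "j \<in> J" for j
  proof -
    note [simp] = that
    have adjT: "adj (?T j) = adj (L j) * Y j - X * adj (L j)"
      by (subst adj_minus[of _ m n]) (auto simp: adj_mult)
    have "\<sigma> * (adj (?T j) * ?T j) = (\<sigma> * (adj (L j) * (Y j * adj (Y j)) * L j) - \<sigma> * X * (adj (L j) * adj (Y j) * L j))
       - (\<sigma> * (adj (L j) * Y j * L j) * adj X - (\<sigma> * X) * (adj (L j) * L j * adj X))"
      unfolding adjT by (simp add: mat_minus_mult mat_mult_minus mat_assoc)
    then have "tr (\<sigma> * (adj (?T j) * ?T j)) = tr (\<sigma> * (adj (L j) * (Y j * adj (Y j)) * L j)) - tr (\<sigma> * X * (adj (L j) * adj (Y j) * L j))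
       - (tr (\<sigma> * (adj (L j) * Y j * L j) * adj X) - tr ((\<sigma> * X) * (adj (L j) * L j * adj X)))"
      by (simp add: tr_minus[of _ n])
    moreover have "tr (\<sigma> * (adj (L j) * Y j * L j) * adj X) = tr ((adj X * \<sigma>) * (adj (L j) * Y j * L j))"
      by (subst tr_rot) (auto simp: mat_assoc)
    moreover have "tr ((\<sigma> * X) * (adj (L j) * L j * adj X)) = tr ((\<sigma> * X * (adj (L j) * L j)) * adj X)"
      by (simp add: mat_assoc)
    moreover have "\<dots> = tr ((adj X * \<sigma> * X) * (adj (L j) * L j))"
      by (subst tr_rot) (auto simp: mat_assoc)
    ultimately show ?thesis by simp
  qed
  have "0 \<le> (\<Sum>j\<in>J. tr (\<sigma> * (adj (?T j) * ?T j)))"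
    by (intro sum_nonneg psd_tr_mult[OF s] psd_gram') auto
  also have "\<dots> = (\<Sum>j\<in>J. tr (\<sigma> * (adj (L j) * (Y j * adj (Y j)) * L j)))
      - (\<Sum>j\<in>J. tr ((adj X * \<sigma>) * (adj (L j) * Y j * L j))) - (\<Sum>j\<in>J. tr ((\<sigma> * X) * (adj (L j) * adj (Y j) * L j)))
      + (\<Sum>j\<in>J. tr ((adj X * \<sigma> * X) * (adj (L j) * L j)))"
    using T by (simp add: sum.distrib sum_subtractf)
  also have "(\<Sum>j\<in>J. tr ((adj X * \<sigma>) * (adj (L j) * Y j * L j))) = tr ((adj X * \<sigma>) * X)"
    unfolding X_def by (rule tr_mult_sum_op[symmetric]) auto
  also have "(\<Sum>j\<in>J. tr ((\<sigma> * X) * (adj (L j) * adj (Y j) * L j))) = tr ((\<sigma> * X) * adj X)"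
    unfolding adjX by (rule tr_mult_sum_op[symmetric]) auto
  also have "(\<Sum>j\<in>J. tr ((adj X * \<sigma> * X) * (adj (L j) * L j))) = tr (adj X * \<sigma> * X)"
    by (subst tr_mult_sum_op[symmetric, of _ n]) (auto simp: one)
  also have "tr ((adj X * \<sigma>) * X) = tr (\<sigma> * (X * adj X))"
    by (subst mat_assoc, simp, simp, subst tr_rot) (auto simp: mat_assoc)
  also have "tr (\<sigma> * X * adj X) = tr (\<sigma> * (X * adj X))" by (simp add: mat_assoc)
  finally have "0 \<le> Re ((\<Sum>j\<in>J. tr (\<sigma> * (adj (L j) * (Y j * adj (Y j)) * L j))) - tr (\<sigma> * (X * adj X)))"
    by (simp add: less_eq_complex_def)
  then show ?thesis by simp
qed

lemma psd_spec_ex: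
  assumes "pos_semidef n A"
  shows "\<exists>U d. is_spec n A U d \<and> (\<forall>i<n. 0 \<le> d i)"
  by (rule psd_spec[OF assms]) blast

definition kraus :: "nat \<Rightarrow> (nat \<Rightarrow> complex mat) \<Rightarrow> nat \<Rightarrow> complex mat \<Rightarrow> complex mat" where
  "kraus m L K \<rho> = sum_op m (\<lambda>k. L k * \<rho> * adj (L k)) {..<K}"

lemma psd_kraus:
  assumes "pos_semidef n \<rho>" "\<And>k. k < K \<Longrightarrow> L k \<in> carrier_mat m n"
  shows "pos_semidef m (kraus m L K \<rho>)"
  unfolding kraus_def using assms by (intro psd_sum_op psd_conj'[of n]) auto

lemma kraus_dim [simp]: "dim_row (kraus m L K \<rho>) = m" "dim_col (kraus m L K \<rho>) = m"
  by (simp_all add: kraus_def)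

lemma tr_kraus_mult:
  assumes "\<rho> \<in> carrier_mat n n" "\<And>k. k < K \<Longrightarrow> L k \<in> carrier_mat m n" "Y \<in> carrier_mat m m"
  shows "tr (kraus m L K \<rho> * Y) = (\<Sum>k<K. tr (\<rho> * (adj (L k) * Y * L k)))"
proof -
  have "tr (kraus m L K \<rho> * Y) = tr (Y * kraus m L K \<rho>)" using assms(3) by (intro tr_rot) auto
  also have "\<dots> = (\<Sum>k<K. tr (Y * (L k * \<rho> * adj (L k))))"
    unfolding kraus_def using assms by (intro tr_mult_sum_op) auto
  also have "\<dots> = (\<Sum>k<K. tr (\<rho> * (adj (L k) * Y * L k)))"
  proof (intro sum.cong refl)
    fix k assume "k \<in> {..<K}"
    then have [simp]: "dim_row (L k) = m" "dim_col (L k) = n" using assms(2)[of k] by auto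
    have [simp]: "dim_row \<rho> = n" "dim_col \<rho> = n" "dim_row Y = m" "dim_col Y = m" using assms by auto
    have "tr (Y * (L k * \<rho> * adj (L k))) = tr ((Y * L k) * (\<rho> * adj (L k)))" by (simp add: mat_assoc)
    also have "\<dots> = tr ((\<rho> * adj (L k)) * (Y * L k))" by (rule tr_rot) auto
    finally show "tr (Y * (L k * \<rho> * adj (L k))) = tr (\<rho> * (adj (L k) * Y * L k))" by (simp add: mat_assoc)
  qed
  finally show ?thesis .
qed

text \<open>Optimal trial operators for the separate outcomes are pulled back to a single trial
  operator on the input. The linear term is preserved by duality, the two quadratic terms can only
  decrease, so the integrand of the input dominates the sum over outcomes.\<close>

theorem rel_entropy_kraus:
  fixes N K m n :: nat and L :: "nat \<Rightarrow> nat \<Rightarrow> complex mat"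
  assumes r: "pos_semidef n \<rho>" and s: "pos_semidef n \<sigma>"
    and L: "\<And>x k. x < N \<Longrightarrow> k < K \<Longrightarrow> L x k \<in> carrier_mat m n"
    and one: "sum_op n (\<lambda>(x, k). adj (L x k) * L x k) ({..<N} \<times> {..<K}) = 1\<^sub>m n"
  shows "(\<Sum>x<N. rel_entropy (kraus m (L x) K \<rho>) (kraus m (L x) K \<sigma>)) \<le> rel_entropy \<rho> \<sigma>"
proof -
  note [simp] = carrier_matD[OF psd_carrier[OF r]] carrier_matD[OF psd_carrier[OF s]]
  let ?J = "{..<N} \<times> {..<K}"
  obtain U p where A: "is_spec n \<rho> U p" and p: "\<And>i. i < n \<Longrightarrow> 0 \<le> p i" using psd_spec[OF r] by blast
  obtain V q where B: "is_spec n \<sigma> V q" and q: "\<And>i. i < n \<Longrightarrow> 0 \<le> q i" using psd_spec[OF s] by blast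
  have "\<forall>x\<in>{..<N}. \<exists>U' p'. is_spec m (kraus m (L x) K \<rho>) U' p' \<and> (\<forall>i<m. 0 \<le> p' i)"
    using psd_kraus[OF r L] by (intro ballI psd_spec_ex) auto
  then obtain U' p' where A': "\<And>x. x < N \<Longrightarrow> is_spec m (kraus m (L x) K \<rho>) (U' x) (p' x)"
    and p': "\<And>x i. x < N \<Longrightarrow> i < m \<Longrightarrow> 0 \<le> p' x i" by (metis lessThan_iff)
  have "\<forall>x\<in>{..<N}. \<exists>U' p'. is_spec m (kraus m (L x) K \<sigma>) U' p' \<and> (\<forall>i<m. 0 \<le> p' i)"
    using psd_kraus[OF s L] by (intro ballI psd_spec_ex) auto
  then obtain V' q' where B': "\<And>x. x < N \<Longrightarrow> is_spec m (kraus m (L x) K \<sigma>) (V' x) (q' x)"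
    and q': "\<And>x i. x < N \<Longrightarrow> i < m \<Longrightarrow> 0 \<le> q' x i" by (metis lessThan_iff)
  have trS: "(\<Sum>x<N. tr (kraus m (L x) K \<tau> * Y x)) = (\<Sum>j\<in>?J. tr (\<tau> * (adj (case_prod L j) * Y (fst j) * case_prod L j)))"
    if "\<And>x. x < N \<Longrightarrow> Y x \<in> carrier_mat m m" "\<tau> \<in> carrier_mat n n" for Y :: "nat \<Rightarrow> complex mat" and \<tau>
  proof -
    have "(\<Sum>x<N. tr (kraus m (L x) K \<tau> * Y x)) = (\<Sum>x<N. \<Sum>k<K. tr (\<tau> * (adj (L x k) * Y x * L x k)))"
      using that L by (intro sum.cong refl tr_kraus_mult) auto
    also have "\<dots> = (\<Sum>j\<in>?J. tr (\<tau> * (adj (case_prod L j) * Y (fst j) * case_prod L j)))"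
      unfolding sum.cartesian_product by (intro sum.cong) auto
    finally show ?thesis .
  qed
  have one': "sum_op n (\<lambda>j. adj (case_prod L j) * case_prod L j) ?J = 1\<^sub>m n"
    unfolding one[symmetric] by (intro sum_op_cong) auto
  have tr_eq: "(\<Sum>x<N. \<Sum>i<m. p' x i) = (\<Sum>i<n. p i)"
  proof -
    have "complex_of_real (\<Sum>x<N. \<Sum>i<m. p' x i) = (\<Sum>x<N. tr (kraus m (L x) K \<rho> * 1\<^sub>m m))"
      using tr_spec[OF A'] by simp
    also have "\<dots> = (\<Sum>j\<in>?J. tr (\<rho> * (adj (case_prod L j) * 1\<^sub>m m * case_prod L j)))"
      by (intro trS) auto
    also have "\<dots> = (\<Sum>j\<in>?J. tr (\<rho> * (adj (case_prod L j) * case_prod L j)))"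
      using L by (intro sum.cong refl) auto
    also have "\<dots> = tr (\<rho> * 1\<^sub>m n)"
      unfolding one'[symmetric] by (rule tr_mult_sum_op[symmetric]) (use L in auto)
    also have "\<dots> = complex_of_real (\<Sum>i<n. p i)" using tr_spec[OF A] by simp
    finally show ?thesis by (simp only: of_real_eq_iff)
  qed
  have g: "(\<Sum>x<N. quad_max m (U' x) (p' x) (V' x) (q' x) t) \<le> quad_max n U p V q t" 
    if t: "0 \<le> t" and ts: "t > 0 \<or> (\<forall>i<n. \<forall>j<n. p i * ovl U V i j \<noteq> 0 \<longrightarrow> q j \<noteq> 0)" for t
  proof -
    have "\<forall>x\<in>{..<N}. \<exists>Y. Y \<in> carrier_mat m m \<and> quad (kraus m (L x) K \<rho>) (kraus m (L x) K \<sigma>) t Y = quad_max m (U' x) (p' x) (V' x) (q' x) t"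
    proof
      fix x assume x: "x \<in> {..<N}"
      then have "x < N" by simp
      show "\<exists>Y. Y \<in> carrier_mat m m \<and> quad (kraus m (L x) K \<rho>) (kraus m (L x) K \<sigma>) t Y = quad_max m (U' x) (p' x) (V' x) (q' x) t"
        by (rule quad_attained[OF A'[OF \<open>x < N\<close>] B'[OF \<open>x < N\<close>], of t]) (use p' q' t \<open>x < N\<close> in auto)
    qed
    then obtain Y :: "nat \<Rightarrow> complex mat" where Y: "\<And>x. x < N \<Longrightarrow> Y x \<in> carrier_mat m m"
      and Yq: "\<And>x. x < N \<Longrightarrow> quad (kraus m (L x) K \<rho>) (kraus m (L x) K \<sigma>) t (Y x) = quad_max m (U' x) (p' x) (V' x) (q' x) t"
      by (metis lessThan_iff)
    \<comment> \<open>The trial operator depends on the outcome x only; the Kraus index k within one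
      outcome is summed over.\<close>
    define Z where "Z j = Y (fst j)" for j :: "nat \<times> nat"
    define X where "X = sum_op n (\<lambda>j. adj (case_prod L j) * Z j * case_prod L j) ?J"
    have [simp]: "dim_row X = n" "dim_col X = n" by (simp_all add: X_def)
    have X: "X \<in> carrier_mat n n" by simp
    have LJ: "case_prod L j \<in> carrier_mat m n" if "j \<in> ?J" for j using that L by (cases j) auto
    have ZJ: "Z j \<in> carrier_mat m m" if "j \<in> ?J" for j using that Y by (auto simp: Z_def)
    have adjX: "adj X = sum_op n (\<lambda>j. adj (case_prod L j) * adj (Z j) * case_prod L j) ?J"
    proof -
      have "adj X = sum_op n (\<lambda>j. adj (adj (case_prod L j) * Z j * case_prod L j)) ?J"
        unfolding X_def using LJ ZJ by (intro adj_sum_op) fastforce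
      also have "\<dots> = sum_op n (\<lambda>j. adj (case_prod L j) * adj (Z j) * case_prod L j) ?J"
      proof (intro sum_op_cong)
        fix j assume j: "j \<in> ?J"
        note [simp] = carrier_matD[OF LJ[OF j]] carrier_matD[OF ZJ[OF j]]
        show "adj (adj (case_prod L j) * Z j * case_prod L j) = adj (case_prod L j) * adj (Z j) * case_prod L j"
          by (simp add: adj_mult mat_assoc)
      qed
      finally show ?thesis .
    qed
    have "(\<Sum>x<N. quad_max m (U' x) (p' x) (V' x) (q' x) t) 
      = 2 * Re (\<Sum>x<N. tr (kraus m (L x) K \<rho> * Y x)) - Re (\<Sum>x<N. tr (kraus m (L x) K \<sigma> * (Y x * adj (Y x))))
       - t * Re (\<Sum>x<N. tr (kraus m (L x) K \<rho> * (adj (Y x) * Y x)))"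
    proof -
      have "(\<Sum>x<N. quad_max m (U' x) (p' x) (V' x) (q' x) t) = (\<Sum>x<N. quad (kraus m (L x) K \<rho>) (kraus m (L x) K \<sigma>) t (Y x))"
        using Yq by (intro sum.cong) auto
      then show ?thesis by (simp add: quad_def sum_subtractf sum_distrib_left)
    qed
    also have "(\<Sum>x<N. tr (kraus m (L x) K \<rho> * Y x)) = (\<Sum>j\<in>?J. tr (\<rho> * (adj (case_prod L j) * Z j * case_prod L j)))"
      unfolding Z_def using Y by (intro trS) auto
    also have "\<dots> = tr (\<rho> * X)" unfolding X_def using LJ ZJ by (intro tr_mult_sum_op[symmetric]) fastforce+
    also have "(\<Sum>x<N. tr (kraus m (L x) K \<sigma> * (Y x * adj (Y x)))) = (\<Sum>j\<in>?J. tr (\<sigma> * (adj (case_prod L j) * (Z j * adj (Z j)) * case_prod L j)))"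
      unfolding Z_def by (rule trS) (use Y in auto)
    also have "(\<Sum>x<N. tr (kraus m (L x) K \<rho> * (adj (Y x) * Y x))) = (\<Sum>j\<in>?J. tr (\<rho> * (adj (case_prod L j) * (adj (Z j) * Z j) * case_prod L j)))"
      unfolding Z_def by (rule trS) (use Y in auto)
    also have "2 * Re (tr (\<rho> * X)) - Re (\<Sum>j\<in>?J. tr (\<sigma> * (adj (case_prod L j) * (Z j * adj (Z j)) * case_prod L j)))
       - t * Re (\<Sum>j\<in>?J. tr (\<rho> * (adj (case_prod L j) * (adj (Z j) * Z j) * case_prod L j))) \<le> quad \<rho> \<sigma> t X"
    proof -
      have "Re (tr (\<sigma> * (X * adj X))) \<le> (\<Sum>j\<in>?J. Re (tr (\<sigma> * (adj (case_prod L j) * (Z j * adj (Z j)) * case_prod L j))))"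
        unfolding X_def by (rule kadison_schwarz[OF s LJ ZJ one'])
      \<comment> \<open>The term weighted by t carries X-adjoint times X, so Kadison-Schwarz is used
        a second time for the adjoint family.\<close>
      moreover have "Re (tr (\<rho> * (adj X * adj (adj X)))) \<le> (\<Sum>j\<in>?J. Re (tr (\<rho> * (adj (case_prod L j) * (adj (Z j) * adj (adj (Z j))) * case_prod L j))))"
        unfolding adjX by (rule kadison_schwarz[OF r LJ _ one']) (use ZJ in auto)
      ultimately show ?thesis using t by (simp add: quad_def mult_left_mono diff_mono)
    qed
    also have "\<dots> \<le> quad_max n U p V q t" by (rule quad_le[OF A B X _ _ t ts]) (use p q in auto)
    finally show ?thesis .
  qed
  show ?thesis
  proof (rule sum_rel_entropy_le_of_gfun[OF _ A B _ _ A' B' _ _ tr_eq])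
    assume "rel_entropy \<rho> \<sigma> \<noteq> \<infinity>"
    then have "\<forall>i<n. \<forall>j<n. p i * ovl U V i j \<noteq> 0 \<longrightarrow> q j \<noteq> 0"
      by (subst (asm) rel_entropy_Dval[OF A B]) (use p q in \<open>auto split: if_splits\<close>)
    then show "(\<Sum>x<N. quad_max m (U' x) (p' x) (V' x) (q' x) 0) \<le> quad_max n U p V q 0" by (intro g) auto
  qed (use p q p' q' g in auto)
qed

subsection \<open>Lieb's three-operator inequality\<close>

text \<open>The reciprocal of the logarithmic mean, equivalently the first divided difference of ln,
  with the derivative on the diagonal.\<close>

definition inv_logmean :: "real \<Rightarrow> real \<Rightarrow> real" where
  "inv_logmean a b = (if a = b then 1 / a else (ln a - ln b) / (a - b))"

text \<open>\<open>int_resolvents a b T = \<integral>\<^sub>0\<^sup>T dt / ((a + t) (b + t))\<close>, which tends to \<open>inv_logmean a b\<close>.\<close>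

definition int_resolvents :: "real \<Rightarrow> real \<Rightarrow> real \<Rightarrow> real" where
  "int_resolvents a b T = (if a = b then 1 / a - 1 / (a + T)
     else ((ln (a + T) - ln (b + T)) - (ln a - ln b)) / (b - a))"

lemma int_resolvents_0 [simp]: "int_resolvents a b 0 = 0"
  by (simp add: int_resolvents_def)

lemma int_resolvents_deriv:
  assumes "a > 0" "b > 0" "T \<ge> 0"
  shows "(int_resolvents a b has_real_derivative 1 / ((a + T) * (b + T))) (at T)"
proof (cases "a = b")
  case True
  have "((\<lambda>T. 1 / a - 1 / (a + T)) has_real_derivative 1 / ((a + T) * (a + T))) (at T)"
    using assms by (auto intro!: derivative_eq_intros simp: power2_eq_square)
  moreover have "int_resolvents a b = (\<lambda>T. 1 / a - 1 / (a + T))"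
    using True by (auto simp: int_resolvents_def)
  ultimately show ?thesis using True by simp
next
  case False
  have "((\<lambda>T. ((ln (a + T) - ln (b + T)) - (ln a - ln b)) / (b - a)) has_real_derivative (1 / (a + T) - 1 / (b + T)) / (b - a)) (at T)"
    using assms False by (auto intro!: derivative_eq_intros)
  moreover have "(1 / (a + T) - 1 / (b + T)) / (b - a) = 1 / ((a + T) * (b + T))"
    using assms False by (simp add: divide_simps) 
  moreover have "int_resolvents a b = (\<lambda>T. ((ln (a + T) - ln (b + T)) - (ln a - ln b)) / (b - a))"
    using False by (auto simp: int_resolvents_def)
  ultimately show ?thesis by simp
qed

lemma ln_diff_tendsto_0:
  fixes a b :: real
  assumes "a > 0" "b > 0"
  shows "((\<lambda>T. ln (a + T) - ln (b + T)) \<longlongrightarrow> 0) at_top"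
proof -
  have "((\<lambda>T. (a + T) / (b + T)) \<longlongrightarrow> 1) at_top"
  proof -
    have "((\<lambda>T. 1 + (a - b) * inverse (b + T)) \<longlongrightarrow> 1 + (a - b) * 0) at_top"
      by (intro tendsto_add tendsto_mult tendsto_const tendsto_inverse_0_at_top
            filterlim_tendsto_add_at_top[OF tendsto_const filterlim_ident])
    moreover have "eventually (\<lambda>T. 1 + (a - b) * inverse (b + T) = (a + T) / (b + T)) at_top"
      using eventually_ge_at_top[of 0] by eventually_elim (use assms in \<open>simp add: field_simps\<close>)
    ultimately show ?thesis using Lim_transform_eventually by fastforce
  qed
  then have "((\<lambda>T. ln ((a + T) / (b + T))) \<longlongrightarrow> ln 1) at_top" by (intro tendsto_ln) auto
  moreover have "eventually (\<lambda>T. ln ((a + T) / (b + T)) = ln (a + T) - ln (b + T)) at_top"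
    using eventually_ge_at_top[of 0] by eventually_elim (use assms in \<open>simp add: ln_div\<close>)
  ultimately show ?thesis using Lim_transform_eventually by fastforce
qed

lemma int_resolvents_limit:
  assumes "a > 0" "b > 0"
  shows "(int_resolvents a b \<longlongrightarrow> inv_logmean a b) at_top"
proof (cases "a = b")
  case True
  have "((\<lambda>T. 1 / a - inverse (a + T)) \<longlongrightarrow> 1 / a - 0) at_top"
    by (intro tendsto_diff tendsto_const tendsto_inverse_0_at_top
            filterlim_tendsto_add_at_top[OF tendsto_const filterlim_ident])
  moreover have "int_resolvents a b = (\<lambda>T. 1 / a - inverse (a + T))"
    using True by (auto simp: int_resolvents_def field_simps)
  ultimately show ?thesis using True by (simp add: inv_logmean_def)
next
  case False
  have "((\<lambda>T. ((ln (a + T) - ln (b + T)) - (ln a - ln b)) / (b - a)) \<longlongrightarrow> (0 - (ln a - ln b)) / (b - a)) at_top"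
    by (intro tendsto_intros ln_diff_tendsto_0 assms) (use False in auto)
  moreover have "int_resolvents a b = (\<lambda>T. ((ln (a + T) - ln (b + T)) - (ln a - ln b)) / (b - a))"
    using False by (auto simp: int_resolvents_def)
  moreover have "(0 - (ln a - ln b)) / (b - a) = inv_logmean a b"
    using False by (simp add: inv_logmean_def divide_simps algebra_simps)
  ultimately show ?thesis by simp
qed

text \<open>Homogeneity of degree -1; in Lieb's inequality it separates the eigenvalues of K from
  those of \<sigma>.\<close>

lemma inv_logmean_scale:
  assumes "a > 0" "b > 0" "c > 0"
  shows "inv_logmean (c * a) (c * b) = inv_logmean a b / c"
proof (cases "a = b")
  case False
  have "ln (c * a) - ln (c * b) = ln a - ln b" using assms by (simp add: ln_mult)
  moreover have "c * a - c * b = c * (a - b)" by (simp add: right_diff_distrib)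
  ultimately show ?thesis using False assms by (simp add: inv_logmean_def)
qed (use assms in \<open>simp add: inv_logmean_def\<close>)

text \<open>The map \<open>Y \<mapsto> \<integral>\<^sub>0\<^sup>\<infinity> (K + t)\<^sup>-\<^sup>1 Y (K + t)\<^sup>-\<^sup>1 dt\<close> for \<open>K = V diag(k) V\<^sup>*\<close>, which is the Frechet derivative
  of the logarithm at \<open>K\<close>.\<close>

definition dlog_map :: "nat \<Rightarrow> complex mat \<Rightarrow> (nat \<Rightarrow> real) \<Rightarrow> complex mat \<Rightarrow> complex mat" where
  "dlog_map n V k Y = V * mat n n (\<lambda>(i, j). (adj V * Y * V) $$ (i, j) * complex_of_real (inv_logmean (k i) (k j))) * adj V"

lemma dlog_map_dim [simp]: "dim_row V = n \<Longrightarrow> dim_row (dlog_map n V k Y) = n" "dim_row V = n \<Longrightarrow> dim_col (dlog_map n V k Y) = n"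
  by (simp_all add: dlog_map_def)

text \<open>A Hermitian form is real, so only its real part has to be tested; the integral argument
  for \<open>dlog_map\<close> yields exactly that real part.\<close>

lemma psdI_herm:
  assumes "A \<in> carrier_mat n n" "\<And>i j. i < n \<Longrightarrow> j < n \<Longrightarrow> A $$ (j, i) = cnj (A $$ (i, j))"
    and "\<And>f. 0 \<le> Re (\<Sum>i<n. \<Sum>j<n. cnj (f i) * A $$ (i, j) * f j)"
  shows "pos_semidef n A"
proof (rule psdI[OF assms(1)])
  have aux: "Im z = 0" if "cnj z = z" for z using arg_cong[OF that, of Im] by simp
  fix f
  let ?S = "\<Sum>i<n. \<Sum>j<n. cnj (f i) * A $$ (i, j) * f j"
  have "cnj ?S = (\<Sum>i<n. \<Sum>j<n. f i * A $$ (j, i) * cnj (f j))"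
    by (simp only: cnj_sum complex_cnj_mult complex_cnj_cnj) (intro sum.cong refl, simp add: assms(2)[symmetric])
  also have "\<dots> = ?S" by (subst sum.swap) (simp add: mult_ac)
  finally have "Im ?S = 0" by (rule aux)
  then show "0 \<le> ?S" using assms(3)[of f] by (simp add: less_eq_complex_def)
qed

text \<open>In the eigenbasis of K the integrand at t is the matrix of Y multiplied entrywise by 1 /
  ((k_i + t)(k_j + t)), a diagonal congruence and hence positive. Integration over t keeps the
  quadratic form nonnegative.\<close>

lemma psd_dlog_map:
  assumes Y: "pos_semidef n Y" and V: "unitary_mat n V" and k: "\<And>i. i < n \<Longrightarrow> k i > 0"
  shows "pos_semidef n (dlog_map n V k Y)"
proof -
  define M where "M = adj V * Y * V"
  have M: "pos_semidef n M" unfolding M_def by (rule psd_conj[OF Y unitary_carrier[OF V]])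
  have "pos_semidef n (mat n n (\<lambda>(i, j). M $$ (i, j) * complex_of_real (inv_logmean (k i) (k j))))" (is "pos_semidef n ?H")
  proof (rule psdI_herm)
    fix i j assume ij: "i < n" "j < n"
    have "inv_logmean (k i) (k j) = inv_logmean (k j) (k i)"
      by (auto simp: inv_logmean_def divide_simps algebra_simps)
    then show "?H $$ (j, i) = cnj (?H $$ (i, j))"
      using ij psd_hermitian_index[OF M ij] by simp
  next
    fix f :: "nat \<Rightarrow> complex"
    have "0 \<le> (\<Sum>i<n. \<Sum>j<n. Re (cnj (f i) * M $$ (i, j) * f j) * inv_logmean (k i) (k j))"
    proof (rule limit_le_of_deriv_le[where f = "\<lambda>_. 0" and f' = "\<lambda>_. 0" and 
        g = "\<lambda>T. \<Sum>i<n. \<Sum>j<n. Re (cnj (f i) * M $$ (i, j) * f j) * int_resolvents (k i) (k j) T" and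
        g' = "\<lambda>T. \<Sum>i<n. \<Sum>j<n. Re (cnj (f i) * M $$ (i, j) * f j) * (1 / ((k i + T) * (k j + T)))"])
      fix t :: real assume t: "0 \<le> t"
      show "((\<lambda>T. \<Sum>i<n. \<Sum>j<n. Re (cnj (f i) * M $$ (i, j) * f j) * int_resolvents (k i) (k j) T) has_real_derivative
        (\<Sum>i<n. \<Sum>j<n. Re (cnj (f i) * M $$ (i, j) * f j) * (1 / ((k i + t) * (k j + t))))) (at t)"
        using k t by (intro DERIV_sum DERIV_cmult int_resolvents_deriv) auto
      \<comment> \<open>The weights 1 / (k_i + t) are absorbed into the vector f, where positivity
        of M applies directly.\<close>
      have "0 \<le> Re (\<Sum>i<n. \<Sum>j<n. cnj (f i * complex_of_real (1 / (k i + t))) * M $$ (i, j) * (f j * complex_of_real (1 / (k j + t))))"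
        using psd_quad[OF M] by (simp only: less_eq_complex_def zero_complex.sel)
      also have "\<dots> = (\<Sum>i<n. \<Sum>j<n. Re (cnj (f i) * M $$ (i, j) * f j * complex_of_real (1 / ((k i + t) * (k j + t)))))"
        by (simp only: Re_sum) (intro sum.cong refl arg_cong[where f = Re], simp)
      also have "\<dots> = (\<Sum>i<n. \<Sum>j<n. Re (cnj (f i) * M $$ (i, j) * f j) * (1 / ((k i + t) * (k j + t))))"
        by (intro sum.cong refl) (simp only: times_complex.sel Re_complex_of_real Im_complex_of_real mult_zero_right diff_zero)
      finally show "0 \<le> (\<Sum>i<n. \<Sum>j<n. Re (cnj (f i) * M $$ (i, j) * f j) * (1 / ((k i + t) * (k j + t))))" .
    next
      show "((\<lambda>T. \<Sum>i<n. \<Sum>j<n. Re (cnj (f i) * M $$ (i, j) * f j) * int_resolvents (k i) (k j) T) \<longlongrightarrow>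
        (\<Sum>i<n. \<Sum>j<n. Re (cnj (f i) * M $$ (i, j) * f j) * inv_logmean (k i) (k j))) at_top"
        using k by (intro tendsto_sum tendsto_mult tendsto_const int_resolvents_limit) auto
    qed auto
    also have "\<dots> = (\<Sum>i<n. \<Sum>j<n. Re (cnj (f i) * ?H $$ (i, j) * f j))"
      by (intro sum.cong refl) (simp add: algebra_simps)
    finally show "0 \<le> Re (\<Sum>i<n. \<Sum>j<n. cnj (f i) * ?H $$ (i, j) * f j)" by (simp only: Re_sum)
  qed simp
  from psd_conj'[OF this unitary_carrier[OF V]] show ?thesis by (simp add: dlog_map_def M_def)
qed

text \<open>Only diagonal multipliers enter the trace, and these are 1 / k_i: the trace of the
  derivative of log at K in direction Y is tr (Y K^-1). With K the inverse of F this gives back tr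
  (Y F).\<close>

lemma tr_dlog_map:
  assumes V: "unitary_mat n V" and Y: "Y \<in> carrier_mat n n" 
  shows "tr (dlog_map n V k Y) = tr (Y * (V * real_diag n (\<lambda>i. 1 / k i) * adj V))"
proof -
  note [simp] = unitary_dims[OF V] carrier_matD[OF Y]
  define M where "M = adj V * Y * V"
  let ?H = "mat n n (\<lambda>(i, j). M $$ (i, j) * complex_of_real (inv_logmean (k i) (k j)))"
  have "tr (dlog_map n V k Y) = tr ((adj V * V) * ?H)"
    unfolding dlog_map_def M_def[symmetric] by (subst tr_rot) (auto simp: mat_assoc)
  also have "\<dots> = (\<Sum>i<n. M $$ (i, i) * complex_of_real (1 / k i))"
    by (simp add: unitary_left[OF V] tr_def inv_logmean_def)
  also have "\<dots> = tr (M * real_diag n (\<lambda>i. 1 / k i))"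
    by (simp add: tr_def M_def)
  also have "\<dots> = tr ((adj V * (Y * V)) * real_diag n (\<lambda>i. 1 / k i))" by (simp add: M_def mat_assoc)
  also have "\<dots> = tr (Y * (V * real_diag n (\<lambda>i. 1 / k i) * adj V))"
    by (simp add: mat_assoc, subst tr_rot) (auto simp: mat_assoc)
  finally show ?thesis .
qed

text \<open>A tangent argument. The relative entropy is jointly convex and homogeneous of degree 1,
  so D(\<rho> || G) is at least the linearization at (\<sigma>, K) evaluated at (\<rho>, G), which
  is tr \<rho> (log \<sigma> + 1 - log K) minus the trace of G with the derivative of log at K in
  direction \<sigma>. Exchanging log \<sigma> and log G on the two sides turns this into a lower
  bound for D(\<rho> || \<sigma>). The tangent is realized by inserting the optimal X of the pair
  (\<sigma>, K) into \<open>quad\<close> for the pair (\<rho>, G).\<close>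

theorem lieb_inequality:
  assumes r: "pos_semidef n \<rho>" and s: "pos_semidef n \<sigma>" and V: "unitary_mat n V"
    and k: "\<And>i. i < n \<Longrightarrow> k i > 0" and G: "is_spec n G W g" and g: "\<And>i. i < n \<Longrightarrow> g i > 0"
  shows "ereal (Re (tr (\<rho> * (V * real_diag n (\<lambda>i. - ln (k i)) * adj V))) + Re (tr (\<rho> * log_op G)) + Re (tr \<rho>)
      - Re (tr (G * dlog_map n V k \<sigma>))) \<le> rel_entropy \<rho> \<sigma>"
proof -
  obtain U p where A: "is_spec n \<rho> U p" and p: "\<And>i. i < n \<Longrightarrow> 0 \<le> p i" using psd_spec[OF r] by blast
  obtain S q where B: "is_spec n \<sigma> S q" and q: "\<And>i. i < n \<Longrightarrow> 0 \<le> q i" using psd_spec[OF s] by blast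
  show ?thesis
  proof (cases "\<forall>i<n. \<forall>j<n. p i * ovl U S i j \<noteq> 0 \<longrightarrow> q j \<noteq> 0")
    case False
    then have "rel_entropy \<rho> \<sigma> = \<infinity>" by (subst rel_entropy_Dval[OF A B]) (use p q in auto)
    then show ?thesis by simp
  next
    case True
    note UU = is_specD(1)[OF A] and SS = is_specD(1)[OF B]
    note [simp] = is_specD(3,4,6,7)[OF A] is_specD(3,4,6,7)[OF B] is_specD(3,4,6,7)[OF G] unitary_dims[OF V]
    define c where "c = adj V * S"
    have c: "unitary_mat n c" unfolding c_def by (intro unitary_mult unitary_adj V SS)
    have [simp]: "dim_row c = n" "dim_col c = n" by (simp_all add: c_def)
    define R where "R = adj S * \<rho> * S"
    define M where "M = adj V * G * V"
    have [simp]: "dim_row R = n" "dim_col R = n" "dim_row M = n" "dim_col M = n" by (simp_all add: R_def M_def)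
    have Rpsd: "pos_semidef n R" unfolding R_def by (rule psd_conj[OF r unitary_carrier[OF SS]])
    \<comment> \<open>By the support condition \<rho> vanishes on the kernel of \<sigma>, so every
      term in which 1 / q_j would be meaningless carries the coefficient 0.\<close>
    have R0: "R $$ (j', j) = 0" if "j' < n" "j < n" "q j = 0 \<or> q j' = 0" for j j'
    proof -
      define C where "C = adj S * U"
      have [simp]: "dim_row C = n" "dim_col C = n" by (simp_all add: C_def)
      have "R = C * real_diag n p * adj C"
        by (simp add: R_def C_def is_specD(2)[OF A] mat_assoc adj_mult)
      then have "R $$ (j', j) = (\<Sum>l<n. C $$ (j', l) * p l * cnj (C $$ (j, l)))"
        using that by (simp add: diag_conj_index)
      also have "\<dots> = 0"
      proof (rule sum.neutral, intro ballI)
        fix l assume l: "l \<in> {..<n}"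
        have *: "p l = 0 \<or> C $$ (j, l) = 0" if "q j = 0" "j < n" for j
        proof -
          have "ovl S U j l = ovl U S l j" using that l by (intro ovl_commute[OF SS UU]) auto
          moreover have "ovl S U j l = (cmod (C $$ (j, l)))\<^sup>2" by (simp add: ovl_def C_def)
          ultimately have "C $$ (j, l) = 0" if "ovl U S l j = 0" using that by simp
          then show ?thesis using True[rule_format, of l j] l that by auto
        qed
        show "C $$ (j', l) * p l * cnj (C $$ (j, l)) = 0" using *[of j] *[of j'] that by auto
      qed
      finally show ?thesis .
    qed
    \<comment> \<open>X solves K X \<sigma>^-1 + t X = 1 on the support of \<sigma>: between the
      eigenbases of K and \<sigma> the identity has entries c_ij and is divided by k_i / q_j +
      t.\<close>
    define x where "x t i j = (if q j = 0 then 0 else 1 / (k i / q j + t))" for t :: real and i j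
    define X where "X t = V * mat n n (\<lambda>(i, j). c $$ (i, j) * complex_of_real (x t i j)) * adj S" for t
    define kp where "kp j' j i = Re (R $$ (j', j) * cnj (c $$ (i, j)) * c $$ (i, j'))" for j' j i
    define mm where "mm i' i j = Re (M $$ (i', i) * c $$ (i, j) * cnj (c $$ (i', j)))" for i' i j
    have Re_mult_real: "Re (z * complex_of_real y) = Re z * y" for z y by simp
    \<comment> \<open>The symmetry permits the linear term, which occurs twice in
      \<open>quad\<close>, to be read once with x at j and once with x at j', giving an integrand
      symmetric in the two.\<close>
    have kp_sym: "kp j' j i = kp j j' i" if "j < n" "j' < n" for j j' i
    proof -
      have "R $$ (j, j') * cnj (c $$ (i, j')) * c $$ (i, j) = cnj (R $$ (j', j) * cnj (c $$ (i, j)) * c $$ (i, j'))"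
        using psd_hermitian_index[OF Rpsd that(2) that(1)] by (simp add: mult_ac)
      then show ?thesis unfolding kp_def by (metis cnj.sel(1))
    qed
    have kp0: "kp j' j i = 0" if "j' < n" "j < n" "q j = 0 \<or> q j' = 0" for j j' i
      using R0[OF that] by (simp add: kp_def)
    have Xh: "adj V * X t * S = mat n n (\<lambda>(i, j). c $$ (i, j) * complex_of_real (x t i j))" for t
      by (simp add: X_def mat_assoc unitary_cancel[OF V] unitary_left[OF SS])
    have trX1: "Re (tr (\<rho> * X t)) = (\<Sum>j'<n. \<Sum>j<n. \<Sum>i<n. kp j' j i * x t i j')" for t
    proof -
      let ?H = "mat n n (\<lambda>(i, j). c $$ (i, j) * complex_of_real (x t i j))"
      have "tr (\<rho> * X t) = tr (R * (adj c * ?H))"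
      proof -
        have "tr (R * (adj c * ?H)) = tr (adj S * (\<rho> * (S * (adj S * (V * ?H)))))"
          by (simp add: R_def c_def adj_mult mat_assoc)
        also have "\<dots> = tr ((\<rho> * (V * ?H)) * adj S)"
          by (subst tr_rot) (auto simp: mat_assoc unitary_cancel[OF SS])
        finally show ?thesis by (simp add: X_def mat_assoc)
      qed
      also have "\<dots> = (\<Sum>j'<n. \<Sum>j<n. \<Sum>i<n. R $$ (j', j) * cnj (c $$ (i, j)) * c $$ (i, j') * complex_of_real (x t i j'))"
        by (subst tr_mult) (auto simp: mat_mult_index sum_distrib_left mult_ac)
      finally show ?thesis by (simp only: Re_sum Re_mult_real kp_def)
    qed
    have trX1': "Re (tr (\<rho> * X t)) = (\<Sum>j'<n. \<Sum>j<n. \<Sum>i<n. kp j' j i * x t i j)" for t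
      unfolding trX1 by (subst sum.swap) (auto simp: kp_sym intro!: sum.cong)
    have trX2: "Re (tr (\<rho> * (adj (X t) * X t))) = (\<Sum>j'<n. \<Sum>j<n. \<Sum>i<n. kp j' j i * (x t i j * x t i j'))" for t
    proof -
      let ?H = "mat n n (\<lambda>(i, j). c $$ (i, j) * complex_of_real (x t i j))"
      have "tr (\<rho> * (adj (X t) * X t)) = tr (R * (adj ?H * ?H))"
      proof -
        have "tr (R * (adj ?H * ?H)) = tr (adj S * (\<rho> * (S * (adj ?H * ?H))))"
          by (simp add: R_def mat_assoc)
        also have "\<dots> = tr ((\<rho> * (S * (adj ?H * ?H))) * adj S)"
          by (subst tr_rot) auto
        finally show ?thesis by (simp add: X_def mat_assoc adj_mult unitary_cancel[OF V])
      qed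
      also have "\<dots> = (\<Sum>j'<n. \<Sum>j<n. \<Sum>i<n. R $$ (j', j) * cnj (c $$ (i, j)) * c $$ (i, j') * complex_of_real (x t i j * x t i j'))"
        by (subst tr_mult) (auto simp: mat_mult_index sum_distrib_left mult_ac)
      finally show ?thesis by (simp only: Re_sum Re_mult_real kp_def)
    qed
    have trX3: "Re (tr (G * (X t * adj (X t)))) = (\<Sum>i'<n. \<Sum>i<n. \<Sum>j<n. mm i' i j * (x t i j * x t i' j))" for t
    proof -
      let ?H = "mat n n (\<lambda>(i, j). c $$ (i, j) * complex_of_real (x t i j))"
      have "tr (G * (X t * adj (X t))) = tr (M * (?H * adj ?H))"
      proof -
        have "tr (M * (?H * adj ?H)) = tr (adj V * (G * (V * (?H * adj ?H))))"
          by (simp add: M_def mat_assoc)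
        also have "\<dots> = tr ((G * (V * (?H * adj ?H))) * adj V)"
          by (subst tr_rot) auto
        finally show ?thesis by (simp add: X_def mat_assoc adj_mult unitary_cancel[OF SS])
      qed
      also have "\<dots> = (\<Sum>i'<n. \<Sum>i<n. \<Sum>j<n. M $$ (i', i) * c $$ (i, j) * cnj (c $$ (i', j)) * complex_of_real (x t i j * x t i' j))"
        by (subst tr_mult) (auto simp: mat_mult_index sum_distrib_left mult_ac)
      finally show ?thesis by (simp only: Re_sum Re_mult_real mm_def)
    qed
    \<comment> \<open>Columns of the unitary c are orthonormal; hence weights that do not depend on
      i collapse to the diagonal j = j'.\<close>
    have orth: "(\<Sum>i<n. cnj (c $$ (i, j)) * c $$ (i, j')) = (if j = j' then 1 else 0)" if "j < n" "j' < n" for j j'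
    proof -
      have "(\<Sum>i<n. cnj (c $$ (i, j)) * c $$ (i, j')) = (adj c * c) $$ (j, j')"
        using that by (subst mat_mult_index) auto
      then show ?thesis using that by (simp add: unitary_left[OF c])
    qed
    have kp_sum: "(\<Sum>j'<n. \<Sum>j<n. \<Sum>i<n. kp j' j i * th j' j) = (\<Sum>j<n. Re (R $$ (j, j)) * th j j)" for th
    proof -
      have "(\<Sum>i<n. kp j' j i * th j' j) = (if j = j' then Re (R $$ (j, j)) * th j j else 0)" if "j' < n" "j < n" for j j'
      proof -
        have "(\<Sum>i<n. kp j' j i * th j' j) = Re (R $$ (j', j) * (\<Sum>i<n. cnj (c $$ (i, j)) * c $$ (i, j'))) * th j' j"
          by (simp only: kp_def sum_distrib_left sum_distrib_right Re_sum mult.assoc)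
        then show ?thesis using orth[OF that(2,1)] by auto
      qed
      then have "(\<Sum>j'<n. \<Sum>j<n. \<Sum>i<n. kp j' j i * th j' j) = (\<Sum>j'<n. \<Sum>j<n. if j = j' then Re (R $$ (j, j)) * th j j else 0)"
        by (intro sum.cong refl) auto
      then show ?thesis by simp
    qed
    have psum: "(\<Sum>i<n. p i) = (\<Sum>j'<n. \<Sum>j<n. \<Sum>i<n. kp j' j i * 1)"
    proof -
      have "complex_of_real (\<Sum>i<n. p i) = tr (\<rho> * (S * adj S))" using tr_spec[OF A] by (simp add: unitary_right[OF SS])
      also have "\<dots> = tr R" unfolding R_def by (subst mat_assoc[symmetric], simp, simp, subst tr_rot) (auto simp: mat_assoc)
      finally have "(\<Sum>i<n. p i) = Re (tr R)" by (metis Re_complex_of_real)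
      then show ?thesis unfolding kp_sum by (simp add: tr_def)
    qed
    \<comment> \<open>With a = k_i / q_j and b = k_i / q_j', the identity 1/(a+t) + 1/(b+t) -
      t/((a+t)(b+t)) = 1/(a+t) + a/((a+t)(b+t)) exhibits an antiderivative made of a logarithm and
      \<open>int_resolvents\<close>.\<close>
    define Ph where "Ph i j j' T = (ln (k i / q j + T) - ln (k i / q j) - ln (1 + T)) + (k i / q j) * int_resolvents (k i / q j) (k i / q j') T"
      for i j j' and T :: real
    define ph where "ph i j j' t = x t i j + x t i j' - t * (x t i j * x t i j') - 1 / (1 + t)" for i j j' and t :: real
    define hh where "hh i i' j T = (if q j = 0 then 0 else int_resolvents (k i / q j) (k i' / q j) T)" for i i' j and T :: real
    define f where "f T = (\<Sum>j'<n. \<Sum>j<n. \<Sum>i<n. kp j' j i * Ph i j j' T) - (\<Sum>i'<n. \<Sum>i<n. \<Sum>j<n. mm i' i j * hh i i' j T)" for T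
    define f' where "f' t = (\<Sum>j'<n. \<Sum>j<n. \<Sum>i<n. kp j' j i * ph i j j' t) - (\<Sum>i'<n. \<Sum>i<n. \<Sum>j<n. mm i' i j * (x t i j * x t i' j))" for t
    define Lim where "Lim = (\<Sum>j'<n. \<Sum>j<n. \<Sum>i<n. kp j' j i * (- ln (k i / q j) + (k i / q j) * inv_logmean (k i / q j) (k i / q j')))
        - (\<Sum>i'<n. \<Sum>i<n. \<Sum>j<n. mm i' i j * (q j * inv_logmean (k i) (k i')))"
    have "ereal Lim \<le> rel_entropy \<rho> G"
    proof (rule rel_entropy_lower[OF A G p _ _ _ _, where f = f and f' = f' and X = X])
      show "f 0 = 0" by (simp add: f_def Ph_def hh_def)
    next
      fix t :: real assume t: "0 \<le> t"
      have quad: "f' t = quad \<rho> G t (X t) - (\<Sum>i<n. p i) / (1 + t)"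
      proof -
        have "f' t = (\<Sum>j'<n. \<Sum>j<n. \<Sum>i<n. kp j' j i * x t i j) + (\<Sum>j'<n. \<Sum>j<n. \<Sum>i<n. kp j' j i * x t i j')
          - t * (\<Sum>j'<n. \<Sum>j<n. \<Sum>i<n. kp j' j i * (x t i j * x t i j')) - (\<Sum>j'<n. \<Sum>j<n. \<Sum>i<n. kp j' j i * 1) / (1 + t)
          - (\<Sum>i'<n. \<Sum>i<n. \<Sum>j<n. mm i' i j * (x t i j * x t i' j))"
          unfolding f'_def ph_def
          by (simp add: sum.distrib sum_subtractf right_diff_distrib distrib_left sum_distrib_left sum_divide_distrib mult_ac)
        also have "\<dots> = quad \<rho> G t (X t) - (\<Sum>i<n. p i) / (1 + t)"
          unfolding trX1[symmetric] trX1'[symmetric] trX2[symmetric] trX3[symmetric] psum[symmetric] quad_def by simp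
        finally show ?thesis .
      qed
      then show "f' t \<le> quad \<rho> G t (X t) - (\<Sum>i<n. p i) / (1 + t)" by simp
      show "X t \<in> carrier_mat n n" by (simp add: X_def)
      show "(f has_real_derivative f' t) (at t)"
        unfolding f_def[abs_def] f'_def
      proof (intro DERIV_diff DERIV_sum)
        fix i j j' assume ij: "j' \<in> {..<n}" "j \<in> {..<n}" "i \<in> {..<n}"
        show "((\<lambda>T. kp j' j i * Ph i j j' T) has_real_derivative kp j' j i * ph i j j' t) (at t)"
        proof (cases "q j = 0 \<or> q j' = 0")
          case True
          then show ?thesis using kp0[of j' j i] ij by simp
        next
          case False
          define a b where "a = k i / q j" and "b = k i / q j'"
          have ab: "a > 0" "b > 0" using False q[of j] q[of j'] k[of i] ij by (auto simp: a_def b_def less_le)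
          have "((\<lambda>T. (ln (a + T) - ln a - ln (1 + T)) + a * int_resolvents a b T) has_real_derivative
              (1 / (a + t) - 1 / (1 + t)) + a * (1 / ((a + t) * (b + t)))) (at t)"
            using ab t by (intro DERIV_add DERIV_cmult int_resolvents_deriv) (auto intro!: derivative_eq_intros)
          moreover have "(1 / (a + t) - 1 / (1 + t)) + a * (1 / ((a + t) * (b + t))) = ph i j j' t"
          proof -
            have "1 / (a + t) + a * (1 / ((a + t) * (b + t))) = 1 / (a + t) + 1 / (b + t) - t * (1 / (a + t) * (1 / (b + t)))"
            proof -
              have "(a + t) * (1 / ((a + t) * (b + t))) = 1 / (b + t)" using ab t by simp
              moreover have "1 / (a + t) * (1 / (b + t)) = 1 / ((a + t) * (b + t))" by simp
              ultimately show ?thesis by (simp only: distrib_right)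
            qed
            then show ?thesis using False by (simp add: ph_def x_def a_def b_def)
          qed
          ultimately have "(Ph i j j' has_real_derivative ph i j j' t) (at t)"
            by (simp add: Ph_def[abs_def] a_def b_def)
          then show ?thesis by (intro DERIV_cmult)
        qed
      next
        fix i i' j assume ij: "i' \<in> {..<n}" "i \<in> {..<n}" "j \<in> {..<n}"
        have "(hh i i' j has_real_derivative x t i j * x t i' j) (at t)"
        proof (cases "q j = 0")
          case False
          then have "(int_resolvents (k i / q j) (k i' / q j) has_real_derivative 1 / ((k i / q j + t) * (k i' / q j + t))) (at t)"
            using q[of j] k[of i] k[of i'] ij t by (intro int_resolvents_deriv) (auto simp: less_le)
          then show ?thesis using False by (simp add: hh_def[abs_def] x_def)
        qed (simp add: hh_def[abs_def] x_def)
        then show "((\<lambda>T. mm i' i j * hh i i' j T) has_real_derivative mm i' i j * (x t i j * x t i' j)) (at t)"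
          by (intro DERIV_cmult)
      qed
    next
      show "(f \<longlongrightarrow> Lim) at_top"
        unfolding f_def[abs_def] Lim_def
      proof (intro tendsto_diff tendsto_sum)
        fix i j j' assume ij: "j' \<in> {..<n}" "j \<in> {..<n}" "i \<in> {..<n}"
        show "((\<lambda>T. kp j' j i * Ph i j j' T) \<longlongrightarrow> kp j' j i * (- ln (k i / q j) + k i / q j * inv_logmean (k i / q j) (k i / q j'))) at_top"
        proof (cases "q j = 0 \<or> q j' = 0")
          case True
          then show ?thesis using kp0[of j' j i] ij by simp
        next
          case False
          define a b where "a = k i / q j" and "b = k i / q j'"
          have ab: "a > 0" "b > 0" using False q[of j] q[of j'] k[of i] ij by (auto simp: a_def b_def less_le)
          have "((\<lambda>T. ((ln (a + T) - ln (1 + T)) - ln a) + a * int_resolvents a b T) \<longlongrightarrow> (0 - ln a) + a * inv_logmean a b) at_top"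
            using ab by (intro tendsto_intros ln_diff_tendsto_0 int_resolvents_limit) auto
          moreover have "Ph i j j' = (\<lambda>T. ((ln (a + T) - ln (1 + T)) - ln a) + a * int_resolvents a b T)"
            by (rule ext) (simp add: Ph_def a_def b_def)
          ultimately have "(Ph i j j' \<longlongrightarrow> - ln a + a * inv_logmean a b) at_top" by simp
          then show ?thesis unfolding a_def b_def by (intro tendsto_mult tendsto_const)
        qed
      next
        fix i i' j assume ij: "i' \<in> {..<n}" "i \<in> {..<n}" "j \<in> {..<n}"
        have "(hh i i' j \<longlongrightarrow> q j * inv_logmean (k i) (k i')) at_top"
        proof (cases "q j = 0")
          case False
          then have qj: "q j > 0" using q[of j] ij by (auto simp: less_le)
          have "(int_resolvents (k i / q j) (k i' / q j) \<longlongrightarrow> inv_logmean (k i / q j) (k i' / q j)) at_top"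
            using qj k[of i] k[of i'] ij by (intro int_resolvents_limit) auto
          moreover have "inv_logmean (k i / q j) (k i' / q j) = q j * inv_logmean (k i) (k i')"
            using inv_logmean_scale[of "k i" "k i'" "1 / q j"] qj k[of i] k[of i'] ij by simp
          ultimately show ?thesis using False by (simp add: hh_def[abs_def])
        qed (simp add: hh_def[abs_def])
        then show "((\<lambda>T. mm i' i j * hh i i' j T) \<longlongrightarrow> mm i' i j * (q j * inv_logmean (k i) (k i'))) at_top"
          by (intro tendsto_mult tendsto_const)
      qed
    qed (use g in \<open>auto intro: less_imp_le\<close>)
    moreover have "Lim = Re (tr (\<rho> * (V * real_diag n (\<lambda>i. - ln (k i)) * adj V))) + Re (tr (\<rho> * log_op \<sigma>)) + Re (tr \<rho>)
        - Re (tr (G * dlog_map n V k \<sigma>))"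
    proof -
      \<comment> \<open>What remains after k_i has been scaled out. It is free of i, so only j = j'
        survives, where it equals ln q_j + 1; the 1 is the source of the term tr \<rho>.\<close>
      define th where "th j' j = (if q j = 0 \<or> q j' = 0 then 0 else ln (q j) + 1 / q j * inv_logmean (1 / q j) (1 / q j'))" for j' j
      have "(\<Sum>j'<n. \<Sum>j<n. \<Sum>i<n. kp j' j i * (- ln (k i / q j) + (k i / q j) * inv_logmean (k i / q j) (k i / q j')))
        = (\<Sum>j'<n. \<Sum>j<n. \<Sum>i<n. kp j' j i * (- ln (k i)) + kp j' j i * th j' j)"
      proof (intro sum.cong refl)
        fix i j j' assume ij: "j' \<in> {..<n}" "j \<in> {..<n}" "i \<in> {..<n}"
        show "kp j' j i * (- ln (k i / q j) + (k i / q j) * inv_logmean (k i / q j) (k i / q j')) = kp j' j i * (- ln (k i)) + kp j' j i * th j' j"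
        proof (cases "q j = 0 \<or> q j' = 0")
          case True
          then show ?thesis using kp0[of j' j i] ij by simp
        next
          case False
          then have pos: "q j > 0" "q j' > 0" "k i > 0" using q[of j] q[of j'] k[of i] ij by (auto simp: less_le)
          have "- ln (k i / q j) + (k i / q j) * inv_logmean (k i / q j) (k i / q j') = - ln (k i) + th j' j"
            using inv_logmean_scale[of "1 / q j" "1 / q j'" "k i"] pos by (simp add: th_def ln_div)
          then show ?thesis by (simp add: right_diff_distrib)
        qed
      qed
      also have "\<dots> = (\<Sum>j'<n. \<Sum>j<n. \<Sum>i<n. kp j' j i * (- ln (k i))) + (\<Sum>j<n. Re (R $$ (j, j)) * th j j)"
        by (simp only: sum.distrib kp_sum)
      also have "(\<Sum>j<n. Re (R $$ (j, j)) * th j j) = (\<Sum>j<n. Re (R $$ (j, j)) * (ln_supp (q j) + 1))"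
      proof (intro sum.cong refl)
        fix j assume j: "j \<in> {..<n}"
        show "Re (R $$ (j, j)) * th j j = Re (R $$ (j, j)) * (ln_supp (q j) + 1)"
          using R0[of j j] j q[of j] by (cases "q j = 0") (auto simp: th_def inv_logmean_def ln_supp_def)
      qed
      also have "\<dots> = Re (tr (\<rho> * log_op \<sigma>)) + Re (tr \<rho>)"
      proof -
        have "tr (\<rho> * log_op \<sigma>) = tr (log_op \<sigma> * \<rho>)"
          by (rule tr_rot) (use is_specD(6,7)[OF is_spec_log[OF B]] in auto)
        also have "\<dots> = (\<Sum>j<n. complex_of_real (ln_supp (q j)) * R $$ (j, j))"
          unfolding R_def by (rule tr_spec_any[OF is_spec_log[OF B]]) simp
        finally have "Re (tr (\<rho> * log_op \<sigma>)) = (\<Sum>j<n. Re (R $$ (j, j)) * ln_supp (q j))" by (simp add: mult.commute)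
        moreover have "Re (tr \<rho>) = (\<Sum>j<n. Re (R $$ (j, j)))"
          using psum tr_spec[OF A] unfolding kp_sum by simp
        ultimately show ?thesis by (simp add: distrib_left sum.distrib)
      qed
      also have "(\<Sum>j'<n. \<Sum>j<n. \<Sum>i<n. kp j' j i * (- ln (k i))) = Re (tr (\<rho> * (V * real_diag n (\<lambda>i. - ln (k i)) * adj V)))"
      proof -
        have sp: "is_spec n (V * real_diag n (\<lambda>i. - ln (k i)) * adj V) V (\<lambda>i. - ln (k i))"
          using V by (simp add: is_spec_def)
        have VrV: "adj V * \<rho> * V = c * (R * adj c)"
          by (simp add: c_def R_def adj_mult mat_assoc unitary_cancel[OF SS])
        have "tr (\<rho> * (V * real_diag n (\<lambda>i. - ln (k i)) * adj V)) = tr ((V * real_diag n (\<lambda>i. - ln (k i)) * adj V) * \<rho>)"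
          by (rule tr_rot) auto
        also have "\<dots> = (\<Sum>i<n. complex_of_real (- ln (k i)) * (c * (R * adj c)) $$ (i, i))"
          unfolding VrV[symmetric] by (rule tr_spec_any[OF sp]) simp
        also have "\<dots> = (\<Sum>i<n. \<Sum>j'<n. \<Sum>j<n. R $$ (j', j) * cnj (c $$ (i, j)) * c $$ (i, j') * complex_of_real (- ln (k i)))"
          by (simp add: mat_mult_index sum_distrib_left mult_ac)
        finally have "Re (tr (\<rho> * (V * real_diag n (\<lambda>i. - ln (k i)) * adj V))) = (\<Sum>i<n. \<Sum>j'<n. \<Sum>j<n. kp j' j i * (- ln (k i)))"
          by (simp only: Re_sum Re_mult_real kp_def)
        also have "\<dots> = (\<Sum>j'<n. \<Sum>i<n. \<Sum>j<n. kp j' j i * (- ln (k i)))" by (rule sum.swap)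
        also have "\<dots> = (\<Sum>j'<n. \<Sum>j<n. \<Sum>i<n. kp j' j i * (- ln (k i)))" by (intro sum.cong refl sum.swap)
        finally show ?thesis by simp
      qed
      finally have 1: "(\<Sum>j'<n. \<Sum>j<n. \<Sum>i<n. kp j' j i * (- ln (k i / q j) + (k i / q j) * inv_logmean (k i / q j) (k i / q j')))
         = Re (tr (\<rho> * (V * real_diag n (\<lambda>i. - ln (k i)) * adj V))) + (Re (tr (\<rho> * log_op \<sigma>)) + Re (tr \<rho>))" .
      have 2: "(\<Sum>i'<n. \<Sum>i<n. \<Sum>j<n. mm i' i j * (q j * inv_logmean (k i) (k i'))) = Re (tr (G * dlog_map n V k \<sigma>))"
      proof -
        let ?H = "mat n n (\<lambda>(i, j). (adj V * \<sigma> * V) $$ (i, j) * complex_of_real (inv_logmean (k i) (k j)))"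
        have VsV: "adj V * \<sigma> * V = c * real_diag n q * adj c"
          by (simp add: c_def is_specD(2)[OF B] adj_mult mat_assoc)
        have "tr (G * dlog_map n V k \<sigma>) = tr ((G * (V * ?H)) * adj V)"
          by (simp add: dlog_map_def mat_assoc)
        also have "\<dots> = tr (adj V * (G * (V * ?H)))"
          by (rule tr_rot) auto
        also have "\<dots> = tr (M * ?H)" by (simp add: M_def mat_assoc)
        also have "\<dots> = (\<Sum>i'<n. \<Sum>i<n. M $$ (i', i) * ((\<Sum>j<n. c $$ (i, j) * q j * cnj (c $$ (i', j))) * complex_of_real (inv_logmean (k i) (k i'))))"
          by (subst tr_mult) (auto simp: VsV diag_conj_index)
        also have "\<dots> = (\<Sum>i'<n. \<Sum>i<n. \<Sum>j<n. M $$ (i', i) * c $$ (i, j) * cnj (c $$ (i', j)) * complex_of_real (q j * inv_logmean (k i) (k i')))"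
          by (intro sum.cong refl) (simp add: sum_distrib_left sum_distrib_right mult_ac)
        finally show ?thesis by (simp only: Re_sum Re_mult_real mm_def)
      qed
      show ?thesis unfolding Lim_def 1 2 by simp
    qed
    \<comment> \<open>Both relative entropies split into the same entropy of \<rho> and one
      logarithmic cross term, so the bound for G is rewritten as one for \<sigma>.\<close>
    moreover have "rel_entropy \<rho> G = ereal (Re (tr (\<rho> * log_op \<rho>)) - Re (tr (\<rho> * log_op G)))"
    proof -
      have "supp \<rho> \<subseteq> supp G" unfolding supp_subset_spec[OF A G] using g by (auto simp: less_le)
      moreover have "\<rho> * (log_op \<rho> - log_op G) = \<rho> * log_op \<rho> - \<rho> * log_op G"
        by (rule mat_mult_minus) (use is_specD(6,7)[OF is_spec_log[OF A]] is_specD(6,7)[OF is_spec_log[OF G]] in auto)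
      moreover have "tr (\<rho> * log_op \<rho> - \<rho> * log_op G) = tr (\<rho> * log_op \<rho>) - tr (\<rho> * log_op G)"
        by (rule tr_minus[of _ n]) (use is_specD(6,7)[OF is_spec_log[OF A]] is_specD(6,7)[OF is_spec_log[OF G]] in auto)
      ultimately show ?thesis by (simp add: rel_entropy_def)
    qed
    moreover have "rel_entropy \<rho> \<sigma> = ereal (Re (tr (\<rho> * log_op \<rho>)) - Re (tr (\<rho> * log_op \<sigma>)))"
    proof -
      have "supp \<rho> \<subseteq> supp \<sigma>" unfolding supp_subset_spec[OF A B] using True by auto
      moreover have "\<rho> * (log_op \<rho> - log_op \<sigma>) = \<rho> * log_op \<rho> - \<rho> * log_op \<sigma>"
        by (rule mat_mult_minus) (use is_specD(6,7)[OF is_spec_log[OF A]] is_specD(6,7)[OF is_spec_log[OF B]] in auto)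
      moreover have "tr (\<rho> * log_op \<rho> - \<rho> * log_op \<sigma>) = tr (\<rho> * log_op \<rho>) - tr (\<rho> * log_op \<sigma>)"
        by (rule tr_minus[of _ n]) (use is_specD(6,7)[OF is_spec_log[OF A]] is_specD(6,7)[OF is_spec_log[OF B]] in auto)
      ultimately show ?thesis by (simp add: rel_entropy_def)
    qed
    ultimately show ?thesis by simp
  qed
qed

subsection \<open>Operator Jensen inequality for the logarithm\<close>

text \<open>Operator convexity of 1 / (x + t), tested against \<rho>. With B the inverse of F + t
  and s_z = f z + t, the sum over z of tr ((1 - s_z B) \<rho> (1 - s_z B) Q_z) / s_z is nonnegative,
  and expanding it leaves the claimed difference.\<close>

lemma resolvent_jensen:
  assumes r: "pos_semidef n \<rho>" and Q: "\<And>z. z < m \<Longrightarrow> pos_semidef n (Q z)" and one: "sum_op n Q {..<m} = 1\<^sub>m n"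
    and f: "\<And>z. z < m \<Longrightarrow> f z > 0" and F: "is_spec n (sum_op n (\<lambda>z. complex_of_real (f z) \<cdot>\<^sub>m Q z) {..<m}) W g"
    and g: "\<And>i. i < n \<Longrightarrow> g i > 0" and t: "0 \<le> t"
  shows "(\<Sum>i<n. Re ((adj W * \<rho> * W) $$ (i, i)) * (1 / (g i + t))) \<le> (\<Sum>z<m. Re (tr (\<rho> * Q z)) * (1 / (f z + t)))"
proof -
  note [simp] = carrier_matD[OF psd_carrier[OF r]] is_specD(3,4)[OF F]
  have [simp]: "dim_row (Q z) = n" "dim_col (Q z) = n" if "z < m" for z
    using psd_carrier[OF Q[OF that]] by auto
  note WW = is_specD(1)[OF F]
  define B where "B = W * real_diag n (\<lambda>i. 1 / (g i + t)) * adj W"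
  have [simp]: "dim_row B = n" "dim_col B = n" by (simp_all add: B_def)
  have adjB: "adj B = B" by (simp add: B_def adj_mult mat_assoc)
  have spB: "is_spec n B W (\<lambda>i. 1 / (g i + t))" using WW by (simp add: is_spec_def B_def)
  let ?F = "sum_op n (\<lambda>z. complex_of_real (f z) \<cdot>\<^sub>m Q z) {..<m}"
  have trB: "tr (\<rho> * B) = (\<Sum>i<n. complex_of_real (1 / (g i + t)) * (adj W * \<rho> * W) $$ (i, i))"
  proof -
    have "tr (\<rho> * B) = tr (B * \<rho>)" by (rule tr_rot) auto
    also have "\<dots> = (\<Sum>i<n. complex_of_real (1 / (g i + t)) * (adj W * \<rho> * W) $$ (i, i))"
      by (rule tr_spec_any[OF spB]) simp
    finally show ?thesis .
  qed
  \<comment> \<open>This is B (F + t) B = B, by which the quadratic term cancels one of the two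
    linear ones.\<close>
  have BFB: "B * ?F * B + complex_of_real t \<cdot>\<^sub>m (B * B) = B"
  proof -
    have "B * ?F * B = W * (real_diag n (\<lambda>i. 1 / (g i + t)) * (real_diag n g * real_diag n (\<lambda>i. 1 / (g i + t)))) * adj W"
      by (subst is_specD(2)[OF F]) (simp add: B_def mat_assoc unitary_cancel[OF WW])
    moreover have "complex_of_real t \<cdot>\<^sub>m (B * B) = W * (complex_of_real t \<cdot>\<^sub>m (real_diag n (\<lambda>i. 1 / (g i + t)) * real_diag n (\<lambda>i. 1 / (g i + t)))) * adj W"
    proof -
      have "B * B = W * (real_diag n (\<lambda>i. 1 / (g i + t)) * real_diag n (\<lambda>i. 1 / (g i + t))) * adj W"
        by (simp add: B_def mat_assoc unitary_cancel[OF WW])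
      then show ?thesis
        by (simp add: mult_smult_distrib[of _ n n _ n] mult_smult_assoc_mat[of _ n n _ n])
    qed
    moreover have "real_diag n (\<lambda>i. 1 / (g i + t)) * (real_diag n g * real_diag n (\<lambda>i. 1 / (g i + t)))
        + complex_of_real t \<cdot>\<^sub>m (real_diag n (\<lambda>i. 1 / (g i + t)) * real_diag n (\<lambda>i. 1 / (g i + t))) = real_diag n (\<lambda>i. 1 / (g i + t))"
    proof (rule eq_matI)
      fix i j assume "i < dim_row (real_diag n (\<lambda>i. 1 / (g i + t)))" "j < dim_col (real_diag n (\<lambda>i. 1 / (g i + t)))"
      then have ij: "i < n" "j < n" by auto
      have "1 / (g j + t) * (g j * (1 / (g j + t))) + t * (1 / (g j + t) * (1 / (g j + t))) = 1 / (g j + t)"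
      proof -
        have "1 / (g j + t) * (g j * (1 / (g j + t))) + t * (1 / (g j + t) * (1 / (g j + t))) = (g j + t) * (1 / (g j + t)) * (1 / (g j + t))"
        proof -
          have "c * (a * c) + b * (c * c) = (a + b) * c * c" for a b c :: real by (simp add: algebra_simps)
          then show ?thesis .
        qed
        also have "\<dots> = 1 / (g j + t)" using g[OF ij(2)] t by simp
        finally show ?thesis .
      qed
      then have "complex_of_real (1 / (g j + t) * (g j * (1 / (g j + t))) + t * (1 / (g j + t) * (1 / (g j + t)))) = complex_of_real (1 / (g j + t))"
        by (simp only:)
      then show "(real_diag n (\<lambda>i. 1 / (g i + t)) * (real_diag n g * real_diag n (\<lambda>i. 1 / (g i + t)))
        + complex_of_real t \<cdot>\<^sub>m (real_diag n (\<lambda>i. 1 / (g i + t)) * real_diag n (\<lambda>i. 1 / (g i + t)))) $$ (i, j) = real_diag n (\<lambda>i. 1 / (g i + t)) $$ (i, j)"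
        using ij by (simp add: real_diag_mult)
    qed auto
    ultimately show ?thesis
      by (simp add: add_mult_distrib_mat[symmetric, of _ n n _ _ n] mult_add_distrib_mat[symmetric, of _ n n _ n])
        (simp add: B_def)
  qed
  have summand: "Re (tr (\<rho> * Q z)) * (1 / (f z + t)) - Re (tr ((\<rho> * B) * Q z)) - Re (tr ((B * \<rho>) * Q z)) + (f z + t) * Re (tr (B * \<rho> * B * Q z)) \<ge> 0"
    if z: "z < m" for z
  proof -
    note [simp] = z
    define s where "s = f z + t"
    have s: "s > 0" using f[OF z] t by (simp add: s_def)
    \<comment> \<open>C measures how far B is from the scalar 1 / s on the outcome z; it is
      Hermitian, so C \<rho> C is positive and pairs nonnegatively with \<open>Q z\<close>.\<close>
    define C where "C = 1\<^sub>m n - complex_of_real s \<cdot>\<^sub>m B"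
    have [simp]: "dim_row C = n" "dim_col C = n" by (simp_all add: C_def)
    have adjC: "adj C = C" unfolding C_def
    proof (rule eq_matI)
      fix i j assume "i < dim_row (1\<^sub>m n - complex_of_real s \<cdot>\<^sub>m B)" "j < dim_col (1\<^sub>m n - complex_of_real s \<cdot>\<^sub>m B)"
      then have ij: "i < n" "j < n" by auto
      have "cnj (B $$ (j, i)) = adj B $$ (i, j)" using ij by (subst adj_index) auto
      then show "adj (1\<^sub>m n - complex_of_real s \<cdot>\<^sub>m B) $$ (i, j) = (1\<^sub>m n - complex_of_real s \<cdot>\<^sub>m B) $$ (i, j)"
        using ij by (simp add: adjB)
    qed auto
    have "0 \<le> tr ((C * \<rho> * adj C) * Q z)" by (rule psd_tr_mult[OF psd_conj'[OF r] Q[OF z]]) simp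
    also have "(C * \<rho> * adj C) = \<rho> - complex_of_real s \<cdot>\<^sub>m (B * \<rho>) - complex_of_real s \<cdot>\<^sub>m (\<rho> * B - complex_of_real s \<cdot>\<^sub>m (B * (\<rho> * B)))"
      unfolding adjC unfolding C_def
      by (simp add: mat_minus_mult mat_mult_minus mult_smult_distrib[of _ n n _ n] mult_smult_assoc_mat[of _ n n _ n] mat_assoc
          right_mult_one_mat'  left_mult_one_mat')
    also have "\<dots> = \<rho> - complex_of_real s \<cdot>\<^sub>m (\<rho> * B) - (complex_of_real s \<cdot>\<^sub>m (B * \<rho>) - complex_of_real (s\<^sup>2) \<cdot>\<^sub>m (B * \<rho> * B))"
      by (rule eq_matI) (auto simp: mat_assoc power2_eq_square algebra_simps)
    also have "(\<rho> - complex_of_real s \<cdot>\<^sub>m (\<rho> * B) - (complex_of_real s \<cdot>\<^sub>m (B * \<rho>) - complex_of_real (s\<^sup>2) \<cdot>\<^sub>m (B * \<rho> * B))) * Q z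
       = \<rho> * Q z - complex_of_real s \<cdot>\<^sub>m (\<rho> * B * Q z) - (complex_of_real s \<cdot>\<^sub>m (B * \<rho> * Q z) - complex_of_real (s\<^sup>2) \<cdot>\<^sub>m (B * \<rho> * B * Q z))"
      by (simp add: mat_minus_mult mult_smult_assoc_mat[of _ n n _ n])
    also have "tr \<dots> = tr (\<rho> * Q z) - complex_of_real s * tr (\<rho> * B * Q z) - (complex_of_real s * tr (B * \<rho> * Q z) - complex_of_real (s\<^sup>2) * tr (B * \<rho> * B * Q z))"
      by (simp add: tr_minus[of _ n] tr_smult[of _ n])
    finally have "0 \<le> Re (tr (\<rho> * Q z)) - s * Re (tr (\<rho> * B * Q z)) - (s * Re (tr (B * \<rho> * Q z)) - s\<^sup>2 * Re (tr (B * \<rho> * B * Q z)))"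
      by (simp add: less_eq_complex_def del: of_real_power)
    then have "0 \<le> (Re (tr (\<rho> * Q z)) - s * Re (tr (\<rho> * B * Q z)) - (s * Re (tr (B * \<rho> * Q z)) - s\<^sup>2 * Re (tr (B * \<rho> * B * Q z)))) / s"
      using s by simp
    also have "\<dots> = Re (tr (\<rho> * Q z)) * (1 / s) - Re (tr (\<rho> * B * Q z)) - Re (tr (B * \<rho> * Q z)) + s * Re (tr (B * \<rho> * B * Q z))"
      using s by (simp add: diff_divide_distrib power2_eq_square)
    finally show ?thesis by (simp add: s_def)
  qed
  have S: "(\<Sum>z<m. Re (tr (X * Q z))) = Re (tr X)" if "dim_row X = n" "dim_col X = n" for X
  proof -
    have "(\<Sum>z<m. tr (X * Q z)) = tr (X * sum_op n Q {..<m})"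
      using that by (intro tr_mult_sum_op[symmetric]) auto
    then have "(\<Sum>z<m. tr (X * Q z)) = tr X" using that by (simp add: one)
    then show ?thesis by (metis Re_sum)
  qed
  have SF: "(\<Sum>z<m. f z * Re (tr (X * Q z))) = Re (tr (X * ?F))" if "dim_row X = n" "dim_col X = n" for X
  proof -
    have "tr (X * ?F) = (\<Sum>z<m. tr (X * (complex_of_real (f z) \<cdot>\<^sub>m Q z)))"
      using that by (intro tr_mult_sum_op) auto
    also have "\<dots> = (\<Sum>z<m. complex_of_real (f z) * tr (X * Q z))"
      using that by (intro sum.cong refl) (simp add: mult_smult_distrib[of _ n n _ n] tr_smult[of _ n])
    finally show ?thesis by simp
  qed
  have "0 \<le> (\<Sum>z<m. Re (tr (\<rho> * Q z)) * (1 / (f z + t)) - Re (tr ((\<rho> * B) * Q z)) - Re (tr ((B * \<rho>) * Q z)) + (f z + t) * Re (tr (B * \<rho> * B * Q z)))"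
    by (intro sum_nonneg summand) auto
  also have "\<dots> = (\<Sum>z<m. Re (tr (\<rho> * Q z)) * (1 / (f z + t))) - Re (tr (\<rho> * B)) - Re (tr (B * \<rho>)) + (Re (tr (B * \<rho> * B * ?F)) + t * Re (tr (B * \<rho> * B)))"
    by (simp add: sum.distrib sum_subtractf distrib_right S SF flip: sum_distrib_left)
  also have "Re (tr (B * \<rho> * B * ?F)) + t * Re (tr (B * \<rho> * B)) = Re (tr (\<rho> * B))"
  proof -
    have "tr (\<rho> * B) = tr (\<rho> * (B * ?F * B + complex_of_real t \<cdot>\<^sub>m (B * B)))" by (simp only: BFB)
    also have "\<dots> = tr (\<rho> * (B * ?F * B)) + complex_of_real t * tr (\<rho> * (B * B))"
      by (simp add: mult_add_distrib_mat[of _ n n _ n] tr_add[of _ n] mult_smult_distrib[of _ n n _ n] tr_smult[of _ n])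
    also have "tr (\<rho> * (B * ?F * B)) = tr (B * \<rho> * B * ?F)"
      using tr_rot[of "\<rho> * (B * ?F)" B] by (simp add: mat_assoc)
    also have "tr (\<rho> * (B * B)) = tr (B * \<rho> * B)"
      using tr_rot[of "\<rho> * B" B] by (simp add: mat_assoc)
    finally show ?thesis by simp
  qed
  also have "tr (B * \<rho>) = tr (\<rho> * B)" by (rule tr_rot) auto
  finally have "Re (tr (\<rho> * B)) \<le> (\<Sum>z<m. Re (tr (\<rho> * Q z)) * (1 / (f z + t)))" by simp
  then show ?thesis unfolding trB by (simp add: mult.commute)
qed

text \<open>Integration of the resolvent inequality over t. \<rho> need not have trace 1; the
  subtracted 1 / (1 + t) terms cancel because both sides carry the same total weight.\<close>

theorem log_jensen:
  assumes r: "pos_semidef n \<rho>" and Q: "\<And>z. z < m \<Longrightarrow> pos_semidef n (Q z)" and one: "sum_op n Q {..<m} = 1\<^sub>m n"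
    and f: "\<And>z. z < m \<Longrightarrow> f z > 0" and F: "is_spec n (sum_op n (\<lambda>z. complex_of_real (f z) \<cdot>\<^sub>m Q z) {..<m}) W g"
    and g: "\<And>i. i < n \<Longrightarrow> g i > 0"
  shows "(\<Sum>z<m. Re (tr (\<rho> * Q z)) * ln (f z)) \<le> Re (tr (\<rho> * (W * real_diag n (\<lambda>i. ln (g i)) * adj W)))"
proof -
  note [simp] = carrier_matD[OF psd_carrier[OF r]] is_specD(3,4)[OF F]
  have [simp]: "dim_row (Q z) = n" "dim_col (Q z) = n" if "z < m" for z
    using psd_carrier[OF Q[OF that]] by auto
  note WW = is_specD(1)[OF F]
  define R where "R i = Re ((adj W * \<rho> * W) $$ (i, i))" for i
  have sumR: "(\<Sum>i<n. R i) = (\<Sum>z<m. Re (tr (\<rho> * Q z)))"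
  proof -
    have "(\<Sum>i<n. (adj W * \<rho> * W) $$ (i, i)) = tr (adj W * (\<rho> * W))" by (simp add: tr_def mat_assoc)
    also have "\<dots> = tr (\<rho> * W * adj W)" by (rule tr_rot) auto
    also have "\<dots> = tr (\<rho> * sum_op n Q {..<m})" by (simp add: mat_assoc unitary_right[OF WW] one)
    also have "\<dots> = (\<Sum>z<m. tr (\<rho> * Q z))" by (rule tr_mult_sum_op) auto
    finally have "Re (\<Sum>i<n. (adj W * \<rho> * W) $$ (i, i)) = Re (\<Sum>z<m. tr (\<rho> * Q z))" by (rule arg_cong)
    then show ?thesis by (simp only: R_def Re_sum)
  qed
  have d: "((\<lambda>T. ln (a + T) - ln a - ln (1 + T)) has_real_derivative 1 / (a + T) - 1 / (1 + T)) (at T)"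
    if "a > 0" "0 \<le> T" for a T :: real
    using that by (auto intro!: derivative_eq_intros)
  have l: "((\<lambda>T. ln (a + T) - ln a - ln (1 + T)) \<longlongrightarrow> - ln a) at_top" if "a > 0" for a :: real
  proof -
    have "((\<lambda>T. (ln (a + T) - ln (1 + T)) - ln a) \<longlongrightarrow> 0 - ln a) at_top"
      using that by (intro tendsto_intros ln_diff_tendsto_0) auto
    moreover have "(\<lambda>T. ln (a + T) - ln a - ln (1 + T)) = (\<lambda>T. (ln (a + T) - ln (1 + T)) - ln a)" by auto
    ultimately show ?thesis by simp
  qed
  have "(\<Sum>i<n. R i * (- ln (g i))) \<le> (\<Sum>z<m. Re (tr (\<rho> * Q z)) * (- ln (f z)))"
  proof (rule limit_le_of_deriv_le[where f = "\<lambda>T. \<Sum>i<n. R i * (ln (g i + T) - ln (g i) - ln (1 + T))" 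
      and g = "\<lambda>T. \<Sum>z<m. Re (tr (\<rho> * Q z)) * (ln (f z + T) - ln (f z) - ln (1 + T))"
      and f' = "\<lambda>T. \<Sum>i<n. R i * (1 / (g i + T) - 1 / (1 + T))"
      and g' = "\<lambda>T. \<Sum>z<m. Re (tr (\<rho> * Q z)) * (1 / (f z + T) - 1 / (1 + T))"])
    fix t :: real assume t: "0 \<le> t"
    show "((\<lambda>T. \<Sum>i<n. R i * (ln (g i + T) - ln (g i) - ln (1 + T))) has_real_derivative (\<Sum>i<n. R i * (1 / (g i + t) - 1 / (1 + t)))) (at t)"
      using g t by (intro DERIV_sum DERIV_cmult d) auto
    show "((\<lambda>T. \<Sum>z<m. Re (tr (\<rho> * Q z)) * (ln (f z + T) - ln (f z) - ln (1 + T))) has_real_derivative (\<Sum>z<m. Re (tr (\<rho> * Q z)) * (1 / (f z + t) - 1 / (1 + t)))) (at t)"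
      using f t by (intro DERIV_sum DERIV_cmult d) auto
    have "(\<Sum>i<n. R i * (1 / (g i + t))) \<le> (\<Sum>z<m. Re (tr (\<rho> * Q z)) * (1 / (f z + t)))"
      unfolding R_def by (rule resolvent_jensen[OF r Q one f F g t])
    moreover have "(\<Sum>i<n. R i * (1 / (1 + t))) = (\<Sum>z<m. Re (tr (\<rho> * Q z)) * (1 / (1 + t)))"
      unfolding sum_distrib_right[symmetric] sumR ..
    ultimately show "(\<Sum>i<n. R i * (1 / (g i + t) - 1 / (1 + t))) \<le> (\<Sum>z<m. Re (tr (\<rho> * Q z)) * (1 / (f z + t) - 1 / (1 + t)))"
      by (simp only: right_diff_distrib sum_subtractf)
  next
    show "((\<lambda>T. \<Sum>i<n. R i * (ln (g i + T) - ln (g i) - ln (1 + T))) \<longlongrightarrow> (\<Sum>i<n. R i * (- ln (g i)))) at_top"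
      using g by (intro tendsto_sum tendsto_mult tendsto_const l) auto
    show "((\<lambda>T. \<Sum>z<m. Re (tr (\<rho> * Q z)) * (ln (f z + T) - ln (f z) - ln (1 + T))) \<longlongrightarrow> (\<Sum>z<m. Re (tr (\<rho> * Q z)) * (- ln (f z)))) at_top"
      using f by (intro tendsto_sum tendsto_mult tendsto_const l) auto
  qed simp
  moreover have "Re (tr (\<rho> * (W * real_diag n (\<lambda>i. ln (g i)) * adj W))) = (\<Sum>i<n. R i * ln (g i))"
  proof -
    have sp: "is_spec n (W * real_diag n (\<lambda>i. ln (g i)) * adj W) W (\<lambda>i. ln (g i))" using WW by (simp add: is_spec_def)
    have "tr (\<rho> * (W * real_diag n (\<lambda>i. ln (g i)) * adj W)) = tr ((W * real_diag n (\<lambda>i. ln (g i)) * adj W) * \<rho>)"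
      by (rule tr_rot) auto
    also have "\<dots> = (\<Sum>i<n. complex_of_real (ln (g i)) * (adj W * \<rho> * W) $$ (i, i))"
      by (rule tr_spec_any[OF sp]) simp
    finally show ?thesis by (simp add: R_def mult.commute)
  qed
  ultimately show ?thesis by (simp add: sum_negf)
qed

subsection \<open>Classical relative entropy\<close>

text \<open>The easy half of the Gibbs variational principle: ln x \<le> x - 1 at x = Q f / P,
  weighted by P.\<close>

lemma classical_rel_entropy_ge:
  assumes fin: "finite Z" and P: "\<And>z. z \<in> Z \<Longrightarrow> 0 \<le> P z" and Q: "\<And>z. z \<in> Z \<Longrightarrow> 0 \<le> Q z"
    and one: "(\<Sum>z\<in>Z. P z) = 1" and f: "\<And>z. z \<in> Z \<Longrightarrow> f z > 0" and Qf: "(\<Sum>z\<in>Z. Q z * f z) \<le> 1"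
  shows "ereal (\<Sum>z\<in>Z. P z * ln (f z)) \<le> classical_rel_entropy Z P Q"
proof (cases "{z \<in> Z. P z \<noteq> 0} \<subseteq> {z \<in> Z. Q z \<noteq> 0}")
  case True
  have "(\<Sum>z\<in>Z. P z * ln (f z)) \<le> (\<Sum>z\<in>Z. P z * ln (P z / Q z) + (Q z * f z - P z))"
  proof (rule sum_mono)
    fix z assume z: "z \<in> Z"
    show "P z * ln (f z) \<le> P z * ln (P z / Q z) + (Q z * f z - P z)"
    proof (cases "P z = 0")
      case False
      then have pos: "P z > 0" "Q z > 0" "f z > 0" using True P[OF z] Q[OF z] f[OF z] z by (auto simp: less_le)
      have "P z * (ln (f z) - ln (P z / Q z)) = P z * ln (Q z * f z / P z)"
        using pos by (simp add: ln_div ln_mult)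
      also have "\<dots> \<le> P z * (Q z * f z / P z - 1)"
        using pos by (intro mult_left_mono ln_le_minus_one) auto
      also have "\<dots> = Q z * f z - P z" using pos by (simp add: field_simps)
      finally show ?thesis by (simp add: right_diff_distrib)
    qed (use Q[OF z] f[OF z] in simp)
  qed
  also have "\<dots> \<le> (\<Sum>z\<in>Z. P z * ln (P z / Q z))"
    using Qf one by (simp add: sum.distrib sum_subtractf)
  finally show ?thesis using True by (simp add: classical_rel_entropy_def)
qed (simp add: classical_rel_entropy_def)

text \<open>The converse half. The ideal weight P / Q may be 0 or undefined, so it is perturbed to a
  strictly positive one. When the relative entropy is infinite, a point with Q = 0 and P > 0 can be
  given an arbitrarily large weight at no cost in the constraint.\<close>

lemma classical_rel_entropy_witness:
  assumes fin: "finite Z" and P: "\<And>z. z \<in> Z \<Longrightarrow> 0 \<le> P z" and Q: "\<And>z. z \<in> Z \<Longrightarrow> 0 \<le> Q z"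
    and one: "(\<Sum>z\<in>Z. P z) = 1" and r: "ereal r < classical_rel_entropy Z P Q"
  obtains f where "\<And>z. f z > 0" "(\<Sum>z\<in>Z. Q z * f z) \<le> 1" "r \<le> (\<Sum>z\<in>Z. P z * ln (f z))"
proof (cases "{z \<in> Z. P z \<noteq> 0} \<subseteq> {z \<in> Z. Q z \<noteq> 0}")
  case True
  define N where "N = real (card Z)"
  \<comment> \<open>Adding d to numerator and denominator keeps the weight positive and finite; the
    factor 1 + d N is the total mass of P + d and restores the constraint. As d tends to 0 the value
    tends to the relative entropy.\<close>
  define f where "f d z = (if z \<in> Z then (P z + d) / ((Q z + d) * (1 + d * N)) else 1)" for d z
  have r': "r < (\<Sum>z\<in>Z. P z * ln (P z / Q z))" using r True by (simp add: classical_rel_entropy_def)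
  have "((\<lambda>d. \<Sum>z\<in>Z. P z * ln (f d z)) \<longlongrightarrow> (\<Sum>z\<in>Z. P z * ln (P z / Q z))) (at_right 0)"
  proof (rule tendsto_sum)
    fix z assume z: "z \<in> Z"
    show "((\<lambda>d. P z * ln (f d z)) \<longlongrightarrow> P z * ln (P z / Q z)) (at_right 0)"
    proof (cases "P z = 0")
      case False
      then have pos: "P z > 0" "Q z > 0" using True P[OF z] Q[OF z] z by (auto simp: less_le)
      have "((\<lambda>d. P z * ln ((P z + d) / ((Q z + d) * (1 + d * N)))) \<longlongrightarrow> P z * ln ((P z + 0) / ((Q z + 0) * (1 + 0 * N)))) (at_right 0)"
        using pos by (intro tendsto_intros) auto
      then show ?thesis using z by (simp add: f_def)
    qed simp
  qed
  then have "\<forall>\<^sub>F d in at_right 0. r < (\<Sum>z\<in>Z. P z * ln (f d z))"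
    using r' by (rule order_tendstoD)
  moreover have "\<forall>\<^sub>F d :: real in at_right 0. d > 0" by (simp add: eventually_at_right_less)
  ultimately have "\<forall>\<^sub>F d in at_right 0. r < (\<Sum>z\<in>Z. P z * ln (f d z)) \<and> d > 0" by eventually_elim simp
  then obtain d where d: "r < (\<Sum>z\<in>Z. P z * ln (f d z))" "d > 0"
    using eventually_happens[of _ "at_right (0::real)"] by auto
  have N: "N \<ge> 0" by (simp add: N_def)
  then have dN: "1 + d * N > 0" using d(2) by (simp add: add_pos_nonneg)
  have "(\<Sum>z\<in>Z. Q z * f d z) \<le> (\<Sum>z\<in>Z. (P z + d) / (1 + d * N))"
  proof (rule sum_mono)
    fix z assume z: "z \<in> Z"
    have "Q z / (Q z + d) * ((P z + d) / (1 + d * N)) \<le> 1 * ((P z + d) / (1 + d * N))"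
      using Q[OF z] P[OF z] d dN by (intro mult_right_mono divide_nonneg_nonneg) (auto simp: divide_simps)
    then show "Q z * f d z \<le> (P z + d) / (1 + d * N)" using z by (simp add: f_def)
  qed
  also have "\<dots> = (\<Sum>z\<in>Z. P z + d) / (1 + d * N)" by (rule sum_divide_distrib[symmetric])
  also have "(\<Sum>z\<in>Z. P z + d) = 1 + d * N" using one by (simp add: sum.distrib N_def)
  also have "\<dots> / (1 + d * N) = 1" using dN by simp
  finally have "(\<Sum>z\<in>Z. Q z * f d z) \<le> 1" .
  moreover have "f d z > 0" for z
    using P[of z] Q[of z] d dN by (auto simp: f_def intro!: divide_pos_pos mult_pos_pos add_nonneg_pos)
  ultimately show ?thesis using that[of "f d"] d(1) by simp
next
  case False
  then obtain w where w: "w \<in> Z" "P w \<noteq> 0" "Q w = 0" by auto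
  then have Pw: "P w > 0" using P[of w] by (auto simp: less_le)
  define S where "S = (\<Sum>z\<in>Z. Q z)"
  have S: "S \<ge> 0" unfolding S_def using Q by (intro sum_nonneg) auto
  \<comment> \<open>Chosen so that P w ln c exceeds the loss (1 - P w) ln (1 + S), caused by the
    weight 1 / (1 + S) at the other points, by at least \<bar>r\<bar>. That small weight keeps the
    constraint at S / (1 + S).\<close>
  define c where "c = exp ((\<bar>r\<bar> + ln (1 + S)) / P w)"
  define f where "f z = (if z = w then c else 1 / (1 + S))" for z
  have "(\<Sum>z\<in>Z. Q z * f z) = (\<Sum>z\<in>Z. Q z * (1 / (1 + S)))"
    using w by (intro sum.cong) (auto simp: f_def)
  also have "\<dots> = S / (1 + S)" by (simp add: S_def sum_divide_distrib)
  also have "\<dots> \<le> 1" using S by simp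
  finally have 1: "(\<Sum>z\<in>Z. Q z * f z) \<le> 1" .
  have "(\<Sum>z\<in>Z. P z * ln (f z)) = P w * ln c + (\<Sum>z\<in>Z - {w}. P z * ln (f z))"
    using w fin by (subst sum.remove[of _ w]) (auto simp: f_def)
  also have "(\<Sum>z\<in>Z - {w}. P z * ln (f z)) = (\<Sum>z\<in>Z - {w}. P z) * (- ln (1 + S))"
    unfolding sum_distrib_right using S by (intro sum.cong) (auto simp: f_def ln_div)
  also have "(\<Sum>z\<in>Z - {w}. P z) = 1 - P w" using one w fin by (subst (asm) sum.remove[of _ w]) auto
  also have "P w * ln c = \<bar>r\<bar> + ln (1 + S)" using Pw by (simp add: c_def)
  finally have "(\<Sum>z\<in>Z. P z * ln (f z)) = \<bar>r\<bar> + P w * ln (1 + S)" by (simp add: algebra_simps)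
  moreover have "0 \<le> P w * ln (1 + S)" using Pw S by simp
  ultimately have "r \<le> (\<Sum>z\<in>Z. P z * ln (f z))" by linarith
  moreover have "f z > 0" for z using S by (simp add: f_def c_def)
  ultimately show ?thesis using that[of f] 1 by simp
qed

subsection \<open>Tensor products and contractions\<close>

lemma index_less:
  fixes a b m n :: nat
  assumes "a < m" "b < n" shows "a * n + b < m * n"
proof -
  have "a * n + b < Suc a * n" using assms by simp
  also have "\<dots> \<le> m * n" using assms by (intro mult_le_mono1) auto
  finally show ?thesis .
qed

lemma index_div_mod [simp]:
  fixes a b n :: nat
  assumes "b < n" shows "(a * n + b) div n = a" "(a * n + b) mod n = b"
  using assms by simp_all

lemma div_less_of_mult:
  fixes i m n :: nat
  assumes "i < m * n" shows "i div n < m" "i mod n < n"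
  using assms by (auto simp: less_mult_imp_div_less) (cases n, auto)

lemma sum_prod_index:
  fixes f :: "nat \<Rightarrow> 'a :: comm_monoid_add"
  shows "(\<Sum>i<m * n. f i) = (\<Sum>a<m. \<Sum>b<n. f (a * n + b))"
proof -
  have "(\<Sum>a<m. \<Sum>b<n. f (a * n + b)) = (\<Sum>(a, b)\<in>{..<m} \<times> {..<n}. f (a * n + b))"
    by (rule sum.cartesian_product)
  also have "\<dots> = (\<Sum>i<m * n. f i)"
    by (rule sum.reindex_bij_witness[of _ "\<lambda>i. (i div n, i mod n)" "\<lambda>(a, b). a * n + b"])
      (auto simp: index_less div_less_of_mult)
  finally show ?thesis ..
qed

section \<open>Kronecker products: algebra, traces, positivity and spectra\<close>

lemma tensor_dim [simp]: "dim_row (A \<otimes>\<^sub>m B) = dim_row A * dim_row B" "dim_col (A \<otimes>\<^sub>m B) = dim_col A * dim_col B"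
  by (simp_all add: tensor_op_def)

lemma tensor_index:
  assumes "i < dim_row A * dim_row B" "j < dim_col A * dim_col B"
  shows "(A \<otimes>\<^sub>m B) $$ (i, j) = A $$ (i div dim_row B, j div dim_col B) * B $$ (i mod dim_row B, j mod dim_col B)"
  using assms by (simp add: tensor_op_def)

lemma tensor_mult:
  assumes "dim_col A = dim_row C" "dim_col B = dim_row D"
  shows "(A \<otimes>\<^sub>m B) * (C \<otimes>\<^sub>m D) = (A * C) \<otimes>\<^sub>m (B * D)"
proof (rule eq_matI)
  fix i j assume "i < dim_row ((A * C) \<otimes>\<^sub>m (B * D))" "j < dim_col ((A * C) \<otimes>\<^sub>m (B * D))"
  then have ij: "i < dim_row A * dim_row B" "j < dim_col C * dim_col D" by auto
  note b = div_less_of_mult[OF ij(1)] div_less_of_mult[OF ij(2)]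
  have "((A \<otimes>\<^sub>m B) * (C \<otimes>\<^sub>m D)) $$ (i, j) = (\<Sum>k<dim_row C * dim_row D. (A \<otimes>\<^sub>m B) $$ (i, k) * (C \<otimes>\<^sub>m D) $$ (k, j))"
    using ij assms by (subst mat_mult_index) auto
  also have "\<dots> = (\<Sum>a<dim_row C. \<Sum>b<dim_row D. (A $$ (i div dim_row B, a) * B $$ (i mod dim_row B, b)) * (C $$ (a, j div dim_col D) * D $$ (b, j mod dim_col D)))"
    unfolding sum_prod_index using ij assms by (intro sum.cong refl) (auto simp: tensor_index index_less)
  also have "\<dots> = (A * C) $$ (i div dim_row B, j div dim_col D) * (B * D) $$ (i mod dim_row B, j mod dim_col D)"
    using b assms by (simp add: mat_mult_index sum_product mult_ac)
  also have "\<dots> = ((A * C) \<otimes>\<^sub>m (B * D)) $$ (i, j)"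
    using ij by (subst tensor_index) auto
  finally show "((A \<otimes>\<^sub>m B) * (C \<otimes>\<^sub>m D)) $$ (i, j) = ((A * C) \<otimes>\<^sub>m (B * D)) $$ (i, j)" .
qed auto

lemma adj_tensor: "adj (A \<otimes>\<^sub>m B) = adj A \<otimes>\<^sub>m adj B"
  by (rule eq_matI) (auto simp: tensor_index div_less_of_mult)

lemma div_mod_eq_iff: "i div n = j div n \<and> i mod n = j mod n \<longleftrightarrow> i = (j :: nat)"
  by (metis div_mult_mod_eq)

lemma tensor_one: "1\<^sub>m m \<otimes>\<^sub>m 1\<^sub>m n = 1\<^sub>m (m * n)"
  by (rule eq_matI) (use div_mod_eq_iff in \<open>auto simp: tensor_index div_less_of_mult\<close>)

lemma tensor_real_diag: "real_diag m d \<otimes>\<^sub>m real_diag n e = real_diag (m * n) (\<lambda>i. d (i div n) * e (i mod n))"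
  by (rule eq_matI) (use div_mod_eq_iff in \<open>auto simp: tensor_index div_less_of_mult\<close>)

lemma tensor_assoc: "(A \<otimes>\<^sub>m B) \<otimes>\<^sub>m C = A \<otimes>\<^sub>m (B \<otimes>\<^sub>m C)"
proof (rule eq_matI)
  fix i j assume "i < dim_row (A \<otimes>\<^sub>m (B \<otimes>\<^sub>m C))" "j < dim_col (A \<otimes>\<^sub>m (B \<otimes>\<^sub>m C))"
  then have ij: "i < dim_row A * dim_row B * dim_row C" "j < dim_col A * dim_col B * dim_col C" by (auto simp: mult.assoc)
  have *: "i mod (m * n) div n = i div n mod m" "i mod (m * n) mod n = i mod n" for i m n :: nat
  proof -
    have "i mod (m * n) = (i div n mod m) * n + i mod n"
      using mod_mult2_eq[of i n m] by (simp add: mult.commute)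
    then show "i mod (m * n) div n = i div n mod m" "i mod (m * n) mod n = i mod n"
      by (cases "n = 0"; simp)+
  qed
  have d: "i div (m * n) = i div n div m" for i m n :: nat
    by (metis div_mult2_eq mult.commute)
  let ?c = "dim_row C" and ?c' = "dim_col C"
  note bd = div_less_of_mult[OF ij(1)] div_less_of_mult[OF ij(2)]
  have "((A \<otimes>\<^sub>m B) \<otimes>\<^sub>m C) $$ (i, j) = (A \<otimes>\<^sub>m B) $$ (i div ?c, j div ?c') * C $$ (i mod ?c, j mod ?c')"
    using ij by (subst tensor_index) auto
  also have "(A \<otimes>\<^sub>m B) $$ (i div ?c, j div ?c') = A $$ (i div ?c div dim_row B, j div ?c' div dim_col B) * B $$ (i div ?c mod dim_row B, j div ?c' mod dim_col B)"
    using bd by (subst tensor_index) auto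
  finally have L: "((A \<otimes>\<^sub>m B) \<otimes>\<^sub>m C) $$ (i, j) = A $$ (i div ?c div dim_row B, j div ?c' div dim_col B) * B $$ (i div ?c mod dim_row B, j div ?c' mod dim_col B) * C $$ (i mod ?c, j mod ?c')" .
  have ij': "i < dim_row A * (dim_row B * dim_row C)" "j < dim_col A * (dim_col B * dim_col C)" using ij by (auto simp: mult.assoc)
  have "(A \<otimes>\<^sub>m (B \<otimes>\<^sub>m C)) $$ (i, j) = A $$ (i div (dim_row B * ?c), j div (dim_col B * ?c')) * (B \<otimes>\<^sub>m C) $$ (i mod (dim_row B * ?c), j mod (dim_col B * ?c'))"
    using ij' by (subst tensor_index) auto
  also have "(B \<otimes>\<^sub>m C) $$ (i mod (dim_row B * ?c), j mod (dim_col B * ?c')) = B $$ (i div ?c mod dim_row B, j div ?c' mod dim_col B) * C $$ (i mod ?c, j mod ?c')"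
    using div_less_of_mult[OF ij'(1)] div_less_of_mult[OF ij'(2)] by (subst tensor_index) (auto simp: *)
  finally show "((A \<otimes>\<^sub>m B) \<otimes>\<^sub>m C) $$ (i, j) = (A \<otimes>\<^sub>m (B \<otimes>\<^sub>m C)) $$ (i, j)"
    unfolding L by (simp add: d)
qed (auto simp: mult.assoc)

lemma tr_tensor:
  assumes "dim_row A = dim_col A" "dim_row B = dim_col B"
  shows "tr (A \<otimes>\<^sub>m B) = tr A * tr B"
proof -
  have "tr (A \<otimes>\<^sub>m B) = (\<Sum>a<dim_row A. \<Sum>b<dim_row B. A $$ (a, a) * B $$ (b, b))"
    unfolding tr_def tensor_dim sum_prod_index using assms
    by (intro sum.cong refl) (auto simp: tensor_index index_less)
  then show ?thesis by (simp add: tr_def sum_product)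
qed

lemma psd_tensor:
  assumes "pos_semidef m A" "pos_semidef n B"
  shows "pos_semidef (m * n) (A \<otimes>\<^sub>m B)"
proof -
  obtain R where R: "R \<in> carrier_mat m m" "A = R * adj R" using psd_factor[OF assms(1)] by blast
  obtain S where S: "S \<in> carrier_mat n n" "B = S * adj S" using psd_factor[OF assms(2)] by blast
  have "A \<otimes>\<^sub>m B = (R \<otimes>\<^sub>m S) * adj (R \<otimes>\<^sub>m S)"
    using R(1) S(1) by (simp add: R(2) S(2) tensor_mult adj_tensor)
  then show ?thesis using psd_gram[of "R \<otimes>\<^sub>m S" "m * n" "m * n"] R(1) S(1) by simp
qed

lemma unitary_tensor:
  assumes "unitary_mat m U" "unitary_mat n V"
  shows "unitary_mat (m * n) (U \<otimes>\<^sub>m V)"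
  using unitary_dims[OF assms(1)] unitary_dims[OF assms(2)] unitary_left[OF assms(1)] unitary_left[OF assms(2)]
  by (simp add: unitary_mat_def adj_tensor tensor_mult tensor_one)

lemma is_spec_tensor:
  assumes "is_spec m A U d" "is_spec n B V e"
  shows "is_spec (m * n) (A \<otimes>\<^sub>m B) (U \<otimes>\<^sub>m V) (\<lambda>i. d (i div n) * e (i mod n))"
  using is_specD(3,4)[OF assms(1)] is_specD(3,4)[OF assms(2)] is_specD(1)[OF assms(1)] is_specD(1)[OF assms(2)]
  by (simp add: is_spec_def unitary_tensor adj_tensor tensor_real_diag[symmetric] is_specD(2)[OF assms(1)] is_specD(2)[OF assms(2)] tensor_mult)

lemma sum_op_tensor_left:
  assumes "\<And>x. x \<in> X \<Longrightarrow> F x \<in> carrier_mat m m" "B \<in> carrier_mat n n"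
  shows "sum_op m F X \<otimes>\<^sub>m B = sum_op (m * n) (\<lambda>x. F x \<otimes>\<^sub>m B) X"
proof (rule eq_matI)
  fix i j assume "i < dim_row (sum_op (m * n) (\<lambda>x. F x \<otimes>\<^sub>m B) X)" "j < dim_col (sum_op (m * n) (\<lambda>x. F x \<otimes>\<^sub>m B) X)"
  then have ij: "i < m * n" "j < m * n" by auto
  show "(sum_op m F X \<otimes>\<^sub>m B) $$ (i, j) = sum_op (m * n) (\<lambda>x. F x \<otimes>\<^sub>m B) X $$ (i, j)"
    using ij assms by (subst tensor_index) (auto simp: tensor_index div_less_of_mult sum_distrib_right intro!: sum.cong)
qed (use assms in auto)

lemma sum_op_tensor_right:
  assumes "\<And>x. x \<in> X \<Longrightarrow> F x \<in> carrier_mat n n" "A \<in> carrier_mat m m"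
  shows "A \<otimes>\<^sub>m sum_op n F X = sum_op (m * n) (\<lambda>x. A \<otimes>\<^sub>m F x) X"
proof (rule eq_matI)
  fix i j assume "i < dim_row (sum_op (m * n) (\<lambda>x. A \<otimes>\<^sub>m F x) X)" "j < dim_col (sum_op (m * n) (\<lambda>x. A \<otimes>\<^sub>m F x) X)"
  then have ij: "i < m * n" "j < m * n" by auto
  show "(A \<otimes>\<^sub>m sum_op n F X) $$ (i, j) = sum_op (m * n) (\<lambda>x. A \<otimes>\<^sub>m F x) X $$ (i, j)"
    using ij assms by (subst tensor_index) (auto simp: tensor_index div_less_of_mult sum_distrib_left intro!: sum.cong)
qed (use assms in auto)

lemma smult_tensor: "(c \<cdot>\<^sub>m A) \<otimes>\<^sub>m B = c \<cdot>\<^sub>m (A \<otimes>\<^sub>m B)"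
  by (rule eq_matI) (auto simp: tensor_index div_less_of_mult)

lemma sum_op_flatten:
  fixes M N n :: nat
  assumes "\<And>x y. x < M \<Longrightarrow> y < N \<Longrightarrow> F x y \<in> carrier_mat n n"
  shows "sum_op n (\<lambda>x. sum_op n (F x) {..<N}) {..<M} = sum_op n (\<lambda>z. F (z div N) (z mod N)) {..<M * N}"
  by (rule eq_matI) (simp_all add: sum_prod_index)

text \<open>The eigenvalues of K \<otimes> 1 depend on the first index only, so the entrywise
  multiplier acts on the first factor alone. Product operators therefore stay products, which is why
  the construction on A preserves separability across A:C.\<close>

lemma dlog_map_tensor:
  assumes V: "unitary_mat m V" and A: "A \<in> carrier_mat m m" and C: "C \<in> carrier_mat n n"
  shows "dlog_map (m * n) (V \<otimes>\<^sub>m 1\<^sub>m n) (\<lambda>i. k (i div n)) (A \<otimes>\<^sub>m C) = dlog_map m V k A \<otimes>\<^sub>m C"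
proof -
  note [simp] = unitary_dims[OF V] carrier_matD[OF A] carrier_matD[OF C]
  have 1: "adj (V \<otimes>\<^sub>m 1\<^sub>m n) * (A \<otimes>\<^sub>m C) * (V \<otimes>\<^sub>m 1\<^sub>m n) = (adj V * A * V) \<otimes>\<^sub>m C"
    by (simp add: adj_tensor tensor_mult)
  have 2: "mat (m * n) (m * n) (\<lambda>(i, j). ((adj V * A * V) \<otimes>\<^sub>m C) $$ (i, j) * complex_of_real (inv_logmean (k (i div n)) (k (j div n))))
      = mat m m (\<lambda>(i, j). (adj V * A * V) $$ (i, j) * complex_of_real (inv_logmean (k i) (k j))) \<otimes>\<^sub>m C"
    by (rule eq_matI) (auto simp: tensor_index div_less_of_mult)
  show ?thesis unfolding dlog_map_def 1 2 by (simp add: adj_tensor tensor_mult)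
qed

text \<open>The partial trace over the first factor of (F \<otimes> 1) Y: what an effect F on that
  factor leaves on the second. \<open>contract_right\<close> is the mirror image.\<close>

definition contract_left :: "nat \<Rightarrow> nat \<Rightarrow> complex mat \<Rightarrow> complex mat \<Rightarrow> complex mat" where
  "contract_left m n F Y = mat n n (\<lambda>(b, b'). \<Sum>a<m. \<Sum>a'<m. F $$ (a', a) * Y $$ (a * n + b, a' * n + b'))"

definition contract_right :: "nat \<Rightarrow> nat \<Rightarrow> complex mat \<Rightarrow> complex mat \<Rightarrow> complex mat" where
  "contract_right m n G Y = mat m m (\<lambda>(a, a'). \<Sum>b<n. \<Sum>b'<n. G $$ (b', b) * Y $$ (a * n + b, a' * n + b'))"

lemma contract_dim [simp]: "dim_row (contract_left m n F Y) = n" "dim_col (contract_left m n F Y) = n"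
  "dim_row (contract_right m n F Y) = m" "dim_col (contract_right m n F Y) = m"
  by (simp_all add: contract_left_def contract_right_def)

lemma tr_tensor_mult:
  assumes "Y \<in> carrier_mat (m * n) (m * n)" "F \<in> carrier_mat m m" "G \<in> carrier_mat n n"
  shows "tr (Y * (F \<otimes>\<^sub>m G)) = (\<Sum>a<m. \<Sum>b<n. \<Sum>a'<m. \<Sum>b'<n. Y $$ (a * n + b, a' * n + b') * (F $$ (a', a) * G $$ (b', b)))"
  using assms unfolding tr_mult[of Y "F \<otimes>\<^sub>m G"]
  by (subst tr_mult) (auto simp: sum_prod_index tensor_index index_less intro!: sum.cong)

lemma tr_contract_left:
  assumes "Y \<in> carrier_mat (m * n) (m * n)" "F \<in> carrier_mat m m" "G \<in> carrier_mat n n"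
  shows "tr (contract_left m n F Y * G) = tr (Y * (F \<otimes>\<^sub>m G))"
proof -
  have "tr (contract_left m n F Y * G) = (\<Sum>b<n. \<Sum>b'<n. \<Sum>a<m. \<Sum>a'<m. Y $$ (a * n + b, a' * n + b') * (F $$ (a', a) * G $$ (b', b)))"
    using assms by (subst tr_mult) (auto simp: contract_left_def sum_distrib_right sum_distrib_left mult_ac intro!: sum.cong)
  also have "\<dots> = (\<Sum>b<n. \<Sum>a<m. \<Sum>b'<n. \<Sum>a'<m. Y $$ (a * n + b, a' * n + b') * (F $$ (a', a) * G $$ (b', b)))"
    by (intro sum.cong refl sum.swap)
  also have "\<dots> = (\<Sum>a<m. \<Sum>b<n. \<Sum>b'<n. \<Sum>a'<m. Y $$ (a * n + b, a' * n + b') * (F $$ (a', a) * G $$ (b', b)))"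
    by (rule sum.swap)
  also have "\<dots> = (\<Sum>a<m. \<Sum>b<n. \<Sum>a'<m. \<Sum>b'<n. Y $$ (a * n + b, a' * n + b') * (F $$ (a', a) * G $$ (b', b)))"
    by (intro sum.cong refl sum.swap)
  finally show ?thesis using tr_tensor_mult[OF assms] by simp
qed

lemma tr_contract_right:
  assumes "Y \<in> carrier_mat (m * n) (m * n)" "F \<in> carrier_mat m m" "G \<in> carrier_mat n n"
  shows "tr (contract_right m n G Y * F) = tr (Y * (F \<otimes>\<^sub>m G))"
proof -
  have "tr (contract_right m n G Y * F) = (\<Sum>a<m. \<Sum>a'<m. \<Sum>b<n. \<Sum>b'<n. Y $$ (a * n + b, a' * n + b') * (F $$ (a', a) * G $$ (b', b)))"
    using assms by (subst tr_mult) (auto simp: contract_right_def sum_distrib_right sum_distrib_left mult_ac intro!: sum.cong)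
  also have "\<dots> = (\<Sum>a<m. \<Sum>b<n. \<Sum>a'<m. \<Sum>b'<n. Y $$ (a * n + b, a' * n + b') * (F $$ (a', a) * G $$ (b', b)))"
    by (intro sum.cong refl sum.swap)
  finally show ?thesis using tr_tensor_mult[OF assms] by simp
qed

text \<open>Contracting with \<open>R R\<^sup>*\<close> is the Kraus map of the rows of \<open>R\<^sup>*\<close>.\<close>

definition bra :: "nat \<Rightarrow> complex mat \<Rightarrow> nat \<Rightarrow> complex mat" where
  "bra m R k = mat 1 m (\<lambda>(_, a). cnj (R $$ (a, k)))"

lemma bra_dim [simp]: "dim_row (bra m R k) = 1" "dim_col (bra m R k) = m"
  by (simp_all add: bra_def)

lemma sum_bra:
  assumes "R \<in> carrier_mat m m"
  shows "sum_op m (\<lambda>k. adj (bra m R k) * bra m R k) {..<m} = R * adj R"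
  by (rule eq_matI) (use assms in \<open>auto simp: bra_def mat_mult_index intro!: sum.cong\<close>)

lemma bra_tensor_mult_index:
  assumes "X \<in> carrier_mat (m * n) p" "b < n" "j < p"
  shows "((bra m R k \<otimes>\<^sub>m 1\<^sub>m n) * X) $$ (b, j) = (\<Sum>a<m. cnj (R $$ (a, k)) * X $$ (a * n + b, j))"
proof -
  have "((bra m R k \<otimes>\<^sub>m 1\<^sub>m n) * X) $$ (b, j) = (\<Sum>a<m. \<Sum>b'<n. cnj (R $$ (a, k)) * (if b' = b then X $$ (a * n + b', j) else 0))"
    using assms by (subst mat_mult_index) (auto simp: sum_prod_index tensor_index index_less bra_def intro!: sum.cong)
  then show ?thesis using assms by (simp flip: sum_distrib_left)
qed

lemma kraus_bra:
  assumes Y: "Y \<in> carrier_mat (m * n) (m * n)" and R: "R \<in> carrier_mat m m"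
  shows "kraus n (\<lambda>k. bra m R k \<otimes>\<^sub>m 1\<^sub>m n) m Y = contract_left m n (R * adj R) Y"
proof (rule eq_matI)
  fix b b' assume "b < dim_row (contract_left m n (R * adj R) Y)" "b' < dim_col (contract_left m n (R * adj R) Y)"
  then have b: "b < n" "b' < n" by auto
  note [simp] = carrier_matD[OF Y] carrier_matD[OF R]
  have "((bra m R k \<otimes>\<^sub>m 1\<^sub>m n) * Y * adj (bra m R k \<otimes>\<^sub>m 1\<^sub>m n)) $$ (b, b')
     = (\<Sum>a<m. \<Sum>a'<m. R $$ (a', k) * cnj (R $$ (a, k)) * Y $$ (a * n + b, a' * n + b'))" for k
  proof -
    let ?L = "bra m R k \<otimes>\<^sub>m 1\<^sub>m n"
    have "(?L * Y * adj ?L) $$ (b, b') = (\<Sum>a<m. cnj (R $$ (a, k)) * (Y * adj ?L) $$ (a * n + b, b'))"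
      using b by (simp add: mat_assoc bra_tensor_mult_index[of "Y * adj ?L" m n n])
    also have "\<dots> = (\<Sum>a<m. cnj (R $$ (a, k)) * cnj ((?L * adj Y) $$ (b', a * n + b)))"
    proof (intro sum.cong refl)
      fix a assume "a \<in> {..<m}"
      have "Y * adj ?L = adj (?L * adj Y)" by (simp add: adj_mult)
      then show "cnj (R $$ (a, k)) * (Y * adj ?L) $$ (a * n + b, b') = cnj (R $$ (a, k)) * cnj ((?L * adj Y) $$ (b', a * n + b))"
        using b \<open>a \<in> {..<m}\<close> by (simp add: index_less)
    qed
    also have "\<dots> = (\<Sum>a<m. \<Sum>a'<m. R $$ (a', k) * cnj (R $$ (a, k)) * Y $$ (a * n + b, a' * n + b'))"
      using b by (intro sum.cong refl, subst bra_tensor_mult_index[of _ m n "m * n"]) (auto simp: index_less sum_distrib_left mult_ac)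
    finally show ?thesis .
  qed
  then have "kraus n (\<lambda>k. bra m R k \<otimes>\<^sub>m 1\<^sub>m n) m Y $$ (b, b') = (\<Sum>k<m. \<Sum>a<m. \<Sum>a'<m. R $$ (a', k) * cnj (R $$ (a, k)) * Y $$ (a * n + b, a' * n + b'))"
    using b by (simp add: kraus_def)
  also have "\<dots> = (\<Sum>a<m. \<Sum>k<m. \<Sum>a'<m. R $$ (a', k) * cnj (R $$ (a, k)) * Y $$ (a * n + b, a' * n + b'))" by (rule sum.swap)
  also have "\<dots> = (\<Sum>a<m. \<Sum>a'<m. \<Sum>k<m. R $$ (a', k) * cnj (R $$ (a, k)) * Y $$ (a * n + b, a' * n + b'))" by (intro sum.cong refl sum.swap)
  also have "\<dots> = contract_left m n (R * adj R) Y $$ (b, b')"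
    using b by (simp add: contract_left_def mat_mult_index sum_distrib_right)
  finally show "kraus n (\<lambda>k. bra m R k \<otimes>\<^sub>m 1\<^sub>m n) m Y $$ (b, b') = contract_left m n (R * adj R) Y $$ (b, b')" .
qed auto

lemma psd_contract_left:
  assumes "pos_semidef m F" "pos_semidef (m * n) Y"
  shows "pos_semidef n (contract_left m n F Y)"
proof -
  obtain R where R: "R \<in> carrier_mat m m" "F = R * adj R" using psd_factor[OF assms(1)] by blast
  show ?thesis unfolding R(2) kraus_bra[OF psd_carrier[OF assms(2)] R(1), symmetric]
    by (rule psd_kraus[OF assms(2)]) auto
qed

lemma psd_contract_right_one:
  assumes "pos_semidef (m * n) Y"
  shows "pos_semidef m (contract_right m n (1\<^sub>m n) Y)"
proof (rule psdI)
  fix f :: "nat \<Rightarrow> complex"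
  have E: "contract_right m n (1\<^sub>m n) Y $$ (a, a') = (\<Sum>b<n. Y $$ (a * n + b, a' * n + b))" if "a < m" "a' < m" for a a'
    using that by (simp add: contract_right_def if_distrib[of "\<lambda>x. x * _"] cong: if_cong)
  have "(\<Sum>b<n. \<Sum>a<m. \<Sum>a'<m. cnj (f a) * Y $$ (a * n + b, a' * n + b) * f a') \<ge> 0"
  proof (rule sum_nonneg)
    fix b assume b: "b \<in> {..<n}"
    \<comment> \<open>The vector f \<otimes> e_b; the form of the partial trace at f is the sum over
      b of the form of Y at these vectors.\<close>
    define h where "h i = (if i mod n = b then f (i div n) else 0)" for i
    have S: "(\<Sum>i<m * n. h i * g i) = (\<Sum>a<m. f a * g (a * n + b))" for g :: "nat \<Rightarrow> complex"
    proof -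
      have "(\<Sum>i<m * n. h i * g i) = (\<Sum>a<m. \<Sum>b'<n. if b' = b then f a * g (a * n + b) else 0)"
        unfolding sum_prod_index by (intro sum.cong refl) (auto simp: h_def)
      then show ?thesis using b by simp
    qed
    have S': "(\<Sum>i<m * n. cnj (h i) * g i) = (\<Sum>a<m. cnj (f a) * g (a * n + b))" for g :: "nat \<Rightarrow> complex"
      using arg_cong[OF S[of "\<lambda>i. cnj (g i)"], of cnj] by simp
    have "0 \<le> (\<Sum>i<m * n. \<Sum>j<m * n. cnj (h i) * Y $$ (i, j) * h j)" by (rule psd_quad[OF assms])
    also have "\<dots> = (\<Sum>i<m * n. cnj (h i) * (\<Sum>j<m * n. h j * Y $$ (i, j)))"
      by (simp add: sum_distrib_left mult_ac)
    also have "\<dots> = (\<Sum>a<m. cnj (f a) * (\<Sum>a'<m. f a' * Y $$ (a * n + b, a' * n + b)))"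
      by (simp only: S S')
    also have "\<dots> = (\<Sum>a<m. \<Sum>a'<m. cnj (f a) * Y $$ (a * n + b, a' * n + b) * f a')"
      by (simp add: sum_distrib_left mult_ac)
    finally show "0 \<le> (\<Sum>a<m. \<Sum>a'<m. cnj (f a) * Y $$ (a * n + b, a' * n + b) * f a')" .
  qed
  also have "(\<Sum>b<n. \<Sum>a<m. \<Sum>a'<m. cnj (f a) * Y $$ (a * n + b, a' * n + b) * f a') = (\<Sum>a<m. \<Sum>b<n. \<Sum>a'<m. cnj (f a) * Y $$ (a * n + b, a' * n + b) * f a')"
    by (rule sum.swap)
  also have "\<dots> = (\<Sum>a<m. \<Sum>a'<m. \<Sum>b<n. cnj (f a) * Y $$ (a * n + b, a' * n + b) * f a')"
    by (intro sum.cong refl sum.swap)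
  also have "\<dots> = (\<Sum>a<m. \<Sum>a'<m. cnj (f a) * contract_right m n (1\<^sub>m n) Y $$ (a, a') * f a')"
    by (intro sum.cong refl) (simp add: E sum_distrib_left sum_distrib_right)
  finally show "0 \<le> (\<Sum>a<m. \<Sum>a'<m. cnj (f a) * contract_right m n (1\<^sub>m n) Y $$ (a, a') * f a')" .
qed simp

subsection \<open>Separable operators\<close>

text \<open>Separability without the trace condition, since measurement outcomes and weighted sums
  produce unnormalized operators; the cone is closed under addition and nonnegative scaling.\<close>

definition sep_cone :: "nat \<Rightarrow> nat \<Rightarrow> complex mat \<Rightarrow> bool" where
  "sep_cone a b \<tau> \<longleftrightarrow> (\<exists>(m :: nat) YA YB. (\<forall>x<m. pos_semidef a (YA x) \<and> pos_semidef b (YB x)) \<and>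
     \<tau> = sum_op (a * b) (\<lambda>x. YA x \<otimes>\<^sub>m YB x) {..<m})"

lemma Sep_iff: "\<sigma> \<in> Sep a b \<longleftrightarrow> \<sigma> \<in> states (a * b) \<and> sep_cone a b \<sigma>"
  by (auto simp: Sep_def sep_cone_def)

lemma sep_cone_psd: "sep_cone a b \<tau> \<Longrightarrow> pos_semidef (a * b) \<tau>"
  by (auto simp: sep_cone_def intro!: psd_sum_op psd_tensor)

lemma sep_cone_tensor:
  assumes "pos_semidef a A" "pos_semidef b B"
  shows "sep_cone a b (A \<otimes>\<^sub>m B)"
proof -
  have "A \<otimes>\<^sub>m B = sum_op (a * b) (\<lambda>x. A \<otimes>\<^sub>m B) {..<1::nat}"
    using psd_carrier[OF assms(1)] psd_carrier[OF assms(2)] by (intro eq_matI) auto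
  then show ?thesis unfolding sep_cone_def using assms
    by (intro exI[of _ "1::nat"] exI[of _ "\<lambda>_. A"] exI[of _ "\<lambda>_. B"]) simp
qed

lemma sep_cone_zero: "sep_cone a b (0\<^sub>m (a * b) (a * b))"
proof -
  have "0\<^sub>m (a * b) (a * b) = sum_op (a * b) (\<lambda>x. 0\<^sub>m a a \<otimes>\<^sub>m 0\<^sub>m b b) {..<0::nat}"
    by (intro eq_matI) auto
  then show ?thesis unfolding sep_cone_def
    by (intro exI[of _ "0::nat"] exI[of _ "\<lambda>_. 0\<^sub>m a a"] exI[of _ "\<lambda>_. 0\<^sub>m b b"]) simp
qed

lemma sep_cone_add:
  assumes "sep_cone a b \<sigma>" "sep_cone a b \<tau>"
  shows "sep_cone a b (\<sigma> + \<tau>)"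
proof -
  obtain m :: nat and YA YB where 1: "\<And>x. x < m \<Longrightarrow> pos_semidef a (YA x) \<and> pos_semidef b (YB x)"
    "\<sigma> = sum_op (a * b) (\<lambda>x. YA x \<otimes>\<^sub>m YB x) {..<m}" using assms(1) unfolding sep_cone_def by blast
  obtain m' :: nat and YA' YB' where 2: "\<And>x. x < m' \<Longrightarrow> pos_semidef a (YA' x) \<and> pos_semidef b (YB' x)"
    "\<tau> = sum_op (a * b) (\<lambda>x. YA' x \<otimes>\<^sub>m YB' x) {..<m'}" using assms(2) unfolding sep_cone_def by blast
  define ZA where "ZA x = (if x < m then YA x else YA' (x - m))" for x
  define ZB where "ZB x = (if x < m then YB x else YB' (x - m))" for x
  have S: "(\<Sum>x<m + m'. (ZA x \<otimes>\<^sub>m ZB x) $$ (i, j)) = (\<Sum>x<m. (YA x \<otimes>\<^sub>m YB x) $$ (i, j)) + (\<Sum>x<m'. (YA' x \<otimes>\<^sub>m YB' x) $$ (i, j))" for i j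
  proof -
    have "(\<Sum>x<m + m'. (ZA x \<otimes>\<^sub>m ZB x) $$ (i, j)) = (\<Sum>x<m. (ZA x \<otimes>\<^sub>m ZB x) $$ (i, j)) + (\<Sum>x<m'. (ZA (m + x) \<otimes>\<^sub>m ZB (m + x)) $$ (i, j))"
      by (induction m') auto
    then show ?thesis by (simp add: ZA_def ZB_def)
  qed
  have "\<sigma> + \<tau> = sum_op (a * b) (\<lambda>x. ZA x \<otimes>\<^sub>m ZB x) {..<m + m'}"
    by (rule eq_matI) (auto simp: 1(2) 2(2) S)
  moreover have "\<forall>x<m + m'. pos_semidef a (ZA x) \<and> pos_semidef b (ZB x)"
    using 1(1) 2(1) by (auto simp: ZA_def ZB_def)
  ultimately show ?thesis unfolding sep_cone_def by blast
qed

lemma sep_cone_sum_op: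
  assumes "finite X" "\<And>x. x \<in> X \<Longrightarrow> sep_cone a b (F x)"
  shows "sep_cone a b (sum_op (a * b) F X)"
  using assms
proof (induction X rule: finite_induct)
  case empty
  have "sum_op (a * b) F {} = 0\<^sub>m (a * b) (a * b)" by (intro eq_matI) auto
  then show ?case using sep_cone_zero by simp
next
  case (insert x X)
  have "sum_op (a * b) F (insert x X) = F x + sum_op (a * b) F X"
    using insert psd_carrier[OF sep_cone_psd[OF insert.prems[of x]]] by (intro eq_matI) auto
  then show ?case using insert by (auto intro: sep_cone_add)
qed

lemma sep_cone_smult:
  assumes "sep_cone a b \<tau>" "0 \<le> c"
  shows "sep_cone a b (complex_of_real c \<cdot>\<^sub>m \<tau>)"
proof -
  obtain m :: nat and YA YB where 1: "\<And>x. x < m \<Longrightarrow> pos_semidef a (YA x) \<and> pos_semidef b (YB x)"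
    "\<tau> = sum_op (a * b) (\<lambda>x. YA x \<otimes>\<^sub>m YB x) {..<m}" using assms(1) unfolding sep_cone_def by blast
  have "complex_of_real c \<cdot>\<^sub>m \<tau> = sum_op (a * b) (\<lambda>x. (complex_of_real c \<cdot>\<^sub>m YA x) \<otimes>\<^sub>m YB x) {..<m}"
    using psd_carrier[OF conjunct1[OF 1(1)]] psd_carrier[OF conjunct2[OF 1(1)]] 
    by (intro eq_matI) (auto simp: 1(2) smult_tensor sum_distrib_left intro!: sum.cong)
  moreover have "\<forall>x<m. pos_semidef a (complex_of_real c \<cdot>\<^sub>m YA x) \<and> pos_semidef b (YB x)"
    using 1(1) assms(2) by (auto intro!: psd_smult simp: less_eq_complex_def)
  ultimately show ?thesis unfolding sep_cone_def
    by (intro exI[of _ m] exI[of _ "\<lambda>x. complex_of_real c \<cdot>\<^sub>m YA x"] exI[of _ YB]) simp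
qed

lemma statesD:
  assumes "\<rho> \<in> states n"
  shows "pos_semidef n \<rho>" "tr \<rho> = 1" "\<rho> \<in> carrier_mat n n" "dim_row \<rho> = n" "dim_col \<rho> = n" "n > 0"
proof -
  show "pos_semidef n \<rho>" and t: "tr \<rho> = 1" using assms by (auto simp: states_def)
  then show "\<rho> \<in> carrier_mat n n" "dim_row \<rho> = n" and d: "dim_col \<rho> = n" using psd_carrier[of n \<rho>] by auto
  show "n > 0"
  proof (rule ccontr)
    assume "\<not> n > 0"
    then have "tr \<rho> = 0" using \<open>dim_row \<rho> = n\<close> by (simp add: tr_def)
    then show False using t by simp
  qed
qed

definition maximally_mixed :: "nat \<Rightarrow> complex mat" where
  "maximally_mixed n = complex_of_real (1 / real n) \<cdot>\<^sub>m 1\<^sub>m n"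

lemma sep_cone_maximally_mixed: "sep_cone a b (maximally_mixed (a * b))"
  unfolding maximally_mixed_def using sep_cone_tensor[OF psd_one psd_one, of a b]
  by (intro sep_cone_smult) (simp_all add: tensor_one)

lemma tr_maximally_mixed: "n > 0 \<Longrightarrow> tr (maximally_mixed n) = 1"
  by (simp add: maximally_mixed_def tr_smult[of _ n] tr_one)

lemma maximally_mixed_carrier [simp]: "dim_row (maximally_mixed n) = n" "dim_col (maximally_mixed n) = n"
  by (simp_all add: maximally_mixed_def)

subsection \<open>Measured relative entropies\<close>

lemma povm_carrier: "M \<in> ALL_povms n \<Longrightarrow> z < length M \<Longrightarrow> pos_semidef n (M ! z)"
  by (auto simp: ALL_povms_def)

lemma povm_sum: "M \<in> ALL_povms n \<Longrightarrow> sum_op n (\<lambda>z. M ! z) {..<length M} = 1\<^sub>m n"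
  by (auto simp: ALL_povms_def)

lemma outcome_prob_nonneg:
  assumes "pos_semidef n \<rho>" "M \<in> ALL_povms n" "z < length M"
  shows "0 \<le> outcome_prob \<rho> M z"
  using psd_tr_mult[OF assms(1) povm_carrier[OF assms(2,3)]] by (simp add: outcome_prob_def less_eq_complex_def)

lemma outcome_prob_sum:
  assumes "\<rho> \<in> carrier_mat n n" "M \<in> ALL_povms n" 
  shows "(\<Sum>z<length M. outcome_prob \<rho> M z) = Re (tr \<rho>)"
proof -
  have "(\<Sum>z<length M. tr (\<rho> * M ! z)) = tr (\<rho> * sum_op n (\<lambda>z. M ! z) {..<length M})"
    using assms by (intro tr_mult_sum_op[symmetric]) (auto dest!: povm_carrier psd_carrier)
  then show ?thesis using assms by (simp add: povm_sum outcome_prob_def flip: Re_sum)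
qed

text \<open>A strict lower bound on the infimum holds in particular at the state obtained by filling
  the missing trace of \<tau> with white noise. Filling only raises outcome probabilities, so the
  constraint proved for that state holds for \<tau> as well.\<close>

lemma E_meas_witness:
  assumes M: "\<M> \<subseteq> ALL_povms (a * b)" and \<rho>: "\<rho> \<in> states (a * b)" and \<tau>: "sep_cone a b \<tau>" "Re (tr \<tau>) \<le> 1"
    and r: "ereal r < E_meas \<M> a b \<rho>"
  obtains M f where "M \<in> \<M>" "\<And>z. f z > 0" "(\<Sum>z<length M. Re (tr (\<tau> * M ! z)) * f z) \<le> 1"
    "r \<le> (\<Sum>z<length M. Re (tr (\<rho> * M ! z)) * ln (f z))"
proof -
  have n: "a * b > 0" by (rule statesD(6)[OF \<rho>])
  \<comment> \<open>The maximally mixed state is separable, hence the completed operator belongs to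
    \<open>Sep\<close>.\<close>
  define \<sigma> where "\<sigma> = \<tau> + complex_of_real (1 - Re (tr \<tau>)) \<cdot>\<^sub>m maximally_mixed (a * b)"
  note [simp] = carrier_matD[OF psd_carrier[OF sep_cone_psd[OF \<tau>(1)]]]
  have trt: "tr \<tau> = complex_of_real (Re (tr \<tau>))"
    using psd_tr[OF sep_cone_psd[OF \<tau>(1)]] by (simp add: less_eq_complex_def complex_eq_iff)
  have sc: "sep_cone a b \<sigma>" unfolding \<sigma>_def
    by (intro sep_cone_add \<tau> sep_cone_smult sep_cone_maximally_mixed) (use \<tau> in auto)
  have "tr \<sigma> = tr \<tau> + complex_of_real (1 - Re (tr \<tau>))"
    unfolding \<sigma>_def using n by (simp add: tr_add[of _ "a * b"] tr_smult[of _ "a * b"] tr_maximally_mixed)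
  also have "\<dots> = 1" by (subst trt) simp
  finally have \<sigma>: "\<sigma> \<in> Sep a b" using sc by (auto simp: Sep_iff states_def intro: sep_cone_psd)
  have "ereal r < measured_rel_entropy \<M> \<rho> \<sigma>"
    using r \<sigma> unfolding E_meas_def by (meson INF_lower less_le_trans)
  then obtain M where M': "M \<in> \<M>" "ereal r < classical_rel_entropy {..<length M} (outcome_prob \<rho> M) (outcome_prob \<sigma> M)"
    unfolding measured_rel_entropy_def less_SUP_iff by blast
  then have Mp: "M \<in> ALL_povms (a * b)" using M by auto
  obtain f where f: "\<And>z. f z > 0" "(\<Sum>z<length M. outcome_prob \<sigma> M z * f z) \<le> 1" "r \<le> (\<Sum>z<length M. outcome_prob \<rho> M z * ln (f z))"
    by (rule classical_rel_entropy_witness[OF _ _ _ _ M'(2)])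
      (use outcome_prob_nonneg[OF statesD(1)[OF \<rho>] Mp] outcome_prob_nonneg[OF sep_cone_psd[OF sc] Mp]
        outcome_prob_sum[OF statesD(3)[OF \<rho>] Mp] statesD(2)[OF \<rho>] in auto)
  have "Re (tr (\<tau> * M ! z)) \<le> outcome_prob \<sigma> M z" if z: "z < length M" for z
  proof -
    note [simp] = carrier_matD[OF psd_carrier[OF povm_carrier[OF Mp z]]]
    let ?c = "1 - Re (tr \<tau>)"
    have "\<sigma> * M ! z = \<tau> * M ! z + complex_of_real ?c \<cdot>\<^sub>m (maximally_mixed (a * b) * M ! z)"
      unfolding \<sigma>_def by (simp add: add_mult_distrib_mat[of _ "a * b" "a * b" _ _ "a * b"] mult_smult_assoc_mat[of _ "a * b" "a * b" _ "a * b"])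
    then have "tr (\<sigma> * M ! z) = tr (\<tau> * M ! z) + complex_of_real ?c * tr (maximally_mixed (a * b) * M ! z)"
      by (simp add: tr_add[of _ "a * b"] tr_smult[of _ "a * b"])
    moreover have "0 \<le> tr (maximally_mixed (a * b) * M ! z)"
      by (rule psd_tr_mult[OF sep_cone_psd[OF sep_cone_maximally_mixed] povm_carrier[OF Mp z]])
    ultimately show ?thesis using \<tau>(2) by (simp add: outcome_prob_def less_eq_complex_def)
  qed
  then have "(\<Sum>z<length M. Re (tr (\<tau> * M ! z)) * f z) \<le> (\<Sum>z<length M. outcome_prob \<sigma> M z * f z)"
    using f(1) by (intro sum_mono mult_right_mono) (auto intro: less_imp_le)
  then show ?thesis by (intro that[of M f]) (use M'(1) f in \<open>auto simp: outcome_prob_def\<close>)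
qed

lemma trivial_povm_ALL: "[1\<^sub>m n] \<in> ALL_povms n"
  by (auto simp: ALL_povms_def intro!: eq_matI)

lemma trivial_povm_LOCC1: "[1\<^sub>m (a * b)] \<in> LOCC1_povms a b"
proof -
  have "[1\<^sub>m (a * b)] ! z = sum_op (a * b) (\<lambda>x. 1\<^sub>m a \<otimes>\<^sub>m 1\<^sub>m b) {..<1::nat}" if "z < length [1\<^sub>m (a * b) :: complex mat]" for z
    using that by (simp add: tensor_one) (rule eq_matI, simp_all)
  moreover have "sum_op b (\<lambda>_. 1\<^sub>m b) {..<1::nat} = 1\<^sub>m b" "sum_op a (\<lambda>_. 1\<^sub>m a) {..<1::nat} = 1\<^sub>m a"
    by (auto intro!: eq_matI)
  ultimately show ?thesis unfolding LOCC1_povms_def using trivial_povm_ALL[of "a * b"]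
    by (intro CollectI conjI exI[of _ "1::nat"] exI[of _ "\<lambda>_ _. 1\<^sub>m a"] exI[of _ "\<lambda>_. 1\<^sub>m b"]) auto
qed

lemma LOCC1_subset_ALL: "LOCC1_povms a b \<subseteq> ALL_povms (a * b)"
  by (auto simp: LOCC1_povms_def)

lemma E_meas_nonneg:
  assumes "[1\<^sub>m (a * b)] \<in> \<M>" "\<rho> \<in> states (a * b)"
  shows "0 \<le> E_meas \<M> a b \<rho>"
  unfolding E_meas_def
proof (rule INF_greatest)
  fix \<sigma> assume "\<sigma> \<in> Sep a b"
  then have \<sigma>: "\<sigma> \<in> states (a * b)" by (simp add: Sep_iff)
  let ?M = "[1\<^sub>m (a * b)] :: complex mat list"
  have P: "outcome_prob \<rho> ?M 0 = 1" "outcome_prob \<sigma> ?M 0 = 1"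
    by (simp_all add: outcome_prob_def statesD[OF assms(2)] statesD[OF \<sigma>])
  have L: "{..<length ?M} = {0}" by auto
  have "classical_rel_entropy {0} (outcome_prob \<rho> ?M) (outcome_prob \<sigma> ?M) = ereal 0"
    unfolding classical_rel_entropy_def using P by (simp add: subset_iff)
  moreover have "classical_rel_entropy {..<length ?M} (outcome_prob \<rho> ?M) (outcome_prob \<sigma> ?M) \<le> measured_rel_entropy \<M> \<rho> \<sigma>"
    unfolding measured_rel_entropy_def by (rule SUP_upper[OF assms(1)])
  ultimately show "0 \<le> measured_rel_entropy \<M> \<rho> \<sigma>" unfolding L by (simp add: zero_ereal_def)
qed

text \<open>Approximating both summands strictly from below treats finite and infinite values alike;
  nonnegativity excludes opposite infinities and supplies real numbers below each summand.\<close>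

lemma ereal_add_le_of_less:
  fixes a b c :: ereal
  assumes "0 \<le> a" "0 \<le> b" and H: "\<And>r s. ereal r < a \<Longrightarrow> ereal s < b \<Longrightarrow> ereal (r + s) \<le> c"
  shows "a + b \<le> c"
proof (rule ccontr)
  assume "\<not> a + b \<le> c"
  then have lt: "c < a + b" by simp
  have "\<exists>r s. ereal r < a \<and> ereal s < b \<and> c < ereal (r + s)"
  proof -
    have bot: "\<exists>r. ereal r < x" if "0 \<le> x" for x :: ereal
      by (rule exI[of _ "-1"], rule less_le_trans[OF _ that]) simp
    show ?thesis
    proof (cases "c = -\<infinity>")
      case True
      then show ?thesis using bot[OF assms(1)] bot[OF assms(2)] by auto
    next
      case False
      moreover have "c \<noteq> \<infinity>" using lt by auto
      ultimately obtain c' where c: "c = ereal c'" by (cases c) auto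
      show ?thesis
      proof (cases "a = \<infinity> \<or> b = \<infinity>")
        case True
        then show ?thesis
        proof
          assume "a = \<infinity>"
          moreover obtain s where "ereal s < b" using bot[OF assms(2)] by blast
          ultimately show ?thesis using c by (intro exI[of _ "c' - s + 1"] exI[of _ s]) auto
        next
          assume "b = \<infinity>"
          moreover obtain s where "ereal s < a" using bot[OF assms(1)] by blast
          ultimately show ?thesis using c by (intro exI[of _ s] exI[of _ "c' - s + 1"]) auto
        qed
      next
        case False
        then obtain a' b' where ab: "a = ereal a'" "b = ereal b'" using assms by (cases a; cases b) auto
        define d where "d = (a' + b' - c') / 4"
        have d: "d > 0" using lt by (simp add: ab c d_def)
        have "4 * d = a' + b' - c'" by (simp add: d_def)
        then show ?thesis using d unfolding ab c by (intro exI[of _ "a' - d"] exI[of _ "b' - d"]) auto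
      qed
    qed
  qed
  then show False using H by (meson leD)
qed

text \<open>The eigenvalue g_i is the average of the f z under the outcome distribution of the i-th
  eigenvector. These probabilities sum to 1, so one of them is positive, and so is the average.
  Positivity makes log F and the inverse of F available.\<close>

lemma spec_pos_of_povm:
  fixes m n i :: nat
  assumes Q: "\<And>z. z < m \<Longrightarrow> pos_semidef n (Q z)" and one: "sum_op n Q {..<m} = 1\<^sub>m n"
    and f: "\<And>z. z < m \<Longrightarrow> f z > 0"
    and F: "is_spec n (sum_op n (\<lambda>z. complex_of_real (f z) \<cdot>\<^sub>m Q z) {..<m}) W g" and i: "i < n"
  shows "g i > 0"
proof -
  note [simp] = is_specD(3,4)[OF F]
  have [simp]: "dim_row (Q z) = n" "dim_col (Q z) = n" if "z < m" for z
    using psd_carrier[OF Q[OF that]] by auto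
  \<comment> \<open>The rank one projection onto the i-th eigenvector of F, playing the role of the
    state that is measured.\<close>
  define E where "E = mat n n (\<lambda>(k, l). W $$ (k, i) * cnj (W $$ (l, i)))"
  have [simp]: "dim_row E = n" "dim_col E = n" by (simp_all add: E_def)
  have E: "pos_semidef n E"
  proof -
    have "E = mat n 1 (\<lambda>(k, _). W $$ (k, i)) * adj (mat n 1 (\<lambda>(k, _). W $$ (k, i)))"
      by (rule eq_matI) (auto simp: E_def mat_mult_index)
    then show ?thesis using psd_gram[of "mat n 1 (\<lambda>(k, _). W $$ (k, i))" n 1] by simp
  qed
  have trE: "tr (X * E) = (adj W * X * W) $$ (i, i)" if "dim_row X = n" "dim_col X = n" for X
    using i that by (subst tr_mult) (auto simp: E_def mat_mult_index mat_assoc sum_distrib_left sum_distrib_right mult_ac intro!: sum.swap)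
  let ?F = "sum_op n (\<lambda>z. complex_of_real (f z) \<cdot>\<^sub>m Q z) {..<m}"
  have q: "0 \<le> Re (tr (E * Q z))" if "z < m" for z
    using psd_tr_mult[OF E Q[OF that]] by (simp add: less_eq_complex_def)
  have "Re (tr (E * ?F)) = g i"
  proof -
    have "tr (E * ?F) = tr (?F * E)" by (rule tr_rot) auto
    then show ?thesis using i by (simp add: trE is_specD(8)[OF F])
  qed
  moreover have "tr (E * ?F) = (\<Sum>z<m. tr (E * (complex_of_real (f z) \<cdot>\<^sub>m Q z)))"
    by (rule tr_mult_sum_op) auto
  then have "Re (tr (E * ?F)) = (\<Sum>z<m. f z * Re (tr (E * Q z)))"
    by (simp add: mult_smult_distrib[of _ n n _ n] tr_smult[of _ n])
  ultimately have gi: "g i = (\<Sum>z<m. f z * Re (tr (E * Q z)))" by simp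
  have "(\<Sum>z<m. Re (tr (E * Q z))) = 1"
  proof -
    have "(\<Sum>z<m. tr (E * Q z)) = tr (E * sum_op n Q {..<m})" by (rule tr_mult_sum_op[symmetric]) auto
    also have "\<dots> = tr (1\<^sub>m n * E)" by (simp add: one)
    also have "\<dots> = 1" using i by (subst trE) (auto simp: unitary_left[OF is_specD(1)[OF F]])
    finally show ?thesis by (metis Re_sum one_complex.sel(1))
  qed
  then obtain z where z: "z < m" "Re (tr (E * Q z)) \<noteq> 0" by (metis lessThan_iff sum.neutral zero_neq_one)
  then have "0 < f z * Re (tr (E * Q z))" using q[OF z(1)] f[OF z(1)] by simp
  also have "\<dots> \<le> g i" unfolding gi using z q f by (intro member_le_sum mult_nonneg_nonneg) (auto intro: less_imp_le)
  finally show ?thesis .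
qed

lemma sum_op_psd_povm:
  assumes Q: "\<And>z. z < m \<Longrightarrow> pos_semidef n (Q z)" and f: "\<And>z. z < m \<Longrightarrow> f z > 0"
  shows "pos_semidef n (sum_op n (\<lambda>z. complex_of_real (f z) \<cdot>\<^sub>m Q z) {..<m})"
  using assms by (intro psd_sum_op psd_smult) (auto simp: less_eq_complex_def intro: less_imp_le)

subsection \<open>The monogamy inequality\<close>

lemma kraus_sum_op:
  assumes L: "\<And>k. k < K \<Longrightarrow> L k \<in> carrier_mat m n" and F: "\<And>x. x \<in> X \<Longrightarrow> F x \<in> carrier_mat n n"
  shows "kraus m L K (sum_op n F X) = sum_op m (\<lambda>x. kraus m L K (F x)) X"
proof (rule eq_matI)
  fix i j assume "i < dim_row (sum_op m (\<lambda>x. kraus m L K (F x)) X)" "j < dim_col (sum_op m (\<lambda>x. kraus m L K (F x)) X)"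
  then have ij: "i < m" "j < m" by auto
  have "(L k * sum_op n F X * adj (L k)) $$ (i, j) = (\<Sum>x\<in>X. (L k * F x * adj (L k)) $$ (i, j))" if k: "k < K" for k
  proof -
    have [simp]: "dim_row (L k) = m" "dim_col (L k) = n" using L[OF k] by auto
    have [simp]: "dim_row (F x) = n" "dim_col (F x) = n" if "x \<in> X" for x using F[OF that] by auto
    have E: "(L k * Y * adj (L k)) $$ (i, j) = (\<Sum>a<n. \<Sum>b<n. L k $$ (i, a) * Y $$ (a, b) * cnj (L k $$ (j, b)))"
      if "dim_row Y = n" "dim_col Y = n" for Y
    proof -
      have "(L k * Y * adj (L k)) $$ (i, j) = (\<Sum>b<n. \<Sum>a<n. L k $$ (i, a) * Y $$ (a, b) * cnj (L k $$ (j, b)))"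
        using ij that by (subst mat_mult_index) (auto simp: mat_mult_index sum_distrib_right)
      also have "\<dots> = (\<Sum>a<n. \<Sum>b<n. L k $$ (i, a) * Y $$ (a, b) * cnj (L k $$ (j, b)))" by (rule sum.swap)
      finally show ?thesis .
    qed
    have "(L k * sum_op n F X * adj (L k)) $$ (i, j) = (\<Sum>a<n. \<Sum>b<n. \<Sum>x\<in>X. L k $$ (i, a) * F x $$ (a, b) * cnj (L k $$ (j, b)))"
      by (subst E) (auto simp: sum_distrib_left sum_distrib_right)
    also have "\<dots> = (\<Sum>a<n. \<Sum>x\<in>X. \<Sum>b<n. L k $$ (i, a) * F x $$ (a, b) * cnj (L k $$ (j, b)))"
      by (intro sum.cong refl sum.swap)
    also have "\<dots> = (\<Sum>x\<in>X. \<Sum>a<n. \<Sum>b<n. L k $$ (i, a) * F x $$ (a, b) * cnj (L k $$ (j, b)))"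
      by (rule sum.swap)
    also have "\<dots> = (\<Sum>x\<in>X. (L k * F x * adj (L k)) $$ (i, j))"
      by (intro sum.cong refl, subst E) auto
    finally show ?thesis .
  qed
  then have "kraus m L K (sum_op n F X) $$ (i, j) = (\<Sum>k<K. \<Sum>x\<in>X. (L k * F x * adj (L k)) $$ (i, j))"
    using ij by (simp add: kraus_def)
  also have "\<dots> = (\<Sum>x\<in>X. \<Sum>k<K. (L k * F x * adj (L k)) $$ (i, j))" by (rule sum.swap)
  finally show "kraus m L K (sum_op n F X) $$ (i, j) = sum_op m (\<lambda>x. kraus m L K (F x)) X $$ (i, j)"
    using ij by (simp add: kraus_def)
qed auto

lemma kraus_one_tensor:
  assumes A: "A \<in> carrier_mat a a" and Y: "Y \<in> carrier_mat n n" and L: "\<And>k. k < K \<Longrightarrow> L k \<in> carrier_mat p n"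
  shows "kraus (a * p) (\<lambda>k. 1\<^sub>m a \<otimes>\<^sub>m L k) K (A \<otimes>\<^sub>m Y) = A \<otimes>\<^sub>m kraus p L K Y"
proof -
  note [simp] = carrier_matD[OF A] carrier_matD[OF Y]
  have [simp]: "dim_row (L k) = p" "dim_col (L k) = n" if "k < K" for k using L[OF that] by auto
  have "kraus (a * p) (\<lambda>k. 1\<^sub>m a \<otimes>\<^sub>m L k) K (A \<otimes>\<^sub>m Y) = sum_op (a * p) (\<lambda>k. A \<otimes>\<^sub>m (L k * Y * adj (L k))) {..<K}"
    unfolding kraus_def by (intro sum_op_cong) (simp add: tensor_mult adj_tensor)
  also have "\<dots> = A \<otimes>\<^sub>m kraus p L K Y"
    unfolding kraus_def by (subst sum_op_tensor_right) auto
  finally show ?thesis .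
qed

text \<open>The operator on the second factor between the basis vectors a and a' of the first. Kraus
  operators of the form 1 \<otimes> L act blockwise by L.\<close>

definition block :: "nat \<Rightarrow> complex mat \<Rightarrow> nat \<Rightarrow> nat \<Rightarrow> complex mat" where
  "block n \<rho> a a' = mat n n (\<lambda>(k, l). \<rho> $$ (a * n + k, a' * n + l))"

lemma block_dim [simp]: "dim_row (block n \<rho> a a') = n" "dim_col (block n \<rho> a a') = n"
  by (simp_all add: block_def)

lemma one_tensor_mult_index:
  assumes "L \<in> carrier_mat p n" "X \<in> carrier_mat (m * n) q" "a < m" "i < p" "j < q"
  shows "((1\<^sub>m m \<otimes>\<^sub>m L) * X) $$ (a * p + i, j) = (\<Sum>l<n. L $$ (i, l) * X $$ (a * n + l, j))"
proof -
  have "((1\<^sub>m m \<otimes>\<^sub>m L) * X) $$ (a * p + i, j) = (\<Sum>a'<m. \<Sum>l<n. if a' = a then L $$ (i, l) * X $$ (a * n + l, j) else 0)"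
    using assms by (subst mat_mult_index) (auto simp: sum_prod_index tensor_index index_less intro!: sum.cong)
  also have "\<dots> = (\<Sum>a'<m. if a' = a then (\<Sum>l<n. L $$ (i, l) * X $$ (a * n + l, j)) else 0)"
    by (intro sum.cong refl) auto
  finally show ?thesis using assms by simp
qed

lemma one_tensor_conj_index:
  assumes L: "L \<in> carrier_mat p n" and \<rho>: "\<rho> \<in> carrier_mat (m * n) (m * n)" and a: "a < m" "a' < m" and i: "i < p" "j < p"
  shows "((1\<^sub>m m \<otimes>\<^sub>m L) * \<rho> * adj (1\<^sub>m m \<otimes>\<^sub>m L)) $$ (a * p + i, a' * p + j) = (L * block n \<rho> a a' * adj L) $$ (i, j)"
proof -
  note [simp] = carrier_matD[OF L] carrier_matD[OF \<rho>]
  let ?L = "1\<^sub>m m \<otimes>\<^sub>m L"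
  have "(?L * \<rho> * adj ?L) $$ (a * p + i, a' * p + j) = (\<Sum>l<n. L $$ (i, l) * (\<rho> * adj ?L) $$ (a * n + l, a' * p + j))"
    using a i by (simp add: mat_assoc one_tensor_mult_index[of L p n _ m "m * p"] index_less)
  also have "\<dots> = (\<Sum>l<n. L $$ (i, l) * cnj ((?L * adj \<rho>) $$ (a' * p + j, a * n + l)))"
  proof (intro sum.cong refl)
    fix l assume l: "l \<in> {..<n}"
    have "\<rho> * adj ?L = adj (?L * adj \<rho>)" by (simp add: adj_mult)
    then show "L $$ (i, l) * (\<rho> * adj ?L) $$ (a * n + l, a' * p + j) = L $$ (i, l) * cnj ((?L * adj \<rho>) $$ (a' * p + j, a * n + l))"
      using a i l by (simp add: index_less)
  qed
  also have "\<dots> = (\<Sum>l<n. L $$ (i, l) * (\<Sum>l'<n. cnj (L $$ (j, l')) * \<rho> $$ (a * n + l, a' * n + l')))"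
    using a i by (intro sum.cong refl) (simp add: one_tensor_mult_index[of L p n _ m "m * n"] index_less)
  also have "\<dots> = (L * (block n \<rho> a a' * adj L)) $$ (i, j)"
    using i by (simp add: mat_mult_index block_def mult_ac)
  finally show ?thesis by (simp add: mat_assoc)
qed

lemma kraus_one_tensor_index:
  assumes L: "\<And>k. k < K \<Longrightarrow> L k \<in> carrier_mat p n" and "\<rho> \<in> carrier_mat (m * n) (m * n)" "a < m" "a' < m" "i < p" "j < p"
  shows "kraus (m * p) (\<lambda>k. 1\<^sub>m m \<otimes>\<^sub>m L k) K \<rho> $$ (a * p + i, a' * p + j) = kraus p L K (block n \<rho> a a') $$ (i, j)"
  using assms(3-) by (simp add: kraus_def index_less one_tensor_conj_index[OF L assms(2)])

text \<open>Kraus operators for the effect \<open>R * adj R\<close> on B that discard B afterwards,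
  identical on A and C. Summed over k they produce the operator on AC left by that outcome.\<close>

definition bra_mid :: "nat \<Rightarrow> nat \<Rightarrow> nat \<Rightarrow> complex mat \<Rightarrow> nat \<Rightarrow> complex mat" where
  "bra_mid dA dB dC R k = 1\<^sub>m dA \<otimes>\<^sub>m (bra dB R k \<otimes>\<^sub>m 1\<^sub>m dC)"

lemma bra_mid_dim [simp]: "dim_row (bra_mid dA dB dC R k) = dA * dC" "dim_col (bra_mid dA dB dC R k) = dA * (dB * dC)"
  by (simp_all add: bra_mid_def)

lemma kraus_bra_mid_index:
  assumes \<rho>: "\<rho> \<in> carrier_mat (dA * (dB * dC)) (dA * (dB * dC))" and R: "R \<in> carrier_mat dB dB"
    and "a < dA" "a' < dA" "i < dC" "j < dC"
  shows "kraus (dA * dC) (bra_mid dA dB dC R) dB \<rho> $$ (a * dC + i, a' * dC + j) = contract_left dB dC (R * adj R) (block (dB * dC) \<rho> a a') $$ (i, j)"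
  unfolding bra_mid_def[abs_def] using assms kraus_bra[of "block (dB * dC) \<rho> a a'" dB dC R]
  by (subst kraus_one_tensor_index) auto

text \<open>Forgetting the outcome of a complete measurement amounts to tracing the measured system
  out.\<close>

lemma sum_contract_left:
  assumes Q: "sum_op m Q {..<N} = 1\<^sub>m m" and b: "b < n" "b' < n"
  shows "(\<Sum>x<N. contract_left m n (Q x) Y $$ (b, b')) = (\<Sum>a<m. Y $$ (a * n + b, a * n + b'))"
proof -
  have Q': "(\<Sum>x<N. Q x $$ (a', a)) = (if a' = a then 1 else 0)" if "a < m" "a' < m" for a a'
    using arg_cong[OF Q, of "\<lambda>A. A $$ (a', a)"] that by simp
  have "(\<Sum>x<N. contract_left m n (Q x) Y $$ (b, b')) = (\<Sum>x<N. \<Sum>a<m. \<Sum>a'<m. Q x $$ (a', a) * Y $$ (a * n + b, a' * n + b'))"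
    using b by (simp add: contract_left_def)
  also have "\<dots> = (\<Sum>a<m. \<Sum>x<N. \<Sum>a'<m. Q x $$ (a', a) * Y $$ (a * n + b, a' * n + b'))" by (rule sum.swap)
  also have "\<dots> = (\<Sum>a<m. \<Sum>a'<m. \<Sum>x<N. Q x $$ (a', a) * Y $$ (a * n + b, a' * n + b'))" by (intro sum.cong refl sum.swap)
  also have "\<dots> = (\<Sum>a<m. \<Sum>a'<m. if a' = a then Y $$ (a * n + b, a * n + b') else 0)"
    by (intro sum.cong refl) (auto simp: Q' simp flip: sum_distrib_right)
  also have "\<dots> = (\<Sum>a<m. Y $$ (a * n + b, a * n + b'))" by simp
  finally show ?thesis .
qed

lemma sum_kraus_bra_mid:
  assumes \<rho>: "\<rho> \<in> carrier_mat (dA * (dB * dC)) (dA * (dB * dC))" and R: "\<And>x. x < N \<Longrightarrow> R x \<in> carrier_mat dB dB"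
    and one: "sum_op dB (\<lambda>x. R x * adj (R x)) {..<N} = 1\<^sub>m dB"
  shows "sum_op (dA * dC) (\<lambda>x. kraus (dA * dC) (bra_mid dA dB dC (R x)) dB \<rho>) {..<N} = ptrace_mid dA dB dC \<rho>"
proof (rule eq_matI)
  fix i j assume "i < dim_row (ptrace_mid dA dB dC \<rho>)" "j < dim_col (ptrace_mid dA dB dC \<rho>)"
  then have ij: "i < dA * dC" "j < dA * dC" by (auto simp: ptrace_mid_def)
  note b = div_less_of_mult[OF ij(1)] div_less_of_mult[OF ij(2)]
  have "sum_op (dA * dC) (\<lambda>x. kraus (dA * dC) (bra_mid dA dB dC (R x)) dB \<rho>) {..<N} $$ (i, j)
     = (\<Sum>x<N. kraus (dA * dC) (bra_mid dA dB dC (R x)) dB \<rho> $$ (i div dC * dC + i mod dC, j div dC * dC + j mod dC))"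
    using ij by simp
  also have "\<dots> = (\<Sum>x<N. contract_left dB dC (R x * adj (R x)) (block (dB * dC) \<rho> (i div dC) (j div dC)) $$ (i mod dC, j mod dC))"
    using b by (intro sum.cong refl kraus_bra_mid_index \<rho> R) auto
  also have "\<dots> = (\<Sum>c<dB. block (dB * dC) \<rho> (i div dC) (j div dC) $$ (c * dC + i mod dC, c * dC + j mod dC))"
    using b by (intro sum_contract_left one) auto
  also have "\<dots> = ptrace_mid dA dB dC \<rho> $$ (i, j)"
    using ij b by (auto simp: ptrace_mid_def block_def index_less algebra_simps intro!: sum.cong)
  finally show "sum_op (dA * dC) (\<lambda>x. kraus (dA * dC) (bra_mid dA dB dC (R x)) dB \<rho>) {..<N} $$ (i, j) = ptrace_mid dA dB dC \<rho> $$ (i, j)" .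
qed (auto simp: ptrace_mid_def)

lemma kraus_bra_mid_tensor:
  assumes "A \<in> carrier_mat dA dA" "Y \<in> carrier_mat (dB * dC) (dB * dC)" "R \<in> carrier_mat dB dB"
  shows "kraus (dA * dC) (bra_mid dA dB dC R) dB (A \<otimes>\<^sub>m Y) = A \<otimes>\<^sub>m contract_left dB dC (R * adj R) Y"
  unfolding bra_mid_def[abs_def] using assms by (subst kraus_one_tensor) (auto simp: kraus_bra)

text \<open>Joint statistics of A and B are recovered from the operator left on AC; this connects
  the one-way LOCC data on AB with the states conditioned on the outcome.\<close>

lemma tr_kraus_bra_mid:
  assumes \<rho>: "\<rho> \<in> carrier_mat (dA * (dB * dC)) (dA * (dB * dC))" and R: "R \<in> carrier_mat dB dB" and F: "F \<in> carrier_mat dA dA"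
  shows "tr (kraus (dA * dC) (bra_mid dA dB dC R) dB \<rho> * (F \<otimes>\<^sub>m 1\<^sub>m dC)) = tr (\<rho> * (F \<otimes>\<^sub>m (R * adj R) \<otimes>\<^sub>m 1\<^sub>m dC))"
proof -
  note [simp] = carrier_matD[OF \<rho>] carrier_matD[OF R] carrier_matD[OF F]
  have "tr (kraus (dA * dC) (bra_mid dA dB dC R) dB \<rho> * (F \<otimes>\<^sub>m 1\<^sub>m dC))
     = (\<Sum>k<dB. tr (\<rho> * (adj (bra_mid dA dB dC R k) * (F \<otimes>\<^sub>m 1\<^sub>m dC) * bra_mid dA dB dC R k)))"
    by (rule tr_kraus_mult[OF \<rho>]) auto
  also have "\<dots> = (\<Sum>k<dB. tr (\<rho> * (F \<otimes>\<^sub>m ((adj (bra dB R k) * bra dB R k) \<otimes>\<^sub>m 1\<^sub>m dC))))"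
  proof (intro sum.cong refl arg_cong[where f = "\<lambda>X. tr (\<rho> * X)"])
    fix k
    have "F \<otimes>\<^sub>m 1\<^sub>m dC = F \<otimes>\<^sub>m (1\<^sub>m 1 \<otimes>\<^sub>m 1\<^sub>m dC)" by (simp add: tensor_one)
    then show "adj (bra_mid dA dB dC R k) * (F \<otimes>\<^sub>m 1\<^sub>m dC) * bra_mid dA dB dC R k = F \<otimes>\<^sub>m ((adj (bra dB R k) * bra dB R k) \<otimes>\<^sub>m 1\<^sub>m dC)"
      by (simp add: bra_mid_def adj_tensor tensor_mult)
  qed
  also have "\<dots> = tr (\<rho> * sum_op (dA * (dB * dC)) (\<lambda>k. F \<otimes>\<^sub>m ((adj (bra dB R k) * bra dB R k) \<otimes>\<^sub>m 1\<^sub>m dC)) {..<dB})"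
    by (rule tr_mult_sum_op[symmetric]) auto
  also have "sum_op (dA * (dB * dC)) (\<lambda>k. F \<otimes>\<^sub>m ((adj (bra dB R k) * bra dB R k) \<otimes>\<^sub>m 1\<^sub>m dC)) {..<dB} = F \<otimes>\<^sub>m (R * adj R) \<otimes>\<^sub>m 1\<^sub>m dC"
    by (subst sum_op_tensor_right[symmetric], simp, simp, subst sum_op_tensor_left[symmetric]) (auto simp: sum_bra)
  finally show ?thesis .
qed

lemma sum_bra_mid:
  assumes R: "\<And>x. x < N \<Longrightarrow> R x \<in> carrier_mat dB dB" and one: "sum_op dB (\<lambda>x. R x * adj (R x)) {..<N} = 1\<^sub>m dB"
  shows "sum_op (dA * (dB * dC)) (\<lambda>(x, k). adj (bra_mid dA dB dC (R x) k) * bra_mid dA dB dC (R x) k) ({..<N} \<times> {..<dB}) = 1\<^sub>m (dA * (dB * dC))"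
proof -
  have "sum_op (dA * (dB * dC)) (\<lambda>(x, k). adj (bra_mid dA dB dC (R x) k) * bra_mid dA dB dC (R x) k) ({..<N} \<times> {..<dB})
     = sum_op (dA * (dB * dC)) (\<lambda>j. 1\<^sub>m dA \<otimes>\<^sub>m ((adj (bra dB (R (fst j)) (snd j)) * bra dB (R (fst j)) (snd j)) \<otimes>\<^sub>m 1\<^sub>m dC)) ({..<N} \<times> {..<dB})"
    by (intro sum_op_cong) (auto simp: bra_mid_def adj_tensor tensor_mult)
  also have "\<dots> = 1\<^sub>m dA \<otimes>\<^sub>m (sum_op dB (\<lambda>j. adj (bra dB (R (fst j)) (snd j)) * bra dB (R (fst j)) (snd j)) ({..<N} \<times> {..<dB}) \<otimes>\<^sub>m 1\<^sub>m dC)"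
    by (subst sum_op_tensor_right[symmetric], simp, simp, subst sum_op_tensor_left[symmetric]) auto
  also have "sum_op dB (\<lambda>j. adj (bra dB (R (fst j)) (snd j)) * bra dB (R (fst j)) (snd j)) ({..<N} \<times> {..<dB}) = sum_op dB (\<lambda>x. R x * adj (R x)) {..<N}"
  proof (rule eq_matI)
    fix i j assume "i < dim_row (sum_op dB (\<lambda>x. R x * adj (R x)) {..<N})" "j < dim_col (sum_op dB (\<lambda>x. R x * adj (R x)) {..<N})"
    then have ij: "i < dB" "j < dB" by auto
    have "(\<Sum>x<N. \<Sum>k<dB. (adj (bra dB (R x) k) * bra dB (R x) k) $$ (i, j)) = (\<Sum>x<N. (R x * adj (R x)) $$ (i, j))"
      using ij by (intro sum.cong refl) (auto simp: sum_bra[OF R, symmetric])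
    then show "sum_op dB (\<lambda>j. adj (bra dB (R (fst j)) (snd j)) * bra dB (R (fst j)) (snd j)) ({..<N} \<times> {..<dB}) $$ (i, j) = sum_op dB (\<lambda>x. R x * adj (R x)) {..<N} $$ (i, j)"
      using ij by (simp add: sum.cartesian_product case_prod_beta)
  qed auto
  finally show ?thesis by (simp add: one tensor_one)
qed

lemma dlog_map_sum_op:
  assumes V: "dim_row V = n" "dim_col V = n" and F: "\<And>x. x \<in> X \<Longrightarrow> F x \<in> carrier_mat n n"
  shows "dlog_map n V k (sum_op n F X) = sum_op n (\<lambda>x. dlog_map n V k (F x)) X"
proof -
  have [simp]: "dim_row (F x) = n" "dim_col (F x) = n" if "x \<in> X" for x using F[OF that] by auto
  note [simp] = V
  have 1: "adj V * sum_op n F X * V = sum_op n (\<lambda>x. adj V * F x * V) X"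
    by (subst sum_op_mult_left, simp, simp, subst sum_op_mult_right) auto
  have 2: "mat n n (\<lambda>(i, j). sum_op n (\<lambda>x. adj V * F x * V) X $$ (i, j) * complex_of_real (inv_logmean (k i) (k j)))
    = sum_op n (\<lambda>x. mat n n (\<lambda>(i, j). (adj V * F x * V) $$ (i, j) * complex_of_real (inv_logmean (k i) (k j)))) X"
    by (rule eq_matI) (auto simp: sum_distrib_right)
  show ?thesis unfolding dlog_map_def 1 2
    by (subst sum_op_mult_left, simp, simp, subst sum_op_mult_right) auto
qed

lemma ptrace_last_contract: "ptrace_last m n \<rho> = contract_right m n (1\<^sub>m n) \<rho>"
proof -
  have "(\<Sum>b<n. \<Sum>b'<n. 1\<^sub>m n $$ (b', b) * \<rho> $$ (a * n + b, a' * n + b')) = (\<Sum>c<n. \<rho> $$ (a * n + c, a' * n + c))" for a a'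
  proof (intro sum.cong refl)
    fix b assume b: "b \<in> {..<n}"
    have "(\<Sum>b'<n. 1\<^sub>m n $$ (b', b) * \<rho> $$ (a * n + b, a' * n + b')) = (\<Sum>b'<n. if b' = b then \<rho> $$ (a * n + b, a' * n + b) else 0)"
      using b by (intro sum.cong refl) auto
    then show "(\<Sum>b'<n. 1\<^sub>m n $$ (b', b) * \<rho> $$ (a * n + b, a' * n + b')) = \<rho> $$ (a * n + b, a' * n + b)" using b by simp
  qed
  then show ?thesis by (auto simp: ptrace_last_def contract_right_def)
qed

lemma tr_ptrace_last:
  assumes "\<rho> \<in> carrier_mat (m * n) (m * n)" "Z \<in> carrier_mat m m"
  shows "tr (ptrace_last m n \<rho> * Z) = tr (\<rho> * (Z \<otimes>\<^sub>m 1\<^sub>m n))"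
  unfolding ptrace_last_contract using assms by (intro tr_contract_right) auto

lemma ptrace_last_states:
  assumes "\<rho> \<in> states (m * n)" shows "ptrace_last m n \<rho> \<in> states m"
proof -
  have "tr (ptrace_last m n \<rho> * 1\<^sub>m m) = tr (\<rho> * (1\<^sub>m m \<otimes>\<^sub>m 1\<^sub>m n))"
    by (rule tr_ptrace_last) (use statesD[OF assms] in auto)
  moreover have "dim_col (ptrace_last m n \<rho>) = m" by (simp add: ptrace_last_def)
  ultimately show ?thesis using statesD[OF assms] psd_contract_right_one[of m n \<rho>]
    by (simp add: states_def tensor_one) (simp add: ptrace_last_contract)
qed

lemma log_jensen_povm:
  fixes n :: nat
  assumes "pos_semidef n \<rho>" "M \<in> ALL_povms n" "\<And>z. f z > 0"
    and "is_spec n (sum_op n (\<lambda>z. complex_of_real (f z) \<cdot>\<^sub>m M ! z) {..<length M}) W g"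
  shows "(\<Sum>z<length M. Re (tr (\<rho> * M ! z)) * ln (f z)) \<le> Re (tr (\<rho> * (W * real_diag n (\<lambda>i. ln (g i)) * adj W)))"
  by (rule log_jensen[OF assms(1) _ _ _ assms(4)])
    (use assms povm_carrier povm_sum spec_pos_of_povm[OF _ _ _ assms(4)] in auto)

lemma tr_sum_op_mult:
  assumes "dim_row A = n" "dim_col A = n" "\<And>x. x \<in> X \<Longrightarrow> F x \<in> carrier_mat n n"
  shows "tr (sum_op n F X * A) = (\<Sum>x\<in>X. tr (F x * A))"
proof -
  have "tr (sum_op n F X * A) = tr (A * sum_op n F X)" using assms by (intro tr_rot) auto
  also have "\<dots> = (\<Sum>x\<in>X. tr (A * F x))" by (rule tr_mult_sum_op) (use assms in auto)
  also have "\<dots> = (\<Sum>x\<in>X. tr (F x * A))" by (intro sum.cong refl tr_rot) (use assms in auto)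
  finally show ?thesis .
qed

lemma tr_tensor_mult_tensor:
  assumes "A \<in> carrier_mat m m" "F \<in> carrier_mat m m" "B \<in> carrier_mat n n" "G \<in> carrier_mat n n"
  shows "tr ((A \<otimes>\<^sub>m B) * (F \<otimes>\<^sub>m G)) = tr (A * F) * tr (B * G)"
  using assms by (subst tensor_mult) (auto simp: tr_tensor)

lemma tr_mult_weighted_sum_op:
  assumes "dim_row A = n" "dim_col A = n" "\<And>z. z \<in> X \<Longrightarrow> F z \<in> carrier_mat n n"
  shows "tr (A * sum_op n (\<lambda>z. complex_of_real (f z) \<cdot>\<^sub>m F z) X) = (\<Sum>z\<in>X. complex_of_real (f z) * tr (A * F z))"
proof -
  have "tr (A * sum_op n (\<lambda>z. complex_of_real (f z) \<cdot>\<^sub>m F z) X) = (\<Sum>z\<in>X. tr (A * (complex_of_real (f z) \<cdot>\<^sub>m F z)))"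
    using assms by (intro tr_mult_sum_op) auto
  also have "\<dots> = (\<Sum>z\<in>X. complex_of_real (f z) * tr (A * F z))"
    using assms by (intro sum.cong refl) (simp add: mult_smult_distrib[of _ n n _ n] tr_smult[of _ n])
  finally show ?thesis .
qed

lemma is_spec_one: "is_spec n (1\<^sub>m n) (1\<^sub>m n) (\<lambda>_. 1)"
  by (auto simp: is_spec_def unitary_mat_def intro!: eq_matI)

text \<open>Tracing out B is the instrument with the single effect 1, so the general Kraus facts
  apply.\<close>

lemma ptrace_mid_states:
  assumes \<rho>: "\<rho> \<in> states (dA * (dB * dC))"
  shows "ptrace_mid dA dB dC \<rho> \<in> states (dA * dC)"
proof -
  have one: "sum_op dB (\<lambda>x. 1\<^sub>m dB * adj (1\<^sub>m dB)) {..<1::nat} = 1\<^sub>m dB" by (auto intro!: eq_matI)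
  let ?K = "kraus (dA * dC) (bra_mid dA dB dC (1\<^sub>m dB)) dB \<rho>"
  have "sum_op (dA * dC) (\<lambda>x. ?K) {..<1::nat} = ptrace_mid dA dB dC \<rho>"
    using one by (intro sum_kraus_bra_mid statesD[OF \<rho>]) auto
  moreover have "sum_op (dA * dC) (\<lambda>x. ?K) {..<1::nat} = ?K" by (auto intro!: eq_matI)
  ultimately have K: "ptrace_mid dA dB dC \<rho> = ?K" by simp
  have "tr (?K * (1\<^sub>m dA \<otimes>\<^sub>m 1\<^sub>m dC)) = tr (\<rho> * (1\<^sub>m dA \<otimes>\<^sub>m (1\<^sub>m dB * adj (1\<^sub>m dB)) \<otimes>\<^sub>m 1\<^sub>m dC))"
    by (rule tr_kraus_bra_mid[OF statesD(3)[OF \<rho>]]) auto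
  then have "tr ?K = 1" using statesD[OF \<rho>] by (simp add: tensor_one)
  moreover have "pos_semidef (dA * dC) ?K" by (rule psd_kraus[OF statesD(1)[OF \<rho>]]) auto
  ultimately show ?thesis by (simp add: states_def K)
qed

text \<open>All terms that mix A with the rest are controlled through one-way structure: conditioned
  on the outcome x of B, the effects on A form a POVM, so Jensen can be applied outcome by outcome,
  while the reference \<tau> gathers all outcomes into one separable operator for the second
  measurement.\<close>

lemma monogamy_lower_bound:
  assumes \<rho>: "\<rho> \<in> states (dA * (dB * dC))" and \<sigma>: "\<sigma> \<in> Sep dA (dB * dC)"
    and r1: "ereal r1 < E_LOCC1 dA dB (ptrace_last (dA * dB) dC \<rho>)"
    and r2: "ereal r2 < E_ALL dA dC (ptrace_mid dA dB dC \<rho>)"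
  shows "ereal (r1 + r2) \<le> rel_entropy \<rho> \<sigma>"
proof -
  define \<rho>AB where "\<rho>AB = ptrace_last (dA * dB) dC \<rho>"
  define \<rho>AC where "\<rho>AC = ptrace_mid dA dB dC \<rho>"
  note [simp] = statesD(4,5)[OF \<rho>]
  have \<sigma>s: "\<sigma> \<in> states (dA * (dB * dC))" and \<sigma>c: "sep_cone dA (dB * dC) \<sigma>" using \<sigma> by (auto simp: Sep_iff)
  note [simp] = statesD(4,5)[OF \<sigma>s]
  obtain m :: nat and YA Y where Y: "\<And>y. y < m \<Longrightarrow> pos_semidef dA (YA y)" "\<And>y. y < m \<Longrightarrow> pos_semidef (dB * dC) (Y y)"
    and \<sigma>Y: "\<sigma> = sum_op (dA * (dB * dC)) (\<lambda>y. YA y \<otimes>\<^sub>m Y y) {..<m}"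
    using \<sigma>c unfolding sep_cone_def by blast
  have [simp]: "dim_row (YA y) = dA" "dim_col (YA y) = dA" "dim_row (Y y) = dB * dC" "dim_col (Y y) = dB * dC" if "y < m" for y
    using psd_carrier[OF Y(1)[OF that]] psd_carrier[OF Y(2)[OF that]] by auto
  have \<rho>': "\<rho> \<in> states (dA * dB * dC)" using \<rho> by (simp add: mult.assoc)
  have \<rho>ABs: "\<rho>AB \<in> states (dA * dB)" unfolding \<rho>AB_def by (rule ptrace_last_states[OF \<rho>'])
  note [simp] = statesD(4,5)[OF \<rho>ABs]
  \<comment> \<open>The marginal of \<sigma> on AB, assembled from the product decomposition so that
    separability across A:B is visible.\<close>
  define \<sigma>AB where "\<sigma>AB = sum_op (dA * dB) (\<lambda>y. YA y \<otimes>\<^sub>m contract_right dB dC (1\<^sub>m dC) (Y y)) {..<m}"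
  have [simp]: "dim_row \<sigma>AB = dA * dB" "dim_col \<sigma>AB = dA * dB" by (simp_all add: \<sigma>AB_def)
  have \<sigma>ABc: "sep_cone dA dB \<sigma>AB" unfolding \<sigma>AB_def
    by (intro sep_cone_sum_op sep_cone_tensor) (auto intro!: Y psd_contract_right_one)
  have tr\<sigma>AB: "tr (\<sigma>AB * (F \<otimes>\<^sub>m Q)) = tr (\<sigma> * (F \<otimes>\<^sub>m Q \<otimes>\<^sub>m 1\<^sub>m dC))"
    if "F \<in> carrier_mat dA dA" "Q \<in> carrier_mat dB dB" for F Q
  proof -
    note [simp] = carrier_matD[OF that(1)] carrier_matD[OF that(2)]
    have "tr (\<sigma>AB * (F \<otimes>\<^sub>m Q)) = (\<Sum>y<m. tr ((YA y \<otimes>\<^sub>m contract_right dB dC (1\<^sub>m dC) (Y y)) * (F \<otimes>\<^sub>m Q)))"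
      unfolding \<sigma>AB_def by (rule tr_sum_op_mult) auto
    also have "\<dots> = (\<Sum>y<m. tr ((YA y \<otimes>\<^sub>m Y y) * (F \<otimes>\<^sub>m Q \<otimes>\<^sub>m 1\<^sub>m dC)))"
    proof (intro sum.cong refl)
      fix y assume "y \<in> {..<m}"
      then have [simp]: "y < m" by simp
      have "tr (contract_right dB dC (1\<^sub>m dC) (Y y) * Q) = tr (Y y * (Q \<otimes>\<^sub>m 1\<^sub>m dC))" by (rule tr_contract_right) auto
      then show "tr ((YA y \<otimes>\<^sub>m contract_right dB dC (1\<^sub>m dC) (Y y)) * (F \<otimes>\<^sub>m Q)) = tr ((YA y \<otimes>\<^sub>m Y y) * (F \<otimes>\<^sub>m Q \<otimes>\<^sub>m 1\<^sub>m dC))"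
        by (simp add: tr_tensor_mult_tensor[of _ dA _ _ dB] tr_tensor_mult_tensor[of _ dA _ _ "dB * dC"])
    qed
    also have "\<dots> = tr (\<sigma> * (F \<otimes>\<^sub>m Q \<otimes>\<^sub>m 1\<^sub>m dC))"
      unfolding \<sigma>Y by (rule tr_sum_op_mult[symmetric]) auto
    finally show ?thesis .
  qed
  have "tr \<sigma>AB = tr (\<sigma>AB * (1\<^sub>m dA \<otimes>\<^sub>m 1\<^sub>m dB))" by (simp add: tensor_one)
  also have "\<dots> = tr \<sigma>" by (subst tr\<sigma>AB) (auto simp: tensor_one)
  finally have tr1: "Re (tr \<sigma>AB) \<le> 1" using statesD(2)[OF \<sigma>s] by simp
  obtain M f where M: "M \<in> LOCC1_povms dA dB" and f: "\<And>z. f z > 0"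
    and fs: "(\<Sum>z<length M. Re (tr (\<sigma>AB * M ! z)) * f z) \<le> 1"
    and fr: "r1 \<le> (\<Sum>z<length M. Re (tr (\<rho>AB * M ! z)) * ln (f z))"
    by (rule E_meas_witness[OF LOCC1_subset_ALL \<rho>ABs \<sigma>ABc tr1 r1[unfolded E_LOCC1_def \<rho>AB_def[symmetric]]]) blast
  obtain N :: nat and QA QB where MD: "\<forall>x<N. pos_semidef dB (QB x)" "\<forall>x<N. \<forall>z<length M. pos_semidef dA (QA z x)"
    "sum_op dB QB {..<N} = 1\<^sub>m dB" "\<forall>x<N. sum_op dA (\<lambda>z. QA z x) {..<length M} = 1\<^sub>m dA"
    "\<forall>z<length M. M ! z = sum_op (dA * dB) (\<lambda>x. QA z x \<otimes>\<^sub>m QB x) {..<N}"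
    using M unfolding LOCC1_povms_def by blast
  have QB: "\<And>x. x < N \<Longrightarrow> pos_semidef dB (QB x)"
    and QA: "\<And>x z. x < N \<Longrightarrow> z < length M \<Longrightarrow> pos_semidef dA (QA z x)" and QB1: "sum_op dB QB {..<N} = 1\<^sub>m dB"
    and QA1: "\<And>x. x < N \<Longrightarrow> sum_op dA (\<lambda>z. QA z x) {..<length M} = 1\<^sub>m dA"
    and Mz: "\<And>z. z < length M \<Longrightarrow> M ! z = sum_op (dA * dB) (\<lambda>x. QA z x \<otimes>\<^sub>m QB x) {..<N}"
    using MD by simp_all
  have [simp]: "dim_row (QA z x) = dA" "dim_col (QA z x) = dA" if "x < N" "z < length M" for x z
    using psd_carrier[OF QA[OF that]] by auto
  have [simp]: "dim_row (QB x) = dB" "dim_col (QB x) = dB" if "x < N" for x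
    using psd_carrier[OF QB[OF that]] by auto
  have "\<forall>x\<in>{..<N}. \<exists>R. R \<in> carrier_mat dB dB \<and> QB x = R * adj R"
  proof
    fix x assume "x \<in> {..<N}"
    then have "pos_semidef dB (QB x)" using QB by simp
    then show "\<exists>R. R \<in> carrier_mat dB dB \<and> QB x = R * adj R" by (rule psd_factor) blast
  qed
  then obtain R where R: "\<And>x. x < N \<Longrightarrow> R x \<in> carrier_mat dB dB" and QR: "\<And>x. x < N \<Longrightarrow> QB x = R x * adj (R x)"
    by (metis lessThan_iff)
  have one: "sum_op dB (\<lambda>x. R x * adj (R x)) {..<N} = 1\<^sub>m dB"
    unfolding QB1[symmetric] using QR by (intro sum_op_cong) auto
  let ?n = "dA * dC"
  define rx where "rx x = kraus ?n (bra_mid dA dB dC (R x)) dB \<rho>" for x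
  define sx where "sx x = kraus ?n (bra_mid dA dB dC (R x)) dB \<sigma>" for x
  have [simp]: "dim_row (rx x) = ?n" "dim_col (rx x) = ?n" "dim_row (sx x) = ?n" "dim_col (sx x) = ?n" for x
    by (simp_all add: rx_def sx_def)
  have rxp: "pos_semidef ?n (rx x)" for x
    unfolding rx_def by (rule psd_kraus[OF statesD(1)[OF \<rho>]]) auto
  have sxp: "pos_semidef ?n (sx x)" for x
    unfolding sx_def by (rule psd_kraus[OF statesD(1)[OF \<sigma>s]]) auto
  have mono: "(\<Sum>x<N. rel_entropy (rx x) (sx x)) \<le> rel_entropy \<rho> \<sigma>"
    unfolding rx_def sx_def
    by (rule rel_entropy_kraus[OF statesD(1)[OF \<rho>] statesD(1)[OF \<sigma>s] _ sum_bra_mid[OF R one]]) auto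
  have \<rho>ACs: "\<rho>AC = sum_op ?n rx {..<N}"
    unfolding \<rho>AC_def rx_def[abs_def] by (rule sum_kraus_bra_mid[OF _ R one, symmetric]) auto
  have trrx: "tr (rx x * (F \<otimes>\<^sub>m 1\<^sub>m dC)) = tr (\<rho>AB * (F \<otimes>\<^sub>m QB x))" if "x < N" "F \<in> carrier_mat dA dA" for x F
  proof -
    have "tr (rx x * (F \<otimes>\<^sub>m 1\<^sub>m dC)) = tr (\<rho> * (F \<otimes>\<^sub>m (R x * adj (R x)) \<otimes>\<^sub>m 1\<^sub>m dC))"
      unfolding rx_def by (rule tr_kraus_bra_mid[OF _ R[OF that(1)] that(2)]) simp
    also have "\<dots> = tr (\<rho> * ((F \<otimes>\<^sub>m QB x) \<otimes>\<^sub>m 1\<^sub>m dC))" by (simp add: tensor_assoc QR[OF that(1)])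
    also have "\<dots> = tr (\<rho>AB * (F \<otimes>\<^sub>m QB x))"
      unfolding \<rho>AB_def by (rule tr_ptrace_last[symmetric]) (use that in \<open>auto simp: mult.assoc\<close>)
    finally show ?thesis .
  qed
  have trsx: "tr (sx x * (F \<otimes>\<^sub>m 1\<^sub>m dC)) = tr (\<sigma>AB * (F \<otimes>\<^sub>m QB x))" if "x < N" "F \<in> carrier_mat dA dA" for x F
  proof -
    have "tr (sx x * (F \<otimes>\<^sub>m 1\<^sub>m dC)) = tr (\<sigma> * (F \<otimes>\<^sub>m (R x * adj (R x)) \<otimes>\<^sub>m 1\<^sub>m dC))"
      unfolding sx_def by (rule tr_kraus_bra_mid[OF _ R[OF that(1)] that(2)]) simp
    also have "\<dots> = tr (\<sigma>AB * (F \<otimes>\<^sub>m QB x))"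
      by (subst tr\<sigma>AB) (use that QR[OF that(1)] R[OF that(1)] in auto)
    finally show ?thesis .
  qed
  have sum_tr_rx: "(\<Sum>x<N. tr (rx x)) = 1"
  proof -
    have "tr (rx x) = tr (\<rho>AB * (1\<^sub>m dA \<otimes>\<^sub>m QB x))" if "x < N" for x
      using trrx[OF that, of "1\<^sub>m dA"] by (simp add: tensor_one)
    then have "(\<Sum>x<N. tr (rx x)) = (\<Sum>x<N. tr (\<rho>AB * (1\<^sub>m dA \<otimes>\<^sub>m QB x)))" by simp
    also have "\<dots> = tr (\<rho>AB * sum_op (dA * dB) (\<lambda>x. 1\<^sub>m dA \<otimes>\<^sub>m QB x) {..<N})"
      by (rule tr_mult_sum_op[symmetric]) auto
    also have "sum_op (dA * dB) (\<lambda>x. 1\<^sub>m dA \<otimes>\<^sub>m QB x) {..<N} = 1\<^sub>m (dA * dB)"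
      by (subst sum_op_tensor_right[symmetric]) (auto simp: QB1 tensor_one)
    finally show ?thesis using statesD(2)[OF \<rho>ABs] by simp
  qed
  have \<rho>ACst: "\<rho>AC \<in> states ?n"
    unfolding states_def \<rho>ACs using rxp sum_tr_rx by (auto intro!: psd_sum_op simp: tr_sum_op)
  \<comment> \<open>The weighted average of the effects on A after outcome x; the value of f
    conditioned on x is its expectation.\<close>
  define F where "F x = sum_op dA (\<lambda>z. complex_of_real (f z) \<cdot>\<^sub>m QA z x) {..<length M}" for x
  have [simp]: "dim_row (F x) = dA" "dim_col (F x) = dA" for x by (simp_all add: F_def)
  have "\<forall>x\<in>{..<N}. \<exists>V g. is_spec dA (F x) V g \<and> (\<forall>i<dA. 0 < g i)"
  proof
    fix x assume "x \<in> {..<N}"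
    then have x: "x < N" by simp
    have "pos_semidef dA (F x)" unfolding F_def by (rule sum_op_psd_povm) (use QA x f in auto)
    then obtain V g where s: "is_spec dA (F x) V g" by (rule psd_spec)
    have "0 < g i" if "i < dA" for i
      by (rule spec_pos_of_povm[OF _ QA1[OF x] _ s[unfolded F_def] that]) (use QA x f in auto)
    then show "\<exists>V g. is_spec dA (F x) V g \<and> (\<forall>i<dA. 0 < g i)" using s by blast
  qed
  then obtain V g where Vg: "\<And>x. x < N \<Longrightarrow> is_spec dA (F x) (V x) (g x)" and g: "\<And>x i. x < N \<Longrightarrow> i < dA \<Longrightarrow> 0 < g x i"
    by (metis lessThan_iff)
  have [simp]: "dim_row (V x) = dA" "dim_col (V x) = dA" if "x < N" for x using is_specD(3,4)[OF Vg[OF that]] by auto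
  have Vu: "unitary_mat dA (V x)" if "x < N" for x using is_specD(1)[OF Vg[OF that]] .
  \<comment> \<open>Eigenvalues of K = F_x^-1. With this choice - log K is log F_x, as Jensen wants
    it, and the trace of \<open>T x\<close> is tr (\<sigma>_x F_x), as the constraint on f wants
    it.\<close>
  define k where "k x i = 1 / g x i" for x i
  define T where "T x = dlog_map ?n (V x \<otimes>\<^sub>m 1\<^sub>m dC) (\<lambda>i. k x (i div dC)) (sx x)" for x
  have VCu: "unitary_mat ?n (V x \<otimes>\<^sub>m 1\<^sub>m dC)" if "x < N" for x
    by (rule unitary_tensor[OF Vu[OF that] is_specD(1)[OF is_spec_one]])
  have FCs: "is_spec ?n (F x \<otimes>\<^sub>m 1\<^sub>m dC) (V x \<otimes>\<^sub>m 1\<^sub>m dC) (\<lambda>i. g x (i div dC))" if "x < N" for x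
    using is_spec_tensor[OF Vg[OF that] is_spec_one, of dC] by simp
  have Tc: "sep_cone dA dC (T x)" if x: "x < N" for x
  proof -
    note [simp] = x carrier_matD[OF R[OF x]]
    have sxY: "sx x = sum_op ?n (\<lambda>y. YA y \<otimes>\<^sub>m contract_left dB dC (QB x) (Y y)) {..<m}"
    proof -
      have "sx x = sum_op ?n (\<lambda>y. kraus ?n (bra_mid dA dB dC (R x)) dB (YA y \<otimes>\<^sub>m Y y)) {..<m}"
        unfolding sx_def \<sigma>Y by (rule kraus_sum_op) auto
      also have "\<dots> = sum_op ?n (\<lambda>y. YA y \<otimes>\<^sub>m contract_left dB dC (QB x) (Y y)) {..<m}"
        by (intro sum_op_cong, subst kraus_bra_mid_tensor) (auto simp: QR)
      finally show ?thesis .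
    qed
    have "T x = sum_op ?n (\<lambda>y. dlog_map ?n (V x \<otimes>\<^sub>m 1\<^sub>m dC) (\<lambda>i. k x (i div dC)) (YA y \<otimes>\<^sub>m contract_left dB dC (QB x) (Y y))) {..<m}"
      unfolding T_def sxY by (rule dlog_map_sum_op) auto
    also have "\<dots> = sum_op ?n (\<lambda>y. dlog_map dA (V x) (k x) (YA y) \<otimes>\<^sub>m contract_left dB dC (QB x) (Y y)) {..<m}"
      by (intro sum_op_cong dlog_map_tensor[OF Vu[OF x]]) auto
    finally show ?thesis
      by (simp, intro sep_cone_sum_op sep_cone_tensor psd_dlog_map[OF _ Vu[OF x]] psd_contract_left)
        (use Y QB g in \<open>auto simp: k_def\<close>)
  qed
  have [simp]: "dim_row (T x) = ?n" "dim_col (T x) = ?n" if "x < N" for x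
    using psd_carrier[OF sep_cone_psd[OF Tc[OF that]]] by auto
  have trT: "tr (T x) = tr (\<sigma>AB * (F x \<otimes>\<^sub>m QB x))" if x: "x < N" for x
  proof -
    note [simp] = x
    have "tr (T x) = tr (sx x * ((V x \<otimes>\<^sub>m 1\<^sub>m dC) * real_diag ?n (\<lambda>i. 1 / k x (i div dC)) * adj (V x \<otimes>\<^sub>m 1\<^sub>m dC)))"
      unfolding T_def by (rule tr_dlog_map[OF VCu[OF x]]) simp
    also have "(V x \<otimes>\<^sub>m 1\<^sub>m dC) * real_diag ?n (\<lambda>i. 1 / k x (i div dC)) * adj (V x \<otimes>\<^sub>m 1\<^sub>m dC) = F x \<otimes>\<^sub>m 1\<^sub>m dC"
      unfolding is_specD(2)[OF FCs[OF x]] by (simp add: k_def)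
    also have "tr (sx x * (F x \<otimes>\<^sub>m 1\<^sub>m dC)) = tr (\<sigma>AB * (F x \<otimes>\<^sub>m QB x))" by (rule trsx) auto
    finally show ?thesis .
  qed
  have trM: "(\<Sum>x<N. tr (A * (QA z x \<otimes>\<^sub>m QB x))) = tr (A * M ! z)" if "dim_row A = dA * dB" "dim_col A = dA * dB" "z < length M" for A z
    unfolding Mz[OF that(3)] by (rule tr_mult_sum_op[symmetric]) (use that in auto)
  \<comment> \<open>Summing over x matters: a single second measurement has to serve all outcomes,
    since the marginal on AC remembers none of them.\<close>
  define \<tau> where "\<tau> = sum_op ?n T {..<N}"
  have \<tau>c: "sep_cone dA dC \<tau>" unfolding \<tau>_def by (rule sep_cone_sum_op) (use Tc in auto)
  have "tr \<tau> = (\<Sum>x<N. tr (T x))" unfolding \<tau>_def by (rule tr_sum_op) auto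
  also have "\<dots> = (\<Sum>x<N. \<Sum>z<length M. complex_of_real (f z) * tr (\<sigma>AB * (QA z x \<otimes>\<^sub>m QB x)))"
  proof (intro sum.cong refl)
    fix x assume "x \<in> {..<N}"
    then have [simp]: "x < N" by simp
    have "F x \<otimes>\<^sub>m QB x = sum_op (dA * dB) (\<lambda>z. complex_of_real (f z) \<cdot>\<^sub>m (QA z x \<otimes>\<^sub>m QB x)) {..<length M}"
      unfolding F_def by (subst sum_op_tensor_left) (auto simp: smult_tensor intro!: sum_op_cong)
    then show "tr (T x) = (\<Sum>z<length M. complex_of_real (f z) * tr (\<sigma>AB * (QA z x \<otimes>\<^sub>m QB x)))"
      unfolding trT[OF \<open>x < N\<close>] by (simp, intro tr_mult_weighted_sum_op) auto
  qed
  also have "\<dots> = (\<Sum>z<length M. \<Sum>x<N. complex_of_real (f z) * tr (\<sigma>AB * (QA z x \<otimes>\<^sub>m QB x)))" by (rule sum.swap)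
  also have "\<dots> = (\<Sum>z<length M. complex_of_real (f z) * tr (\<sigma>AB * M ! z))"
    by (intro sum.cong refl) (simp add: trM flip: sum_distrib_left)
  finally have tr2: "Re (tr \<tau>) \<le> 1" using fs by (simp add: mult.commute)
  obtain P h where P: "P \<in> ALL_povms ?n" and h: "\<And>z. h z > 0"
    and hs: "(\<Sum>z<length P. Re (tr (\<tau> * P ! z)) * h z) \<le> 1"
    and hr: "r2 \<le> (\<Sum>z<length P. Re (tr (\<rho>AC * P ! z)) * ln (h z))"
    by (rule E_meas_witness[OF order_refl \<rho>ACst \<tau>c tr2 r2[unfolded E_ALL_def \<rho>AC_def[symmetric]]]) blast
  have [simp]: "dim_row (P ! z) = ?n" "dim_col (P ! z) = ?n" if "z < length P" for z
    using psd_carrier[OF povm_carrier[OF P that]] by auto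
  \<comment> \<open>The average of the second weights; its logarithm is the remaining free operator
    in Lieb's inequality and is the same for every x.\<close>
  define G where "G = sum_op ?n (\<lambda>z. complex_of_real (h z) \<cdot>\<^sub>m P ! z) {..<length P}"
  have [simp]: "dim_row G = ?n" "dim_col G = ?n" by (simp_all add: G_def)
  have "pos_semidef ?n G" unfolding G_def by (rule sum_op_psd_povm) (use povm_carrier[OF P] h in auto)
  then obtain W e where We: "is_spec ?n G W e" by (rule psd_spec)
  have e: "0 < e i" if "i < ?n" for i
    by (rule spec_pos_of_povm[OF _ povm_sum[OF P] _ We[unfolded G_def] that]) (use povm_carrier[OF P] h in auto)
  note [simp] = is_specD(3,4)[OF We]
  have logG: "log_op G = W * real_diag ?n (\<lambda>i. ln (e i)) * adj W"
  proof -
    have "real_diag ?n (\<lambda>i. ln_supp (e i)) = real_diag ?n (\<lambda>i. ln (e i))"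
      using e by (intro real_diag_cong) (simp add: ln_supp_def)
    then show ?thesis by (simp add: log_op_spec[OF We])
  qed
  define l where "l x = (\<Sum>z<length M. Re (tr (\<rho>AB * (QA z x \<otimes>\<^sub>m QB x))) * ln (f z)) + Re (tr (rx x * log_op G)) + Re (tr (rx x))
      - Re (tr (G * T x))" for x
  have "ereal (l x) \<le> rel_entropy (rx x) (sx x)" if x: "x < N" for x
  proof -
    note [simp] = x
    have "ereal (Re (tr (rx x * ((V x \<otimes>\<^sub>m 1\<^sub>m dC) * real_diag ?n (\<lambda>i. - ln (k x (i div dC))) * adj (V x \<otimes>\<^sub>m 1\<^sub>m dC)))) 
        + Re (tr (rx x * log_op G)) + Re (tr (rx x)) - Re (tr (G * T x))) \<le> rel_entropy (rx x) (sx x)"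
      unfolding T_def by (rule lieb_inequality[OF rxp sxp VCu[OF x] _ We]) (use g e div_less_of_mult in \<open>auto simp: k_def\<close>)
    moreover have "(\<Sum>z<length M. Re (tr (\<rho>AB * (QA z x \<otimes>\<^sub>m QB x))) * ln (f z))
       \<le> Re (tr (rx x * ((V x \<otimes>\<^sub>m 1\<^sub>m dC) * real_diag ?n (\<lambda>i. - ln (k x (i div dC))) * adj (V x \<otimes>\<^sub>m 1\<^sub>m dC))))"
    proof -
      have FC: "F x \<otimes>\<^sub>m 1\<^sub>m dC = sum_op ?n (\<lambda>z. complex_of_real (f z) \<cdot>\<^sub>m (QA z x \<otimes>\<^sub>m 1\<^sub>m dC)) {..<length M}"
        unfolding F_def by (subst sum_op_tensor_left) (auto simp: smult_tensor intro!: sum_op_cong)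
      have one': "sum_op ?n (\<lambda>z. QA z x \<otimes>\<^sub>m 1\<^sub>m dC) {..<length M} = 1\<^sub>m ?n"
        by (subst sum_op_tensor_left[symmetric]) (auto simp: QA1 tensor_one)
      have "(\<Sum>z<length M. Re (tr (\<rho>AB * (QA z x \<otimes>\<^sub>m QB x))) * ln (f z)) = (\<Sum>z<length M. Re (tr (rx x * (QA z x \<otimes>\<^sub>m 1\<^sub>m dC))) * ln (f z))"
        by (intro sum.cong refl) (simp add: trrx)
      also have "\<dots> \<le> Re (tr (rx x * ((V x \<otimes>\<^sub>m 1\<^sub>m dC) * real_diag ?n (\<lambda>i. ln (g x (i div dC))) * adj (V x \<otimes>\<^sub>m 1\<^sub>m dC))))"
        by (rule log_jensen[OF rxp _ one' _ FCs[OF x, unfolded FC]]) (use QA f g div_less_of_mult in \<open>auto intro: psd_tensor\<close>)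
      also have "real_diag ?n (\<lambda>i. ln (g x (i div dC))) = real_diag ?n (\<lambda>i. - ln (k x (i div dC)))"
        using g[OF x] div_less_of_mult by (intro real_diag_cong) (auto simp: k_def ln_div)
      finally show ?thesis .
    qed
    ultimately show ?thesis unfolding l_def by (elim order_trans[rotated]) simp
  qed
  then have "(\<Sum>x<N. ereal (l x)) \<le> (\<Sum>x<N. rel_entropy (rx x) (sx x))" by (intro sum_mono) auto
  also note mono
  finally have D: "ereal (\<Sum>x<N. l x) \<le> rel_entropy \<rho> \<sigma>" by simp
  have "(\<Sum>x<N. l x) = (\<Sum>x<N. \<Sum>z<length M. Re (tr (\<rho>AB * (QA z x \<otimes>\<^sub>m QB x))) * ln (f z)) + Re (\<Sum>x<N. tr (rx x * log_op G))
     + Re (\<Sum>x<N. tr (rx x)) - Re (\<Sum>x<N. tr (G * T x))"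
    by (simp add: l_def sum.distrib sum_subtractf)
  also have "(\<Sum>x<N. \<Sum>z<length M. Re (tr (\<rho>AB * (QA z x \<otimes>\<^sub>m QB x))) * ln (f z)) = (\<Sum>z<length M. \<Sum>x<N. Re (tr (\<rho>AB * (QA z x \<otimes>\<^sub>m QB x))) * ln (f z))"
    by (rule sum.swap)
  also have "\<dots> = (\<Sum>z<length M. Re (tr (\<rho>AB * M ! z)) * ln (f z))"
    by (intro sum.cong refl) (simp add: trM[symmetric] sum_distrib_right)
  also have "(\<Sum>x<N. tr (rx x * log_op G)) = tr (\<rho>AC * log_op G)"
    unfolding \<rho>ACs by (rule tr_sum_op_mult[symmetric]) (auto simp: logG)
  also have "(\<Sum>x<N. tr (rx x)) = 1" by (rule sum_tr_rx)
  also have "(\<Sum>x<N. tr (G * T x)) = tr (G * \<tau>)"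
    unfolding \<tau>_def by (rule tr_mult_sum_op[symmetric]) auto
  also have "tr (G * \<tau>) = tr (\<tau> * G)" by (rule tr_rot) (auto simp: \<tau>_def)
  also have "\<dots> = (\<Sum>z<length P. complex_of_real (h z) * tr (\<tau> * P ! z))"
    unfolding G_def by (rule tr_mult_weighted_sum_op) (auto simp: \<tau>_def)
  finally have L: "(\<Sum>x<N. l x) = (\<Sum>z<length M. Re (tr (\<rho>AB * M ! z)) * ln (f z)) + Re (tr (\<rho>AC * log_op G)) + 1 - (\<Sum>z<length P. Re (tr (\<tau> * P ! z)) * h z)"
    by (simp add: mult.commute)
  have "(\<Sum>z<length P. Re (tr (\<rho>AC * P ! z)) * ln (h z)) \<le> Re (tr (\<rho>AC * log_op G))"
    unfolding logG by (rule log_jensen_povm[OF statesD(1)[OF \<rho>ACst] P h We[unfolded G_def]])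
  \<comment> \<open>The constraint on h makes the leftover 1 - tr \<tau> G nonnegative.\<close>
  then have "r1 + r2 \<le> (\<Sum>x<N. l x)" using fr hr hs unfolding L by linarith
  then show ?thesis using D by (meson ereal_less_eq(3) order_trans)
qed

theorem monogamy:
  assumes \<rho>: "\<rho> \<in> states (dA * (dB * dC))"
  shows "E_LOCC1 dA dB (ptrace_last (dA * dB) dC \<rho>) + E_ALL dA dC (ptrace_mid dA dB dC \<rho>) \<le> E_rel dA (dB * dC) \<rho>"
  unfolding E_rel_def
proof (rule INF_greatest)
  fix \<sigma> assume "\<sigma> \<in> Sep dA (dB * dC)"
  moreover have "\<rho> \<in> states (dA * dB * dC)" using \<rho> by (simp add: mult.assoc)
  then have "ptrace_last (dA * dB) dC \<rho> \<in> states (dA * dB)" by (rule ptrace_last_states)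
  ultimately show "E_LOCC1 dA dB (ptrace_last (dA * dB) dC \<rho>) + E_ALL dA dC (ptrace_mid dA dB dC \<rho>) \<le> rel_entropy \<rho> \<sigma>"
    using ptrace_mid_states[OF \<rho>] monogamy_lower_bound[OF \<rho>]
    by (intro ereal_add_le_of_less) (auto simp: E_LOCC1_def E_ALL_def intro!: E_meas_nonneg trivial_povm_ALL trivial_povm_LOCC1)
qed

subsection \<open>Relabelling of basis vectors\<close>

definition reindex :: "nat \<Rightarrow> (nat \<Rightarrow> nat) \<Rightarrow> complex mat \<Rightarrow> complex mat" where
  "reindex n \<pi> X = mat n n (\<lambda>(i, j). X $$ (\<pi> i, \<pi> j))"

definition perm_mat :: "nat \<Rightarrow> (nat \<Rightarrow> nat) \<Rightarrow> complex mat" where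
  "perm_mat n \<pi> = mat n n (\<lambda>(i, j). if j = \<pi> i then 1 else 0)"

lemma reindex_dim [simp]: "dim_row (reindex n \<pi> X) = n" "dim_col (reindex n \<pi> X) = n"
  by (simp_all add: reindex_def)

lemma perm_mat_dim [simp]: "dim_row (perm_mat n \<pi>) = n" "dim_col (perm_mat n \<pi>) = n"
  by (simp_all add: perm_mat_def)

lemma reindex_conj:
  assumes \<pi>: "\<And>i. i < n \<Longrightarrow> \<pi> i < n" and X: "X \<in> carrier_mat n n"
  shows "reindex n \<pi> X = perm_mat n \<pi> * X * adj (perm_mat n \<pi>)"
proof (rule eq_matI)
  fix i j assume "i < dim_row (perm_mat n \<pi> * X * adj (perm_mat n \<pi>))" "j < dim_col (perm_mat n \<pi> * X * adj (perm_mat n \<pi>))"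
  then have ij: "i < n" "j < n" by auto
  note [simp] = carrier_matD[OF X]
  have 1: "(perm_mat n \<pi> * X) $$ (i, l) = X $$ (\<pi> i, l)" if "l < n" for l
  proof -
    have "(perm_mat n \<pi> * X) $$ (i, l) = (\<Sum>k<n. perm_mat n \<pi> $$ (i, k) * X $$ (k, l))"
      using ij that by (subst mat_mult_index) auto
    also have "\<dots> = (\<Sum>k<n. if k = \<pi> i then X $$ (\<pi> i, l) else 0)"
      using ij by (intro sum.cong refl) (auto simp: perm_mat_def)
    finally show ?thesis using \<pi>[OF ij(1)] by simp
  qed
  have "(perm_mat n \<pi> * X * adj (perm_mat n \<pi>)) $$ (i, j) = (\<Sum>k<n. X $$ (\<pi> i, k) * adj (perm_mat n \<pi>) $$ (k, j))"
    using ij by (subst mat_mult_index) (auto simp: 1)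
  also have "\<dots> = (\<Sum>k<n. if k = \<pi> j then X $$ (\<pi> i, \<pi> j) else 0)"
    using ij by (intro sum.cong refl) (auto simp: perm_mat_def)
  finally show "reindex n \<pi> X $$ (i, j) = (perm_mat n \<pi> * X * adj (perm_mat n \<pi>)) $$ (i, j)"
    using \<pi>[OF ij(2)] ij by (simp add: reindex_def)
qed auto

lemma reindex_one:
  assumes inj: "inj_on \<pi> {..<n}" and \<pi>: "\<And>i. i < n \<Longrightarrow> \<pi> i < n"
  shows "reindex n \<pi> (1\<^sub>m n) = 1\<^sub>m n"
proof (rule eq_matI)
  fix i j assume "i < dim_row (1\<^sub>m n :: complex mat)" "j < dim_col (1\<^sub>m n :: complex mat)"
  then have ij: "i < n" "j < n" by auto
  then have "\<pi> i = \<pi> j \<longleftrightarrow> i = j" using inj_on_eq_iff[OF inj, of i j] by simp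
  then show "reindex n \<pi> (1\<^sub>m n) $$ (i, j) = 1\<^sub>m n $$ (i, j)"
    using ij \<pi>[OF ij(1)] \<pi>[OF ij(2)] by (simp add: reindex_def)
qed auto

lemma unitary_perm_mat:
  assumes \<pi>: "\<And>i. i < n \<Longrightarrow> \<pi> i < n" and inj: "inj_on \<pi> {..<n}"
  shows "unitary_mat n (perm_mat n \<pi>)"
proof -
  have "perm_mat n \<pi> * adj (perm_mat n \<pi>) = 1\<^sub>m n"
  proof -
    have "perm_mat n \<pi> * 1\<^sub>m n * adj (perm_mat n \<pi>) = reindex n \<pi> (1\<^sub>m n)"
      by (rule reindex_conj[symmetric]) (use \<pi> in auto)
    also have "\<dots> = 1\<^sub>m n" by (rule reindex_one[OF inj \<pi>])
    finally show ?thesis by simp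
  qed
  then have "unitary_mat n (adj (perm_mat n \<pi>))" by (simp add: unitary_mat_def)
  then show ?thesis using unitary_adj by fastforce
qed

lemma psd_reindex:
  assumes "\<And>i. i < n \<Longrightarrow> \<pi> i < n" "pos_semidef n X"
  shows "pos_semidef n (reindex n \<pi> X)"
  using psd_conj'[OF assms(2), of "perm_mat n \<pi>" n] reindex_conj[of n \<pi> X, OF assms(1)] psd_carrier[OF assms(2)] by simp

lemma tr_reindex_mult:
  assumes \<pi>: "\<And>i. i < n \<Longrightarrow> \<pi> i < n" and inj: "inj_on \<pi> {..<n}" and X: "X \<in> carrier_mat n n" and Y: "Y \<in> carrier_mat n n"
  shows "tr (reindex n \<pi> X * reindex n \<pi> Y) = tr (X * Y)"
proof -
  let ?P = "perm_mat n \<pi>"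
  note [simp] = carrier_matD[OF X] carrier_matD[OF Y]
  have "reindex n \<pi> X * reindex n \<pi> Y = ?P * (X * Y) * adj ?P"
    using unitary_cancel[OF unitary_perm_mat[OF \<pi> inj]]
    by (simp add: reindex_conj[OF \<pi> X] reindex_conj[OF \<pi> Y] mat_assoc)
  then have "tr (reindex n \<pi> X * reindex n \<pi> Y) = tr (adj ?P * (?P * (X * Y)))"
    by (simp add: tr_rot[of "?P * (X * Y)" "adj ?P"])
  then show ?thesis using unitary_cancel[OF unitary_perm_mat[OF \<pi> inj]] by simp
qed

lemma tr_reindex:
  assumes \<pi>: "\<And>i. i < n \<Longrightarrow> \<pi> i < n" and inj: "inj_on \<pi> {..<n}" and X: "X \<in> carrier_mat n n" 
  shows "tr (reindex n \<pi> X) = tr X"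
  using tr_reindex_mult[OF \<pi> inj X, of "1\<^sub>m n"] X by (simp add: reindex_one[OF inj \<pi>])

lemma reindex_sum_op:
  assumes \<pi>: "\<And>i. i < n \<Longrightarrow> \<pi> i < n"
  shows "reindex n \<pi> (sum_op n F X) = sum_op n (\<lambda>x. reindex n \<pi> (F x)) X"
  by (rule eq_matI) (use \<pi> in \<open>auto simp: reindex_def\<close>)

lemma reindex_states:
  assumes \<pi>: "\<And>i. i < n \<Longrightarrow> \<pi> i < n" and inj: "inj_on \<pi> {..<n}" and X: "X \<in> states n"
  shows "reindex n \<pi> X \<in> states n"
  using X psd_reindex[of n \<pi> X, OF \<pi>] tr_reindex[OF \<pi> inj statesD(3)[OF X]] by (simp add: states_def)

text \<open>Relabelling is conjugation by a permutation matrix; both eigenbases rotate together, so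
  the spectra and overlaps do not change.\<close>

lemma rel_entropy_reindex:
  assumes \<pi>: "\<And>i. i < n \<Longrightarrow> \<pi> i < n" and inj: "inj_on \<pi> {..<n}" and r: "pos_semidef n \<rho>" and s: "pos_semidef n \<sigma>"
  shows "rel_entropy (reindex n \<pi> \<rho>) (reindex n \<pi> \<sigma>) = rel_entropy \<rho> \<sigma>"
proof -
  obtain U p where A: "is_spec n \<rho> U p" and p: "\<And>i. i < n \<Longrightarrow> 0 \<le> p i" using psd_spec[OF r] by blast
  obtain V q where B: "is_spec n \<sigma> V q" and q: "\<And>i. i < n \<Longrightarrow> 0 \<le> q i" using psd_spec[OF s] by blast
  let ?P = "perm_mat n \<pi>"
  note PP = unitary_perm_mat[OF \<pi> inj]
  note [simp] = is_specD(3,4)[OF A] is_specD(3,4)[OF B]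
  have RC: "reindex n \<pi> \<rho> = ?P * \<rho> * adj ?P" "reindex n \<pi> \<sigma> = ?P * \<sigma> * adj ?P"
    using \<pi> psd_carrier[OF r] psd_carrier[OF s] by (intro reindex_conj; simp)+
  have A': "is_spec n (reindex n \<pi> \<rho>) (?P * U) p"
    unfolding RC(1) using unitary_mult[OF PP is_specD(1)[OF A]]
    by (simp add: is_spec_def adj_mult mat_assoc is_specD(2)[OF A])
  have B': "is_spec n (reindex n \<pi> \<sigma>) (?P * V) q"
    unfolding RC(2) using unitary_mult[OF PP is_specD(1)[OF B]]
    by (simp add: is_spec_def adj_mult mat_assoc is_specD(2)[OF B])
  have o: "ovl (?P * U) (?P * V) = ovl U V"
    by (rule ext)+ (simp add: ovl_def adj_mult mat_assoc unitary_cancel[OF PP])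
  have "rel_entropy (reindex n \<pi> \<rho>) (reindex n \<pi> \<sigma>) = (if \<forall>i<n. \<forall>j<n. p i * ovl (?P * U) (?P * V) i j \<noteq> 0 \<longrightarrow> q j \<noteq> 0 then ereal (Dval n (?P * U) p (?P * V) q) else \<infinity>)"
    by (rule rel_entropy_Dval[OF A' B']) (use p q in auto)
  moreover have "rel_entropy \<rho> \<sigma> = (if \<forall>i<n. \<forall>j<n. p i * ovl U V i j \<noteq> 0 \<longrightarrow> q j \<noteq> 0 then ereal (Dval n U p V q) else \<infinity>)"
    by (rule rel_entropy_Dval[OF A B]) (use p q in auto)
  ultimately show ?thesis by (simp only: o Dval_def)
qed

subsection \<open>Additivity of the relative entropy\<close>

text \<open>In Nussbaum-Szkola form both weight families have total mass 1, and the constant weight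
  f = 1 gives the bound 0.\<close>

lemma rel_entropy_nonneg:
  assumes "\<rho> \<in> states n" "\<sigma> \<in> states n" shows "0 \<le> rel_entropy \<rho> \<sigma>"
proof -
  obtain U p where A: "is_spec n \<rho> U p" and p: "\<And>i. i < n \<Longrightarrow> 0 \<le> p i" using psd_spec[OF statesD(1)[OF assms(1)]] by blast
  obtain V q where B: "is_spec n \<sigma> V q" and q: "\<And>i. i < n \<Longrightarrow> 0 \<le> q i" using psd_spec[OF statesD(1)[OF assms(2)]] by blast
  note UU = is_specD(1)[OF A] and VV = is_specD(1)[OF B]
  have sp: "(\<Sum>i<n. p i) = 1" using tr_spec[OF A] statesD(2)[OF assms(1)] by (metis of_real_eq_1_iff)
  have sq: "(\<Sum>i<n. q i) = 1" using tr_spec[OF B] statesD(2)[OF assms(2)] by (metis of_real_eq_1_iff)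
  let ?P = "\<lambda>(i, j). p i * ovl U V i j" and ?Q = "\<lambda>(i, j). q j * ovl U V i j"
  have P1: "(\<Sum>z\<in>{..<n} \<times> {..<n}. ?P z) = 1"
    by (simp add: sum.cartesian_product[symmetric] ovl_sum[OF UU VV] sp flip: sum_distrib_left)
  have "(\<Sum>z\<in>{..<n} \<times> {..<n}. ?Q z) = (\<Sum>j<n. \<Sum>i<n. q j * ovl U V i j)"
    by (subst sum.cartesian_product[symmetric], rule sum.swap)
  then have Q1: "(\<Sum>z\<in>{..<n} \<times> {..<n}. ?Q z) = 1"
    by (simp add: ovl_sum'[OF UU VV] sq flip: sum_distrib_left)
  have "ereal (\<Sum>z\<in>{..<n} \<times> {..<n}. ?P z * ln ((\<lambda>_. 1) z)) \<le> classical_rel_entropy ({..<n} \<times> {..<n}) ?P ?Q"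
    by (rule classical_rel_entropy_ge) (use p q P1 Q1 in auto)
  also have "\<dots> = rel_entropy \<rho> \<sigma>" by (rule rel_entropy_spec[OF A B, symmetric]) (use p q in auto)
  finally show ?thesis by (simp add: zero_ereal_def)
qed

text \<open>The Nussbaum-Szkola weights of a tensor product are products, so the logarithm splits
  and each factor integrates to 1 over the other. Finiteness is assumed so that the support
  conditions of both factors are at hand.\<close>

lemma rel_entropy_tensor_le:
  assumes r1: "\<rho>1 \<in> states m" and r2: "\<rho>2 \<in> states n" and s1: "pos_semidef m \<sigma>1" and s2: "pos_semidef n \<sigma>2"
    and fin: "rel_entropy \<rho>1 \<sigma>1 \<noteq> \<infinity>" "rel_entropy \<rho>2 \<sigma>2 \<noteq> \<infinity>"
  shows "rel_entropy (\<rho>1 \<otimes>\<^sub>m \<rho>2) (\<sigma>1 \<otimes>\<^sub>m \<sigma>2) = rel_entropy \<rho>1 \<sigma>1 + rel_entropy \<rho>2 \<sigma>2"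
proof -
  obtain U1 p1 where A1: "is_spec m \<rho>1 U1 p1" and p1: "\<And>i. i < m \<Longrightarrow> 0 \<le> p1 i" using psd_spec[OF statesD(1)[OF r1]] by blast
  obtain U2 p2 where A2: "is_spec n \<rho>2 U2 p2" and p2: "\<And>i. i < n \<Longrightarrow> 0 \<le> p2 i" using psd_spec[OF statesD(1)[OF r2]] by blast
  obtain V1 q1 where B1: "is_spec m \<sigma>1 V1 q1" and q1: "\<And>i. i < m \<Longrightarrow> 0 \<le> q1 i" using psd_spec[OF s1] by blast
  obtain V2 q2 where B2: "is_spec n \<sigma>2 V2 q2" and q2: "\<And>i. i < n \<Longrightarrow> 0 \<le> q2 i" using psd_spec[OF s2] by blast
  have sp1: "(\<Sum>i<m. p1 i) = 1" using tr_spec[OF A1] statesD(2)[OF r1] by (metis of_real_eq_1_iff)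
  have sp2: "(\<Sum>i<n. p2 i) = 1" using tr_spec[OF A2] statesD(2)[OF r2] by (metis of_real_eq_1_iff)
  have D1: "rel_entropy \<rho>1 \<sigma>1 = (if \<forall>i<m. \<forall>j<m. p1 i * ovl U1 V1 i j \<noteq> 0 \<longrightarrow> q1 j \<noteq> 0 then ereal (Dval m U1 p1 V1 q1) else \<infinity>)"
    by (rule rel_entropy_Dval[OF A1 B1]) (use p1 q1 in auto)
  have D2: "rel_entropy \<rho>2 \<sigma>2 = (if \<forall>i<n. \<forall>j<n. p2 i * ovl U2 V2 i j \<noteq> 0 \<longrightarrow> q2 j \<noteq> 0 then ereal (Dval n U2 p2 V2 q2) else \<infinity>)"
    by (rule rel_entropy_Dval[OF A2 B2]) (use p2 q2 in auto)
  have S1: "\<forall>i<m. \<forall>j<m. p1 i * ovl U1 V1 i j \<noteq> 0 \<longrightarrow> q1 j \<noteq> 0" using fin(1) unfolding D1 by presburger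
  have S2: "\<forall>i<n. \<forall>j<n. p2 i * ovl U2 V2 i j \<noteq> 0 \<longrightarrow> q2 j \<noteq> 0" using fin(2) unfolding D2 by presburger
  note [simp] = is_specD(3,4)[OF A1] is_specD(3,4)[OF A2] is_specD(3,4)[OF B1] is_specD(3,4)[OF B2]
  let ?U = "U1 \<otimes>\<^sub>m U2" and ?V = "V1 \<otimes>\<^sub>m V2" and ?p = "\<lambda>i. p1 (i div n) * p2 (i mod n)" and ?q = "\<lambda>i. q1 (i div n) * q2 (i mod n)"
  have o: "ovl ?U ?V i j = ovl U1 V1 (i div n) (j div n) * ovl U2 V2 (i mod n) (j mod n)" if "i < m * n" "j < m * n" for i j
    using that by (simp add: ovl_def adj_tensor tensor_mult tensor_index norm_mult power_mult_distrib)
  define P1 where "P1 i j = p1 i * ovl U1 V1 i j" for i j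
  define P2 where "P2 i j = p2 i * ovl U2 V2 i j" for i j
  have D: "rel_entropy (\<rho>1 \<otimes>\<^sub>m \<rho>2) (\<sigma>1 \<otimes>\<^sub>m \<sigma>2) = (if \<forall>i<m * n. \<forall>j<m * n. ?p i * ovl ?U ?V i j \<noteq> 0 \<longrightarrow> ?q j \<noteq> 0 then ereal (Dval (m * n) ?U ?p ?V ?q) else \<infinity>)"
    by (rule rel_entropy_Dval[OF is_spec_tensor[OF A1 A2] is_spec_tensor[OF B1 B2]]) (use p1 p2 q1 q2 div_less_of_mult in auto)
  have S: "\<forall>i<m * n. \<forall>j<m * n. ?p i * ovl ?U ?V i j \<noteq> 0 \<longrightarrow> ?q j \<noteq> 0"
  proof (intro allI impI)
    fix i j assume ij: "i < m * n" "j < m * n" and nz: "?p i * ovl ?U ?V i j \<noteq> 0"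
    then have "p1 (i div n) * ovl U1 V1 (i div n) (j div n) \<noteq> 0" "p2 (i mod n) * ovl U2 V2 (i mod n) (j mod n) \<noteq> 0"
      by (auto simp: o)
    then show "?q j \<noteq> 0"
      using S1[rule_format, OF div_less_of_mult(1)[OF ij(1)] div_less_of_mult(1)[OF ij(2)]]
        S2[rule_format, OF div_less_of_mult(2)[OF ij(1)] div_less_of_mult(2)[OF ij(2)]] by auto
  qed
  have "Dval (m * n) ?U ?p ?V ?q = (\<Sum>a<m. \<Sum>b<n. \<Sum>a'<m. \<Sum>b'<n. 
      P2 b b' * (P1 a a' * (ln (p1 a) - ln (q1 a'))) + P1 a a' * (P2 b b' * (ln (p2 b) - ln (q2 b'))))"
    unfolding Dval_def sum_prod_index
  proof (intro sum.cong refl)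
    fix a b a' b' assume ab: "a \<in> {..<m}" "b \<in> {..<n}" "a' \<in> {..<m}" "b' \<in> {..<n}"
    have e: "?p (a * n + b) = p1 a * p2 b" "?q (a' * n + b') = q1 a' * q2 b'" "ovl ?U ?V (a * n + b) (a' * n + b') = ovl U1 V1 a a' * ovl U2 V2 b b'"
      using ab by (auto simp: o index_less)
    show "?p (a * n + b) * ovl ?U ?V (a * n + b) (a' * n + b') * (ln (?p (a * n + b)) - ln (?q (a' * n + b')))
       = P2 b b' * (P1 a a' * (ln (p1 a) - ln (q1 a'))) + P1 a a' * (P2 b b' * (ln (p2 b) - ln (q2 b')))"
    proof (cases "P1 a a' = 0 \<or> P2 b b' = 0")
      case True
      then show ?thesis unfolding e by (auto simp: P1_def P2_def)
    next
      case False
      then have "p1 a > 0" "p2 b > 0" "q1 a' > 0" "q2 b' > 0"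
        using p1[of a] p2[of b] q1[of a'] q2[of b'] ab S1[rule_format, of a a'] S2[rule_format, of b b'] by (auto simp: P1_def P2_def less_le)
      then show ?thesis unfolding e by (simp add: P1_def P2_def ln_mult algebra_simps)
    qed
  qed
  also have "\<dots> = (\<Sum>b<n. \<Sum>b'<n. P2 b b') * Dval m U1 p1 V1 q1 + (\<Sum>a<m. \<Sum>a'<m. P1 a a') * Dval n U2 p2 V2 q2"
  proof -
    have "(\<Sum>a<m. \<Sum>b<n. \<Sum>a'<m. \<Sum>b'<n. P2 b b' * (P1 a a' * (ln (p1 a) - ln (q1 a'))))
      = (\<Sum>b<n. \<Sum>b'<n. P2 b b') * Dval m U1 p1 V1 q1"
    proof -
      have "(\<Sum>a<m. \<Sum>b<n. \<Sum>a'<m. \<Sum>b'<n. P2 b b' * (P1 a a' * (ln (p1 a) - ln (q1 a'))))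
        = (\<Sum>a<m. \<Sum>b<n. (\<Sum>b'<n. P2 b b') * (\<Sum>a'<m. P1 a a' * (ln (p1 a) - ln (q1 a'))))"
        by (intro sum.cong refl) (simp add: sum_distrib_left sum_distrib_right)
      then show ?thesis by (simp add: Dval_def P1_def sum_distrib_right[symmetric] sum_distrib_left[symmetric])
    qed
    moreover have "(\<Sum>a<m. \<Sum>b<n. \<Sum>a'<m. \<Sum>b'<n. P1 a a' * (P2 b b' * (ln (p2 b) - ln (q2 b'))))
      = (\<Sum>a<m. \<Sum>a'<m. P1 a a') * Dval n U2 p2 V2 q2"
    proof -
      have "(\<Sum>a<m. \<Sum>b<n. \<Sum>a'<m. \<Sum>b'<n. P1 a a' * (P2 b b' * (ln (p2 b) - ln (q2 b'))))
        = (\<Sum>a<m. \<Sum>b<n. (\<Sum>a'<m. P1 a a') * (\<Sum>b'<n. P2 b b' * (ln (p2 b) - ln (q2 b'))))"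
        by (intro sum.cong refl) (simp add: sum_distrib_left sum_distrib_right, rule sum.swap)
      then show ?thesis by (simp add: Dval_def P2_def sum_distrib_right[symmetric] sum_distrib_left[symmetric])
    qed
    ultimately show ?thesis by (simp add: sum.distrib)
  qed
  also have "(\<Sum>b<n. \<Sum>b'<n. P2 b b') = 1"
    using ovl_sum[OF is_specD(1)[OF A2] is_specD(1)[OF B2]] sp2 by (simp add: P2_def sum_distrib_left[symmetric])
  also have "(\<Sum>a<m. \<Sum>a'<m. P1 a a') = 1"
    using ovl_sum[OF is_specD(1)[OF A1] is_specD(1)[OF B1]] sp1 by (simp add: P1_def sum_distrib_left[symmetric])
  finally have "Dval (m * n) ?U ?p ?V ?q = Dval m U1 p1 V1 q1 + Dval n U2 p2 V2 q2" by simp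
  then show ?thesis using S S1 S2 by (simp only: D D1 D2 if_True) simp
qed

subsection \<open>Regrouping of tensor factors\<close>

text \<open>Relabels \<open>(A\<^sub>1 \<otimes> B\<^sub>1) \<otimes> (A\<^sub>2 \<otimes> B\<^sub>2)\<close> as \<open>(A\<^sub>1 \<otimes> A\<^sub>2) \<otimes> (B\<^sub>1 \<otimes> B\<^sub>2)\<close>.\<close>

definition regroup_ix :: "nat \<Rightarrow> nat \<Rightarrow> nat \<Rightarrow> nat \<Rightarrow> nat" where
  "regroup_ix b1 a2 b2 i = (i div (b1 * b2) div a2 * b1 + i mod (b1 * b2) div b2) * (a2 * b2)
     + (i div (b1 * b2) mod a2 * b2 + i mod (b1 * b2) mod b2)"

lemma regroup_ix_bounds:
  fixes i a1 a2 b1 b2 :: nat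
  assumes "i < (a1 * a2) * (b1 * b2)"
  shows "i div (b1 * b2) div a2 < a1" "i div (b1 * b2) mod a2 < a2" "i mod (b1 * b2) div b2 < b1" "i mod (b1 * b2) mod b2 < b2"
  using div_less_of_mult[OF assms] div_less_of_mult[of "i div (b1 * b2)" a1 a2] div_less_of_mult[of "i mod (b1 * b2)" b1 b2] by auto

lemma regroup_ix_less:
  assumes "i < (a1 * a2) * (b1 * b2)" shows "regroup_ix b1 a2 b2 i < (a1 * a2) * (b1 * b2)"
proof -
  have "regroup_ix b1 a2 b2 i < (a1 * b1) * (a2 * b2)"
    unfolding regroup_ix_def using regroup_ix_bounds[OF assms] by (intro index_less) auto
  then show ?thesis by (simp add: mult_ac)
qed

lemma regroup_ix_inj: "inj_on (regroup_ix b1 a2 b2) {..<(a1 * a2) * (b1 * b2)}"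
proof (rule inj_onI)
  fix i j assume ij: "i \<in> {..<(a1 * a2) * (b1 * b2)}" "j \<in> {..<(a1 * a2) * (b1 * b2)}" and eq: "regroup_ix b1 a2 b2 i = regroup_ix b1 a2 b2 j"
  note bi = regroup_ix_bounds[of i a1 a2 b1 b2] and bj = regroup_ix_bounds[of j a1 a2 b1 b2]
  have u: "x = x' \<and> y = y'" if "x * n + y = x' * n + y'" "y < n" "y' < n" for x y x' y' n :: nat
    using index_div_mod[of y n x] index_div_mod[of y' n x'] that by metis
  have 1: "i div (b1 * b2) div a2 * b1 + i mod (b1 * b2) div b2 = j div (b1 * b2) div a2 * b1 + j mod (b1 * b2) div b2 \<and>
    i div (b1 * b2) mod a2 * b2 + i mod (b1 * b2) mod b2 = j div (b1 * b2) mod a2 * b2 + j mod (b1 * b2) mod b2"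
    by (rule u[of _ "a2 * b2"]) (use eq bi bj ij in \<open>auto simp: regroup_ix_def index_less\<close>)
  have 2: "i div (b1 * b2) div a2 = j div (b1 * b2) div a2 \<and> i mod (b1 * b2) div b2 = j mod (b1 * b2) div b2"
    by (rule u[of _ b1]) (use 1 bi bj ij in auto)
  have 3: "i div (b1 * b2) mod a2 = j div (b1 * b2) mod a2 \<and> i mod (b1 * b2) mod b2 = j mod (b1 * b2) mod b2"
    by (rule u[of _ b2]) (use 1 bi bj ij in auto)
  show "i = j" using 2 3 by (metis div_mod_eq_iff)
qed

definition regroup :: "nat \<Rightarrow> nat \<Rightarrow> nat \<Rightarrow> nat \<Rightarrow> complex mat \<Rightarrow> complex mat \<Rightarrow> complex mat" where
  "regroup a1 b1 a2 b2 X Y = reindex ((a1 * a2) * (b1 * b2)) (regroup_ix b1 a2 b2) (X \<otimes>\<^sub>m Y)"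

lemma regroup_dim [simp]: "dim_row (regroup a1 b1 a2 b2 X Y) = a1 * a2 * (b1 * b2)" "dim_col (regroup a1 b1 a2 b2 X Y) = a1 * a2 * (b1 * b2)"
  by (simp_all add: regroup_def)

lemma regroup_tensor:
  assumes "A1 \<in> carrier_mat a1 a1" "B1 \<in> carrier_mat b1 b1" "A2 \<in> carrier_mat a2 a2" "B2 \<in> carrier_mat b2 b2"
  shows "regroup a1 b1 a2 b2 (A1 \<otimes>\<^sub>m B1) (A2 \<otimes>\<^sub>m B2) = (A1 \<otimes>\<^sub>m A2) \<otimes>\<^sub>m (B1 \<otimes>\<^sub>m B2)"
proof (rule eq_matI)
  fix i j assume "i < dim_row ((A1 \<otimes>\<^sub>m A2) \<otimes>\<^sub>m (B1 \<otimes>\<^sub>m B2))" "j < dim_col ((A1 \<otimes>\<^sub>m A2) \<otimes>\<^sub>m (B1 \<otimes>\<^sub>m B2))"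
  then have ij: "i < (a1 * a2) * (b1 * b2)" "j < (a1 * a2) * (b1 * b2)" using assms by auto
  note [simp] = carrier_matD[OF assms(1)] carrier_matD[OF assms(2)] carrier_matD[OF assms(3)] carrier_matD[OF assms(4)]
  note b = regroup_ix_bounds[OF ij(1)] regroup_ix_bounds[OF ij(2)]
  have l: "regroup_ix b1 a2 b2 k < a1 * b1 * (a2 * b2)" if "k < (a1 * a2) * (b1 * b2)" for k
    using regroup_ix_less[OF that] by (simp add: mult_ac)
  have d: "regroup_ix b1 a2 b2 k div (a2 * b2) = k div (b1 * b2) div a2 * b1 + k mod (b1 * b2) div b2"
    "regroup_ix b1 a2 b2 k mod (a2 * b2) = k div (b1 * b2) mod a2 * b2 + k mod (b1 * b2) mod b2" if "k < (a1 * a2) * (b1 * b2)" for k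
    unfolding regroup_ix_def using regroup_ix_bounds[OF that] by (auto simp: index_less)
  have "regroup a1 b1 a2 b2 (A1 \<otimes>\<^sub>m B1) (A2 \<otimes>\<^sub>m B2) $$ (i, j)
     = ((A1 \<otimes>\<^sub>m B1) \<otimes>\<^sub>m (A2 \<otimes>\<^sub>m B2)) $$ (regroup_ix b1 a2 b2 i, regroup_ix b1 a2 b2 j)"
    using ij by (simp add: regroup_def reindex_def)
  also have "\<dots> = (A1 $$ (i div (b1 * b2) div a2, j div (b1 * b2) div a2) * B1 $$ (i mod (b1 * b2) div b2, j mod (b1 * b2) div b2))
      * (A2 $$ (i div (b1 * b2) mod a2, j div (b1 * b2) mod a2) * B2 $$ (i mod (b1 * b2) mod b2, j mod (b1 * b2) mod b2))"
    using ij b l[OF ij(1)] l[OF ij(2)] by (simp add: tensor_index d index_less)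
  also have "\<dots> = ((A1 \<otimes>\<^sub>m A2) \<otimes>\<^sub>m (B1 \<otimes>\<^sub>m B2)) $$ (i, j)"
    using ij b div_less_of_mult[OF ij(1)] div_less_of_mult[OF ij(2)] by (simp add: tensor_index)
  finally show "regroup a1 b1 a2 b2 (A1 \<otimes>\<^sub>m B1) (A2 \<otimes>\<^sub>m B2) $$ (i, j) = ((A1 \<otimes>\<^sub>m A2) \<otimes>\<^sub>m (B1 \<otimes>\<^sub>m B2)) $$ (i, j)" .
qed (use assms in auto)

lemma regroup_states:
  assumes "\<rho>1 \<in> states (a1 * b1)" "\<rho>2 \<in> states (a2 * b2)"
  shows "regroup a1 b1 a2 b2 \<rho>1 \<rho>2 \<in> states ((a1 * a2) * (b1 * b2))"
  unfolding regroup_def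
proof (rule reindex_states[OF regroup_ix_less regroup_ix_inj])
  have "pos_semidef ((a1 * b1) * (a2 * b2)) (\<rho>1 \<otimes>\<^sub>m \<rho>2)" by (intro psd_tensor statesD assms)
  moreover have "tr (\<rho>1 \<otimes>\<^sub>m \<rho>2) = 1" using statesD[OF assms(1)] statesD[OF assms(2)] by (simp add: tr_tensor)
  ultimately show "\<rho>1 \<otimes>\<^sub>m \<rho>2 \<in> states ((a1 * a2) * (b1 * b2))" by (simp add: states_def mult_ac)
qed auto

lemma tr_regroup_mult:
  assumes "X1 \<in> carrier_mat (a1 * b1) (a1 * b1)" "X2 \<in> carrier_mat (a2 * b2) (a2 * b2)"
    "Y1 \<in> carrier_mat (a1 * b1) (a1 * b1)" "Y2 \<in> carrier_mat (a2 * b2) (a2 * b2)"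
  shows "tr (regroup a1 b1 a2 b2 X1 X2 * regroup a1 b1 a2 b2 Y1 Y2) = tr (X1 * Y1) * tr (X2 * Y2)"
proof -
  have "tr (regroup a1 b1 a2 b2 X1 X2 * regroup a1 b1 a2 b2 Y1 Y2) = tr ((X1 \<otimes>\<^sub>m X2) * (Y1 \<otimes>\<^sub>m Y2))"
    unfolding regroup_def by (rule tr_reindex_mult[OF regroup_ix_less regroup_ix_inj]) (use assms in \<open>auto simp: mult_ac\<close>)
  also have "\<dots> = tr (X1 * Y1) * tr (X2 * Y2)" by (rule tr_tensor_mult_tensor) (use assms in auto)
  finally show ?thesis .
qed

lemma sum_op_tensor_sum_op:
  fixes M N m n :: nat
  assumes "\<And>x. x < M \<Longrightarrow> F x \<in> carrier_mat m m" "\<And>y. y < N \<Longrightarrow> G y \<in> carrier_mat n n"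
  shows "sum_op m F {..<M} \<otimes>\<^sub>m sum_op n G {..<N} = sum_op (m * n) (\<lambda>z. F (z div N) \<otimes>\<^sub>m G (z mod N)) {..<M * N}"
proof -
  have "sum_op m F {..<M} \<otimes>\<^sub>m sum_op n G {..<N} = sum_op (m * n) (\<lambda>x. F x \<otimes>\<^sub>m sum_op n G {..<N}) {..<M}"
    using assms by (intro sum_op_tensor_left) auto
  also have "\<dots> = sum_op (m * n) (\<lambda>x. sum_op (m * n) (\<lambda>y. F x \<otimes>\<^sub>m G y) {..<N}) {..<M}"
    using assms by (intro sum_op_cong sum_op_tensor_right) auto
  also have "\<dots> = sum_op (m * n) (\<lambda>z. F (z div N) \<otimes>\<^sub>m G (z mod N)) {..<M * N}"
    using assms by (intro sum_op_flatten) auto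
  finally show ?thesis .
qed

lemma regroup_sum_op_tensor:
  fixes M N :: nat
  assumes "\<And>x. x < M \<Longrightarrow> A1 x \<in> carrier_mat a1 a1 \<and> B1 x \<in> carrier_mat b1 b1"
    "\<And>y. y < N \<Longrightarrow> A2 y \<in> carrier_mat a2 a2 \<and> B2 y \<in> carrier_mat b2 b2"
  shows "regroup a1 b1 a2 b2 (sum_op (a1 * b1) (\<lambda>x. A1 x \<otimes>\<^sub>m B1 x) {..<M}) (sum_op (a2 * b2) (\<lambda>y. A2 y \<otimes>\<^sub>m B2 y) {..<N})
     = sum_op ((a1 * a2) * (b1 * b2)) (\<lambda>z. (A1 (z div N) \<otimes>\<^sub>m A2 (z mod N)) \<otimes>\<^sub>m (B1 (z div N) \<otimes>\<^sub>m B2 (z mod N))) {..<M * N}"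
proof -
  let ?n = "(a1 * a2) * (b1 * b2)"
  have n: "a1 * b1 * (a2 * b2) = ?n" by (simp add: mult_ac)
  have "sum_op (a1 * b1) (\<lambda>x. A1 x \<otimes>\<^sub>m B1 x) {..<M} \<otimes>\<^sub>m sum_op (a2 * b2) (\<lambda>y. A2 y \<otimes>\<^sub>m B2 y) {..<N}
    = sum_op (a1 * b1 * (a2 * b2)) (\<lambda>z. (A1 (z div N) \<otimes>\<^sub>m B1 (z div N)) \<otimes>\<^sub>m (A2 (z mod N) \<otimes>\<^sub>m B2 (z mod N))) {..<M * N}"
    using assms by (intro sum_op_tensor_sum_op) auto
  then have "regroup a1 b1 a2 b2 (sum_op (a1 * b1) (\<lambda>x. A1 x \<otimes>\<^sub>m B1 x) {..<M}) (sum_op (a2 * b2) (\<lambda>y. A2 y \<otimes>\<^sub>m B2 y) {..<N})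
    = reindex ?n (regroup_ix b1 a2 b2) (sum_op ?n (\<lambda>z. (A1 (z div N) \<otimes>\<^sub>m B1 (z div N)) \<otimes>\<^sub>m (A2 (z mod N) \<otimes>\<^sub>m B2 (z mod N))) {..<M * N})"
    unfolding regroup_def n by simp
  also have "\<dots> = sum_op ?n (\<lambda>z. regroup a1 b1 a2 b2 (A1 (z div N) \<otimes>\<^sub>m B1 (z div N)) (A2 (z mod N) \<otimes>\<^sub>m B2 (z mod N))) {..<M * N}"
    unfolding regroup_def by (rule reindex_sum_op[OF regroup_ix_less])
  also have "\<dots> = sum_op ?n (\<lambda>z. (A1 (z div N) \<otimes>\<^sub>m A2 (z mod N)) \<otimes>\<^sub>m (B1 (z div N) \<otimes>\<^sub>m B2 (z mod N))) {..<M * N}"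
    using assms div_less_of_mult[of _ M N] by (intro sum_op_cong regroup_tensor) auto
  finally show ?thesis .
qed

lemma regroup_Sep:
  assumes "\<sigma>1 \<in> Sep a1 b1" "\<sigma>2 \<in> Sep a2 b2"
  shows "regroup a1 b1 a2 b2 \<sigma>1 \<sigma>2 \<in> Sep (a1 * a2) (b1 * b2)"
proof -
  obtain m1 :: nat and YA1 YB1 where 1: "\<And>x. x < m1 \<Longrightarrow> pos_semidef a1 (YA1 x) \<and> pos_semidef b1 (YB1 x)"
    "\<sigma>1 = sum_op (a1 * b1) (\<lambda>x. YA1 x \<otimes>\<^sub>m YB1 x) {..<m1}" using assms(1) unfolding Sep_def by blast
  obtain m2 :: nat and YA2 YB2 where 2: "\<And>x. x < m2 \<Longrightarrow> pos_semidef a2 (YA2 x) \<and> pos_semidef b2 (YB2 x)"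
    "\<sigma>2 = sum_op (a2 * b2) (\<lambda>x. YA2 x \<otimes>\<^sub>m YB2 x) {..<m2}" using assms(2) unfolding Sep_def by blast
  have "regroup a1 b1 a2 b2 \<sigma>1 \<sigma>2 = sum_op ((a1 * a2) * (b1 * b2)) (\<lambda>z. (YA1 (z div m2) \<otimes>\<^sub>m YA2 (z mod m2)) \<otimes>\<^sub>m (YB1 (z div m2) \<otimes>\<^sub>m YB2 (z mod m2))) {..<m1 * m2}"
    unfolding 1(2) 2(2) by (rule regroup_sum_op_tensor) (use 1(1) 2(1) in \<open>auto dest!: psd_carrier\<close>)
  moreover have "sep_cone (a1 * a2) (b1 * b2) \<dots>"
    using 1(1) 2(1) div_less_of_mult[of _ m1 m2] by (intro sep_cone_sum_op sep_cone_tensor psd_tensor) auto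
  moreover have "regroup a1 b1 a2 b2 \<sigma>1 \<sigma>2 \<in> states ((a1 * a2) * (b1 * b2))"
    using assms by (intro regroup_states) (auto simp: Sep_iff)
  ultimately show ?thesis by (simp add: Sep_iff)
qed

text \<open>The regrouped product of two separable states is separable, and its relative entropy is
  the sum. Nearly optimal states for the two infima then give the bound.\<close>

lemma E_rel_regroup_le:
  assumes r1: "\<rho>1 \<in> states (a1 * b1)" and r2: "\<rho>2 \<in> states (a2 * b2)"
  shows "E_rel (a1 * a2) (b1 * b2) (regroup a1 b1 a2 b2 \<rho>1 \<rho>2) \<le> E_rel a1 b1 \<rho>1 + E_rel a2 b2 \<rho>2"
proof -
  let ?E = "E_rel (a1 * a2) (b1 * b2) (regroup a1 b1 a2 b2 \<rho>1 \<rho>2)"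
  have H: "?E \<le> rel_entropy \<rho>1 \<sigma>1 + rel_entropy \<rho>2 \<sigma>2" if s: "\<sigma>1 \<in> Sep a1 b1" "\<sigma>2 \<in> Sep a2 b2" for \<sigma>1 \<sigma>2
  proof (cases "rel_entropy \<rho>1 \<sigma>1 = \<infinity> \<or> rel_entropy \<rho>2 \<sigma>2 = \<infinity>")
    case True
    have "0 \<le> rel_entropy \<rho>1 \<sigma>1" "0 \<le> rel_entropy \<rho>2 \<sigma>2"
      using s r1 r2 by (auto simp: Sep_iff intro: rel_entropy_nonneg)
    then show ?thesis using True by auto
  next
    case False
    have s': "\<sigma>1 \<in> states (a1 * b1)" "\<sigma>2 \<in> states (a2 * b2)" using s by (auto simp: Sep_iff)
    have "?E \<le> rel_entropy (regroup a1 b1 a2 b2 \<rho>1 \<rho>2) (regroup a1 b1 a2 b2 \<sigma>1 \<sigma>2)"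
      unfolding E_rel_def by (rule INF_lower[OF regroup_Sep[OF s]])
    also have "\<dots> = rel_entropy (\<rho>1 \<otimes>\<^sub>m \<rho>2) (\<sigma>1 \<otimes>\<^sub>m \<sigma>2)"
    proof -
      have "pos_semidef ((a1 * b1) * (a2 * b2)) (\<rho>1 \<otimes>\<^sub>m \<rho>2)" "pos_semidef ((a1 * b1) * (a2 * b2)) (\<sigma>1 \<otimes>\<^sub>m \<sigma>2)"
        by (intro psd_tensor statesD r1 r2 s')+
      moreover have "(a1 * b1) * (a2 * b2) = (a1 * a2) * (b1 * b2)" by (simp add: mult_ac)
      ultimately show ?thesis unfolding regroup_def by (intro rel_entropy_reindex[OF regroup_ix_less regroup_ix_inj]) auto
    qed
    also have "\<dots> = rel_entropy \<rho>1 \<sigma>1 + rel_entropy \<rho>2 \<sigma>2"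
      using False by (intro rel_entropy_tensor_le[OF r1 r2] statesD s') auto
    finally show ?thesis .
  qed
  show ?thesis
  proof (rule ccontr)
    assume "\<not> ?thesis"
    then have lt: "E_rel a1 b1 \<rho>1 + E_rel a2 b2 \<rho>2 < ?E" by simp
    have nn: "0 \<le> E_rel a1 b1 \<rho>1" "0 \<le> E_rel a2 b2 \<rho>2"
      unfolding E_rel_def using r1 r2 by (auto simp: Sep_iff intro!: INF_greatest rel_entropy_nonneg)
    obtain e1 e2 where e: "E_rel a1 b1 \<rho>1 = ereal e1" "E_rel a2 b2 \<rho>2 = ereal e2"
      using lt nn by (cases "E_rel a1 b1 \<rho>1"; cases "E_rel a2 b2 \<rho>2") auto
    obtain c where c: "ereal (e1 + e2) < ereal c" "ereal c < ?E" using lt unfolding e by (metis ereal_dense2 plus_ereal.simps(1))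
    \<comment> \<open>Half of the gap between the assumed violation c and the sum of the two infima,
      one half for each near-minimizer.\<close>
    define d where "d = (c - e1 - e2) / 2"
    have d: "d > 0" using c by (simp add: d_def)
    have "E_rel a1 b1 \<rho>1 < ereal (e1 + d)" "E_rel a2 b2 \<rho>2 < ereal (e2 + d)" using d by (simp_all add: e)
    then obtain \<sigma>1 \<sigma>2 where s: "\<sigma>1 \<in> Sep a1 b1" "rel_entropy \<rho>1 \<sigma>1 < ereal (e1 + d)" "\<sigma>2 \<in> Sep a2 b2" "rel_entropy \<rho>2 \<sigma>2 < ereal (e2 + d)"
      unfolding E_rel_def INF_less_iff by blast
    have "?E \<le> rel_entropy \<rho>1 \<sigma>1 + rel_entropy \<rho>2 \<sigma>2" by (rule H) (use s in auto)
    also have "\<dots> \<le> ereal (e1 + d) + ereal (e2 + d)" using s by (intro add_mono) auto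
    also have "\<dots> = ereal c" by (simp add: d_def field_simps)
    finally show False using c(2) by simp
  qed
qed

subsection \<open>Superadditivity of the one-way LOCC relative entropy of entanglement\<close>

text \<open>The total operator sums to 1 by summing first over z for fixed x and then over x, so
  membership in \<open>ALL_povms\<close> follows from the local normalizations.\<close>

lemma LOCC1_povmI:
  fixes N :: nat
  assumes QB: "\<And>x. x < N \<Longrightarrow> pos_semidef b (QB x)"
    and QA: "\<And>x z. x < N \<Longrightarrow> z < length M \<Longrightarrow> pos_semidef a (QA z x)" and QB1: "sum_op b QB {..<N} = 1\<^sub>m b"
    and QA1: "\<And>x. x < N \<Longrightarrow> sum_op a (\<lambda>z. QA z x) {..<length M} = 1\<^sub>m a"
    and Mz: "\<And>z. z < length M \<Longrightarrow> M ! z = sum_op (a * b) (\<lambda>x. QA z x \<otimes>\<^sub>m QB x) {..<N}"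
  shows "M \<in> LOCC1_povms a b"
proof -
  have [simp]: "dim_row (QA z x) = a" "dim_col (QA z x) = a" if "x < N" "z < length M" for x z
    using psd_carrier[OF QA[OF that]] by auto
  have [simp]: "dim_row (QB x) = b" "dim_col (QB x) = b" if "x < N" for x
    using psd_carrier[OF QB[OF that]] by auto
  have "sum_op (a * b) (\<lambda>z. M ! z) {..<length M} = sum_op (a * b) (\<lambda>z. sum_op (a * b) (\<lambda>x. QA z x \<otimes>\<^sub>m QB x) {..<N}) {..<length M}"
    using Mz by (intro sum_op_cong) auto
  also have "\<dots> = sum_op (a * b) (\<lambda>x. sum_op (a * b) (\<lambda>z. QA z x \<otimes>\<^sub>m QB x) {..<length M}) {..<N}"
    by (rule eq_matI) (simp_all, rule sum.swap)
  also have "\<dots> = sum_op (a * b) (\<lambda>x. 1\<^sub>m a \<otimes>\<^sub>m QB x) {..<N}"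
  proof (intro sum_op_cong)
    fix x assume "x \<in> {..<N}"
    then have x: "x < N" by simp
    have "sum_op (a * b) (\<lambda>z. QA z x \<otimes>\<^sub>m QB x) {..<length M} = sum_op a (\<lambda>z. QA z x) {..<length M} \<otimes>\<^sub>m QB x"
      using x by (intro sum_op_tensor_left[symmetric]) auto
    then show "sum_op (a * b) (\<lambda>z. QA z x \<otimes>\<^sub>m QB x) {..<length M} = 1\<^sub>m a \<otimes>\<^sub>m QB x" using QA1[OF x] by simp
  qed
  also have "\<dots> = 1\<^sub>m (a * b)"
    by (subst sum_op_tensor_right[symmetric]) (auto simp: QB1 tensor_one)
  finally have 1: "sum_op (a * b) (\<lambda>z. M ! z) {..<length M} = 1\<^sub>m (a * b)" .
  have "pos_semidef (a * b) (M ! z)" if "z < length M" for z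
    unfolding Mz[OF that] using QA QB that by (intro psd_sum_op psd_tensor) auto
  then have "M \<in> ALL_povms (a * b)" using 1 by (simp add: ALL_povms_def)
  then show ?thesis unfolding LOCC1_povms_def using assms
    by (intro CollectI conjI exI[of _ N] exI[of _ QA] exI[of _ QB]) auto
qed

lemma tr_sep_sum:
  assumes "\<And>y. y < m \<Longrightarrow> YA y \<in> carrier_mat a a" "\<And>y. y < m \<Longrightarrow> YB y \<in> carrier_mat b b"
    "F \<in> carrier_mat a a" "G \<in> carrier_mat b b"
  shows "tr (sum_op (a * b) (\<lambda>y. YA y \<otimes>\<^sub>m YB y) {..<m} * (F \<otimes>\<^sub>m G)) = (\<Sum>y<m. tr (YA y * F) * tr (YB y * G))"
proof -
  have "tr (sum_op (a * b) (\<lambda>y. YA y \<otimes>\<^sub>m YB y) {..<m} * (F \<otimes>\<^sub>m G)) = (\<Sum>y<m. tr ((YA y \<otimes>\<^sub>m YB y) * (F \<otimes>\<^sub>m G)))"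
    by (rule tr_sum_op_mult) (use assms in auto)
  also have "\<dots> = (\<Sum>y<m. tr (YA y * F) * tr (YB y * G))"
    using assms by (intro sum.cong refl tr_tensor_mult_tensor) auto
  finally show ?thesis .
qed

lemma sum_div_mod:
  fixes f :: "nat \<Rightarrow> nat \<Rightarrow> 'a :: comm_monoid_add"
  shows "(\<Sum>z<m * n. f (z div n) (z mod n)) = (\<Sum>x<m. \<Sum>y<n. f x y)"
  by (subst sum_prod_index) (auto intro!: sum.cong)

text \<open>The chain rule behind superadditivity. The first witness is taken for the marginal of
  \<sigma> on the first pair; weighting the outcomes of its measurement by \<open>f1\<close> leaves
  a separable operator of trace at most 1 on the second pair, for which the second witness is taken.
  On the product state the values add.\<close>

theorem E_LOCC1_superadditive_aux:
  assumes \<rho>1: "\<rho>1 \<in> states (a1 * b1)" and \<rho>2: "\<rho>2 \<in> states (a2 * b2)" and \<sigma>: "\<sigma> \<in> Sep (a1 * a2) (b1 * b2)"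
    and r1: "ereal r1 < E_LOCC1 a1 b1 \<rho>1" and r2: "ereal r2 < E_LOCC1 a2 b2 \<rho>2"
  shows "ereal (r1 + r2) \<le> measured_rel_entropy (LOCC1_povms (a1 * a2) (b1 * b2)) (regroup a1 b1 a2 b2 \<rho>1 \<rho>2) \<sigma>"
proof -
  have \<sigma>s: "\<sigma> \<in> states ((a1 * a2) * (b1 * b2))" and \<sigma>c: "sep_cone (a1 * a2) (b1 * b2) \<sigma>" using \<sigma> by (auto simp: Sep_iff)
  note [simp] = statesD(4,5)[OF \<sigma>s] statesD(4,5)[OF \<rho>1] statesD(4,5)[OF \<rho>2]
  obtain m :: nat and YA YB where Y: "\<And>y. y < m \<Longrightarrow> pos_semidef (a1 * a2) (YA y)" "\<And>y. y < m \<Longrightarrow> pos_semidef (b1 * b2) (YB y)"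
    and \<sigma>Y: "\<sigma> = sum_op ((a1 * a2) * (b1 * b2)) (\<lambda>y. YA y \<otimes>\<^sub>m YB y) {..<m}"
    using \<sigma>c unfolding sep_cone_def by blast
  have [simp]: "dim_row (YA y) = a1 * a2" "dim_col (YA y) = a1 * a2" "dim_row (YB y) = b1 * b2" "dim_col (YB y) = b1 * b2" if "y < m" for y
    using psd_carrier[OF Y(1)[OF that]] psd_carrier[OF Y(2)[OF that]] by auto
  define \<tau>1 where "\<tau>1 = sum_op (a1 * b1) (\<lambda>y. contract_right a1 a2 (1\<^sub>m a2) (YA y) \<otimes>\<^sub>m contract_right b1 b2 (1\<^sub>m b2) (YB y)) {..<m}"
  have [simp]: "dim_row \<tau>1 = a1 * b1" "dim_col \<tau>1 = a1 * b1" by (simp_all add: \<tau>1_def)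
  have \<tau>1c: "sep_cone a1 b1 \<tau>1" unfolding \<tau>1_def
    by (intro sep_cone_sum_op sep_cone_tensor) (auto intro!: Y psd_contract_right_one)
  have tr\<sigma>: "tr (\<sigma> * (F \<otimes>\<^sub>m G)) = (\<Sum>y<m. tr (YA y * F) * tr (YB y * G))"
    if "F \<in> carrier_mat (a1 * a2) (a1 * a2)" "G \<in> carrier_mat (b1 * b2) (b1 * b2)" for F G
    unfolding \<sigma>Y by (rule tr_sep_sum) (use that in auto)
  have tr\<tau>1: "tr (\<tau>1 * (F \<otimes>\<^sub>m Q)) = tr (\<sigma> * ((F \<otimes>\<^sub>m 1\<^sub>m a2) \<otimes>\<^sub>m (Q \<otimes>\<^sub>m 1\<^sub>m b2)))"
    if "F \<in> carrier_mat a1 a1" "Q \<in> carrier_mat b1 b1" for F Q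
  proof -
    have "tr (\<tau>1 * (F \<otimes>\<^sub>m Q)) = (\<Sum>y<m. tr (contract_right a1 a2 (1\<^sub>m a2) (YA y) * F) * tr (contract_right b1 b2 (1\<^sub>m b2) (YB y) * Q))"
      unfolding \<tau>1_def by (rule tr_sep_sum) (use that in auto)
    also have "\<dots> = (\<Sum>y<m. tr (YA y * (F \<otimes>\<^sub>m 1\<^sub>m a2)) * tr (YB y * (Q \<otimes>\<^sub>m 1\<^sub>m b2)))"
      using that by (intro sum.cong refl arg_cong2[where f = "(*)"] tr_contract_right) auto
    also have "\<dots> = tr (\<sigma> * ((F \<otimes>\<^sub>m 1\<^sub>m a2) \<otimes>\<^sub>m (Q \<otimes>\<^sub>m 1\<^sub>m b2)))"
      by (rule tr\<sigma>[symmetric]) (use that in auto)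
    finally show ?thesis .
  qed
  have "tr \<tau>1 = tr (\<tau>1 * (1\<^sub>m a1 \<otimes>\<^sub>m 1\<^sub>m b1))" by (simp add: tensor_one)
  also have "\<dots> = tr \<sigma>" by (subst tr\<tau>1) (auto simp: tensor_one)
  finally have t1: "Re (tr \<tau>1) \<le> 1" using statesD(2)[OF \<sigma>s] by simp
  obtain M1 f1 where M1: "M1 \<in> LOCC1_povms a1 b1" and f1: "\<And>z. f1 z > 0"
    and fs1: "(\<Sum>z<length M1. Re (tr (\<tau>1 * M1 ! z)) * f1 z) \<le> 1"
    and fr1: "r1 \<le> (\<Sum>z<length M1. Re (tr (\<rho>1 * M1 ! z)) * ln (f1 z))"
    by (rule E_meas_witness[OF LOCC1_subset_ALL \<rho>1 \<tau>1c t1 r1[unfolded E_LOCC1_def]]) blast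
  obtain N1 :: nat and QA1 QB1 where MD1: "\<forall>x<N1. pos_semidef b1 (QB1 x)" "\<forall>x<N1. \<forall>z<length M1. pos_semidef a1 (QA1 z x)"
    "sum_op b1 QB1 {..<N1} = 1\<^sub>m b1" "\<forall>x<N1. sum_op a1 (\<lambda>z. QA1 z x) {..<length M1} = 1\<^sub>m a1"
    "\<forall>z<length M1. M1 ! z = sum_op (a1 * b1) (\<lambda>x. QA1 z x \<otimes>\<^sub>m QB1 x) {..<N1}"
    using M1 unfolding LOCC1_povms_def by blast
  have [simp]: "dim_row (QA1 z x) = a1" "dim_col (QA1 z x) = a1" if "x < N1" "z < length M1" for x z
    using psd_carrier MD1(2) that by fastforce+
  have [simp]: "dim_row (QB1 x) = b1" "dim_col (QB1 x) = b1" if "x < N1" for x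
    using psd_carrier MD1(1) that by fastforce+
  define F where "F x = sum_op a1 (\<lambda>z. complex_of_real (f1 z) \<cdot>\<^sub>m QA1 z x) {..<length M1}" for x
  have [simp]: "dim_row (F x) = a1" "dim_col (F x) = a1" for x by (simp_all add: F_def)
  have Fp: "pos_semidef a1 (F x)" if "x < N1" for x
    unfolding F_def by (rule sum_op_psd_povm) (use MD1(2) that f1 in auto)
  \<comment> \<open>What \<sigma> leaves on the second pair, outcomes being weighted by
    \<open>f1\<close>. Each LOCC element is a sum of products, so contracting a product operator
    yields a product again.\<close>
  define \<tau>2 where "\<tau>2 = sum_op (a2 * b2) (\<lambda>x. sum_op (a2 * b2) (\<lambda>y. contract_left a1 a2 (F x) (YA y) \<otimes>\<^sub>m contract_left b1 b2 (QB1 x) (YB y)) {..<m}) {..<N1}"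
  have [simp]: "dim_row \<tau>2 = a2 * b2" "dim_col \<tau>2 = a2 * b2" by (simp_all add: \<tau>2_def)
  have \<tau>2c: "sep_cone a2 b2 \<tau>2" unfolding \<tau>2_def
    by (intro sep_cone_sum_op sep_cone_tensor psd_contract_left) (use Y Fp MD1(1) in auto)
  \<comment> \<open>The joint value of \<sigma> on one product effect of the first measurement and
    arbitrary effects on the second pair; both \<tau>2 and the combined measurement are expressed
    through it.\<close>
  define t where "t z1 x1 F' Q' = tr (\<sigma> * ((QA1 z1 x1 \<otimes>\<^sub>m F') \<otimes>\<^sub>m (QB1 x1 \<otimes>\<^sub>m Q')))" for z1 x1 F' Q'
  have tr\<tau>2: "tr (\<tau>2 * (F' \<otimes>\<^sub>m Q')) = (\<Sum>z<length M1. complex_of_real (f1 z) * (\<Sum>x<N1. t z x F' Q'))"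
    if F': "F' \<in> carrier_mat a2 a2" and Q': "Q' \<in> carrier_mat b2 b2" for F' Q'
  proof -
    note [simp] = carrier_matD[OF F'] carrier_matD[OF Q']
    have "tr (\<tau>2 * (F' \<otimes>\<^sub>m Q')) = (\<Sum>x<N1. tr (sum_op (a2 * b2) (\<lambda>y. contract_left a1 a2 (F x) (YA y) \<otimes>\<^sub>m contract_left b1 b2 (QB1 x) (YB y)) {..<m} * (F' \<otimes>\<^sub>m Q')))"
      unfolding \<tau>2_def by (rule tr_sum_op_mult) auto
    also have "\<dots> = (\<Sum>x<N1. \<Sum>z<length M1. complex_of_real (f1 z) * t z x F' Q')"
    proof (intro sum.cong refl)
      fix x assume "x \<in> {..<N1}"
      then have [simp]: "x < N1" by simp
      have "tr (sum_op (a2 * b2) (\<lambda>y. contract_left a1 a2 (F x) (YA y) \<otimes>\<^sub>m contract_left b1 b2 (QB1 x) (YB y)) {..<m} * (F' \<otimes>\<^sub>m Q'))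
        = (\<Sum>y<m. tr (contract_left a1 a2 (F x) (YA y) * F') * tr (contract_left b1 b2 (QB1 x) (YB y) * Q'))"
        by (rule tr_sep_sum) auto
      also have "\<dots> = (\<Sum>y<m. tr (YA y * (F x \<otimes>\<^sub>m F')) * tr (YB y * (QB1 x \<otimes>\<^sub>m Q')))"
        by (intro sum.cong refl arg_cong2[where f = "(*)"] tr_contract_left) auto
      also have "\<dots> = tr (\<sigma> * ((F x \<otimes>\<^sub>m F') \<otimes>\<^sub>m (QB1 x \<otimes>\<^sub>m Q')))"
        by (rule tr\<sigma>[symmetric]) auto
      also have "(F x \<otimes>\<^sub>m F') \<otimes>\<^sub>m (QB1 x \<otimes>\<^sub>m Q') = sum_op ((a1 * a2) * (b1 * b2)) (\<lambda>z. complex_of_real (f1 z) \<cdot>\<^sub>m ((QA1 z x \<otimes>\<^sub>m F') \<otimes>\<^sub>m (QB1 x \<otimes>\<^sub>m Q'))) {..<length M1}"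
        unfolding F_def by (subst sum_op_tensor_left, simp, simp, subst sum_op_tensor_left) (auto simp: smult_tensor intro!: sum_op_cong)
      also have "tr (\<sigma> * \<dots>) = (\<Sum>z<length M1. complex_of_real (f1 z) * t z x F' Q')"
        unfolding t_def by (rule tr_mult_weighted_sum_op) auto
      finally show "tr (sum_op (a2 * b2) (\<lambda>y. contract_left a1 a2 (F x) (YA y) \<otimes>\<^sub>m contract_left b1 b2 (QB1 x) (YB y)) {..<m} * (F' \<otimes>\<^sub>m Q'))
        = (\<Sum>z<length M1. complex_of_real (f1 z) * t z x F' Q')" .
    qed
    also have "\<dots> = (\<Sum>z<length M1. complex_of_real (f1 z) * (\<Sum>x<N1. t z x F' Q'))"
      by (subst sum.swap) (simp add: sum_distrib_left)
    finally show ?thesis .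
  qed
  have "tr \<tau>2 = tr (\<tau>2 * (1\<^sub>m a2 \<otimes>\<^sub>m 1\<^sub>m b2))" by (simp add: tensor_one)
  also have "\<dots> = (\<Sum>z<length M1. complex_of_real (f1 z) * (\<Sum>x<N1. t z x (1\<^sub>m a2) (1\<^sub>m b2)))" by (rule tr\<tau>2) auto
  also have "\<dots> = (\<Sum>z<length M1. complex_of_real (f1 z) * tr (\<tau>1 * M1 ! z))"
  proof (intro sum.cong refl arg_cong2[where f = "(*)"])
    fix z assume "z \<in> {..<length M1}"
    then have [simp]: "z < length M1" by simp
    have "tr (\<tau>1 * M1 ! z) = (\<Sum>x<N1. tr (\<tau>1 * (QA1 z x \<otimes>\<^sub>m QB1 x)))"
      using MD1(5) by (simp, intro tr_mult_sum_op) auto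
    also have "\<dots> = (\<Sum>x<N1. t z x (1\<^sub>m a2) (1\<^sub>m b2))"
      unfolding t_def by (intro sum.cong refl tr\<tau>1) auto
    finally show "(\<Sum>x<N1. t z x (1\<^sub>m a2) (1\<^sub>m b2)) = tr (\<tau>1 * M1 ! z)" by simp
  qed
  finally have t2: "Re (tr \<tau>2) \<le> 1" using fs1 by (simp add: mult.commute)
  obtain M2 f2 where M2: "M2 \<in> LOCC1_povms a2 b2" and f2: "\<And>z. f2 z > 0"
    and fs2: "(\<Sum>z<length M2. Re (tr (\<tau>2 * M2 ! z)) * f2 z) \<le> 1"
    and fr2: "r2 \<le> (\<Sum>z<length M2. Re (tr (\<rho>2 * M2 ! z)) * ln (f2 z))"
    by (rule E_meas_witness[OF LOCC1_subset_ALL \<rho>2 \<tau>2c t2 r2[unfolded E_LOCC1_def]]) blast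
  obtain N2 :: nat and QA2 QB2 where MD2: "\<forall>x<N2. pos_semidef b2 (QB2 x)" "\<forall>x<N2. \<forall>z<length M2. pos_semidef a2 (QA2 z x)"
    "sum_op b2 QB2 {..<N2} = 1\<^sub>m b2" "\<forall>x<N2. sum_op a2 (\<lambda>z. QA2 z x) {..<length M2} = 1\<^sub>m a2"
    "\<forall>z<length M2. M2 ! z = sum_op (a2 * b2) (\<lambda>x. QA2 z x \<otimes>\<^sub>m QB2 x) {..<N2}"
    using M2 unfolding LOCC1_povms_def by blast
  have [simp]: "dim_row (QA2 z x) = a2" "dim_col (QA2 z x) = a2" if "x < N2" "z < length M2" for x z
    using psd_carrier MD2(2) that by fastforce+
  have [simp]: "dim_row (QB2 x) = b2" "dim_col (QB2 x) = b2" if "x < N2" for x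
    using psd_carrier MD2(1) that by fastforce+
  define L1 where "L1 = length M1"
  define L2 where "L2 = length M2"
  \<comment> \<open>Both measurements are performed in parallel. B sends the pair of outcomes in one
    message, so the result is again one-way from B to A.\<close>
  define M where "M = map (\<lambda>z. regroup a1 b1 a2 b2 (M1 ! (z div L2)) (M2 ! (z mod L2))) [0..<L1 * L2]"
  have lenM: "length M = L1 * L2" by (simp add: M_def)
  have Mz: "M ! z = regroup a1 b1 a2 b2 (M1 ! (z div L2)) (M2 ! (z mod L2))" if "z < L1 * L2" for z
    using that by (simp add: M_def)
  define QA where "QA z x = QA1 (z div L2) (x div N2) \<otimes>\<^sub>m QA2 (z mod L2) (x mod N2)" for z x
  define QB where "QB x = QB1 (x div N2) \<otimes>\<^sub>m QB2 (x mod N2)" for x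
  have Mz': "M ! z = sum_op ((a1 * a2) * (b1 * b2)) (\<lambda>x. QA z x \<otimes>\<^sub>m QB x) {..<N1 * N2}" if z: "z < L1 * L2" for z
  proof -
    have z': "z div L2 < length M1" "z mod L2 < length M2" using div_less_of_mult[OF z] by (auto simp: L1_def L2_def)
    have "M ! z = regroup a1 b1 a2 b2 (sum_op (a1 * b1) (\<lambda>x. QA1 (z div L2) x \<otimes>\<^sub>m QB1 x) {..<N1}) (sum_op (a2 * b2) (\<lambda>x. QA2 (z mod L2) x \<otimes>\<^sub>m QB2 x) {..<N2})"
      using MD1(5) MD2(5) z' by (simp add: Mz[OF z])
    also have "\<dots> = sum_op ((a1 * a2) * (b1 * b2)) (\<lambda>x. QA z x \<otimes>\<^sub>m QB x) {..<N1 * N2}"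
      unfolding QA_def QB_def by (rule regroup_sum_op_tensor) (use z' in auto)
    finally show ?thesis .
  qed
  have M: "M \<in> LOCC1_povms (a1 * a2) (b1 * b2)"
  proof (rule LOCC1_povmI[where N = "N1 * N2" and QA = QA and QB = QB])
    fix x assume x: "x < N1 * N2"
    note x' = div_less_of_mult[OF x]
    show "pos_semidef (b1 * b2) (QB x)" unfolding QB_def using MD1(1) MD2(1) x' by (intro psd_tensor) auto
    show "sum_op (a1 * a2) (\<lambda>z. QA z x) {..<length M} = 1\<^sub>m (a1 * a2)"
      unfolding QA_def lenM using x' MD1(4) MD2(4)
      by (subst sum_op_tensor_sum_op[symmetric]) (auto simp: L1_def L2_def tensor_one)
    fix z assume z: "z < length M"
    show "pos_semidef (a1 * a2) (QA z x)" unfolding QA_def using MD1(2) MD2(2) x' div_less_of_mult[OF z[unfolded lenM]]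
      by (intro psd_tensor) (auto simp: L1_def L2_def)
  next
    show "sum_op (b1 * b2) QB {..<N1 * N2} = 1\<^sub>m (b1 * b2)"
      unfolding QB_def[abs_def] using MD1(3) MD2(3)
      by (subst sum_op_tensor_sum_op[symmetric]) (auto simp: tensor_one)
  next
    fix z assume "z < length M"
    then show "M ! z = sum_op (a1 * a2 * (b1 * b2)) (\<lambda>x. QA z x \<otimes>\<^sub>m QB x) {..<N1 * N2}" using Mz' lenM by simp
  qed
  have Mp: "M \<in> ALL_povms ((a1 * a2) * (b1 * b2))" using M LOCC1_subset_ALL by blast
  have M1p: "M1 \<in> ALL_povms (a1 * b1)" and M2p: "M2 \<in> ALL_povms (a2 * b2)" using M1 M2 LOCC1_subset_ALL by blast+
  let ?R = "regroup a1 b1 a2 b2 \<rho>1 \<rho>2"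
  have Rs: "?R \<in> states ((a1 * a2) * (b1 * b2))" by (rule regroup_states[OF \<rho>1 \<rho>2])
  define P1 where "P1 = outcome_prob \<rho>1 M1"
  define P2 where "P2 = outcome_prob \<rho>2 M2"
  have PR: "outcome_prob ?R M z = P1 (z div L2) * P2 (z mod L2)" if z: "z < L1 * L2" for z
  proof -
    have z': "z div L2 < length M1" "z mod L2 < length M2" using div_less_of_mult[OF z] by (auto simp: L1_def L2_def)
    have "tr (?R * M ! z) = tr (\<rho>1 * M1 ! (z div L2)) * tr (\<rho>2 * M2 ! (z mod L2))"
      unfolding Mz[OF z] by (rule tr_regroup_mult) (use psd_carrier[OF povm_carrier[OF M1p z'(1)]] psd_carrier[OF povm_carrier[OF M2p z'(2)]] in auto)
    moreover have "0 \<le> tr (\<rho>1 * M1 ! (z div L2))" "0 \<le> tr (\<rho>2 * M2 ! (z mod L2))"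
      by (rule psd_tr_mult[OF statesD(1)[OF \<rho>1] povm_carrier[OF M1p z'(1)]],
          rule psd_tr_mult[OF statesD(1)[OF \<rho>2] povm_carrier[OF M2p z'(2)]])
    ultimately show ?thesis by (simp add: outcome_prob_def P1_def P2_def less_eq_complex_def)
  qed
  define f where "f z = f1 (z div L2) * f2 (z mod L2)" for z
  have P1s: "(\<Sum>z<L1. P1 z) = 1" unfolding P1_def L1_def using outcome_prob_sum[OF statesD(3)[OF \<rho>1] M1p] statesD(2)[OF \<rho>1] by simp
  have P2s: "(\<Sum>z<L2. P2 z) = 1" unfolding P2_def L2_def using outcome_prob_sum[OF statesD(3)[OF \<rho>2] M2p] statesD(2)[OF \<rho>2] by simp
  have "r1 + r2 \<le> (\<Sum>z<L1. P1 z * ln (f1 z)) + (\<Sum>z<L2. P2 z * ln (f2 z))"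
    using fr1 fr2 by (simp add: P1_def P2_def L1_def L2_def outcome_prob_def)
  also have "\<dots> = (\<Sum>z1<L1. \<Sum>z2<L2. P1 z1 * P2 z2 * ln (f1 z1) + P1 z1 * P2 z2 * ln (f2 z2))"
  proof -
    have "(\<Sum>z1<L1. \<Sum>z2<L2. P1 z1 * P2 z2 * ln (f1 z1)) = (\<Sum>z1<L1. P1 z1 * ln (f1 z1)) * (\<Sum>z<L2. P2 z)"
      unfolding sum_product by (intro sum.cong refl) simp
    moreover have "(\<Sum>z1<L1. \<Sum>z2<L2. P1 z1 * P2 z2 * ln (f2 z2)) = (\<Sum>z1<L1. P1 z1) * (\<Sum>z<L2. P2 z * ln (f2 z))"
      unfolding sum_product by (intro sum.cong refl) simp
    ultimately show ?thesis by (simp add: P1s P2s sum.distrib)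
  qed
  also have "\<dots> = (\<Sum>z1<L1. \<Sum>z2<L2. P1 z1 * P2 z2 * ln (f1 z1 * f2 z2))"
    using f1 f2 by (intro sum.cong refl) (simp add: ln_mult distrib_left less_imp_neq[symmetric])
  also have "\<dots> = (\<Sum>z<L1 * L2. P1 (z div L2) * P2 (z mod L2) * ln (f z))"
    unfolding f_def by (rule sum_div_mod[symmetric])
  also have "\<dots> = (\<Sum>z<length M. outcome_prob ?R M z * ln (f z))"
    unfolding lenM by (intro sum.cong refl) (simp add: PR)
  finally have rr: "ereal (r1 + r2) \<le> ereal (\<Sum>z<length M. outcome_prob ?R M z * ln (f z))" by simp
  also have "\<dots> \<le> classical_rel_entropy {..<length M} (outcome_prob ?R M) (outcome_prob \<sigma> M)"
  proof (rule classical_rel_entropy_ge)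
    show "(\<Sum>z<length M. outcome_prob ?R M z) = 1"
      using outcome_prob_sum[OF statesD(3)[OF Rs] Mp] statesD(2)[OF Rs] by simp
    show "0 < f z" for z using f1 f2 by (simp add: f_def)
    \<comment> \<open>Although \<sigma> is not a product, the expectation of f1 f2 under it is the
      expectation of f2 under \<tau>2, by the way \<tau>2 was built.\<close>
    have "(\<Sum>z<length M. outcome_prob \<sigma> M z * f z) = (\<Sum>z<L1 * L2. f1 (z div L2) * f2 (z mod L2) * (\<Sum>x1<N1. \<Sum>x2<N2. Re (t (z div L2) x1 (QA2 (z mod L2) x2) (QB2 x2))))"
      unfolding lenM
    proof (intro sum.cong refl)
      fix z assume "z \<in> {..<L1 * L2}"
      then have z: "z < L1 * L2" by simp
      have z': "z div L2 < length M1" "z mod L2 < length M2" using div_less_of_mult[OF z] by (auto simp: L1_def L2_def)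
      have "tr (\<sigma> * M ! z) = (\<Sum>x<N1 * N2. tr (\<sigma> * (QA z x \<otimes>\<^sub>m QB x)))"
        unfolding Mz'[OF z] by (rule tr_mult_sum_op) (use z' div_less_of_mult[of _ N1 N2] in \<open>auto simp: QA_def QB_def\<close>)
      also have "\<dots> = (\<Sum>x<N1 * N2. t (z div L2) (x div N2) (QA2 (z mod L2) (x mod N2)) (QB2 (x mod N2)))"
        by (simp add: t_def QA_def QB_def)
      also have "\<dots> = (\<Sum>x1<N1. \<Sum>x2<N2. t (z div L2) x1 (QA2 (z mod L2) x2) (QB2 x2))"
        by (rule sum_div_mod)
      finally show "outcome_prob \<sigma> M z * f z = f1 (z div L2) * f2 (z mod L2) * (\<Sum>x1<N1. \<Sum>x2<N2. Re (t (z div L2) x1 (QA2 (z mod L2) x2) (QB2 x2)))"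
        by (simp add: outcome_prob_def f_def)
    qed
    also have "\<dots> = (\<Sum>z1<L1. \<Sum>z2<L2. f1 z1 * f2 z2 * (\<Sum>x1<N1. \<Sum>x2<N2. Re (t z1 x1 (QA2 z2 x2) (QB2 x2))))"
      by (rule sum_div_mod)
    also have "\<dots> = (\<Sum>z2<L2. \<Sum>z1<L1. f1 z1 * f2 z2 * (\<Sum>x1<N1. \<Sum>x2<N2. Re (t z1 x1 (QA2 z2 x2) (QB2 x2))))"
      by (rule sum.swap)
    also have "\<dots> = (\<Sum>z2<L2. Re (tr (\<tau>2 * M2 ! z2)) * f2 z2)"
    proof (intro sum.cong refl)
      fix z2 assume "z2 \<in> {..<L2}"
      then have [simp]: "z2 < length M2" by (simp add: L2_def)
      have "tr (\<tau>2 * M2 ! z2) = (\<Sum>x2<N2. tr (\<tau>2 * (QA2 z2 x2 \<otimes>\<^sub>m QB2 x2)))"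
        using MD2(5) by (simp, intro tr_mult_sum_op) auto
      also have "\<dots> = (\<Sum>x2<N2. \<Sum>z1<L1. complex_of_real (f1 z1) * (\<Sum>x1<N1. t z1 x1 (QA2 z2 x2) (QB2 x2)))"
        unfolding L1_def by (intro sum.cong refl tr\<tau>2) auto
      also have "\<dots> = (\<Sum>z1<L1. \<Sum>x2<N2. complex_of_real (f1 z1) * (\<Sum>x1<N1. t z1 x1 (QA2 z2 x2) (QB2 x2)))" by (rule sum.swap)
      also have "\<dots> = (\<Sum>z1<L1. complex_of_real (f1 z1) * (\<Sum>x1<N1. \<Sum>x2<N2. t z1 x1 (QA2 z2 x2) (QB2 x2)))"
        unfolding sum_distrib_left[symmetric] by (intro sum.cong refl arg_cong2[where f = "(*)"] sum.swap)
      finally show "(\<Sum>z1<L1. f1 z1 * f2 z2 * (\<Sum>x1<N1. \<Sum>x2<N2. Re (t z1 x1 (QA2 z2 x2) (QB2 x2)))) = Re (tr (\<tau>2 * M2 ! z2)) * f2 z2"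
        by (simp add: sum_distrib_left sum_distrib_right mult_ac)
    qed
    also have "\<dots> \<le> 1" using fs2 by (simp add: L2_def)
    finally show "(\<Sum>z<length M. outcome_prob \<sigma> M z * f z) \<le> 1" .
  qed (auto intro: outcome_prob_nonneg[OF statesD(1)[OF Rs] Mp] outcome_prob_nonneg[OF statesD(1)[OF \<sigma>s] Mp])
  also have "\<dots> \<le> measured_rel_entropy (LOCC1_povms (a1 * a2) (b1 * b2)) ?R \<sigma>"
    unfolding measured_rel_entropy_def by (rule SUP_upper[OF M])
  finally show ?thesis .
qed

theorem E_LOCC1_regroup_ge:
  assumes \<rho>1: "\<rho>1 \<in> states (a1 * b1)" and \<rho>2: "\<rho>2 \<in> states (a2 * b2)"
  shows "E_LOCC1 a1 b1 \<rho>1 + E_LOCC1 a2 b2 \<rho>2 \<le> E_LOCC1 (a1 * a2) (b1 * b2) (regroup a1 b1 a2 b2 \<rho>1 \<rho>2)"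
  unfolding E_LOCC1_def[of "a1 * a2"] E_meas_def
proof (rule INF_greatest)
  fix \<sigma> assume "\<sigma> \<in> Sep (a1 * a2) (b1 * b2)"
  then show "E_LOCC1 a1 b1 \<rho>1 + E_LOCC1 a2 b2 \<rho>2 \<le> measured_rel_entropy (LOCC1_povms (a1 * a2) (b1 * b2)) (regroup a1 b1 a2 b2 \<rho>1 \<rho>2) \<sigma>"
    using \<rho>1 \<rho>2 E_LOCC1_superadditive_aux[OF \<rho>1 \<rho>2]
    by (intro ereal_add_le_of_less) (auto simp: E_LOCC1_def intro!: E_meas_nonneg trivial_povm_LOCC1)
qed

subsection \<open>Measured versus quantum relative entropy\<close>

text \<open>A is a partial isometry, so A A-adjoint is a projection too, and a diagonal entry x of a
  projection satisfies x^2 \<le> x.\<close>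

lemma gram_projection_diag_le_1:
  assumes A: "A \<in> carrier_mat n n" and D: "adj A * A = real_diag n d" and d: "\<And>a. a < n \<Longrightarrow> d a = 0 \<or> d a = 1" and i: "i < n"
  shows "(\<Sum>a<n. (cmod (A $$ (i, a)))\<^sup>2) \<le> 1"
proof -
  note [simp] = carrier_matD[OF A]
  have A0: "A $$ (j, a) = 0" if "a < n" "d a = 0" "j < n" for j a
  proof -
    have "(adj A * A) $$ (a, a) = complex_of_real (\<Sum>j<n. (cmod (A $$ (j, a)))\<^sup>2)"
      using that by (subst mat_mult_index) (auto simp: complex_norm_square mult.commute simp del: of_real_power)
    then have "complex_of_real (\<Sum>j<n. (cmod (A $$ (j, a)))\<^sup>2) = complex_of_real 0"
      using that unfolding D by (simp del: of_real_sum of_real_power)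
    then have "(\<Sum>j<n. (cmod (A $$ (j, a)))\<^sup>2) = 0" by (simp only: of_real_eq_iff)
    then have "\<forall>j\<in>{..<n}. (cmod (A $$ (j, a)))\<^sup>2 = 0" by (subst (asm) sum_nonneg_eq_0_iff) auto
    then show ?thesis using that by simp
  qed
  \<comment> \<open>Columns with d = 0 are zero, so multiplying by the projection changes nothing;
    this gives idempotence of Z.\<close>
  have AD: "A * real_diag n d = A"
    by (rule eq_matI) (use d A0 in force)+
  define Z where "Z = A * adj A"
  have [simp]: "dim_row Z = n" "dim_col Z = n" by (simp_all add: Z_def)
  have "Z * adj Z = A * (adj A * A) * adj A" by (simp add: Z_def adj_mult mat_assoc)
  then have ZZ: "Z * adj Z = Z" by (simp add: D AD Z_def)
  define x where "x = (\<Sum>a<n. (cmod (A $$ (i, a)))\<^sup>2)"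
  have Zii: "Z $$ (i, i) = complex_of_real x"
    using i unfolding Z_def by (subst mat_mult_index) (auto simp: complex_norm_square x_def simp del: of_real_power)
  have "(Z * adj Z) $$ (i, i) = complex_of_real (\<Sum>j<n. (cmod (Z $$ (i, j)))\<^sup>2)"
    using i by (subst mat_mult_index) (auto simp: complex_norm_square simp del: of_real_power)
  then have "x = (\<Sum>j<n. (cmod (Z $$ (i, j)))\<^sup>2)" unfolding ZZ Zii by (simp only: of_real_eq_iff)
  moreover have "(cmod (Z $$ (i, i)))\<^sup>2 \<le> (\<Sum>j<n. (cmod (Z $$ (i, j)))\<^sup>2)"
    using i by (intro member_le_sum) auto
  moreover have "(cmod (Z $$ (i, i)))\<^sup>2 = x\<^sup>2" unfolding Zii norm_of_real by simp
  ultimately have "x\<^sup>2 \<le> x" by linarith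
  have "x \<le> 1"
  proof (rule ccontr)
    assume "\<not> x \<le> 1"
    then have "x * 1 < x * x" by (intro mult_strict_left_mono) auto
    with \<open>x\<^sup>2 \<le> x\<close> show False by (simp add: power2_eq_square)
  qed
  then show ?thesis by (simp add: x_def)
qed

text \<open>Scaling rows by sqrt p and columns by 1 / sqrt r turns C into a partial isometry, whose
  squared row norms are at most 1. Columns with r = 0 are set to 0, in accordance with division by 0
  in the statement.\<close>

lemma pinch_weights_le_1:
  assumes C: "C \<in> carrier_mat n n" and p: "\<And>i. i < n \<Longrightarrow> 0 \<le> p i" and r: "\<And>a. a < n \<Longrightarrow> 0 \<le> r a"
    and D: "adj C * real_diag n p * C = real_diag n r"
  shows "(\<Sum>i<n. \<Sum>a<n. (p i)\<^sup>2 * (cmod (C $$ (i, a)))\<^sup>2 / r a) \<le> (\<Sum>i<n. p i)"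
proof -
  note [simp] = carrier_matD[OF C]
  define s where "s a = (if r a = 0 then 0 else 1 / sqrt (r a))" for a
  define A where "A = real_diag n (\<lambda>i. sqrt (p i)) * (C * real_diag n s)"
  have A: "A \<in> carrier_mat n n" by (simp add: A_def)
  have "adj A * A = real_diag n s * (adj C * (real_diag n (\<lambda>i. sqrt (p i)) * real_diag n (\<lambda>i. sqrt (p i))) * C) * real_diag n s"
    by (simp add: A_def adj_mult mat_assoc)
  also have "real_diag n (\<lambda>i. sqrt (p i)) * real_diag n (\<lambda>i. sqrt (p i)) = real_diag n p"
    unfolding real_diag_mult using p by (intro real_diag_cong) auto
  also have "real_diag n s * (adj C * real_diag n p * C) * real_diag n s = real_diag n (\<lambda>a. if r a = 0 then 0 else 1)"
    unfolding D real_diag_mult using r by (intro real_diag_cong) (auto simp: s_def)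
  finally have AA: "adj A * A = real_diag n (\<lambda>a. if r a = 0 then 0 else 1)" .
  have "(\<Sum>i<n. \<Sum>a<n. (p i)\<^sup>2 * (cmod (C $$ (i, a)))\<^sup>2 / r a) = (\<Sum>i<n. p i * (\<Sum>a<n. (cmod (A $$ (i, a)))\<^sup>2))"
    unfolding sum_distrib_left
  proof (intro sum.cong refl)
    fix i a assume ia: "i \<in> {..<n}" "a \<in> {..<n}"
    have "A $$ (i, a) = complex_of_real (sqrt (p i)) * (C $$ (i, a) * complex_of_real (s a))" using ia by (simp add: A_def)
    then have "(cmod (A $$ (i, a)))\<^sup>2 = p i * ((cmod (C $$ (i, a)))\<^sup>2 * (s a)\<^sup>2)"
      using p[of i] ia by (simp add: norm_mult power_mult_distrib)
    moreover have "(s a)\<^sup>2 = 1 / r a" using r[of a] ia by (simp add: s_def power_divide)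
    ultimately show "(p i)\<^sup>2 * (cmod (C $$ (i, a)))\<^sup>2 / r a = p i * (cmod (A $$ (i, a)))\<^sup>2" by (simp add: power2_eq_square)
  qed
  also have "\<dots> \<le> (\<Sum>i<n. p i * 1)"
    using p by (intro sum_mono mult_left_mono gram_projection_diag_le_1[OF A AA]) auto
  finally show ?thesis by simp
qed

text \<open>Pinching into v blocks raises the entropy by at most ln v. Here \<open>t k i a\<close>
  are the overlaps of the eigenvectors of \<rho> with those of the k-th block, and
  \<open>r k a\<close> the eigenvalues of the block.\<close>

lemma pinched_entropy:
  fixes v :: nat and t :: "nat \<Rightarrow> nat \<Rightarrow> nat \<Rightarrow> real"
  assumes v: "v > 0" and p: "\<And>i. i < n \<Longrightarrow> 0 \<le> p i" and p1: "(\<Sum>i<n. p i) = 1"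
    and t: "\<And>k i a. 0 \<le> t k i a" and t1: "\<And>i. i < n \<Longrightarrow> (\<Sum>k<v. \<Sum>a<n. t k i a) = 1"
    and r: "\<And>k a. k < v \<Longrightarrow> a < n \<Longrightarrow> r k a = (\<Sum>i<n. p i * t k i a)"
    and w: "\<And>k. k < v \<Longrightarrow> (\<Sum>i<n. \<Sum>a<n. (p i)\<^sup>2 * t k i a / r k a) \<le> 1"
  shows "(\<Sum>i<n. p i * ln (p i)) \<le> (\<Sum>k<v. \<Sum>a<n. r k a * ln (r k a)) + ln (real v)"
proof -
  have "(\<Sum>i<n. p i * ln (p i)) = (\<Sum>i<n. p i * ln (p i) * (\<Sum>k<v. \<Sum>a<n. t k i a))" using t1 by simp
  also have "\<dots> = (\<Sum>i<n. \<Sum>k<v. \<Sum>a<n. p i * t k i a * ln (p i))"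
    by (simp add: sum_distrib_left mult_ac)
  also have "\<dots> \<le> (\<Sum>i<n. \<Sum>k<v. \<Sum>a<n. p i * t k i a * ln (r k a) + ((p i)\<^sup>2 * t k i a / r k a / v - p i * t k i a + p i * t k i a * ln v))"
  proof (intro sum_mono)
    fix i k a assume ika: "i \<in> {..<n}" "k \<in> {..<v}" "a \<in> {..<n}"
    show "p i * t k i a * ln (p i) \<le> p i * t k i a * ln (r k a) + ((p i)\<^sup>2 * t k i a / r k a / v - p i * t k i a + p i * t k i a * ln v)"
    proof (cases "p i * t k i a = 0")
      case False
      then have pos: "p i > 0" "t k i a > 0" using p[of i] t[of k i a] ika by (auto simp: less_le)
      have "p i * t k i a \<le> r k a"
        using ika p t unfolding r[OF ika(2,3)[unfolded lessThan_iff]] by (intro member_le_sum[where f = "\<lambda>i. p i * t k i a"]) auto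
      then have rp: "r k a > 0" using pos by (meson less_le_trans mult_pos_pos)
      have vp: "real v > 0" using v by simp
      \<comment> \<open>The factor v normalizes: each block contributes at most 1 to the sum of p^2
        t / r, so after division by v the linear terms total at most 1 and cancel the subtracted
        1.\<close>
      have "ln (p i / (r k a * v)) \<le> p i / (r k a * v) - 1" using pos rp vp by (intro ln_le_minus_one) auto
      then have "ln (p i) - ln (r k a) - ln v \<le> p i / r k a / v - 1"
        using pos rp vp by (simp add: ln_div ln_mult)
      then have "p i * t k i a * (ln (p i) - ln (r k a) - ln v) \<le> p i * t k i a * (p i / r k a / v - 1)"
        using pos by (intro mult_left_mono) auto
      then show ?thesis by (simp add: algebra_simps power2_eq_square)
    qed (auto simp: power2_eq_square)
  qed
  also have "\<dots> = (\<Sum>i<n. \<Sum>k<v. \<Sum>a<n. p i * t k i a * ln (r k a)) + (\<Sum>i<n. \<Sum>k<v. \<Sum>a<n. (p i)\<^sup>2 * t k i a / r k a) / v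
     - (\<Sum>i<n. p i * (\<Sum>k<v. \<Sum>a<n. t k i a)) + (\<Sum>i<n. p i * (\<Sum>k<v. \<Sum>a<n. t k i a)) * ln v"
    by (simp add: sum.distrib sum_subtractf sum_divide_distrib sum_distrib_left sum_distrib_right mult_ac)
  also have "(\<Sum>i<n. p i * (\<Sum>k<v. \<Sum>a<n. t k i a)) = 1" using t1 p1 by simp
  also have "(\<Sum>i<n. \<Sum>k<v. \<Sum>a<n. (p i)\<^sup>2 * t k i a / r k a) = (\<Sum>k<v. \<Sum>i<n. \<Sum>a<n. (p i)\<^sup>2 * t k i a / r k a)" by (rule sum.swap)
  also have "\<dots> / v \<le> 1"
  proof -
    have "(\<Sum>k<v. \<Sum>i<n. \<Sum>a<n. (p i)\<^sup>2 * t k i a / r k a) \<le> (\<Sum>k<v. 1)" using w by (intro sum_mono) auto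
    then show ?thesis using v by simp
  qed
  also have "(\<Sum>i<n. \<Sum>k<v. \<Sum>a<n. p i * t k i a * ln (r k a)) = (\<Sum>k<v. \<Sum>i<n. \<Sum>a<n. p i * t k i a * ln (r k a))" by (rule sum.swap)
  also have "\<dots> = (\<Sum>k<v. \<Sum>a<n. \<Sum>i<n. p i * t k i a * ln (r k a))" by (intro sum.cong refl sum.swap)
  also have "\<dots> = (\<Sum>k<v. \<Sum>a<n. r k a * ln (r k a))"
    by (intro sum.cong refl) (simp add: r sum_distrib_right)
  finally show ?thesis by simp
qed

definition rank_one :: "nat \<Rightarrow> complex mat \<Rightarrow> nat \<Rightarrow> complex mat" where
  "rank_one n W a = W * real_diag n (\<lambda>i. if i = a then 1 else 0) * adj W"

lemma is_spec_conj_diag: "unitary_mat n W \<Longrightarrow> is_spec n (W * real_diag n d * adj W) W d"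
  by (simp add: is_spec_def)

lemma rank_one_dim [simp]: "dim_row W = n \<Longrightarrow> dim_row (rank_one n W a) = n" "dim_row W = n \<Longrightarrow> dim_col (rank_one n W a) = n"
  by (simp_all add: rank_one_def)

lemma sum_conj_diag:
  assumes "unitary_mat n W" and "\<And>i. i < n \<Longrightarrow> (\<Sum>x\<in>X. d x i) = 1"
  shows "sum_op n (\<lambda>x. W * real_diag n (d x) * adj W) X = 1\<^sub>m n"
proof -
  note [simp] = unitary_dims[OF assms(1)]
  have "sum_op n (\<lambda>x. real_diag n (d x)) X = 1\<^sub>m n"
  proof (rule eq_matI)
    fix i j assume "i < dim_row (1\<^sub>m n :: complex mat)" "j < dim_col (1\<^sub>m n :: complex mat)"
    then have ij: "i < n" "j < n" by auto
    have "(\<Sum>x\<in>X. complex_of_real (d x j)) = 1" using assms(2)[OF ij(2)] by (metis of_real_1 of_real_sum)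
    then show "sum_op n (\<lambda>x. real_diag n (d x)) X $$ (i, j) = 1\<^sub>m n $$ (i, j)" using ij by simp
  qed auto
  then have "W * sum_op n (\<lambda>x. real_diag n (d x)) X * adj W = 1\<^sub>m n" by (simp add: unitary_right[OF assms(1)])
  moreover have "W * sum_op n (\<lambda>x. real_diag n (d x)) X * adj W = sum_op n (\<lambda>x. W * real_diag n (d x) * adj W) X"
    by (subst sum_op_mult_left, simp, simp, subst sum_op_mult_right) auto
  ultimately show ?thesis by simp
qed

lemma tr_mult_rank_one:
  assumes B: "is_spec n B S s" and W: "unitary_mat n W" and a: "a < n"
  shows "tr (B * rank_one n W a) = complex_of_real (\<Sum>i<n. s i * ovl S W i a)"
proof -
  have "tr (B * rank_one n W a) = complex_of_real (\<Sum>i<n. \<Sum>j<n. s i * (if j = a then 1 else 0) * ovl S W i j)"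
    unfolding rank_one_def by (rule tr_spec_mult[OF B is_spec_conj_diag[OF W]])
  also have "(\<Sum>i<n. \<Sum>j<n. s i * (if j = a then 1 else 0) * ovl S W i j) = (\<Sum>i<n. \<Sum>j<n. if j = a then s i * ovl S W i a else 0)"
    by (intro sum.cong refl) auto
  finally show ?thesis using a by simp
qed

text \<open>Measure which of the \<open>v\<close> windows of width \<open>1\<close> the logarithm of the eigenvalue of \<open>\<sigma>\<close> lies in, then measure
  in an eigenbasis of the projected \<open>\<rho>\<close>. The windows cost \<open>1\<close> and the pinching costs \<open>ln v\<close>.\<close>

lemma measured_rel_entropy_pinching:
  assumes \<rho>: "\<rho> \<in> states n" and B: "is_spec n \<sigma> S s" and s: "\<And>i. i < n \<Longrightarrow> 0 < s i" "\<And>i. i < n \<Longrightarrow> s i \<le> 1"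
    and sv: "\<And>i. i < n \<Longrightarrow> - ln (s i) < real v"
  shows "rel_entropy \<rho> \<sigma> \<le> measured_rel_entropy (ALL_povms n) \<rho> \<sigma> + ereal (1 + ln (real v))"
proof -
  have n: "n > 0" by (rule statesD(6)[OF \<rho>])
  have v: "v > 0" using sv[OF n] s(2)[OF n] s(1)[OF n] by (cases v) auto
  obtain U p where A: "is_spec n \<rho> U p" and p: "\<And>i. i < n \<Longrightarrow> 0 \<le> p i" using psd_spec[OF statesD(1)[OF \<rho>]] by blast
  note [simp] = is_specD(3,4,6,7)[OF A] is_specD(3,4,6,7)[OF B]
  note UU = is_specD(1)[OF A] and SS = is_specD(1)[OF B]
  have p1: "(\<Sum>i<n. p i) = 1" using tr_spec[OF A] statesD(2)[OF \<rho>] by (metis of_real_eq_1_iff)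
  \<comment> \<open>The index of the window containing - ln (s i); eigenvalues in window k lie above
    exp (-(k+1)) and at most at exp (-k).\<close>
  define kk where "kk i = nat \<lfloor>- ln (s i)\<rfloor>" for i
  have kk: "real (kk i) \<le> - ln (s i)" "- ln (s i) < real (kk i) + 1" "kk i < v" if i: "i < n" for i
  proof -
    have "0 \<le> - ln (s i)" using s[OF i] by simp
    then have e: "real (kk i) = of_int \<lfloor>- ln (s i)\<rfloor>" by (simp add: kk_def)
    show 1: "real (kk i) \<le> - ln (s i)" unfolding e by linarith
    show "- ln (s i) < real (kk i) + 1" unfolding e by linarith
    show "kk i < v" using 1 sv[OF i] by linarith
  qed
  define ch where "ch k i = (if kk i = k then 1 else 0 :: real)" for k i
  have ch1: "(\<Sum>k<v. ch k i) = 1" if "i < n" for i using kk(3)[OF that] by (simp add: ch_def)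
  define Pk where "Pk k = S * real_diag n (ch k) * adj S" for k
  have Pks: "is_spec n (Pk k) S (ch k)" for k unfolding Pk_def by (rule is_spec_conj_diag[OF SS])
  have [simp]: "dim_row (Pk k) = n" "dim_col (Pk k) = n" for k by (simp_all add: Pk_def)
  have adjPk: "adj (Pk k) = Pk k" for k by (simp add: Pk_def adj_mult mat_assoc)
  have PkPk: "Pk k * Pk k = Pk k" for k
  proof -
    have "Pk k * Pk k = S * (real_diag n (ch k) * real_diag n (ch k)) * adj S"
      by (simp add: Pk_def mat_assoc unitary_cancel[OF SS])
    also have "real_diag n (ch k) * real_diag n (ch k) = real_diag n (ch k)"
      unfolding real_diag_mult by (rule real_diag_cong) (simp add: ch_def)
    finally show ?thesis by (simp add: Pk_def)
  qed
  define Bk where "Bk k = Pk k * \<rho> * Pk k" for k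
  have Bkp: "pos_semidef n (Bk k)" for k
    using psd_conj'[OF statesD(1)[OF \<rho>], of "Pk k" n] by (simp add: Bk_def adjPk)
  have "\<forall>k. \<exists>W r. is_spec n (Bk k) W r \<and> (\<forall>i<n. 0 \<le> r i)" using psd_spec_ex[OF Bkp] by blast
  then obtain W r where Wr: "\<And>k. is_spec n (Bk k) (W k) (r k)" and r: "\<And>k i. i < n \<Longrightarrow> 0 \<le> r k i" by metis
  note [simp] = is_specD(3,4)[OF Wr]
  note WW = is_specD(1)[OF Wr]
  \<comment> \<open>Overlaps between the eigenvectors of \<rho> and the eigenbasis of the k-th
    block, seen through the window projection.\<close>
  define C where "C k = adj U * Pk k * W k" for k
  have [simp]: "dim_row (C k) = n" "dim_col (C k) = n" for k by (simp_all add: C_def)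
  have CD: "adj (C k) * real_diag n p * C k = real_diag n (r k)" for k
  proof -
    have "adj (C k) * real_diag n p * C k = adj (W k) * (Pk k * (U * real_diag n p * adj U) * Pk k) * W k"
      by (simp add: C_def adj_mult adjPk mat_assoc)
    also have "\<dots> = adj (W k) * Bk k * W k" by (simp only: is_specD(2)[OF A, symmetric] Bk_def)
    also have "\<dots> = real_diag n (r k)" by (rule is_specD(8)[OF Wr])
    finally show ?thesis .
  qed
  define t where "t k i a = (cmod (C k $$ (i, a)))\<^sup>2" for k i a
  have rk: "r k a = (\<Sum>i<n. p i * t k i a)" if "a < n" for k a
  proof -
    have "complex_of_real (r k a) = (adj (C k) * (real_diag n p * C k)) $$ (a, a)"
      using that CD[of k] by (simp add: mat_assoc)
    also have "\<dots> = (\<Sum>i<n. cnj (C k $$ (i, a)) * (p i * C k $$ (i, a)))"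
      using that by (subst mat_mult_index) auto
    also have "\<dots> = complex_of_real (\<Sum>i<n. p i * t k i a)"
      by (simp add: t_def complex_norm_square mult_ac del: of_real_power)
    finally show ?thesis by (simp only: of_real_eq_iff)
  qed
  have tsum: "(\<Sum>a<n. t k i a) = (\<Sum>j<n. ch k j * ovl U S i j)" if "i < n" for k i
  proof -
    have "complex_of_real (\<Sum>a<n. t k i a) = (C k * adj (C k)) $$ (i, i)"
      using that by (subst mat_mult_index) (auto simp: t_def complex_norm_square simp del: of_real_power)
    also have "C k * adj (C k) = adj U * (Pk k * Pk k) * U"
      by (simp add: C_def adj_mult adjPk mat_assoc unitary_cancel[OF WW])
    also have "\<dots> = (adj U * S) * real_diag n (ch k) * adj (adj U * S)"
      by (simp add: PkPk) (simp add: Pk_def adj_mult mat_assoc)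
    also have "\<dots> $$ (i, i) = complex_of_real (\<Sum>j<n. ch k j * ovl U S i j)"
      using that by (subst diag_conj_index_diag) (auto simp: ovl_def)
    finally show ?thesis by (simp only: of_real_eq_iff)
  qed
  have t1: "(\<Sum>k<v. \<Sum>a<n. t k i a) = 1" if "i < n" for i
  proof -
    have "(\<Sum>k<v. \<Sum>a<n. t k i a) = (\<Sum>k<v. \<Sum>j<n. ch k j * ovl U S i j)" using tsum[OF that] by simp
    also have "\<dots> = (\<Sum>j<n. (\<Sum>k<v. ch k j) * ovl U S i j)" by (subst sum.swap) (simp add: sum_distrib_right)
    also have "\<dots> = 1" using ch1 ovl_sum[OF UU SS that] by simp
    finally show ?thesis .
  qed
  have ent: "(\<Sum>i<n. p i * ln (p i)) \<le> (\<Sum>k<v. \<Sum>a<n. r k a * ln (r k a)) + ln (real v)"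
  proof (rule pinched_entropy[OF v p p1 _ t1])
    show "(\<Sum>i<n. \<Sum>a<n. (p i)\<^sup>2 * t k i a / r k a) \<le> 1" for k
      unfolding t_def p1[symmetric] by (rule pinch_weights_le_1[OF _ _ _ CD]) (use p r in auto)
  qed (auto simp: t_def[abs_def] rk)
  \<comment> \<open>The eigenbasis of the block spans the whole space, and null vectors of the block
    may leave the window; sandwiching with \<open>Pk k\<close> makes the elements of one window add
    up to its projection.\<close>
  define E where "E k a = Pk k * rank_one n (W k) a * Pk k" for k a
  have [simp]: "dim_row (E k a) = n" "dim_col (E k a) = n" for k a by (simp_all add: E_def)
  have Ep: "pos_semidef n (E k a)" for k a
  proof -
    have "pos_semidef n (rank_one n (W k) a)" unfolding rank_one_def by (rule spec_psd[OF is_spec_conj_diag[OF WW]]) auto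
    from psd_conj'[OF this, of "Pk k" n] show ?thesis by (simp add: E_def adjPk)
  qed
  define M where "M = map (\<lambda>z. E (z div n) (z mod n)) [0..<v * n]"
  have lenM: "length M = v * n" by (simp add: M_def)
  have Mz: "M ! z = E (z div n) (z mod n)" if "z < v * n" for z using that by (simp add: M_def)
  have sumE: "sum_op n (E k) {..<n} = Pk k" for k
  proof -
    have "sum_op n (E k) {..<n} = Pk k * sum_op n (rank_one n (W k)) {..<n} * Pk k"
      unfolding E_def[abs_def] by (subst sum_op_mult_left, simp, simp, subst sum_op_mult_right) auto
    also have "sum_op n (rank_one n (W k)) {..<n} = 1\<^sub>m n"
      unfolding rank_one_def[abs_def] by (rule sum_conj_diag[OF WW]) auto
    finally show ?thesis by (simp add: PkPk)
  qed
  have "sum_op n (\<lambda>z. M ! z) {..<length M} = sum_op n (\<lambda>z. E (z div n) (z mod n)) {..<v * n}"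
    unfolding lenM by (intro sum_op_cong) (simp add: Mz)
  also have "\<dots> = sum_op n (\<lambda>k. sum_op n (E k) {..<n}) {..<v}" by (rule sum_op_flatten[symmetric]) auto
  also have "\<dots> = 1\<^sub>m n" unfolding sumE Pk_def by (rule sum_conj_diag[OF SS ch1])
  finally have M: "M \<in> ALL_povms n" using Ep by (auto simp: ALL_povms_def lenM Mz)
  have trE: "tr (X * E k a) = tr (Pk k * X * Pk k * rank_one n (W k) a)" if "dim_row X = n" "dim_col X = n" for X k a
  proof -
    have "tr (X * E k a) = tr ((X * Pk k * rank_one n (W k) a) * Pk k)" using that by (simp add: E_def mat_assoc)
    also have "\<dots> = tr (Pk k * (X * Pk k * rank_one n (W k) a))" by (rule tr_rot) (use that in auto)
    finally show ?thesis using that by (simp add: mat_assoc)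
  qed
  have P: "Re (tr (\<rho> * E k a)) = r k a" if a: "a < n" for k a
  proof -
    have "tr (\<rho> * E k a) = tr (Bk k * rank_one n (W k) a)" by (simp add: trE Bk_def)
    also have "\<dots> = complex_of_real (\<Sum>i<n. r k i * ovl (W k) (W k) i a)" by (rule tr_mult_rank_one[OF Wr WW a])
    also have "(\<Sum>i<n. r k i * ovl (W k) (W k) i a) = (\<Sum>i<n. if i = a then r k a else 0)"
      using a by (intro sum.cong refl) (auto simp: ovl_self[OF WW])
    finally show ?thesis using a by simp
  qed
  \<comment> \<open>Within window k all eigenvalues of \<sigma> are at most exp (-k), so outcomes
    are unlikely enough under \<sigma>.\<close>
  have Q: "Re (tr (\<sigma> * E k a)) \<le> exp (- real k)" if a: "a < n" for k a
  proof -
    have "Pk k * \<sigma> * Pk k = S * (real_diag n (ch k) * (real_diag n s * real_diag n (ch k))) * adj S"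
      by (subst is_specD(2)[OF B]) (simp add: Pk_def mat_assoc unitary_cancel[OF SS])
    then have sp: "is_spec n (Pk k * \<sigma> * Pk k) S (\<lambda>i. ch k i * (s i * ch k i))"
      using SS by (simp add: is_spec_def real_diag_mult)
    have "Re (tr (\<sigma> * E k a)) = (\<Sum>i<n. ch k i * (s i * ch k i) * ovl S (W k) i a)"
      using tr_mult_rank_one[OF sp WW a] by (simp add: trE)
    also have "\<dots> \<le> (\<Sum>i<n. exp (- real k) * ovl S (W k) i a)"
    proof (intro sum_mono mult_right_mono)
      fix i assume "i \<in> {..<n}"
      then have i: "i < n" by simp
      show "ch k i * (s i * ch k i) \<le> exp (- real k)"
      proof (cases "kk i = k")
        case True
        have "s i = exp (ln (s i))" using s[OF i] by simp
        also have "\<dots> \<le> exp (- real k)" using kk(1)[OF i] True by simp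
        finally show ?thesis using True by (simp add: ch_def)
      qed (simp add: ch_def)
    qed auto
    also have "\<dots> = exp (- real k)" using ovl_sum'[OF SS WW a] by (simp flip: sum_distrib_left)
    finally show ?thesis .
  qed
  have "ereal (\<Sum>k<v. \<Sum>a<n. r k a * (ln (r k a) + real k)) \<le> classical_rel_entropy {..<length M} (outcome_prob \<rho> M) (outcome_prob \<sigma> M)"
  proof (cases "{z \<in> {..<length M}. outcome_prob \<rho> M z \<noteq> 0} \<subseteq> {z \<in> {..<length M}. outcome_prob \<sigma> M z \<noteq> 0}")
    case True
    have "(\<Sum>k<v. \<Sum>a<n. r k a * (ln (r k a) + real k)) = (\<Sum>z<v * n. r (z div n) (z mod n) * (ln (r (z div n) (z mod n)) + real (z div n)))"
      by (rule sum_div_mod[symmetric])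
    also have "\<dots> \<le> (\<Sum>z<v * n. outcome_prob \<rho> M z * ln (outcome_prob \<rho> M z / outcome_prob \<sigma> M z))"
    proof (rule sum_mono)
      fix z assume "z \<in> {..<v * n}"
      then have z: "z < v * n" by simp
      note z' = div_less_of_mult[OF z]
      let ?r = "r (z div n) (z mod n)"
      have Pz: "outcome_prob \<rho> M z = ?r" using P[OF z'(2)] by (simp add: outcome_prob_def Mz[OF z])
      have Qz: "outcome_prob \<sigma> M z \<le> exp (- real (z div n))" using Q[OF z'(2)] by (simp add: outcome_prob_def Mz[OF z])
      show "?r * (ln ?r + real (z div n)) \<le> outcome_prob \<rho> M z * ln (outcome_prob \<rho> M z / outcome_prob \<sigma> M z)"
      proof (cases "?r = 0")
        case False
        then have rp: "?r > 0" using r[OF z'(2)] by (simp add: less_le)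
        have "outcome_prob \<sigma> M z \<noteq> 0" using True False z Pz lenM by auto
        moreover have "0 \<le> outcome_prob \<sigma> M z"
          using outcome_prob_nonneg[OF spec_psd[OF B] M] s z lenM by (auto intro: less_imp_le)
        ultimately have qp: "outcome_prob \<sigma> M z > 0" by simp
        have "ln (outcome_prob \<sigma> M z) \<le> ln (exp (- real (z div n)))" using qp Qz by (subst ln_le_cancel_iff) auto
        then have "ln ?r + real (z div n) \<le> ln (?r / outcome_prob \<sigma> M z)" using rp qp by (simp add: ln_div)
        then show ?thesis unfolding Pz using rp by (intro mult_left_mono) auto
      qed (simp add: Pz)
    qed
    finally show ?thesis using True by (simp add: classical_rel_entropy_def lenM)
  qed (simp add: classical_rel_entropy_def)
  also have "\<dots> \<le> measured_rel_entropy (ALL_povms n) \<rho> \<sigma>"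
    unfolding measured_rel_entropy_def by (rule SUP_upper[OF M])
  finally have ME: "ereal (\<Sum>k<v. \<Sum>a<n. r k a * (ln (r k a) + real k)) \<le> measured_rel_entropy (ALL_povms n) \<rho> \<sigma>" .
  \<comment> \<open>The diagonal of \<rho> in the eigenbasis of \<sigma>; the cross term tr \<rho>
    log \<sigma> depends on \<rho> through it alone.\<close>
  define R where "R j = (\<Sum>i<n. p i * ovl U S i j)" for j
  have R0: "0 \<le> R j" for j unfolding R_def using p by (intro sum_nonneg) auto
  have R1: "(\<Sum>j<n. R j) = 1"
    unfolding R_def by (subst sum.swap) (simp add: ovl_sum[OF UU SS] p1 flip: sum_distrib_left)
  have rsum: "(\<Sum>a<n. r k a) = (\<Sum>j<n. ch k j * R j)" for k
  proof -
    have "(\<Sum>a<n. r k a) = (\<Sum>a<n. \<Sum>i<n. p i * t k i a)" by (simp add: rk)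
    also have "\<dots> = (\<Sum>i<n. p i * (\<Sum>a<n. t k i a))" by (subst sum.swap) (simp add: sum_distrib_left)
    also have "\<dots> = (\<Sum>i<n. \<Sum>j<n. p i * (ch k j * ovl U S i j))" by (simp add: tsum sum_distrib_left)
    also have "\<dots> = (\<Sum>j<n. ch k j * R j)" by (subst sum.swap) (simp add: R_def sum_distrib_left mult_ac)
    finally show ?thesis .
  qed
  have "(\<Sum>k<v. \<Sum>a<n. r k a * real k) = (\<Sum>k<v. \<Sum>j<n. real k * (ch k j * R j))"
    by (simp add: rsum sum_distrib_left flip: sum_distrib_right) (simp add: sum_distrib_left sum_distrib_right mult_ac)
  also have "\<dots> = (\<Sum>j<n. \<Sum>k<v. real k * (ch k j * R j))" by (rule sum.swap)
  also have "\<dots> = (\<Sum>j<n. \<Sum>k<v. if k = kk j then real (kk j) * R j else 0)"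
    by (intro sum.cong refl) (auto simp: ch_def)
  also have "\<dots> = (\<Sum>j<n. real (kk j) * R j)" using kk(3) by (intro sum.cong refl) simp
  finally have "(\<Sum>k<v. \<Sum>a<n. r k a * real k) = (\<Sum>j<n. real (kk j) * R j)" .
  moreover have "(\<Sum>j<n. (- ln (s j) - 1) * R j) \<le> (\<Sum>j<n. real (kk j) * R j)"
    using kk(2) R0 by (intro sum_mono mult_right_mono) (auto simp: less_imp_le algebra_simps)
  moreover have "(\<Sum>j<n. (- ln (s j) - 1) * R j) = - (\<Sum>j<n. R j * ln (s j)) - 1"
    using R1 by (simp add: algebra_simps sum_subtractf sum_negf)
  \<comment> \<open>Rounding - ln (s j) down to its window index loses at most 1 per unit of
    probability.\<close>
  ultimately have K: "- (\<Sum>j<n. R j * ln (s j)) - 1 \<le> (\<Sum>k<v. \<Sum>a<n. r k a * real k)" by simp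
  have "rel_entropy \<rho> \<sigma> = ereal (Dval n U p S s)"
    using s by (subst rel_entropy_Dval[OF A B]) (use p in \<open>auto simp: less_le\<close>)
  also have "Dval n U p S s = (\<Sum>i<n. p i * ln (p i)) - (\<Sum>j<n. R j * ln (s j))"
  proof -
    have "Dval n U p S s = (\<Sum>i<n. p i * ln (p i) * (\<Sum>j<n. ovl U S i j)) - (\<Sum>i<n. \<Sum>j<n. p i * ovl U S i j * ln (s j))"
      by (simp add: Dval_def right_diff_distrib sum_subtractf sum_distrib_left mult_ac)
    also have "(\<Sum>i<n. \<Sum>j<n. p i * ovl U S i j * ln (s j)) = (\<Sum>j<n. R j * ln (s j))"
      by (subst sum.swap) (simp add: R_def sum_distrib_right)
    finally show ?thesis by (simp add: ovl_sum[OF UU SS])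
  qed
  also have "ereal \<dots> \<le> ereal ((\<Sum>k<v. \<Sum>a<n. r k a * (ln (r k a) + real k)) + (1 + ln (real v)))"
    using ent K by (simp add: distrib_left sum.distrib)
  also have "\<dots> = ereal (\<Sum>k<v. \<Sum>a<n. r k a * (ln (r k a) + real k)) + ereal (1 + ln (real v))" by simp
  also have "\<dots> \<le> measured_rel_entropy (ALL_povms n) \<rho> \<sigma> + ereal (1 + ln (real v))"
    using ME by (rule add_right_mono)
  finally show ?thesis .
qed

text \<open>Halving the reference weights costs ln 2; this is the price for mixing in white noise
  with probability one half.\<close>

lemma classical_rel_entropy_half:
  assumes "finite Z" and P: "\<And>z. z \<in> Z \<Longrightarrow> 0 \<le> P z" and one: "(\<Sum>z\<in>Z. P z) = 1" and Q: "\<And>z. z \<in> Z \<Longrightarrow> 0 \<le> Q z" and Q': "\<And>z. z \<in> Z \<Longrightarrow> Q z / 2 \<le> Q' z"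
  shows "classical_rel_entropy Z P Q' \<le> classical_rel_entropy Z P Q + ereal (ln 2)"
proof (cases "{z \<in> Z. P z \<noteq> 0} \<subseteq> {z \<in> Z. Q z \<noteq> 0}")
  case True
  have pos: "Q z > 0" "Q' z > 0" "P z > 0" if "z \<in> Z" "P z \<noteq> 0" for z
    using True that P[OF that(1)] Q[OF that(1)] Q'[OF that(1)] by (auto simp: less_le)
  then have "{z \<in> Z. P z \<noteq> 0} \<subseteq> {z \<in> Z. Q' z \<noteq> 0}" by fastforce
  moreover have "(\<Sum>z\<in>Z. P z * ln (P z / Q' z)) \<le> (\<Sum>z\<in>Z. P z * ln (P z / Q z) + P z * ln 2)"
  proof (rule sum_mono)
    fix z assume z: "z \<in> Z"
    show "P z * ln (P z / Q' z) \<le> P z * ln (P z / Q z) + P z * ln 2"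
    proof (cases "P z = 0")
      case False
      note pz = pos[OF z False]
      have "ln (Q z / 2) \<le> ln (Q' z)" using pz Q'[OF z] by (subst ln_le_cancel_iff) auto
      then have "ln (P z / Q' z) \<le> ln (P z / Q z) + ln 2" using pz by (simp add: ln_div)
      then have "P z * ln (P z / Q' z) \<le> P z * (ln (P z / Q z) + ln 2)" using pz by (intro mult_left_mono) auto
      then show ?thesis by (simp add: distrib_left)
    qed simp
  qed
  moreover have "(\<Sum>z\<in>Z. P z * ln (P z / Q z) + P z * ln 2) = (\<Sum>z\<in>Z. P z * ln (P z / Q z)) + ln 2"
    using one by (simp add: sum.distrib flip: sum_distrib_right)
  ultimately show ?thesis using True by (simp add: classical_rel_entropy_def)
next
  case False
  then have "classical_rel_entropy Z P Q = \<infinity>" unfolding classical_rel_entropy_def by (rule if_not_P)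
  then show ?thesis by simp
qed

text \<open>The three constants are ln 2 for mixing \<sigma> with white noise, 1 for the width of
  the windows, and the logarithm of their number for the pinching. The number of windows is
  logarithmic in the dimension because the noise keeps the spectrum above 1 / (2 a b).\<close>

theorem E_rel_le_E_ALL:
  assumes \<rho>: "\<rho> \<in> states (a * b)"
  shows "E_rel a b \<rho> \<le> E_ALL a b \<rho> + ereal (ln 2 + 1 + ln (ln (2 * real (a * b)) + 2))"
proof -
  let ?n = "a * b"
  have n: "?n > 0" by (rule statesD(6)[OF \<rho>])
  \<comment> \<open>One more than the integer part of ln (2 a b), the largest possible value of - ln
    of an eigenvalue after mixing, so that every eigenvalue falls into some window.\<close>
  define v where "v = nat \<lfloor>ln (2 * real ?n)\<rfloor> + 1"
  have "1 \<le> real ?n" using n unfolding Suc_le_eq[symmetric] by (metis One_nat_def of_nat_1 of_nat_mono)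
  then have ln0: "0 \<le> ln (2 * real ?n)" by (intro ln_ge_zero) linarith
  have v: "ln (2 * real ?n) < real v" "real v \<le> ln (2 * real ?n) + 1" using ln0 unfolding v_def by linarith+
  \<comment> \<open>The constant is moved to the left so that the right side is a plain
    infimum.\<close>
  have "E_rel a b \<rho> + ereal (- (ln 2 + 1 + ln (real v + 1))) \<le> E_ALL a b \<rho>"
    unfolding E_ALL_def E_meas_def
  proof (rule INF_greatest)
    fix \<sigma> assume \<sigma>: "\<sigma> \<in> Sep a b"
    then have \<sigma>s: "\<sigma> \<in> states ?n" and \<sigma>c: "sep_cone a b \<sigma>" by (auto simp: Sep_iff)
    note [simp] = statesD(4,5)[OF \<sigma>s]
    define \<sigma>' where "\<sigma>' = complex_of_real (1/2) \<cdot>\<^sub>m \<sigma> + complex_of_real (1/2) \<cdot>\<^sub>m maximally_mixed ?n"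
    have [simp]: "dim_row \<sigma>' = ?n" "dim_col \<sigma>' = ?n" by (simp_all add: \<sigma>'_def)
    have c': "sep_cone a b \<sigma>'" unfolding \<sigma>'_def by (intro sep_cone_add sep_cone_smult \<sigma>c sep_cone_maximally_mixed) auto
    have "tr \<sigma>' = 1" unfolding \<sigma>'_def using n statesD(2)[OF \<sigma>s]
      by (simp add: tr_add[of _ ?n] tr_smult[of _ ?n] tr_maximally_mixed)
    then have \<sigma>'S: "\<sigma>' \<in> Sep a b" and \<sigma>'s: "\<sigma>' \<in> states ?n" using c' by (auto simp: Sep_iff states_def intro: sep_cone_psd)
    obtain S s where B: "is_spec ?n \<sigma>' S s" and s0: "\<And>i. i < ?n \<Longrightarrow> 0 \<le> s i" using psd_spec[OF statesD(1)[OF \<sigma>'s]] by blast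
    note [simp] = is_specD(3,4)[OF B]
    have s1: "s i \<le> 1" if "i < ?n" for i
    proof -
      have "s i \<le> (\<Sum>i<?n. s i)" using that s0 by (intro member_le_sum) auto
      also have "\<dots> = 1" using tr_spec[OF B] statesD(2)[OF \<sigma>'s] by (metis of_real_eq_1_iff)
      finally show ?thesis .
    qed
    \<comment> \<open>In the eigenbasis of the mixture each eigenvalue is half a nonnegative
      diagonal entry of \<sigma> plus the share of the noise.\<close>
    have sl: "1 / (2 * real ?n) \<le> s i" if i: "i < ?n" for i
    proof -
      have ss: "c \<cdot>\<^sub>m (d \<cdot>\<^sub>m X) = (c * d) \<cdot>\<^sub>m X" for c d :: complex and X
        by (rule eq_matI) simp_all
      have "adj S * \<sigma>' * S = complex_of_real (1/2) \<cdot>\<^sub>m (adj S * \<sigma> * S) + complex_of_real (1 / (2 * real ?n)) \<cdot>\<^sub>m 1\<^sub>m ?n"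
        unfolding \<sigma>'_def maximally_mixed_def
        by (simp add: mult_add_distrib_mat[of _ ?n ?n _ ?n] add_mult_distrib_mat[of _ ?n ?n _ _ ?n] mult_smult_distrib[of _ ?n ?n _ ?n]
            mult_smult_assoc_mat[of _ ?n ?n _ ?n] unitary_left[OF is_specD(1)[OF B]] ss)
      from arg_cong[OF this[unfolded is_specD(8)[OF B]], of "\<lambda>X. X $$ (i, i)"]
      have "complex_of_real (s i) = complex_of_real (1/2) * (adj S * \<sigma> * S) $$ (i, i) + complex_of_real (1 / (2 * real ?n))"
        using i by simp
      moreover have "0 \<le> (adj S * \<sigma> * S) $$ (i, i)"
        using psd_diag[OF psd_conj[OF statesD(1)[OF \<sigma>s] unitary_carrier[OF is_specD(1)[OF B]]] i] .
      ultimately show ?thesis by (simp add: less_eq_complex_def complex_eq_iff)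
    qed
    have sp: "0 < s i" if "i < ?n" for i
    proof -
      have "0 < 1 / (2 * real ?n)" using n by (simp del: of_nat_mult)
      then show ?thesis using sl[OF that] by linarith
    qed
    have sv: "- ln (s i) < real v" if i: "i < ?n" for i
    proof -
      have "ln (1 / (2 * real ?n)) \<le> ln (s i)" using sl[OF i] sp[OF i] n by (subst ln_le_cancel_iff) (auto simp del: of_nat_mult)
      moreover have "ln (1 / (2 * real ?n)) = - ln (2 * real ?n)" using n by (simp add: ln_div del: of_nat_mult)
      ultimately show ?thesis using v by linarith
    qed
    have "E_rel a b \<rho> \<le> rel_entropy \<rho> \<sigma>'" unfolding E_rel_def by (rule INF_lower[OF \<sigma>'S])
    also have "\<dots> \<le> measured_rel_entropy (ALL_povms ?n) \<rho> \<sigma>' + ereal (1 + ln (real v))"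
      by (rule measured_rel_entropy_pinching[OF \<rho> B]) (use sp s1 sv in auto)
    also have "\<dots> \<le> (measured_rel_entropy (ALL_povms ?n) \<rho> \<sigma> + ereal (ln 2)) + ereal (1 + ln (real v))"
    proof (rule add_right_mono)
      show "measured_rel_entropy (ALL_povms ?n) \<rho> \<sigma>' \<le> measured_rel_entropy (ALL_povms ?n) \<rho> \<sigma> + ereal (ln 2)"
        unfolding measured_rel_entropy_def[of _ _ \<sigma>']
      proof (rule SUP_least)
        fix M assume M: "M \<in> ALL_povms ?n"
        have "classical_rel_entropy {..<length M} (outcome_prob \<rho> M) (outcome_prob \<sigma>' M) \<le> classical_rel_entropy {..<length M} (outcome_prob \<rho> M) (outcome_prob \<sigma> M) + ereal (ln 2)"
        proof (rule classical_rel_entropy_half)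
          show "(\<Sum>z<length M. outcome_prob \<rho> M z) = 1" using outcome_prob_sum[OF statesD(3)[OF \<rho>] M] statesD(2)[OF \<rho>] by simp
          fix z assume "z \<in> {..<length M}"
          then have z: "z < length M" by simp
          note [simp] = carrier_matD[OF psd_carrier[OF povm_carrier[OF M z]]]
          show "0 \<le> outcome_prob \<rho> M z" "0 \<le> outcome_prob \<sigma> M z"
            using outcome_prob_nonneg[OF statesD(1)[OF \<rho>] M z] outcome_prob_nonneg[OF statesD(1)[OF \<sigma>s] M z] by auto
          have "\<sigma>' * M ! z = complex_of_real (1/2) \<cdot>\<^sub>m (\<sigma> * M ! z) + complex_of_real (1/2) \<cdot>\<^sub>m (maximally_mixed ?n * M ! z)"
            unfolding \<sigma>'_def by (simp add: add_mult_distrib_mat[of _ ?n ?n _ _ ?n] mult_smult_assoc_mat[of _ ?n ?n _ ?n])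
          then have "tr (\<sigma>' * M ! z) = complex_of_real (1/2) * tr (\<sigma> * M ! z) + complex_of_real (1/2) * tr (maximally_mixed ?n * M ! z)"
            by (simp add: tr_add[of _ ?n] tr_smult[of _ ?n])
          moreover have "0 \<le> tr (maximally_mixed ?n * M ! z)"
            by (rule psd_tr_mult[OF sep_cone_psd[OF sep_cone_maximally_mixed] povm_carrier[OF M z]])
          ultimately show "outcome_prob \<sigma> M z / 2 \<le> outcome_prob \<sigma>' M z"
            by (simp add: outcome_prob_def less_eq_complex_def)
        qed simp
        also have "\<dots> \<le> measured_rel_entropy (ALL_povms ?n) \<rho> \<sigma> + ereal (ln 2)"
          unfolding measured_rel_entropy_def by (intro add_right_mono SUP_upper[OF M])
        finally show "classical_rel_entropy {..<length M} (outcome_prob \<rho> M) (outcome_prob \<sigma>' M) \<le> measured_rel_entropy (ALL_povms ?n) \<rho> \<sigma> + ereal (ln 2)" .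
      qed
    qed
    also have "\<dots> \<le> measured_rel_entropy (ALL_povms ?n) \<rho> \<sigma> + ereal (ln 2 + 1 + ln (real v + 1))"
    proof -
      have "ln (real v) \<le> ln (real v + 1)" by (simp add: v_def)
      then have "ereal (ln 2) + ereal (1 + ln (real v)) \<le> ereal (ln 2 + 1 + ln (real v + 1))" by simp
      then show ?thesis unfolding add.assoc by (rule add_left_mono)
    qed
    finally have "E_rel a b \<rho> \<le> measured_rel_entropy (ALL_povms ?n) \<rho> \<sigma> + ereal (ln 2 + 1 + ln (real v + 1))" .
    then show "E_rel a b \<rho> + ereal (- (ln 2 + 1 + ln (real v + 1))) \<le> measured_rel_entropy (ALL_povms ?n) \<rho> \<sigma>"
      by (cases "E_rel a b \<rho>"; cases "measured_rel_entropy (ALL_povms ?n) \<rho> \<sigma>") auto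
  qed
  then have "E_rel a b \<rho> \<le> E_ALL a b \<rho> + ereal (ln 2 + 1 + ln (real v + 1))"
    by (cases "E_rel a b \<rho>"; cases "E_ALL a b \<rho>") auto
  also have "\<dots> \<le> E_ALL a b \<rho> + ereal (ln 2 + 1 + ln (ln (2 * real ?n) + 2))"
  proof (intro add_left_mono)
    have "ln (real v + 1) \<le> ln (ln (2 * real ?n) + 2)" using v(2) ln0 by (subst ln_le_cancel_iff) auto
    then show "ereal (ln 2 + 1 + ln (real v + 1)) \<le> ereal (ln 2 + 1 + ln (ln (2 * real ?n) + 2))" by simp
  qed
  finally show ?thesis .
qed

subsection \<open>Digits\<close>

lemma digit_less: "0 < d \<Longrightarrow> digit d k i < d"
  by (simp add: digit_def)

lemma digit_mod_power:
  assumes "k < m" shows "digit d k (x mod d ^ m) = digit d k x"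
proof -
  define e where "e = d ^ (m - Suc k)"
  have "d ^ m = d ^ (Suc k + (m - Suc k))" using assms by simp
  then have m: "d ^ m = d ^ k * (d * e)" unfolding power_add e_def by simp
  have "x mod (d ^ k * (d * e)) div d ^ k = x div d ^ k mod (d * e)"
    by (cases "d = 0") (simp_all add: mod_mult2_eq)
  then show ?thesis unfolding digit_def m by (simp add: mod_mod_cancel)
qed

lemma digit_div_power: "digit d k (x div d ^ m) = digit d (m + k) x"
  by (simp add: digit_def power_add div_mult2_eq)

text \<open>Induction peels off the most significant digit: the remainder has n digits and the
  quotient is the digit at position n.\<close>

lemma digits_inject:
  assumes "x < d ^ n" "y < d ^ n" "\<And>k. k < n \<Longrightarrow> digit d k x = digit d k y"
  shows "x = y"
  using assms
proof (induction n arbitrary: x y)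
  case (Suc n)
  have "x mod d ^ n = y mod d ^ n"
  proof (rule Suc.IH)
    show "x mod d ^ n < d ^ n" "y mod d ^ n < d ^ n"
      using Suc.prems(1) by (cases "d = 0"; simp)+
    show "digit d k (x mod d ^ n) = digit d k (y mod d ^ n)" if "k < n" for k
      using that Suc.prems(3)[of k] by (simp add: digit_mod_power)
  qed
  moreover have "x div d ^ n = y div d ^ n"
    using Suc.prems(3)[of n] div_less_of_mult(1)[of x d "d ^ n"] div_less_of_mult(1)[of y d "d ^ n"] Suc.prems(1,2)
    by (simp add: digit_def)
  ultimately show ?case by (metis div_mult_mod_eq)
qed simp

lemma digit_sum:
  assumes "\<And>k. k < n \<Longrightarrow> g k < d"
  shows "(\<Sum>k<n. g k * d ^ k) < d ^ n" "k < n \<Longrightarrow> digit d k (\<Sum>k<n. g k * d ^ k) = g k"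
proof -
  have "(\<Sum>k<n. g k * d ^ k) < d ^ n \<and> (\<forall>k<n. digit d k (\<Sum>k<n. g k * d ^ k) = g k)"
    using assms
  proof (induction n)
    case (Suc n)
    let ?u = "\<Sum>k<n. g k * d ^ k"
    have u: "?u < d ^ n" and dig: "\<And>k. k < n \<Longrightarrow> digit d k ?u = g k" using Suc by auto
    have gn: "g n < d" using Suc.prems by simp
    have S: "(\<Sum>k<Suc n. g k * d ^ k) = g n * d ^ n + ?u" by simp
    have "digit d k (g n * d ^ n + ?u) = g k" if k: "k < Suc n" for k
    proof (cases "k = n")
      case True
      then show ?thesis using u gn by (simp add: digit_def)
    next
      case False
      then have k': "k < n" using k by simp
      have "digit d k (g n * d ^ n + ?u) = digit d k ((g n * d ^ n + ?u) mod d ^ n)" by (rule digit_mod_power[OF k', symmetric])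
      then show ?thesis using u dig[OF k'] by simp
    qed
    moreover have "g n * d ^ n + ?u < d * d ^ n" by (rule index_less[OF gn u])
    ultimately show ?case unfolding S by simp
  qed simp
  then show "(\<Sum>k<n. g k * d ^ k) < d ^ n" "k < n \<Longrightarrow> digit d k (\<Sum>k<n. g k * d ^ k) = g k" by auto
qed

text \<open>The distributive law over all digit strings. It is the reason why a partial trace of a
  tensor power is the tensor power of the partial trace.\<close>

lemma sum_prod_digits:
  fixes h :: "nat \<Rightarrow> nat \<Rightarrow> 'a :: comm_semiring_1"
  shows "(\<Sum>x<d ^ n. \<Prod>k<n. h k (digit d k x)) = (\<Prod>k<n. \<Sum>c<d. h k c)"
proof (induction n)
  case (Suc n)
  have "(\<Sum>x<d ^ Suc n. \<Prod>k<Suc n. h k (digit d k x)) = (\<Sum>q<d. \<Sum>r<d ^ n. \<Prod>k<Suc n. h k (digit d k (q * d ^ n + r)))"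
    unfolding power_Suc by (rule sum_prod_index)
  also have "\<dots> = (\<Sum>q<d. \<Sum>r<d ^ n. h n q * (\<Prod>k<n. h k (digit d k r)))"
  proof (intro sum.cong refl)
    fix q r assume qr: "q \<in> {..<d}" "r \<in> {..<d ^ n}"
    have "digit d n (q * d ^ n + r) = q" using qr by (simp add: digit_def)
    moreover have "digit d k (q * d ^ n + r) = digit d k r" if "k < n" for k
      using digit_mod_power[OF that, of d "q * d ^ n + r"] qr by simp
    ultimately show "(\<Prod>k<Suc n. h k (digit d k (q * d ^ n + r))) = h n q * (\<Prod>k<n. h k (digit d k r))"
      by (simp add: mult.commute)
  qed
  also have "\<dots> = (\<Sum>q<d. h n q) * (\<Sum>r<d ^ n. \<Prod>k<n. h k (digit d k r))" by (simp add: sum_product)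
  finally show ?case unfolding Suc.IH by (simp add: mult.commute)
qed simp

subsection \<open>Tensor powers\<close>

lemma tensor_power_dim [simp]:
  "dim_row (tensor_power dA dB n \<rho>) = dA ^ n * dB ^ n" "dim_col (tensor_power dA dB n \<rho>) = dA ^ n * dB ^ n"
  by (simp_all add: tensor_power_def)

lemma tensor_power_index:
  assumes "i < dA ^ n * dB ^ n" "j < dA ^ n * dB ^ n"
  shows "tensor_power dA dB n \<rho> $$ (i, j) =
    (\<Prod>k<n. \<rho> $$ (digit dA k (i div dB ^ n) * dB + digit dB k (i mod dB ^ n),
                  digit dA k (j div dB ^ n) * dB + digit dB k (j mod dB ^ n)))"
  using assms by (simp add: tensor_power_def)

lemma prod_lessThan_add:
  fixes f :: "nat \<Rightarrow> 'a :: comm_monoid_mult"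
  shows "(\<Prod>k<m + n. f k) = (\<Prod>k<n. f (m + k)) * (\<Prod>k<m. f k)"
  by (induction n) (simp_all add: mult_ac)

text \<open>Factor k is stored in digit k, so the last n copies occupy the high digits and come
  first in the mixed radix numbering; hence the order of the two blocks.\<close>

lemma tensor_power_add:
  "tensor_power dA dB (m + n) \<rho> = regroup (dA ^ n) (dB ^ n) (dA ^ m) (dB ^ m) (tensor_power dA dB n \<rho>) (tensor_power dA dB m \<rho>)"
proof (rule eq_matI)
  let ?R = "regroup (dA ^ n) (dB ^ n) (dA ^ m) (dB ^ m) (tensor_power dA dB n \<rho>) (tensor_power dA dB m \<rho>)"
  let ?b = "dB ^ n * dB ^ m"
  have pw: "dA ^ (m + n) = dA ^ n * dA ^ m" "dB ^ (m + n) = ?b" by (simp_all add: power_add mult.commute)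
  show "dim_row (tensor_power dA dB (m + n) \<rho>) = dim_row ?R" "dim_col (tensor_power dA dB (m + n) \<rho>) = dim_col ?R"
    by (simp_all add: pw)
  fix i j assume "i < dim_row ?R" "j < dim_col ?R"
  then have ij: "i < (dA ^ n * dA ^ m) * ?b" "j < (dA ^ n * dA ^ m) * ?b" by simp_all
  let ?h = "\<lambda>k i. digit dA k (i div ?b) * dB + digit dB k (i mod ?b)"
  have hi: "digit dA k (i div ?b div dA ^ m) * dB + digit dB k (i mod ?b div dB ^ m) = ?h (m + k) i" for k i
    by (simp add: digit_div_power)
  have lo: "digit dA k (i div ?b mod dA ^ m) * dB + digit dB k (i mod ?b mod dB ^ m) = ?h k i" if "k < m" for k i
    using that by (simp add: digit_mod_power)
  note bi = regroup_ix_bounds[OF ij(1)] and bj = regroup_ix_bounds[OF ij(2)]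
  note less = index_less[OF bi(1,3)] index_less[OF bi(2,4)] index_less[OF bj(1,3)] index_less[OF bj(2,4)]
  have "?R $$ (i, j) = (tensor_power dA dB n \<rho> \<otimes>\<^sub>m tensor_power dA dB m \<rho>) $$ (regroup_ix (dB ^ n) (dA ^ m) (dB ^ m) i, regroup_ix (dB ^ n) (dA ^ m) (dB ^ m) j)"
    using ij by (simp add: regroup_def reindex_def)
  also have "\<dots> = tensor_power dA dB n \<rho> $$ (i div ?b div dA ^ m * dB ^ n + i mod ?b div dB ^ m, j div ?b div dA ^ m * dB ^ n + j mod ?b div dB ^ m) *
      tensor_power dA dB m \<rho> $$ (i div ?b mod dA ^ m * dB ^ m + i mod ?b mod dB ^ m, j div ?b mod dA ^ m * dB ^ m + j mod ?b mod dB ^ m)"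
    unfolding regroup_ix_def using less by (subst tensor_index) (simp_all add: index_less)
  also have "\<dots> = (\<Prod>k<n. \<rho> $$ (?h (m + k) i, ?h (m + k) j)) * (\<Prod>k<m. \<rho> $$ (?h k i, ?h k j))"
    using less bi bj by (simp add: tensor_power_index hi lo)
  also have "\<dots> = (\<Prod>k<m + n. \<rho> $$ (?h k i, ?h k j))" by (rule prod_lessThan_add[symmetric])
  also have "\<dots> = tensor_power dA dB (m + n) \<rho> $$ (i, j)" using ij by (subst tensor_power_index) (simp_all add: pw)
  finally show "tensor_power dA dB (m + n) \<rho> $$ (i, j) = ?R $$ (i, j)" by simp
qed

lemma tensor_power_0: "tensor_power dA dB 0 \<rho> = 1\<^sub>m 1"
  by (rule eq_matI) (simp_all add: tensor_power_def)

lemma tensor_power_1: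
  assumes "\<rho> \<in> carrier_mat (dA * dB) (dA * dB)" shows "tensor_power dA dB (Suc 0) \<rho> = \<rho>"
proof (rule eq_matI)
  note [simp] = carrier_matD[OF assms]
  fix i j assume "i < dim_row \<rho>" "j < dim_col \<rho>"
  then have ij: "i < dA * dB" "j < dA * dB" by simp_all
  then show "tensor_power dA dB (Suc 0) \<rho> $$ (i, j) = \<rho> $$ (i, j)"
    using div_less_of_mult[OF ij(1)] div_less_of_mult[OF ij(2)] by (simp add: tensor_power_def digit_def)
qed (simp_all add: tensor_power_def carrier_matD[OF assms])

lemma tensor_power_states:
  assumes "\<rho> \<in> states (dA * dB)" shows "tensor_power dA dB n \<rho> \<in> states (dA ^ n * dB ^ n)"
proof (induction n)
  case 0
  have "maximally_mixed 1 = 1\<^sub>m 1" by (rule eq_matI) (simp_all add: maximally_mixed_def)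
  then have "pos_semidef 1 (1\<^sub>m 1)" "tr (1\<^sub>m 1) = 1"
    using sep_cone_psd[OF sep_cone_maximally_mixed[of 1 1]] tr_maximally_mixed[of 1] by simp_all
  then show ?case by (simp add: tensor_power_0 states_def)
next
  case (Suc n)
  have 1: "tensor_power dA dB 1 \<rho> \<in> states (dA ^ 1 * dB ^ 1)" using assms statesD(3)[OF assms] by (simp add: tensor_power_1)
  have "tensor_power dA dB (n + 1) \<rho> \<in> states ((dA ^ 1 * dA ^ n) * (dB ^ 1 * dB ^ n))"
    unfolding tensor_power_add by (rule regroup_states[OF 1 Suc.IH])
  then show ?case by simp
qed

lemma E_rel_tensor_power_subadd:
  assumes "\<rho> \<in> states (dA * dB)"
  shows "E_rel (dA ^ (m + n)) (dB ^ (m + n)) (tensor_power dA dB (m + n) \<rho>)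
    \<le> E_rel (dA ^ m) (dB ^ m) (tensor_power dA dB m \<rho>) + E_rel (dA ^ n) (dB ^ n) (tensor_power dA dB n \<rho>)"
proof -
  have pw: "d ^ (m + n) = d ^ n * d ^ m" for d :: nat by (simp add: power_add mult.commute)
  show ?thesis unfolding tensor_power_add pw
    using E_rel_regroup_le[OF tensor_power_states[OF assms, of n] tensor_power_states[OF assms, of m]] by (simp add: add.commute)
qed

lemma E_LOCC1_tensor_power_superadd:
  assumes "\<rho> \<in> states (dA * dB)"
  shows "E_LOCC1 (dA ^ m) (dB ^ m) (tensor_power dA dB m \<rho>) + E_LOCC1 (dA ^ n) (dB ^ n) (tensor_power dA dB n \<rho>)
    \<le> E_LOCC1 (dA ^ (m + n)) (dB ^ (m + n)) (tensor_power dA dB (m + n) \<rho>)"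
proof -
  have pw: "d ^ (m + n) = d ^ n * d ^ m" for d :: nat by (simp add: power_add mult.commute)
  show ?thesis unfolding tensor_power_add pw
    using E_LOCC1_regroup_ge[OF tensor_power_states[OF assms, of n] tensor_power_states[OF assms, of m]] by (simp add: add.commute)
qed

subsection \<open>Regrouping tensor powers of tripartite states\<close>

text \<open>Relabels \<open>(B \<otimes> C)\<^sup>\<otimes>\<^sup>n\<close> as \<open>B\<^sup>\<otimes>\<^sup>n \<otimes> C\<^sup>\<otimes>\<^sup>n\<close>.\<close>

definition zip_ix :: "nat \<Rightarrow> nat \<Rightarrow> nat \<Rightarrow> nat \<Rightarrow> nat" where
  "zip_ix b c n x = (\<Sum>k<n. (digit b k (x div c ^ n) * c + digit c k (x mod c ^ n)) * (b * c) ^ k)"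

lemma zip_ix:
  assumes "0 < b" "0 < c"
  shows "zip_ix b c n x < b ^ n * c ^ n"
    "k < n \<Longrightarrow> digit (b * c) k (zip_ix b c n x) = digit b k (x div c ^ n) * c + digit c k (x mod c ^ n)"
proof -
  have g: "digit b k (x div c ^ n) * c + digit c k (x mod c ^ n) < b * c" for k
    by (intro index_less digit_less assms)
  show "zip_ix b c n x < b ^ n * c ^ n" unfolding zip_ix_def power_mult_distrib[symmetric] by (rule digit_sum(1)[OF g])
  show "k < n \<Longrightarrow> digit (b * c) k (zip_ix b c n x) = digit b k (x div c ^ n) * c + digit c k (x mod c ^ n)"
    unfolding zip_ix_def by (rule digit_sum(2)[OF g])
qed

lemma zip_ix_inj:
  assumes bc: "0 < b" "0 < c" shows "inj_on (zip_ix b c n) {..<b ^ n * c ^ n}"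
proof (rule inj_onI)
  fix x y assume xy: "x \<in> {..<b ^ n * c ^ n}" "y \<in> {..<b ^ n * c ^ n}" and eq: "zip_ix b c n x = zip_ix b c n y"
  have xb: "x div c ^ n < b ^ n" "x mod c ^ n < c ^ n" and yb: "y div c ^ n < b ^ n" "y mod c ^ n < c ^ n"
    using xy div_less_of_mult[of x "b ^ n" "c ^ n"] div_less_of_mult[of y "b ^ n" "c ^ n"] by auto
  have D: "digit b k (x div c ^ n) * c + digit c k (x mod c ^ n) = digit b k (y div c ^ n) * c + digit c k (y mod c ^ n)" if "k < n" for k
    using zip_ix(2)[OF bc that, of x] zip_ix(2)[OF bc that, of y] eq by simp
  have "digit b k (x div c ^ n) = digit b k (y div c ^ n) \<and> digit c k (x mod c ^ n) = digit c k (y mod c ^ n)" if "k < n" for k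
    using arg_cong[OF D[OF that], of "\<lambda>z. z div c"] arg_cong[OF D[OF that], of "\<lambda>z. z mod c"] digit_less[OF bc(2)] by simp
  then have "x div c ^ n = y div c ^ n" "x mod c ^ n = y mod c ^ n"
    using digits_inject[OF xb(1) yb(1)] digits_inject[OF xb(2) yb(2)] by auto
  then show "x = y" by (metis div_mult_mod_eq)
qed

definition second_ix :: "nat \<Rightarrow> (nat \<Rightarrow> nat) \<Rightarrow> nat \<Rightarrow> nat" where
  "second_ix n \<pi> i = i div n * n + \<pi> (i mod n)"

lemma second_ix:
  assumes \<pi>: "\<And>i. i < n \<Longrightarrow> \<pi> i < n" and inj: "inj_on \<pi> {..<n}"
  shows "i < m * n \<Longrightarrow> second_ix n \<pi> i < m * n" "inj_on (second_ix n \<pi>) {..<m * n}"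
proof -
  show "i < m * n \<Longrightarrow> second_ix n \<pi> i < m * n"
    unfolding second_ix_def by (intro index_less div_less_of_mult(1) \<pi> div_less_of_mult(2))
  show "inj_on (second_ix n \<pi>) {..<m * n}"
  proof (rule inj_onI)
    fix i j assume ij: "i \<in> {..<m * n}" "j \<in> {..<m * n}" and eq: "second_ix n \<pi> i = second_ix n \<pi> j"
    have ib: "i mod n < n" and jb: "j mod n < n" using ij div_less_of_mult(2)[of _ m n] by auto
    have "i div n = j div n" "\<pi> (i mod n) = \<pi> (j mod n)"
      using arg_cong[OF eq, of "\<lambda>z. z div n"] arg_cong[OF eq, of "\<lambda>z. z mod n"] \<pi>[OF ib] \<pi>[OF jb] by (simp_all add: second_ix_def)
    moreover from this(2) have "i mod n = j mod n" using inj_onD[OF inj] ib jb by auto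
    ultimately show "i = j" by (metis div_mult_mod_eq)
  qed
qed

lemma reindex_second_tensor:
  assumes \<pi>: "\<And>i. i < n \<Longrightarrow> \<pi> i < n" and "A \<in> carrier_mat m m" "B \<in> carrier_mat n n"
  shows "reindex (m * n) (second_ix n \<pi>) (A \<otimes>\<^sub>m B) = A \<otimes>\<^sub>m reindex n \<pi> B"
proof (rule eq_matI)
  note [simp] = carrier_matD[OF assms(2)] carrier_matD[OF assms(3)]
  fix i j assume "i < dim_row (A \<otimes>\<^sub>m reindex n \<pi> B)" "j < dim_col (A \<otimes>\<^sub>m reindex n \<pi> B)"
  then have ij: "i < m * n" "j < m * n" by simp_all
  note b = div_less_of_mult[OF ij(1)] div_less_of_mult[OF ij(2)]
  show "reindex (m * n) (second_ix n \<pi>) (A \<otimes>\<^sub>m B) $$ (i, j) = (A \<otimes>\<^sub>m reindex n \<pi> B) $$ (i, j)"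
    using ij b \<pi>[OF b(2)] \<pi>[OF b(4)] by (simp add: reindex_def second_ix_def tensor_index index_less)
qed (use carrier_matD[OF assms(2)] carrier_matD[OF assms(3)] in simp_all)

text \<open>A relabelling of the second factor is a local unitary: it maps \<open>Sep\<close> into
  itself and leaves the relative entropy unchanged.\<close>

lemma E_rel_reindex_second_le:
  assumes \<pi>: "\<And>i. i < n \<Longrightarrow> \<pi> i < n" and inj: "inj_on \<pi> {..<n}" and \<rho>: "\<rho> \<in> states (m * n)"
  shows "E_rel m n (reindex (m * n) (second_ix n \<pi>) \<rho>) \<le> E_rel m n \<rho>"
  unfolding E_rel_def[of m n \<rho>]
proof (rule INF_greatest)
  fix \<sigma> assume "\<sigma> \<in> Sep m n"
  then have \<sigma>: "\<sigma> \<in> states (m * n)" and "sep_cone m n \<sigma>" by (auto simp: Sep_iff)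
  then obtain l :: nat and YA YB where Y: "\<And>x. x < l \<Longrightarrow> pos_semidef m (YA x) \<and> pos_semidef n (YB x)"
    and \<sigma>e: "\<sigma> = sum_op (m * n) (\<lambda>x. YA x \<otimes>\<^sub>m YB x) {..<l}" by (auto simp: sep_cone_def)
  note ix = second_ix[OF \<pi> inj, where m = m]
  have "reindex (m * n) (second_ix n \<pi>) \<sigma> = sum_op (m * n) (\<lambda>x. YA x \<otimes>\<^sub>m reindex n \<pi> (YB x)) {..<l}"
  proof -
    have "reindex (m * n) (second_ix n \<pi>) \<sigma> = sum_op (m * n) (\<lambda>x. reindex (m * n) (second_ix n \<pi>) (YA x \<otimes>\<^sub>m YB x)) {..<l}"
      unfolding \<sigma>e by (rule reindex_sum_op[OF ix(1)])
    also have "\<dots> = sum_op (m * n) (\<lambda>x. YA x \<otimes>\<^sub>m reindex n \<pi> (YB x)) {..<l}"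
      using Y by (intro sum_op_cong refl reindex_second_tensor \<pi>) (auto dest: psd_carrier)
    finally show ?thesis .
  qed
  then have "sep_cone m n (reindex (m * n) (second_ix n \<pi>) \<sigma>)"
    unfolding sep_cone_def
    by (intro exI[of _ l] exI[of _ YA] exI[of _ "\<lambda>x. reindex n \<pi> (YB x)"] conjI) (use Y psd_reindex[OF \<pi>] in auto)
  then have "reindex (m * n) (second_ix n \<pi>) \<sigma> \<in> Sep m n" using reindex_states[OF ix(1,2) \<sigma>] by (simp add: Sep_iff)
  then have "E_rel m n (reindex (m * n) (second_ix n \<pi>) \<rho>) \<le> rel_entropy (reindex (m * n) (second_ix n \<pi>) \<rho>) (reindex (m * n) (second_ix n \<pi>) \<sigma>)"
    unfolding E_rel_def by (rule INF_lower)
  also have "\<dots> = rel_entropy \<rho> \<sigma>" by (rule rel_entropy_reindex[OF ix(1,2) statesD(1)[OF \<rho>] statesD(1)[OF \<sigma>]])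
  finally show "E_rel m n (reindex (m * n) (second_ix n \<pi>) \<rho>) \<le> rel_entropy \<rho> \<sigma>" .
qed

text \<open>In \<open>tensor_power dA (dB * dC) n\<close> each B stays paired with its C. The
  relabelling collects all B before all C, so that n copies form a tripartite state to which the
  one-shot inequality and the partial traces apply.\<close>

definition tripartite_power :: "nat \<Rightarrow> nat \<Rightarrow> nat \<Rightarrow> nat \<Rightarrow> complex mat \<Rightarrow> complex mat" where
  "tripartite_power dA dB dC n \<rho> = reindex (dA ^ n * (dB ^ n * dC ^ n)) (second_ix (dB ^ n * dC ^ n) (zip_ix dB dC n))
     (tensor_power dA (dB * dC) n \<rho>)"

lemma tripartite_power_index:
  assumes d: "0 < dB" "0 < dC" and b: "a < dA ^ n" "b < dB ^ n" "c < dC ^ n" "a' < dA ^ n" "b' < dB ^ n" "c' < dC ^ n"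
  shows "tripartite_power dA dB dC n \<rho> $$ ((a * dB ^ n + b) * dC ^ n + c, (a' * dB ^ n + b') * dC ^ n + c') =
    (\<Prod>k<n. \<rho> $$ ((digit dA k a * dB + digit dB k b) * dC + digit dC k c, (digit dA k a' * dB + digit dB k b') * dC + digit dC k c'))"
proof -
  let ?D = "dB ^ n * dC ^ n"
  have E: "(a * dB ^ n + b) * dC ^ n + c = a * ?D + (b * dC ^ n + c)" for a b c :: nat by (simp add: algebra_simps)
  have E': "(a * dB + b) * dC + c = a * (dB * dC) + (b * dC + c)" for a b c :: nat by (simp add: algebra_simps)
  note less = index_less[OF b(2,3)] index_less[OF b(5,6)]
  have z: "zip_ix dB dC n x < ?D" for x by (rule zip_ix(1)[OF d])
  have S: "second_ix ?D (zip_ix dB dC n) (a * ?D + (b * dC ^ n + c)) = a * ?D + zip_ix dB dC n (b * dC ^ n + c)"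
    "second_ix ?D (zip_ix dB dC n) (a' * ?D + (b' * dC ^ n + c')) = a' * ?D + zip_ix dB dC n (b' * dC ^ n + c')"
    using less by (simp_all add: second_ix_def)
  show ?thesis unfolding E E' tripartite_power_def reindex_def using b less z
    by (simp add: index_less S tensor_power_index power_mult_distrib zip_ix(2)[OF d])
qed

lemma tripartite_power_states:
  assumes d: "0 < dB" "0 < dC" and \<rho>: "\<rho> \<in> states (dA * (dB * dC))"
  shows "tripartite_power dA dB dC n \<rho> \<in> states (dA ^ n * (dB ^ n * dC ^ n))"
  unfolding tripartite_power_def
  by (rule reindex_states, rule second_ix(1), rule zip_ix(1)[OF d], rule zip_ix_inj[OF d], assumption,
      rule second_ix(2), rule zip_ix(1)[OF d], rule zip_ix_inj[OF d])
    (use tensor_power_states[OF \<rho>, of n] in \<open>simp add: power_mult_distrib\<close>)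

lemma E_rel_tripartite_power_le:
  assumes d: "0 < dB" "0 < dC" and \<rho>: "\<rho> \<in> states (dA * (dB * dC))"
  shows "E_rel (dA ^ n) (dB ^ n * dC ^ n) (tripartite_power dA dB dC n \<rho>) \<le> E_rel (dA ^ n) ((dB * dC) ^ n) (tensor_power dA (dB * dC) n \<rho>)"
  unfolding tripartite_power_def power_mult_distrib
  by (rule E_rel_reindex_second_le, rule zip_ix(1)[OF d], rule zip_ix_inj[OF d])
    (use tensor_power_states[OF \<rho>, of n] in \<open>simp add: power_mult_distrib\<close>)

text \<open>Entries of the regrouped power are products over the copies, and the sum over the index
  of the traced block runs over all digit strings, so it factors copy by copy.\<close>

lemma ptrace_last_tripartite_power:
  assumes d: "0 < dA" "0 < dB" "0 < dC"
  shows "ptrace_last (dA ^ n * dB ^ n) (dC ^ n) (tripartite_power dA dB dC n \<rho>) = tensor_power dA dB n (ptrace_last (dA * dB) dC \<rho>)"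
proof (rule eq_matI)
  fix i j assume "i < dim_row (tensor_power dA dB n (ptrace_last (dA * dB) dC \<rho>))" "j < dim_col (tensor_power dA dB n (ptrace_last (dA * dB) dC \<rho>))"
  then have ij: "i < dA ^ n * dB ^ n" "j < dA ^ n * dB ^ n" by simp_all
  note b = div_less_of_mult[OF ij(1)] div_less_of_mult[OF ij(2)]
  let ?a = "\<lambda>i k. digit dA k (i div dB ^ n) * dB + digit dB k (i mod dB ^ n)"
  have "ptrace_last (dA ^ n * dB ^ n) (dC ^ n) (tripartite_power dA dB dC n \<rho>) $$ (i, j)
    = (\<Sum>c<dC ^ n. tripartite_power dA dB dC n \<rho> $$ ((i div dB ^ n * dB ^ n + i mod dB ^ n) * dC ^ n + c, (j div dB ^ n * dB ^ n + j mod dB ^ n) * dC ^ n + c))"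
    unfolding div_mult_mod_eq using ij by (simp add: ptrace_last_def)
  also have "\<dots> = (\<Sum>c<dC ^ n. \<Prod>k<n. \<rho> $$ (?a i k * dC + digit dC k c, ?a j k * dC + digit dC k c))"
    using b by (intro sum.cong refl tripartite_power_index d) auto
  also have "\<dots> = (\<Prod>k<n. \<Sum>c<dC. \<rho> $$ (?a i k * dC + c, ?a j k * dC + c))"
    by (rule sum_prod_digits)
  also have "\<dots> = tensor_power dA dB n (ptrace_last (dA * dB) dC \<rho>) $$ (i, j)"
    unfolding tensor_power_index[OF ij] by (intro prod.cong refl) (simp add: ptrace_last_def index_less digit_less d)
  finally show "ptrace_last (dA ^ n * dB ^ n) (dC ^ n) (tripartite_power dA dB dC n \<rho>) $$ (i, j) = tensor_power dA dB n (ptrace_last (dA * dB) dC \<rho>) $$ (i, j)" .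
qed (simp_all add: ptrace_last_def)

lemma ptrace_mid_tripartite_power:
  assumes d: "0 < dA" "0 < dB" "0 < dC"
  shows "ptrace_mid (dA ^ n) (dB ^ n) (dC ^ n) (tripartite_power dA dB dC n \<rho>) = tensor_power dA dC n (ptrace_mid dA dB dC \<rho>)"
proof (rule eq_matI)
  fix i j assume "i < dim_row (tensor_power dA dC n (ptrace_mid dA dB dC \<rho>))" "j < dim_col (tensor_power dA dC n (ptrace_mid dA dB dC \<rho>))"
  then have ij: "i < dA ^ n * dC ^ n" "j < dA ^ n * dC ^ n" by simp_all
  note b = div_less_of_mult[OF ij(1)] div_less_of_mult[OF ij(2)]
  let ?f = "\<lambda>i k b. (digit dA k (i div dC ^ n) * dB + b) * dC + digit dC k (i mod dC ^ n)"
  have "ptrace_mid (dA ^ n) (dB ^ n) (dC ^ n) (tripartite_power dA dB dC n \<rho>) $$ (i, j)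
    = (\<Sum>b<dB ^ n. tripartite_power dA dB dC n \<rho> $$ ((i div dC ^ n * dB ^ n + b) * dC ^ n + i mod dC ^ n, (j div dC ^ n * dB ^ n + b) * dC ^ n + j mod dC ^ n))"
    using ij by (simp add: ptrace_mid_def)
  also have "\<dots> = (\<Sum>b<dB ^ n. \<Prod>k<n. \<rho> $$ (?f i k (digit dB k b), ?f j k (digit dB k b)))"
    using b by (intro sum.cong refl tripartite_power_index d) auto
  also have "\<dots> = (\<Prod>k<n. \<Sum>b<dB. \<rho> $$ (?f i k b, ?f j k b))"
    by (rule sum_prod_digits)
  also have "\<dots> = tensor_power dA dC n (ptrace_mid dA dB dC \<rho>) $$ (i, j)"
    unfolding tensor_power_index[OF ij] by (intro prod.cong refl) (simp add: ptrace_mid_def index_less digit_less d)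
  finally show "ptrace_mid (dA ^ n) (dB ^ n) (dC ^ n) (tripartite_power dA dB dC n \<rho>) $$ (i, j) = tensor_power dA dC n (ptrace_mid dA dB dC \<rho>) $$ (i, j)" .
qed (simp_all add: ptrace_mid_def)

subsection \<open>Regularization\<close>

lemma subadditive_mult_le:
  fixes f :: "nat \<Rightarrow> real"
  assumes "\<And>m n. f (m + n) \<le> f m + f n"
  shows "f (q * m + r) \<le> real q * f m + f r"
proof (induction q)
  case (Suc q)
  have "f (Suc q * m + r) = f (m + (q * m + r))" by (simp add: add.assoc)
  also have "\<dots> \<le> f m + f (q * m + r)" by (rule assms)
  finally show ?case using Suc by (simp add: algebra_simps)
qed simp

lemma fekete:
  fixes f :: "nat \<Rightarrow> real"
  assumes sub: "\<And>m n. f (m + n) \<le> f m + f n" and lower: "\<And>n. c * real n \<le> f n"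
  shows "convergent (\<lambda>n. f n / real n)"
proof -
  let ?g = "\<lambda>n. f n / real n"
  \<comment> \<open>The limit is the infimum of the averages; n = 0 is excluded because there the
    quotient is 0 by convention.\<close>
  define L where "L = Inf (?g ` {1..})"
  have lo: "c \<le> ?g n" if "n \<ge> 1" for n using lower[of n] that by (simp add: field_simps)
  have bdd: "bdd_below (?g ` {1..})" using lo by (intro bdd_belowI[of _ c]) auto
  have L: "L \<le> ?g n" if "n \<ge> 1" for n unfolding L_def using that by (intro cInf_lower bdd) auto
  have "?g \<longlonglongrightarrow> L"
  proof (rule LIMSEQ_I)
    fix e :: real assume e: "0 < e"
    have "Inf (?g ` {1..}) < L + e / 2" using e by (simp add: L_def)
    then obtain m where m: "m \<ge> 1" "?g m < L + e / 2" using bdd by (subst (asm) cInf_less_iff) auto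
    \<comment> \<open>A bound on the error of writing n as a multiple of m plus a remainder: one
      copy of f m for rounding n / m and the largest possible remainder term.\<close>
    define K where "K = \<bar>f m\<bar> + (\<Sum>r<m. \<bar>f r\<bar>)"
    have K0: "0 \<le> K" by (simp add: K_def sum_nonneg)
    have up: "?g n \<le> ?g m + K / real n" if n: "n \<ge> 1" for n
    proof -
      have r: "n mod m < m" using m by simp
      have "f n \<le> real (n div m) * f m + f (n mod m)" using subadditive_mult_le[OF sub, of "n div m" m "n mod m"] by simp
      moreover have "f (n mod m) \<le> (\<Sum>r<m. \<bar>f r\<bar>)"
        using member_le_sum[of "n mod m" "{..<m}" "\<lambda>r. \<bar>f r\<bar>"] r by simp
      moreover have "real (n div m) * f m \<le> real n * ?g m + \<bar>f m\<bar>"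
      proof -
        have "real n = real (n div m) * real m + real (n mod m)" by (simp flip: of_nat_mult of_nat_add)
        then have "real n * ?g m = real (n div m) * f m + real (n mod m) / real m * f m" using m by (simp add: field_simps)
        moreover have "\<bar>real (n mod m) / real m * f m\<bar> \<le> 1 * \<bar>f m\<bar>"
          unfolding abs_mult using r by (intro mult_right_mono) (auto simp: field_simps)
        ultimately show ?thesis by linarith
      qed
      ultimately have "f n \<le> real n * ?g m + K" by (simp add: K_def)
      then have "?g n \<le> (real n * ?g m + K) / real n" by (intro divide_right_mono) auto
      also have "\<dots> = ?g m + K / real n" using n by (simp add: field_simps)
      finally show ?thesis .
    qed
    obtain N :: nat where N: "2 * K / e < real N" using reals_Archimedean2 by blast
    show "\<exists>no. \<forall>n\<ge>no. norm (?g n - L) < e"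
    proof (intro exI[of _ "max 1 N"] allI impI)
      fix n assume "max 1 N \<le> n"
      then have n: "n \<ge> 1" "real N \<le> real n" by auto
      have "2 * K / e < real n" using N n by linarith
      then have "K / real n < e / 2" using e n by (simp add: field_simps)
      then have "L \<le> ?g n" "?g n < L + e" using up[OF n(1)] L[OF n(1)] m(2) by linarith+
      then show "norm (?g n - L) < e" by simp
    qed
  qed
  then show ?thesis by (rule convergentI)
qed

section \<open>Finiteness and comparison of the entanglement measures\<close>

lemma E_rel_nonneg:
  assumes "\<rho> \<in> states (a * b)" shows "0 \<le> E_rel a b \<rho>"
  unfolding E_rel_def using assms by (intro INF_greatest rel_entropy_nonneg) (auto simp: Sep_iff)

text \<open>The maximally mixed state is separable and has trivial kernel, so its support contains
  every other.\<close>

lemma E_rel_finite: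
  assumes "\<rho> \<in> states (a * b)" shows "E_rel a b \<rho> < \<infinity>"
proof -
  let ?n = "a * b"
  let ?\<mu> = "maximally_mixed ?n"
  have n: "?n > 0" by (rule statesD(6)[OF assms])
  have "?\<mu> \<in> Sep a b"
    using n by (auto simp: Sep_iff states_def tr_maximally_mixed intro: sep_cone_psd sep_cone_maximally_mixed)
  then have "E_rel a b \<rho> \<le> rel_entropy \<rho> ?\<mu>" unfolding E_rel_def by (rule INF_lower)
  moreover have "supp \<rho> \<subseteq> supp ?\<mu>"
  proof -
    have "w = 0\<^sub>v ?n" if "w \<in> mat_kernel ?\<mu>" for w
    proof -
      have w: "w \<in> carrier_vec ?n" "?\<mu> *\<^sub>v w = 0\<^sub>v ?n" using that by (auto simp: mat_kernel_def)
      have "?\<mu> *\<^sub>v w = complex_of_real (1 / real ?n) \<cdot>\<^sub>v w"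
        unfolding maximally_mixed_def using w(1)
        by (intro eq_vecI) (auto simp: scalar_prod_def if_distrib[of "\<lambda>z. z * c" for c] cong: if_cong simp flip: sum_divide_distrib)
      then have "complex_of_real (1 / real ?n) \<cdot>\<^sub>v w = 0\<^sub>v ?n" using w(2) by simp
      then have z: "(complex_of_real (1 / real ?n) \<cdot>\<^sub>v w) $ i = 0\<^sub>v ?n $ i" for i by simp
      show ?thesis
      proof (rule eq_vecI)
        fix i assume "i < dim_vec (0\<^sub>v ?n :: complex vec)"
        then show "w $ i = 0\<^sub>v ?n $ i" using z[of i] w(1) n by simp
      qed (use w(1) in simp)
    qed
    moreover have "v \<bullet>c 0\<^sub>v ?n = 0" for v :: "complex vec" by (simp add: scalar_prod_def)
    ultimately have "v \<bullet>c w = 0" if "w \<in> mat_kernel ?\<mu>" for v w using that by metis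
    then show ?thesis unfolding supp_def by (simp add: statesD(5)[OF assms] subset_iff)
  qed
  ultimately show ?thesis by (auto simp: rel_entropy_def)
qed

lemma E_ALL_nonneg: "\<rho> \<in> states (a * b) \<Longrightarrow> 0 \<le> E_ALL a b \<rho>"
  unfolding E_ALL_def by (rule E_meas_nonneg[OF trivial_povm_ALL])

lemma E_LOCC1_nonneg: "\<rho> \<in> states (a * b) \<Longrightarrow> 0 \<le> E_LOCC1 a b \<rho>"
  unfolding E_LOCC1_def by (rule E_meas_nonneg[OF trivial_povm_LOCC1])

text \<open>The monogamy inequality with a one-dimensional system C, where the second term is
  nonnegative.\<close>

lemma E_LOCC1_le_E_rel:
  assumes "\<rho> \<in> states (a * b)" shows "E_LOCC1 a b \<rho> \<le> E_rel a b \<rho>"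
proof -
  have \<rho>: "\<rho> \<in> states (a * (b * 1))" using assms by simp
  have P: "ptrace_last (a * b) 1 \<rho> = \<rho>" by (rule eq_matI) (use statesD(4,5)[OF assms] in \<open>auto simp: ptrace_last_def\<close>)
  have "E_LOCC1 a b \<rho> + 0 \<le> E_LOCC1 a b \<rho> + E_ALL a 1 (ptrace_mid a b 1 \<rho>)"
    by (intro add_left_mono E_ALL_nonneg ptrace_mid_states \<rho>)
  also have "\<dots> \<le> E_rel a b \<rho>" using monogamy[OF \<rho>] unfolding P by simp
  finally show ?thesis by simp
qed

text \<open>Both quantities are finite on tensor powers of a state, so they can be treated as real
  sequences, to which Fekete's lemma and limits of real numbers apply.\<close>

definition rel_seq :: "nat \<Rightarrow> nat \<Rightarrow> complex mat \<Rightarrow> nat \<Rightarrow> real" where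
  "rel_seq dA dB \<rho> n = real_of_ereal (E_rel (dA ^ n) (dB ^ n) (tensor_power dA dB n \<rho>))"

definition locc_seq :: "nat \<Rightarrow> nat \<Rightarrow> complex mat \<Rightarrow> nat \<Rightarrow> real" where
  "locc_seq dA dB \<rho> n = real_of_ereal (E_LOCC1 (dA ^ n) (dB ^ n) (tensor_power dA dB n \<rho>))"

context
  fixes dA dB :: nat and \<rho> :: "complex mat"
  assumes \<rho>: "\<rho> \<in> states (dA * dB)"
begin

lemma rel_seq: "E_rel (dA ^ n) (dB ^ n) (tensor_power dA dB n \<rho>) = ereal (rel_seq dA dB \<rho> n)"
  using E_rel_nonneg[OF tensor_power_states[OF \<rho>], of n] E_rel_finite[OF tensor_power_states[OF \<rho>], of n]
  unfolding rel_seq_def by (intro ereal_real'[symmetric]) auto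

lemma locc_seq: "E_LOCC1 (dA ^ n) (dB ^ n) (tensor_power dA dB n \<rho>) = ereal (locc_seq dA dB \<rho> n)"
  using E_LOCC1_nonneg[OF tensor_power_states[OF \<rho>], of n] E_LOCC1_le_E_rel[OF tensor_power_states[OF \<rho>], of n]
  unfolding locc_seq_def rel_seq by (intro ereal_real'[symmetric]) auto

lemma rel_seq_1: "E_rel dA dB \<rho> = ereal (rel_seq dA dB \<rho> 1)"
  using rel_seq[of 1] by (simp add: tensor_power_1[OF statesD(3)[OF \<rho>]])

lemma locc_seq_1: "E_LOCC1 dA dB \<rho> = ereal (locc_seq dA dB \<rho> 1)"
  using locc_seq[of 1] by (simp add: tensor_power_1[OF statesD(3)[OF \<rho>]])

lemma rel_seq_subadd: "rel_seq dA dB \<rho> (m + n) \<le> rel_seq dA dB \<rho> m + rel_seq dA dB \<rho> n"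
  using E_rel_tensor_power_subadd[OF \<rho>, of m n] unfolding rel_seq by simp

lemma locc_seq_superadd: "locc_seq dA dB \<rho> m + locc_seq dA dB \<rho> n \<le> locc_seq dA dB \<rho> (m + n)"
  using E_LOCC1_tensor_power_superadd[OF \<rho>, of m n] unfolding locc_seq by simp

lemma rel_seq_nonneg: "0 \<le> rel_seq dA dB \<rho> n"
  using E_rel_nonneg[OF tensor_power_states[OF \<rho>], of n] unfolding rel_seq by simp

lemma locc_seq_le: "locc_seq dA dB \<rho> n \<le> rel_seq dA dB \<rho> n"
  using E_LOCC1_le_E_rel[OF tensor_power_states[OF \<rho>], of n] unfolding rel_seq locc_seq by simp

text \<open>Writing n as (n - 1) * 1 + 1 avoids the value at 0.\<close>

lemma rel_seq_le:
  assumes "n \<ge> 1" shows "rel_seq dA dB \<rho> n \<le> real n * rel_seq dA dB \<rho> 1"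
  using subadditive_mult_le[of "rel_seq dA dB \<rho>", OF rel_seq_subadd, of "n - 1" 1 1] assms
  by (simp add: of_nat_diff algebra_simps)

lemma locc_seq_ge:
  assumes "n \<ge> 1" shows "real n * locc_seq dA dB \<rho> 1 \<le> locc_seq dA dB \<rho> n"
  using subadditive_mult_le[of "\<lambda>n. - locc_seq dA dB \<rho> n" "n - 1" 1 1] locc_seq_superadd assms
  by (simp add: of_nat_diff algebra_simps)

lemma lim_ereal_seq:
  assumes "\<And>n. X n = ereal (f n)" "(\<lambda>n. f n / real n) \<longlonglongrightarrow> L"
  shows "lim (\<lambda>n. X n / ereal (real n)) = ereal L"
proof (rule limI)
  have "(\<lambda>n. ereal (f n / real n)) \<longlonglongrightarrow> ereal L" using assms(2) by simp
  moreover have "eventually (\<lambda>n. ereal (f n / real n) = X n / ereal (real n)) sequentially"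
    using eventually_ge_at_top[of 1] by eventually_elim (simp add: assms(1))
  ultimately show "(\<lambda>n. X n / ereal (real n)) \<longlonglongrightarrow> ereal L" by (rule Lim_transform_eventually)
qed

lemma E_rel_reg_limit:
  obtains L where "(\<lambda>n. rel_seq dA dB \<rho> n / real n) \<longlonglongrightarrow> L" "E_rel_reg dA dB \<rho> = ereal L"
proof -
  have "convergent (\<lambda>n. rel_seq dA dB \<rho> n / real n)"
    using rel_seq_subadd by (rule fekete[where c = 0]) (simp add: rel_seq_nonneg)
  then obtain L where L: "(\<lambda>n. rel_seq dA dB \<rho> n / real n) \<longlonglongrightarrow> L" by (auto simp: convergent_def)
  moreover have "E_rel_reg dA dB \<rho> = ereal L" unfolding E_rel_reg_def by (rule lim_ereal_seq[OF rel_seq L])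
  ultimately show ?thesis by (rule that)
qed

lemma E_LOCC1_reg_limit:
  obtains L where "(\<lambda>n. locc_seq dA dB \<rho> n / real n) \<longlonglongrightarrow> L" "E_LOCC1_reg dA dB \<rho> = ereal L"
proof -
  have "locc_seq dA dB \<rho> 0 \<le> 0" using locc_seq_superadd[of 0 0] rel_seq_subadd[of 0 0] by simp
  \<comment> \<open>Fekete is applied to the negated sequence, which needs a linear lower bound; it
    comes from the one-way LOCC quantity being below \<open>rel_seq\<close> and from subadditivity
    of the latter. The case n = 0 rests on superadditivity at 0.\<close>
  then have b: "- (rel_seq dA dB \<rho> 1) * real n \<le> - locc_seq dA dB \<rho> n" for n
    using rel_seq_le[of n] locc_seq_le[of n] by (cases "n = 0") (auto simp: mult.commute)
  have "convergent (\<lambda>n. - locc_seq dA dB \<rho> n / real n)"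
    by (rule fekete[where c = "- rel_seq dA dB \<rho> 1"]) (use locc_seq_superadd b in \<open>simp_all add: algebra_simps\<close>)
  then obtain L where "(\<lambda>n. - locc_seq dA dB \<rho> n / real n) \<longlonglongrightarrow> L" by (auto simp: convergent_def)
  from tendsto_minus[OF this] have L: "(\<lambda>n. locc_seq dA dB \<rho> n / real n) \<longlonglongrightarrow> - L" by simp
  moreover have "E_LOCC1_reg dA dB \<rho> = ereal (- L)" unfolding E_LOCC1_reg_def by (rule lim_ereal_seq[OF locc_seq L])
  ultimately show ?thesis by (rule that)
qed

end

text \<open>The logarithm of d^n is linear in n, so the iterated logarithm is at most ln n plus a
  constant, which vanishes after division by n.\<close>

lemma ln_ln_power_over_n:
  assumes "0 < d"
  shows "(\<lambda>n. (ln 2 + 1 + ln (ln (2 * real (d ^ n)) + 2)) / real n) \<longlonglongrightarrow> 0"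
proof -
  define K where "K = ln (real d)"
  have K: "0 \<le> K" using assms by (simp add: K_def)
  have l2: "0 < ln (2 :: real)" by simp
  \<comment> \<open>For n \<ge> 1 the inner expression is at most n (ln 2 + K + 2); its logarithm
    splits into ln n and the constant collected here.\<close>
  define C where "C = ln 2 + 1 + ln (ln 2 + K + 2)"
  have "(\<lambda>n. C * (1 / real n) + ln (real n) / real n) \<longlonglongrightarrow> C * 0 + 0"
    by (intro tendsto_intros lim_1_over_n filterlim_compose[OF ln_x_over_x_tendsto_0 filterlim_real_sequentially])
  then have lim: "(\<lambda>n. C * (1 / real n) + ln (real n) / real n) \<longlonglongrightarrow> 0" by simp
  show ?thesis
  proof (rule tendsto_sandwich[OF _ _ tendsto_const lim])
    have ln: "ln (2 * real (d ^ n)) = ln 2 + real n * K" for n using assms by (simp add: ln_mult ln_realpow K_def)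
    show "\<forall>\<^sub>F n in sequentially. 0 \<le> (ln 2 + 1 + ln (ln (2 * real (d ^ n)) + 2)) / real n"
    proof (intro always_eventually allI divide_nonneg_nonneg)
      fix n
      have "0 \<le> real n * K" using K by simp
      then have "0 \<le> ln (ln (2 * real (d ^ n)) + 2)" unfolding ln using l2 by (intro ln_ge_zero) linarith
      then show "0 \<le> ln 2 + 1 + ln (ln (2 * real (d ^ n)) + 2)" using l2 by linarith
    qed simp
    show "\<forall>\<^sub>F n in sequentially. (ln 2 + 1 + ln (ln (2 * real (d ^ n)) + 2)) / real n \<le> C * (1 / real n) + ln (real n) / real n"
      using eventually_ge_at_top[of 1]
    proof eventually_elim
      case (elim n)
      have n: "1 \<le> real n" using elim by simp
      have K2: "0 < ln 2 + K + 2" using K l2 by linarith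
      have "ln 2 + real n * K + 2 \<le> real n * (ln 2 + K + 2)"
      proof -
        have "1 * (ln 2 + 2) \<le> real n * (ln 2 + 2)" using n l2 by (intro mult_right_mono) linarith+
        then show ?thesis by (simp add: algebra_simps)
      qed
      moreover have "0 < ln 2 + real n * K + 2" using mult_nonneg_nonneg[of "real n" K] K l2 n by linarith
      ultimately have "ln (ln 2 + real n * K + 2) \<le> ln (real n * (ln 2 + K + 2))" using K2 n by (subst ln_le_cancel_iff) auto
      also have "\<dots> = ln (real n) + ln (ln 2 + K + 2)" using K2 n by (subst ln_mult) auto
      finally have "ln 2 + 1 + ln (ln (2 * real (d ^ n)) + 2) \<le> C + ln (real n)" unfolding ln C_def by simp
      then have "(ln 2 + 1 + ln (ln (2 * real (d ^ n)) + 2)) / real n \<le> (C + ln (real n)) / real n" by (intro divide_right_mono) auto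
      then show ?case by (simp add: add_divide_distrib)
    qed
  qed
qed

theorem proposition7:
  fixes dA dB dC :: nat and \<rho> \<rho>AB \<rho>AC :: "complex mat"
  assumes "\<rho> \<in> states (dA * dB * dC)"
    and "\<rho>AB = ptrace_last (dA * dB) dC \<rho>"
    and "\<rho>AC = ptrace_mid dA dB dC \<rho>"
  shows "E_rel dA (dB * dC) \<rho> \<ge> E_LOCC1 dA dB \<rho>AB + E_ALL dA dC \<rho>AC \<and>
         E_rel dA (dB * dC) \<rho> \<ge> E_LOCC1 dA dB \<rho>AB + E_rel_reg dA dC \<rho>AC \<and>
         E_rel_reg dA (dB * dC) \<rho> \<ge> E_LOCC1_reg dA dB \<rho>AB + E_rel_reg dA dC \<rho>AC"
proof -
  have \<rho>: "\<rho> \<in> states (dA * (dB * dC))" using assms(1) by (simp add: mult.assoc)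
  have AB: "\<rho>AB \<in> states (dA * dB)" unfolding assms(2) by (rule ptrace_last_states[OF assms(1)])
  have AC: "\<rho>AC \<in> states (dA * dC)" unfolding assms(3) by (rule ptrace_mid_states[OF \<rho>])
  \<comment> \<open>An operator of trace 1 exists in positive dimension only; positivity is what the
    digit arithmetic requires.\<close>
  have d: "0 < dA" "0 < dB" "0 < dC" using statesD(6)[OF \<rho>] by auto
  let ?e = "rel_seq dA (dB * dC) \<rho>" and ?l = "locc_seq dA dB \<rho>AB" and ?c = "rel_seq dA dC \<rho>AC"
  define \<delta> where "\<delta> n = ln 2 + 1 + ln (ln (2 * real ((dA * dC) ^ n)) + 2)" for n :: nat
  have \<delta>: "(\<lambda>n. \<delta> n / real n) \<longlonglongrightarrow> 0" unfolding \<delta>_def using d by (intro ln_ln_power_over_n) simp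
  \<comment> \<open>The one-shot inequality for n copies, with the measured quantity on AC replaced
    by E at the cost \<delta> n.\<close>
  have key: "?l n + ?c n \<le> ?e n + \<delta> n" for n
  proof -
    let ?a = "E_ALL (dA ^ n) (dC ^ n) (tensor_power dA dC n \<rho>AC)"
    let ?R = "tripartite_power dA dB dC n \<rho>"
    have "ereal (?l n) + ?a \<le> E_rel (dA ^ n) (dB ^ n * dC ^ n) ?R"
      using monogamy[OF tripartite_power_states[OF d(2,3) \<rho>, of n]]
      unfolding ptrace_last_tripartite_power[OF d] ptrace_mid_tripartite_power[OF d] assms(2,3)[symmetric] locc_seq[OF AB] .
    also have "\<dots> \<le> ereal (?e n)" using E_rel_tripartite_power_le[OF d(2,3) \<rho>, of n] unfolding rel_seq[OF \<rho>] .
    finally have 1: "ereal (?l n) + ?a \<le> ereal (?e n)" .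
    have "ereal (?c n) \<le> ?a + ereal (\<delta> n)"
      using E_rel_le_E_ALL[OF tensor_power_states[OF AC, of n]] unfolding rel_seq[OF AC] \<delta>_def power_mult_distrib .
    with 1 show ?thesis by (cases ?a) auto
  qed
  have key': "?l n / real n + ?c n / real n \<le> ?e n / real n + \<delta> n / real n" for n
    using divide_right_mono[OF key[of n], of "real n"] by (simp add: add_divide_distrib)
  obtain Lc where Lc: "(\<lambda>n. ?c n / real n) \<longlonglongrightarrow> Lc" "E_rel_reg dA dC \<rho>AC = ereal Lc" by (rule E_rel_reg_limit[OF AC])
  obtain Le where Le: "(\<lambda>n. ?e n / real n) \<longlonglongrightarrow> Le" "E_rel_reg dA (dB * dC) \<rho> = ereal Le" by (rule E_rel_reg_limit[OF \<rho>])
  obtain Ll where Ll: "(\<lambda>n. ?l n / real n) \<longlonglongrightarrow> Ll" "E_LOCC1_reg dA dB \<rho>AB = ereal Ll" by (rule E_LOCC1_reg_limit[OF AB])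
  \<comment> \<open>The second inequality: superadditivity bounds the one-copy LOCC term by its
    average over n copies, subadditivity bounds the average of E by its one-copy value, and n tends
    to infinity in the remaining terms only.\<close>
  have "?l 1 + Lc \<le> ?e 1 + 0"
  proof (rule tendsto_le[OF sequentially_bot tendsto_add[OF tendsto_const \<delta>] tendsto_add[OF tendsto_const Lc(1)]])
    show "\<forall>\<^sub>F n in sequentially. ?l 1 + ?c n / real n \<le> ?e 1 + \<delta> n / real n"
      using eventually_ge_at_top[of 1]
    proof eventually_elim
      case (elim n)
      have "?l 1 \<le> ?l n / real n" "?e n / real n \<le> ?e 1"
        using locc_seq_ge[OF AB elim] rel_seq_le[OF \<rho> elim] elim by (simp_all add: field_simps)
      with key'[of n] show ?case by linarith
    qed
  qed
  moreover have "Ll + Lc \<le> Le + 0"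
    by (rule LIMSEQ_le[OF tendsto_add[OF Ll(1) Lc(1)] tendsto_add[OF Le(1) \<delta>]]) (use key' in auto)
  ultimately show ?thesis
    using monogamy[OF \<rho>] unfolding assms(2,3)[symmetric] rel_seq_1[OF \<rho>] locc_seq_1[OF AB] Lc(2) Le(2) Ll(2) by simp
qed

end
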